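(* Let $u>0$. Under $\mathbb{P}_{x_0}\otimes P^{G,U}$ set $\Phi_x=\sqrt{\varphi_x^2+2\ell_x(\tau_u)}$ for $x\in V$. Then, under $\mathbb{P}_{x_0}\otimes P^{G,U}$ and conditionally on $\Phi=(\Phi_x)_{x\in V}$, the pair $$\big((X_t)_{t\in[0,\tau_u]},\ \varphi\big)$$ has the law of $$\big((\check Z_t)_{t\in[0,\check T]},\ \sigma\Phi(\check T)\big),\qquad \sigma\Phi(\check T)=(\sigma_x\Phi_x(\check T))_{x\in V},$$ where $\check Z$ is distributed under $\mathbb{P}^{\check Z}_{\Phi,x_0}$ and, conditionally on $\check Z$, $\sigma$ is distributed according to the Ising model on $G$ with interaction $W_{i,j}\Phi_i(\check T)\Phi_j(\check T)$ and boundary condition $\sigma_{x_0}=+1$.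
   Context: Graph. $G=(V,E)$ is a finite connected undirected graph without loops, with positive conductances $(W_e)_{e\in E}$; $W_{x,y}=W_{\{x,y\}}$ if $\{x,y\}\in E$ and $W_{x,y}=0$ otherwise. A vertex $x_0\in V$ is fixed and $U=V\setminus\{x_0\}$. Gaussian free field. $\mathcal{E}(f,f)=\frac12\sum_{x,y\in V}W_{x,y}(f(x)-f(y))^2$ for $f\in\mathbb{R}^V$. $P^{G,U}$ is the law of the centered Gaussian field $\varphi=(\varphi_x)_{x\in V}$ with $\varphi_{x_0}=0$ and density on $\mathbb{R}^U$ proportional to $\exp(-\frac12\mathcal{E}(\varphi,\varphi))\prod_{x\in U}d\varphi_x$. Markov jump process. Under $\mathbb{P}_{z}$, $(X_t)_{t\ge0}$ is the right-continuous continuous-time Markov jump process on $V$ started at $z$ with jump rate $W_{i,j}$ from $i$ to $j$; $\ell_x(t)=\int_0^t 1_{\{X_r=x\}}\,dr$ and $\tau_u=\inf\{t\ge0:\ell_{x_0}(t)>u\}$. Under $\mathbb{P}_{x_0}\otimes P^{G,U}$, $X$ and $\varphi$ are independent. Ising model. The Ising model on $G$ with interaction $(J_{i,j})_{\{i,j\}\in E}$ and boundary condition $\sigma_{x_0}=+1$ is the probability on $\{\sigma\in\{-1,+1\}^V:\sigma_{x_0}=+1\}$ giving $\sigma$ a weight proportional to $\exp(\sum_{\{i,j\}\in E}J_{i,j}\sigma_i\sigma_j)$. The process $\check Y$. Let $\Phi=(\Phi_x)_{x\in V}$ be positive reals. $(\check Y_s)$ is the continuous-time $V$-valued jump process with $\check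 Y_0=z$ defined as follows. Put $\check L_i(s)=\Phi_i-\int_0^s 1_{\{\check Y_r=i\}}\,dr$, and let $\langle\cdot\rangle_s$ denote the expectation of the Ising model on $G$ with interaction $W_{i,j}\check L_i(s)\check L_j(s)$ and boundary condition $\sigma_{x_0}=+1$. Conditionally on the past at time $s$, if $\check Y_s=i$, the process jumps from $i$ to $j$ at rate $W_{i,j}\check L_j(s)\,\langle\sigma_j\rangle_s/\langle\sigma_i\rangle_s$. It is stopped at time $S=\sup\{s\ge0:\check L_i(s)>0\text{ for all }i\in V\}$; one has $\langle\sigma_x\rangle_s>0$ for all $x\in V$ and $s<S$. The time change $\check Z$. Put $\check D(s)=\frac12\sum_{i\in V}(\Phi_i^2-\check L_i^2(s))$, $\check Z_t=\check Y_{\check D^{-1}(t)}$, and let $\ell^{\check Z}_i(t)=\int_0^t1_{\{\check Z_r=i\}}\,dr$. Set $\Phi_i(t)=\sqrt{\Phi_i^2-2\ell_i^{\check Z}(t)}=\check L_i(\check D^{-1}(t))$. Equivalently, conditionally on the past at time $t$, $\check Z$ jumps from $\check Z_t=i$ to $j$ at rate $W_{i,j}\frac{\Phi_j(t)}{\Phi_i(t)}\frac{\langle\sigma_j\rangle_{(t)}}{\langle\sigma_i\rangle_{(t)}}$, where $\langle\cdot\rangle_{(t)}$ is the expectation of the Ising model with interaction $W_{i,j}\Phi_i(t)\Phi_j(t)$ and boundary condition $\sigma_{x_0}=+1$. The process $\check Z$ is considered up to time $\check T=\check D(S)=\inf\{t\ge0:\ell_i^{\check Z}(t)=\frac12\Phi_i^2\text{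 for some }i\in V\}$, and $\mathbb{P}^{\check Z}_{\Phi,z}$ denotes its law started at $z$ up to time $\check T$. *)

theory Defs
  imports "HOL-Probability.Probability"
begin

text \<open>The vertex set is the whole finite type; edges are two-element sets of vertices.\<close>

definition conductance_graph :: "'v::finite set set \<Rightarrow> ('v set \<Rightarrow> real) \<Rightarrow> bool" where
  "conductance_graph E W \<longleftrightarrow>
     (\<forall>e\<in>E. card e = 2) \<and> (\<forall>x y. (\<lambda>a b. {a, b} \<in> E)\<^sup>*\<^sup>* x y) \<and> (\<forall>e\<in>E. 0 < W e)"

definition conductance :: "'v set set \<Rightarrow> ('v set \<Rightarrow> real) \<Rightarrow> 'v \<Rightarrow> 'v \<Rightarrow> real" where
  "conductance E W x y = (if {x, y} \<in> E then W {x, y} else 0)"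

definition energy :: "'v::finite set set \<Rightarrow> ('v set \<Rightarrow> real) \<Rightarrow> ('v \<Rightarrow> real) \<Rightarrow> real" where
  "energy E W f = (1/2) * (\<Sum>x\<in>UNIV. \<Sum>y\<in>UNIV. conductance E W x y * (f x - f y)\<^sup>2)"

abbreviation field_space :: "('v::finite \<Rightarrow> real) measure" where
  "field_space \<equiv> Pi\<^sub>M UNIV (\<lambda>_. borel)"

definition gff_weight ::
    "'v::finite set set \<Rightarrow> ('v set \<Rightarrow> real) \<Rightarrow> 'v \<Rightarrow> ('v \<Rightarrow> real) \<Rightarrow> real" where
  "gff_weight E W x0 f = exp (- (1/2) * energy E W (f(x0 := 0)))"

definition gff :: "'v::finite set set \<Rightarrow> ('v set \<Rightarrow> real) \<Rightarrow> 'v \<Rightarrow> ('v \<Rightarrow> real) measure" where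
  "gff E W x0 =
     (let \<mu> = Pi\<^sub>M (UNIV - {x0}) (\<lambda>_. lborel)
      in distr (density \<mu> (\<lambda>f. ennreal (gff_weight E W x0 f / integral\<^sup>L \<mu> (gff_weight E W x0))))
               field_space (\<lambda>f. f(x0 := 0)))"

definition spins :: "'v::finite \<Rightarrow> ('v \<Rightarrow> real) set" where
  "spins x0 = {\<sigma>. (\<forall>x. \<sigma> x \<in> {-1, 1}) \<and> \<sigma> x0 = 1}"

text \<open>For an edge \<open>e = {i, j}\<close>, the product over \<open>e\<close> is \<open>\<sigma> i * \<sigma> j\<close>.\<close>

definition ising_weight :: "'v::finite set set \<Rightarrow> ('v set \<Rightarrow> real) \<Rightarrow> ('v \<Rightarrow> real) \<Rightarrow> real" where
  "ising_weight E J \<sigma> = exp (\<Sum>e\<in>E. J e * (\<Prod>i\<in>e. \<sigma> i))"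

definition ising :: "'v::finite set set \<Rightarrow> ('v set \<Rightarrow> real) \<Rightarrow> 'v \<Rightarrow> ('v \<Rightarrow> real) measure" where
  "ising E J x0 =
     point_measure (spins x0)
       (\<lambda>\<sigma>. ennreal (ising_weight E J \<sigma> / (\<Sum>\<sigma>'\<in>spins x0. ising_weight E J \<sigma>')))"

definition spin_mean :: "'v::finite set set \<Rightarrow> ('v set \<Rightarrow> real) \<Rightarrow> 'v \<Rightarrow> 'v \<Rightarrow> real" where
  "spin_mean E J x0 x = (\<integral>\<sigma>. \<sigma> x \<partial>ising E J x0)"

definition interaction :: "('v set \<Rightarrow> real) \<Rightarrow> ('v \<Rightarrow> real) \<Rightarrow> 'v set \<Rightarrow> real" where
  "interaction W f e = W e * (\<Prod>i\<in>e. f i)"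

text \<open>
  A trajectory is encoded by its sequence of events: \<open>\<omega> n = (t, i)\<close> means that the \<open>n\<close>-th jump
  takes place at time \<open>t\<close> and leads to the state \<open>i\<close>; event \<open>0\<close> is the start at time \<open>0\<close>, and
  the time \<open>\<infinity>\<close> means that there is no further jump. The position \<open>traj \<omega> t\<close> is the target
  of the last jump up to time \<open>t\<close>, which makes paths right-continuous; after an accumulation
  point of jump times it is an arbitrary fixed entry of the sequence.
\<close>

type_synonym 'v event = "ereal \<times> 'v"

abbreviation event_space :: "'v event measure" where
  "event_space \<equiv> borel \<Otimes>\<^sub>M count_space UNIV"

definition traj :: "(nat \<Rightarrow> 'v event) \<Rightarrow> real \<Rightarrow> 'v" where
  "traj \<omega> t = snd (\<omega> (Max {k. fst (\<omega> k) \<le> ereal t}))"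

definition freeze :: "nat \<Rightarrow> (nat \<Rightarrow> 'v event) \<Rightarrow> nat \<Rightarrow> 'v event" where
  "freeze m \<omega> k = (if k \<le> m then \<omega> k else (\<infinity>, snd (\<omega> m)))"

text \<open>
  Starting at time \<open>a\<close> in state \<open>i\<close>, with \<open>R t j\<close> the rate of jumping to \<open>j\<close> at time \<open>t\<close> as long
  as no jump has occurred, the next jump happens in \<open>dt\<close> and leads to \<open>j\<close> with probability
  \<open>R t j * exp (- (\<integral> s from a to t. \<Sum>k. R s k)) dt\<close>; the remaining mass is the probability that
  there is no further jump.
\<close>

definition jump_density :: "(real \<Rightarrow> 'v::finite \<Rightarrow> real) \<Rightarrow> real \<Rightarrow> real \<Rightarrow> 'v \<Rightarrow> real" where
  "jump_density R a t j = R t j * exp (- (LINT s:{a..t}|lborel. (\<Sum>k\<in>UNIV. R s k)))"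

definition jump_mass :: "(real \<Rightarrow> 'v::finite \<Rightarrow> real) \<Rightarrow> real \<Rightarrow> 'v event set \<Rightarrow> ennreal" where
  "jump_mass R a A =
     (\<integral>\<^sup>+t\<in>{a<..}. (\<Sum>j\<in>UNIV. ennreal (jump_density R a t j) * indicator A (ereal t, j)) \<partial>lborel)"

definition next_event :: "(real \<Rightarrow> 'v::finite \<Rightarrow> real) \<Rightarrow> real \<Rightarrow> 'v \<Rightarrow> 'v event measure" where
  "next_event R a i =
     measure_of UNIV (sets event_space)
       (\<lambda>A. jump_mass R a A + (1 - jump_mass R a UNIV) * indicator A (\<infinity>, i))"

text \<open>
  A rate functional \<open>r\<close> gives, for a trajectory \<open>y\<close> and a time \<open>s\<close>, the rate \<open>r y s j\<close> of jumping
  from \<open>y s\<close> to \<open>j\<close>; it is meant to depend on \<open>y\<close> only through its restriction to \<open>[0, s]\<close>.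
\<close>

type_synonym 'v rate = "(real \<Rightarrow> 'v) \<Rightarrow> real \<Rightarrow> 'v \<Rightarrow> real"

definition event_kernel ::
    "'v::finite rate \<Rightarrow> 'v \<Rightarrow> nat \<Rightarrow> (nat \<Rightarrow> 'v event) \<Rightarrow> 'v event measure" where
  "event_kernel r z n \<omega> =
     (case n of
        0 \<Rightarrow> return event_space (0, z)
      | Suc m \<Rightarrow>
          if fst (\<omega> m) = \<infinity> then return event_space (\<omega> m)
          else next_event (r (traj (freeze m \<omega>))) (real_of_ereal (fst (\<omega> m))) (snd (\<omega> m)))"

definition jump_process :: "'v::finite rate \<Rightarrow> 'v \<Rightarrow> (nat \<Rightarrow> 'v event) measure" where
  "jump_process r z =
     projective_family.lim UNIV
       (Ionescu_Tulcea.CI (event_kernel r z) (\<lambda>_. event_space)) (\<lambda>_. event_space)"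

definition local_time :: "(real \<Rightarrow> 'v) \<Rightarrow> 'v \<Rightarrow> real \<Rightarrow> real" where
  "local_time p x t = (LINT s:{0..t}|lborel. indicator {x} (p s))"

text \<open>
  The trajectory \<open>p\<close> on the closed interval \<open>[0, T]\<close> is recorded as the pair of \<open>T\<close> and the path
  stopped at \<open>T\<close>, so that the value at the end point is an observable.
\<close>

abbreviation stopped_path_space :: "(real \<times> (real \<Rightarrow> 'v)) measure" where
  "stopped_path_space \<equiv> borel \<Otimes>\<^sub>M Pi\<^sub>M {0..} (\<lambda>_. count_space UNIV)"

definition path_upto :: "real \<Rightarrow> (real \<Rightarrow> 'v) \<Rightarrow> real \<times> (real \<Rightarrow> 'v)" where
  "path_upto T p = (T, \<lambda>t\<in>{0..}. p (min t T))"

definition markov_rate :: "'v::finite set set \<Rightarrow> ('v set \<Rightarrow> real) \<Rightarrow> 'v rate" where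
  "markov_rate E W p t j = conductance E W (p t) j"

definition markov_process ::
    "'v::finite set set \<Rightarrow> ('v set \<Rightarrow> real) \<Rightarrow> 'v \<Rightarrow> (nat \<Rightarrow> 'v event) measure" where
  "markov_process E W z = jump_process (markov_rate E W) z"

definition inv_local_time :: "'v \<Rightarrow> real \<Rightarrow> (real \<Rightarrow> 'v) \<Rightarrow> real" where
  "inv_local_time x0 u p = Inf {t. 0 \<le> t \<and> u < local_time p x0 t}"

definition L_check :: "('v \<Rightarrow> real) \<Rightarrow> (real \<Rightarrow> 'v) \<Rightarrow> real \<Rightarrow> 'v \<Rightarrow> real" where
  "L_check \<Phi> y s i = \<Phi> i - local_time y i s"

text \<open>The rate vanishes once some \<open>L_check\<close> has reached \<open>0\<close>: the process is stopped there.\<close>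

definition Y_rate ::
    "'v::finite set set \<Rightarrow> ('v set \<Rightarrow> real) \<Rightarrow> 'v \<Rightarrow> ('v \<Rightarrow> real) \<Rightarrow> 'v rate" where
  "Y_rate E W x0 \<Phi> y s j =
     (let L = L_check \<Phi> y s; m = spin_mean E (interaction W L) x0
      in if \<forall>i. 0 < L i then conductance E W (y s) j * L j * (m j / m (y s)) else 0)"

definition Y_process ::
    "'v::finite set set \<Rightarrow> ('v set \<Rightarrow> real) \<Rightarrow> 'v \<Rightarrow> ('v \<Rightarrow> real) \<Rightarrow> 'v \<Rightarrow> (nat \<Rightarrow> 'v event) measure" where
  "Y_process E W x0 \<Phi> z = jump_process (Y_rate E W x0 \<Phi>) z"

definition S_end :: "('v \<Rightarrow> real) \<Rightarrow> (real \<Rightarrow> 'v) \<Rightarrow> real" where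
  "S_end \<Phi> y = Sup {s. 0 \<le> s \<and> (\<forall>i. 0 < L_check \<Phi> y s i)}"

definition D_check :: "('v::finite \<Rightarrow> real) \<Rightarrow> (real \<Rightarrow> 'v) \<Rightarrow> real \<Rightarrow> real" where
  "D_check \<Phi> y s = (1/2) * (\<Sum>i\<in>UNIV. (\<Phi> i)\<^sup>2 - (L_check \<Phi> y s i)\<^sup>2)"

definition T_check :: "('v::finite \<Rightarrow> real) \<Rightarrow> (real \<Rightarrow> 'v) \<Rightarrow> real" where
  "T_check \<Phi> y = D_check \<Phi> y (S_end \<Phi> y)"

text \<open>Only used for \<open>0 \<le> t \<le> T_check \<Phi> y\<close>; \<open>D_check \<Phi> y\<close> is strictly increasing on \<open>[0, S]\<close>.\<close>

definition Z_check :: "('v::finite \<Rightarrow> real) \<Rightarrow> (real \<Rightarrow> 'v) \<Rightarrow> real \<Rightarrow> 'v" where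
  "Z_check \<Phi> y t = y (inv_into {0..S_end \<Phi> y} (D_check \<Phi> y) t)"

definition Phi_at :: "('v \<Rightarrow> real) \<Rightarrow> (real \<Rightarrow> 'v) \<Rightarrow> real \<Rightarrow> 'v \<Rightarrow> real" where
  "Phi_at \<Phi> p t i = sqrt ((\<Phi> i)\<^sup>2 - 2 * local_time p i t)"

definition Z_field_law ::
    "'v::finite set set \<Rightarrow> ('v set \<Rightarrow> real) \<Rightarrow> 'v \<Rightarrow> ('v \<Rightarrow> real) \<Rightarrow> 'v \<Rightarrow>
     ((real \<times> (real \<Rightarrow> 'v)) \<times> ('v \<Rightarrow> real)) measure" where
  "Z_field_law E W x0 \<Phi> z =
     Y_process E W x0 \<Phi> z \<bind> (\<lambda>\<omega>.
       let y = traj \<omega>; T = T_check \<Phi> y; Z = Z_check \<Phi> y; \<Phi>T = Phi_at \<Phi> Z T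
       in distr (ising E (interaction W \<Phi>T) x0) (stopped_path_space \<Otimes>\<^sub>M field_space)
            (\<lambda>\<sigma>. (path_upto T Z, \<lambda>x. \<sigma> x * \<Phi>T x)))"

definition has_conditional_law ::
    "'a measure \<Rightarrow> ('a \<Rightarrow> 'b) \<Rightarrow> 'b measure \<Rightarrow> ('a \<Rightarrow> 'c) \<Rightarrow> 'c measure \<Rightarrow> ('b \<Rightarrow> 'c measure) \<Rightarrow> bool" where
  "has_conditional_law M X L Y N K \<longleftrightarrow>
     prob_space M \<and> X \<in> M \<rightarrow>\<^sub>M L \<and> Y \<in> M \<rightarrow>\<^sub>M N \<and>
     (AE \<omega> in M. prob_space (K (X \<omega>)) \<and> sets (K (X \<omega>)) = sets N) \<and>
     (\<forall>B\<in>sets N. AE \<omega> in M.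
        real_cond_exp M (vimage_algebra (space M) X L) (indicator (Y -` B \<inter> space M)) \<omega>
          = measure (K (X \<omega>)) B)"

end

theory Submission
  imports Defs "HOL-Real_Asymp.Real_Asymp"
begin

text \<open>
  Both sides are compared through explicit densities. A path with \<open>n\<close> jumps is determined by its skeleton, the
  list of its jump times and targets, and the laws of jump processes have densities in these coordinates
  (\<open>nn_integral_PP_skeleton\<close>).

  For the Markov process, run until the local time at \<open>x0\<close> reaches \<open>u\<close>, the density of the skeleton is the product of
  the conductances along the path times \<open>exp (- \<Sum>x. W\<^sub>x * \<ell> x)\<close>, where \<open>W\<^sub>x\<close> is the total rate out of \<open>x\<close>
  and \<open>\<ell> x\<close> the final local time. The free field contributes \<open>exp (- (1/2) * \<Sum>x. W\<^sub>x * (\<phi> x)\<^sup>2)\<close> times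
  an exponential of the cross terms \<open>\<phi> x * \<phi> y\<close>. Write \<open>\<phi> = \<sigma> M\<close> with signs \<open>\<sigma>\<close> and \<open>M = sqrt (\<Phi>\<^sup>2 - 2 \<ell>)\<close>.
  The diagonal terms combine to \<open>exp (- (1/2) * \<Sum>x. W\<^sub>x * (\<Phi> x)\<^sup>2)\<close>, which does not depend on the path,
  the cross terms become the Ising weight of \<open>\<sigma>\<close> with interaction \<open>W M M\<close>, and the change of variables
  from the modulus \<open>M\<close> to \<open>\<Phi>\<close> has Jacobian \<open>\<Prod>x. \<Phi> x / M x\<close> over \<open>x \<noteq> x0\<close>
  (\<open>skeleton_change_of_variables\<close>). So the joint density of \<open>\<Phi>\<close>, skeleton and signs is a function of
  \<open>\<Phi>\<close> times \<open>(\<Prod> W) * (\<Prod>x. \<Phi> x / M x) * weight M \<sigma> / partition_fun \<Phi>\<close> (\<open>joint_law\<close>).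

  The same expression comes out for the self-interacting process. While it sits at \<open>i\<close>, its total jump rate is minus
  the logarithmic derivative of the unnormalised Ising moment at \<open>i\<close> (\<open>moment_has_derivative\<close>), so the density of
  a skeleton telescopes to conductances, times the remaining field \<open>left\<close> at the arrivals, times a ratio of Ising
  moments (\<open>Y_path_density\<close>). The arrivals differ from the departures by the factor \<open>\<Prod>x. \<Phi> x / M x\<close>
  (\<open>arrivals_departures\<close>), and the product over the departures is the Jacobian of the time change
  (\<open>nn_integral_time_change\<close>). The last stay at \<open>x0\<close> (\<open>Y_survival\<close>) leaves \<open>partition_fun M / partition_fun \<Phi>\<close>, and
  choosing the signs gives \<open>weight M \<sigma> / partition_fun M\<close>.

  This accounts only for paths of the self-interacting process that have finitely many jumps and end at \<open>x0\<close>,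
  so it bounds its law from below (\<open>path_law_le_Z_field_law\<close>). That almost all paths are of this kind need not be
  proved separately: the Markov process completes after finitely many jumps (\<open>completion_mass\<close>), so the joint law
  has total mass \<open>1\<close>, and then for almost every \<open>\<Phi>\<close> the lower bound has mass \<open>1\<close> and is the whole law
  (\<open>path_law_regular\<close>). The averaging property of conditional expectations is then \<open>joint_law\<close> again.

  The rates of the self-interacting process make sense because Ising moments are positive, by Griffiths' inequality
  (\<open>moment_pos\<close>).
\<close>

section \<open>The Ising model\<close>

definition ising_moment ::
    "'v::finite set set \<Rightarrow> ('v set \<Rightarrow> real) \<Rightarrow> 'v \<Rightarrow> 'v \<Rightarrow> ('v \<Rightarrow> real) \<Rightarrow> real" where
  "ising_moment E W x0 x L = (\<Sum>\<sigma>\<in>spins x0. \<sigma> x * ising_weight E (interaction W L) \<sigma>)"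

abbreviation ising_partition ::
    "'v::finite set set \<Rightarrow> ('v set \<Rightarrow> real) \<Rightarrow> 'v \<Rightarrow> ('v \<Rightarrow> real) \<Rightarrow> real" where
  "ising_partition E W x0 \<equiv> ising_moment E W x0 x0"

lemma finite_spins [simp]: "finite (spins x0 :: ('v::finite \<Rightarrow> real) set)"
proof -
  have "spins x0 \<subseteq> PiE UNIV (\<lambda>_::'v. {-1, 1::real})"
    by (auto simp: spins_def)
  then show ?thesis
    by (rule finite_subset) (auto intro!: finite_PiE)
qed

lemma one_in_spins [simp]: "(\<lambda>_. 1) \<in> spins x0"
  by (simp add: spins_def)

lemma ising_weight_pos: "0 < ising_weight E J \<sigma>"
  by (simp add: ising_weight_def)

lemma ising_partition_eq:
  "ising_partition E W x0 L = (\<Sum>\<sigma>\<in>spins x0. ising_weight E (interaction W L) \<sigma>)"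
  unfolding ising_moment_def by (intro sum.cong) (auto simp: spins_def)

lemma ising_partition_pos: "0 < ising_partition E W x0 L"
  unfolding ising_partition_eq using one_in_spins
  by (intro sum_pos) (auto simp: ising_weight_pos simp del: one_in_spins)

lemma spin_mean_eq:
  "spin_mean E (interaction W L) x0 x = ising_moment E W x0 x L / ising_partition E W x0 L"
  unfolding spin_mean_def ising_def
  by (subst lebesgue_integral_point_measure_finite)
     (auto simp: ising_partition_eq ising_moment_def sum_divide_distrib less_imp_le[OF ising_weight_pos] mult.commute
           intro!: divide_nonneg_nonneg sum_nonneg)

lemma spin_flip_in_spins: "\<sigma> \<in> spins x0 \<Longrightarrow> x \<noteq> x0 \<Longrightarrow> \<sigma>(x := - \<sigma> x) \<in> spins x0"
  by (auto simp: spins_def)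

text \<open>Griffiths' first inequality. Since \<open>\<sigma>\<^sub>e = \<plusminus>1\<close>, each factor \<open>exp (J e \<sigma>\<^sub>e)\<close> equals
  \<open>cosh (J e) + sinh (J e) \<sigma>\<^sub>e\<close>, so induction on the edge set leaves sums of monomials, and those
  vanish under a spin flip unless every spin other than the fixed one occurs to an even power.\<close>
lemma ising_monomial_nonneg:
  fixes x0 :: "'v::finite"
  assumes "finite E" and "\<And>e. e \<in> E \<Longrightarrow> 0 \<le> J e"
  shows "0 \<le> (\<Sum>\<sigma>\<in>spins x0. (\<Prod>x\<in>UNIV. \<sigma> x ^ k x) * ising_weight E J \<sigma>)"
  using assms
proof (induction E arbitrary: k rule: finite_induct)
  case empty
  show ?case
  proof (cases "\<exists>x. x \<noteq> x0 \<and> odd (k x)")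
    case True
    then obtain x where x: "x \<noteq> x0" "odd (k x)" by blast
    let ?m = "\<lambda>\<sigma> :: 'v \<Rightarrow> real. \<Prod>x\<in>UNIV. \<sigma> x ^ k x"
    let ?flip = "\<lambda>\<sigma> :: 'v \<Rightarrow> real. \<sigma>(x := - \<sigma> x)"
    have flip: "?m (?flip \<sigma>) = - ?m \<sigma>" for \<sigma>
    proof -
      have "?m (?flip \<sigma>) = (- \<sigma> x) ^ k x * (\<Prod>y\<in>UNIV - {x}. \<sigma> y ^ k y)"
        by (subst prod.remove[of _ x]) (auto intro!: prod.cong)
      also have "\<dots> = - (\<sigma> x ^ k x * (\<Prod>y\<in>UNIV - {x}. \<sigma> y ^ k y))"
        using x by simp
      finally show ?thesis by (subst (2) prod.remove[of _ x]) auto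
    qed
    have "(\<Sum>\<sigma>\<in>spins x0. ?m \<sigma>) = (\<Sum>\<sigma>\<in>spins x0. ?m (?flip \<sigma>))"
      using x spin_flip_in_spins[of _ x0 x]
      by (intro sum.reindex_bij_witness[where i = ?flip and j = ?flip]) auto
    then have "(\<Sum>\<sigma>\<in>spins x0. ?m \<sigma>) = 0"
      by (simp only: flip sum_negf)
    then show ?thesis by (simp add: ising_weight_def)
  next
    case False
    have "(\<sigma> x) ^ k x = 1" if "\<sigma> \<in> spins x0" for \<sigma> x
    proof (cases "x = x0")
      case True
      then show ?thesis using that by (simp add: spins_def)
    next
      case ne: False
      then have "even (k x)" using False by blast
      moreover have "\<sigma> x = -1 \<or> \<sigma> x = 1" using that by (auto simp: spins_def)
      ultimately show ?thesis by auto
    qed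
    then show ?thesis by (auto simp: ising_weight_def intro!: sum_nonneg)
  qed
next
  case (insert e E)
  have [simp]: "e \<notin> E" "finite E" by fact+
  define k' where "k' x = k x + (if x \<in> e then 1 else 0)" for x
  have weight: "ising_weight (insert e E) J \<sigma>
      = cosh (J e) * ising_weight E J \<sigma> + sinh (J e) * ((\<Prod>x\<in>e. \<sigma> x) * ising_weight E J \<sigma>)"
    if "\<sigma> \<in> spins x0" for \<sigma>
  proof -
    have "(\<Prod>x\<in>e. \<sigma> x) \<in> {-1, 1}"
      using finite[of e] that
    proof (induction e rule: finite_induct)
      case (insert y e)
      moreover have "\<sigma> y = -1 \<or> \<sigma> y = 1" using insert.prems by (auto simp: spins_def)
      ultimately show ?case by auto
    qed simp
    then have "exp (J e * (\<Prod>x\<in>e. \<sigma> x)) = cosh (J e) + sinh (J e) * (\<Prod>x\<in>e. \<sigma> x)"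
      by (auto simp: cosh_def sinh_def field_simps)
    then show ?thesis
      by (simp add: ising_weight_def exp_add algebra_simps)
  qed
  have k': "(\<Prod>x\<in>UNIV. \<sigma> x ^ k x) * (\<Prod>x\<in>e. \<sigma> x) = (\<Prod>x\<in>UNIV. \<sigma> x ^ k' x)" for \<sigma> :: "'v \<Rightarrow> real"
  proof -
    have "(\<Prod>x\<in>e. \<sigma> x) = (\<Prod>x\<in>UNIV. if x \<in> e then \<sigma> x else 1)"
      by (simp add: prod.If_cases)
    also have "(\<Prod>x\<in>UNIV. \<sigma> x ^ k x) * \<dots> = (\<Prod>x\<in>UNIV. \<sigma> x ^ k' x)"
      unfolding prod.distrib[symmetric] by (intro prod.cong) (auto simp: k'_def)
    finally show ?thesis .
  qed
  have "(\<Sum>\<sigma>\<in>spins x0. (\<Prod>x\<in>UNIV. \<sigma> x ^ k x) * ising_weight (insert e E) J \<sigma>)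
      = (\<Sum>\<sigma>\<in>spins x0. cosh (J e) * ((\<Prod>x\<in>UNIV. \<sigma> x ^ k x) * ising_weight E J \<sigma>)
          + sinh (J e) * ((\<Prod>x\<in>UNIV. \<sigma> x ^ k' x) * ising_weight E J \<sigma>))"
    by (intro sum.cong refl) (simp add: weight k'[symmetric] algebra_simps)
  also have "\<dots> = cosh (J e) * (\<Sum>\<sigma>\<in>spins x0. (\<Prod>x\<in>UNIV. \<sigma> x ^ k x) * ising_weight E J \<sigma>)
      + sinh (J e) * (\<Sum>\<sigma>\<in>spins x0. (\<Prod>x\<in>UNIV. \<sigma> x ^ k' x) * ising_weight E J \<sigma>)"
    by (simp add: sum.distrib sum_distrib_left)
  also have "\<dots> \<ge> 0"
    using insert.IH[of k] insert.IH[of k'] insert.prems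
    by (intro add_nonneg_nonneg mult_nonneg_nonneg) auto
  finally show ?case .
qed

lemma ising_spin_nonneg:
  fixes x0 :: "'v::finite"
  assumes "finite E" and "\<And>e. e \<in> E \<Longrightarrow> 0 \<le> J e"
  shows "0 \<le> (\<Sum>\<sigma>\<in>spins x0. \<sigma> x * ising_weight E J \<sigma>)"
proof -
  have "(\<Prod>y\<in>UNIV. \<sigma> y ^ (if y = x then 1 else 0)) = \<sigma> x" for \<sigma> :: "'v \<Rightarrow> real"
    by (simp add: if_distrib prod.If_cases cong: if_cong)
  then show ?thesis
    using ising_monomial_nonneg[OF assms, where k = "\<lambda>y. if y = x then 1 else 0" and ?x0.0 = x0] by simp
qed

locale conductance_network =
  fixes E :: "'v::finite set set" and W :: "'v set \<Rightarrow> real" and x0 :: 'v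
  assumes network: "conductance_graph E W"
begin

abbreviation cond :: "'v \<Rightarrow> 'v \<Rightarrow> real" where "cond \<equiv> conductance E W"
abbreviation moment :: "'v \<Rightarrow> ('v \<Rightarrow> real) \<Rightarrow> real" where "moment \<equiv> ising_moment E W x0"
abbreviation partition_fun :: "('v \<Rightarrow> real) \<Rightarrow> real" where "partition_fun \<equiv> ising_moment E W x0 x0"
abbreviation weight :: "('v \<Rightarrow> real) \<Rightarrow> ('v \<Rightarrow> real) \<Rightarrow> real" where
  "weight L \<equiv> ising_weight E (interaction W L)"

lemma card_edge: "e \<in> E \<Longrightarrow> card e = 2"
  and edge_pos: "e \<in> E \<Longrightarrow> 0 < W e"
  and connected_graph: "(\<lambda>a b. {a, b} \<in> E)\<^sup>*\<^sup>* x y"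
  using network by (auto simp: conductance_graph_def)

lemma edge_neq: "{x, y} \<in> E \<Longrightarrow> x \<noteq> y"
  using card_edge[of "{x, y}"] by auto

lemma cond_nonneg: "0 \<le> cond x y"
  by (auto simp: conductance_def dest: edge_pos)

lemma cond_self [simp]: "cond x x = 0"
  using edge_neq[of x x] by (auto simp: conductance_def)

lemma cond_commute: "cond x y = cond y x"
  by (simp add: conductance_def insert_commute)

text \<open>Positivity travels along edges: for an edge \<open>e = {x, y}\<close>, splitting off its factor writes the
  moment at \<open>x\<close> as \<open>cosh (J e) F\<^sub>x + sinh (J e) F\<^sub>y\<close>, where the moments \<open>F\<close> of the graph without
  \<open>e\<close> are nonnegative, and the moment at \<open>y\<close> with the roles exchanged.\<close>
lemma moment_pos:
  assumes L: "\<And>x. 0 < L x"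
  shows "0 < moment x L"
  using connected_graph[of x0 x]
proof (induction rule: rtranclp_induct)
  case base
  show ?case by (rule ising_partition_pos)
next
  case (step x y)
  define J where "J = interaction W L"
  define e where "e = {x, y}"
  have e: "e \<in> E" "x \<noteq> y" using step edge_neq by (auto simp: e_def)
  have J: "0 < J d" if "d \<in> E" for d
    using that L by (auto simp: J_def interaction_def intro!: mult_pos_pos edge_pos prod_pos)
  define F where "F z = (\<Sum>\<sigma>\<in>spins x0. \<sigma> z * ising_weight (E - {e}) J \<sigma>)" for z
  have F: "0 \<le> F z" for z
    unfolding F_def using J by (intro ising_spin_nonneg) (auto intro: less_imp_le)
  have split: "ising_weight E J \<sigma> = (cosh (J e) + sinh (J e) * (\<sigma> x * \<sigma> y)) * ising_weight (E - {e}) J \<sigma>"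
    if "\<sigma> \<in> spins x0" for \<sigma>
  proof -
    have "\<sigma> x \<in> {-1, 1}" "\<sigma> y \<in> {-1, 1}" using that by (auto simp: spins_def)
    then have "exp (J e * (\<sigma> x * \<sigma> y)) = cosh (J e) + sinh (J e) * (\<sigma> x * \<sigma> y)"
      by (auto simp: cosh_def sinh_def field_simps)
    moreover have "ising_weight E J \<sigma> = exp (J e * (\<sigma> x * \<sigma> y)) * ising_weight (E - {e}) J \<sigma>"
      using e by (simp add: ising_weight_def sum.remove[of E e] exp_add e_def)
    ultimately show ?thesis by simp
  qed
  have moment_eq: "moment a L = cosh (J e) * F a + sinh (J e) * F b" if "a \<in> e" "b \<in> e" "a \<noteq> b" for a b
  proof -
    have "\<sigma> a * ising_weight E J \<sigma> = cosh (J e) * (\<sigma> a * ising_weight (E - {e}) J \<sigma>)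
        + sinh (J e) * (\<sigma> b * ising_weight (E - {e}) J \<sigma>)" if \<sigma>: "\<sigma> \<in> spins x0" for \<sigma>
    proof -
      have "\<sigma> a \<in> {-1, 1}" "\<sigma> b \<in> {-1, 1}" using \<sigma> by (auto simp: spins_def)
      moreover have "\<sigma> x * \<sigma> y = \<sigma> a * \<sigma> b" using \<open>a \<in> e\<close> \<open>b \<in> e\<close> \<open>a \<noteq> b\<close> by (auto simp: e_def)
      ultimately show ?thesis
        unfolding split[OF \<sigma>] by (auto simp: algebra_simps)
    qed
    then show ?thesis
      unfolding ising_moment_def J_def[symmetric] F_def by (simp add: sum.distrib sum_distrib_left)
  qed
  have x: "moment x L = cosh (J e) * F x + sinh (J e) * F y"
    and y: "moment y L = cosh (J e) * F y + sinh (J e) * F x"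
    using e moment_eq[of x y] moment_eq[of y x] by (simp_all add: e_def)
  have "0 < sinh (J e)" "0 < cosh (J e)" using J[OF e(1)] by auto
  moreover have "F x > 0 \<or> F y > 0"
    using step.IH F[of x] F[of y] unfolding x by (auto simp: less_le)
  ultimately show ?case
    unfolding y using F[of x] F[of y]
    by (auto intro: add_pos_nonneg add_nonneg_pos)
qed

lemma sum_edges_split:
  fixes f :: "'v set \<Rightarrow> real"
  shows "(\<Sum>e\<in>E. f e) = (\<Sum>e\<in>{e\<in>E. x \<notin> e}. f e) + (\<Sum>y\<in>UNIV. if {x, y} \<in> E then f {x, y} else 0)"
proof -
  have "(\<Sum>e\<in>E. f e) = (\<Sum>e\<in>{e\<in>E. x \<notin> e}. f e) + (\<Sum>e\<in>{e\<in>E. x \<in> e}. f e)"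
    by (subst sum.union_disjoint[symmetric]) (auto intro!: sum.cong)
  also have "(\<Sum>e\<in>{e\<in>E. x \<in> e}. f e) = (\<Sum>y\<in>{y. {x, y} \<in> E}. f {x, y})"
  proof (rule sum.reindex_bij_betw[symmetric], rule bij_betwI')
    show "\<exists>y\<in>{y. {x, y} \<in> E}. e = {x, y}" if "e \<in> {e \<in> E. x \<in> e}" for e
    proof -
      have "card e = 2" "x \<in> e" "e \<in> E" using that card_edge by auto
      then show ?thesis by (auto simp: card_2_iff doubleton_eq_iff insert_commute)
    qed
  qed (auto simp: doubleton_eq_iff)
  also have "\<dots> = (\<Sum>y\<in>UNIV. if {x, y} \<in> E then f {x, y} else 0)"
    by (simp add: sum.If_cases)
  finally show ?thesis .
qed

text \<open>In the exponent, \<open>L x\<close> is multiplied by \<open>\<sigma> x\<close> times \<open>\<Sum>y. W\<^sub>x\<^sub>y L y \<sigma> y\<close>, and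
  \<open>\<sigma> x * \<sigma> x = 1\<close>. This identity makes the jump rates out of \<open>x\<close> add up to a logarithmic derivative.\<close>
lemma moment_has_derivative:
  "((\<lambda>s. moment x (L(x := s))) has_real_derivative (\<Sum>y\<in>UNIV. cond x y * L y * moment y (L(x := s))))
     (at s)"
proof -
  have expo: "(\<Sum>e\<in>E. interaction W (L(x := s)) e * (\<Prod>i\<in>e. \<sigma> i))
      = (\<Sum>e\<in>{e\<in>E. x \<notin> e}. interaction W L e * (\<Prod>i\<in>e. \<sigma> i)) + s * (\<sigma> x * (\<Sum>y\<in>UNIV. cond x y * L y * \<sigma> y))"
    for \<sigma> s
  proof -
    have "(\<Sum>y\<in>UNIV. if {x, y} \<in> E then interaction W (L(x := s)) {x, y} * (\<Prod>i\<in>{x, y}. \<sigma> i) else 0)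
        = s * (\<sigma> x * (\<Sum>y\<in>UNIV. cond x y * L y * \<sigma> y))"
      unfolding sum_distrib_left
      by (intro sum.cong refl) (auto simp: interaction_def conductance_def dest: edge_neq)
    moreover have "(\<Sum>e\<in>{e\<in>E. x \<notin> e}. interaction W (L(x := s)) e * (\<Prod>i\<in>e. \<sigma> i))
        = (\<Sum>e\<in>{e\<in>E. x \<notin> e}. interaction W L e * (\<Prod>i\<in>e. \<sigma> i))"
      by (intro sum.cong refl) (auto simp: interaction_def intro!: prod.cong)
    ultimately show ?thesis by (subst sum_edges_split[where x = x]) auto
  qed
  have "((\<lambda>s. moment x (L(x := s))) has_real_derivative
      (\<Sum>\<sigma>\<in>spins x0. \<sigma> x * (\<sigma> x * (\<Sum>y\<in>UNIV. cond x y * L y * \<sigma> y) * weight (L(x := s)) \<sigma>))) (at s)"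
    unfolding ising_moment_def ising_weight_def expo
    by (auto intro!: derivative_eq_intros sum.cong)
  also have "(\<Sum>\<sigma>\<in>spins x0. \<sigma> x * (\<sigma> x * (\<Sum>y\<in>UNIV. cond x y * L y * \<sigma> y) * weight (L(x := s)) \<sigma>))
      = (\<Sum>\<sigma>\<in>spins x0. \<Sum>y\<in>UNIV. cond x y * L y * (\<sigma> y * weight (L(x := s)) \<sigma>))"
  proof (intro sum.cong refl)
    fix \<sigma> assume "\<sigma> \<in> spins x0"
    then have "\<sigma> x = -1 \<or> \<sigma> x = 1" by (simp add: spins_def)
    then have "\<sigma> x * \<sigma> x = 1" by auto
    then have "\<sigma> x * (\<sigma> x * S * w) = S * w" for S w :: real by (metis mult.assoc mult_1)
    also have "(\<Sum>y\<in>UNIV. cond x y * L y * \<sigma> y) * weight (L(x := s)) \<sigma>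
        = (\<Sum>y\<in>UNIV. cond x y * L y * (\<sigma> y * weight (L(x := s)) \<sigma>))"
      by (simp add: sum_distrib_right mult.assoc)
    finally show "\<sigma> x * (\<sigma> x * (\<Sum>y\<in>UNIV. cond x y * L y * \<sigma> y) * weight (L(x := s)) \<sigma>)
        = (\<Sum>y\<in>UNIV. cond x y * L y * (\<sigma> y * weight (L(x := s)) \<sigma>))" .
  qed
  also have "\<dots> = (\<Sum>y\<in>UNIV. cond x y * L y * moment y (L(x := s)))"
    unfolding ising_moment_def by (subst sum.swap) (simp add: sum_distrib_left)
  finally show ?thesis .
qed

lemma moment_measurable [measurable (raw)]:
  assumes [measurable]: "\<And>i. (\<lambda>\<omega>. L \<omega> i) \<in> borel_measurable M"
  shows "(\<lambda>\<omega>. moment x (L \<omega>)) \<in> borel_measurable M"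
  unfolding ising_moment_def ising_weight_def interaction_def by measurable

lemma weight_measurable [measurable (raw)]:
  assumes [measurable]: "\<And>i. (\<lambda>\<omega>. L \<omega> i) \<in> borel_measurable M"
  shows "(\<lambda>\<omega>. weight (L \<omega>) \<sigma>) \<in> borel_measurable M"
  unfolding ising_weight_def interaction_def by measurable

lemma moment_continuous [continuous_intros]:
  assumes "\<And>i. continuous_on A (\<lambda>s. L s i)"
  shows "continuous_on A (\<lambda>s. moment x (L s))"
  unfolding ising_moment_def ising_weight_def interaction_def
  by (intro continuous_intros assms)

end

section \<open>Trajectories and local times\<close>

lemma traj_measurable [measurable (raw)]:
  fixes f :: "'a \<Rightarrow> nat \<Rightarrow> 'v::finite event"
  assumes [measurable]: "f \<in> M \<rightarrow>\<^sub>M Pi\<^sub>M UNIV (\<lambda>_. event_space)" "g \<in> borel_measurable M"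
  shows "(\<lambda>x. traj (f x) (g x)) \<in> M \<rightarrow>\<^sub>M count_space UNIV"
proof -
  have [measurable]: "(\<lambda>x. Max {k. fst (f x k) \<le> ereal (g x)}) \<in> M \<rightarrow>\<^sub>M count_space UNIV"
    by measurable
  show ?thesis
    unfolding traj_def
    by (rule measurable_compose_countable[where f = "\<lambda>k x. snd (f x k)"]) measurable
qed

lemma freeze_measurable [measurable (raw)]:
  fixes f :: "'a \<Rightarrow> nat \<Rightarrow> 'v::finite event"
  assumes [measurable]: "\<And>k. k \<le> m \<Longrightarrow> (\<lambda>x. f x k) \<in> M \<rightarrow>\<^sub>M event_space"
  shows "(\<lambda>x. freeze m (f x)) \<in> M \<rightarrow>\<^sub>M Pi\<^sub>M UNIV (\<lambda>_. event_space)"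
proof (rule measurable_PiM_single')
  fix k show "(\<lambda>x. freeze m (f x) k) \<in> M \<rightarrow>\<^sub>M event_space"
  proof (cases "k \<le> m")
    case False
    have [measurable]: "(\<lambda>x. f x m) \<in> M \<rightarrow>\<^sub>M event_space" by simp
    show ?thesis using False unfolding freeze_def by simp
  qed (simp add: freeze_def)
qed (auto simp: space_pair_measure)

lemma local_time_measurable:
  assumes [measurable]: "(\<lambda>(x, s). p x s) \<in> M \<Otimes>\<^sub>M borel \<rightarrow>\<^sub>M count_space UNIV" "t \<in> borel_measurable M"
  shows "(\<lambda>x. local_time (p x) i (t x)) \<in> borel_measurable M"
proof -
  have [measurable]: "(\<lambda>(x, s). p x s) \<in> M \<Otimes>\<^sub>M lborel \<rightarrow>\<^sub>M count_space UNIV"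
    using assms(1) by (simp cong: measurable_cong_sets)
  have "(\<lambda>x. local_time (p x) i (t x))
      = (\<lambda>x. \<integral>s. (if 0 \<le> s \<and> s \<le> t x \<and> p x s = i then 1 else 0) \<partial>lborel)"
    by (auto simp: local_time_def set_lebesgue_integral_def fun_eq_iff indicator_def
             intro!: Bochner_Integration.integral_cong)
  also have "\<dots> \<in> borel_measurable M"
    by measurable
  finally show ?thesis .
qed

lemma local_time_traj_measurable [measurable (raw)]:
  fixes f :: "'a \<Rightarrow> nat \<Rightarrow> 'v::finite event"
  assumes [measurable]: "f \<in> M \<rightarrow>\<^sub>M Pi\<^sub>M UNIV (\<lambda>_. event_space)" "t \<in> borel_measurable M"
  shows "(\<lambda>x. local_time (traj (f x)) i (t x)) \<in> borel_measurable M"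
  by (rule local_time_measurable) measurable

lemma local_time_eq_measure:
  "local_time p i t = measure lborel ({0..t} \<inter> p -` {i})"
proof -
  have "local_time p i t = (\<integral>s. indicator ({0..t} \<inter> p -` {i}) s \<partial>lborel)"
    unfolding local_time_def set_lebesgue_integral_def
    by (intro Bochner_Integration.integral_cong) (auto simp: indicator_def)
  then show ?thesis by simp
qed

lemma local_time_nonneg: "0 \<le> local_time p i t"
  by (simp add: local_time_eq_measure)

lemma local_time_nonpos [simp]: "t \<le> 0 \<Longrightarrow> local_time p i t = 0"
proof -
  assume "t \<le> 0"
  then have "{0..t} \<inter> p -` {i} \<subseteq> {0}" by auto
  then have "{0..t} \<inter> p -` {i} \<in> null_sets lborel"
    by (metis null_sets_subset finite.emptyI finite.insertI finite_imp_null_set_lborel finite_subset)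
  then show ?thesis by (auto simp: local_time_eq_measure null_sets_def measure_def)
qed

lemma local_time_cong:
  assumes "\<And>s. 0 \<le> s \<Longrightarrow> s < t \<Longrightarrow> p s = q s"
    and "p \<in> borel \<rightarrow>\<^sub>M count_space UNIV" "q \<in> borel \<rightarrow>\<^sub>M count_space UNIV"
  shows "local_time p i t = local_time q i t"
proof -
  note [measurable] = assms(2,3)
  have "AE s in lborel. s \<noteq> t" by (rule AE_lborel_singleton)
  then show ?thesis
    unfolding local_time_def set_lebesgue_integral_def using assms(1)
    by (intro integral_cong_AE) (auto simp: indicator_def)
qed

context
  fixes p :: "real \<Rightarrow> 'v"
  assumes p [measurable]: "p \<in> borel \<rightarrow>\<^sub>M count_space UNIV"
begin

lemma local_time_split:
  assumes "0 \<le> a" "a \<le> b"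
  shows "local_time p i b = local_time p i a + measure lborel ({a<..b} \<inter> p -` {i})"
proof -
  have [measurable]: "p -` {i} \<in> sets borel" using measurable_sets[OF p, of "{i}"] by simp
  have fin: "emeasure lborel (I \<inter> p -` {i}) \<noteq> \<infinity>" if "I \<subseteq> {a'..b'}" "I \<in> sets borel" for I a' b'
  proof -
    have "emeasure lborel (I \<inter> p -` {i}) \<le> emeasure lborel {a'..b'}"
      using that by (intro emeasure_mono) auto
    also have "\<dots> < \<infinity>" by (simp add: emeasure_lborel_Icc_eq)
    finally show ?thesis by simp
  qed
  have "emeasure lborel ({0..a} \<inter> p -` {i}) \<noteq> \<infinity>"
    by (rule fin[of _ 0 a]) auto
  moreover have "emeasure lborel ({a<..b} \<inter> p -` {i}) \<noteq> \<infinity>"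
    by (rule fin[of _ a b]) auto
  moreover
  have "{0..b} \<inter> p -` {i} = ({0..a} \<inter> p -` {i}) \<union> ({a<..b} \<inter> p -` {i})"
    using assms by auto
  ultimately show ?thesis
    unfolding local_time_eq_measure
    by (subst measure_Union[symmetric]) auto
qed

lemma local_time_mono: "a \<le> b \<Longrightarrow> local_time p i a \<le> local_time p i b"
  by (cases "0 \<le> a"; cases "0 \<le> b") (simp_all add: local_time_split[of a b] local_time_nonneg)

lemma local_time_diff_le:
  assumes "a \<le> b" shows "local_time p i b - local_time p i a \<le> b - a"
proof -
  have *: "measure lborel ({c<..b} \<inter> p -` {i}) \<le> b - c" if "c \<le> b" for c
  proof -
    have [measurable]: "p -` {i} \<in> sets borel" using measurable_sets[OF p, of "{i}"] by simp
    have "measure lborel ({c<..b} \<inter> p -` {i}) \<le> measure lborel {c<..b}"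
      using that by (intro measure_mono_fmeasurable) (auto simp: fmeasurable_def)
    then show ?thesis using that by simp
  qed
  consider "b \<le> 0" | "a \<le> 0" "0 \<le> b" | "0 \<le> a" using assms by linarith
  then show ?thesis
  proof cases
    case 2
    then show ?thesis using local_time_split[of 0 b] *[of 0] by simp
  next
    case 3
    then show ?thesis using local_time_split[of a b] *[of a] assms by simp
  qed (use assms in simp)
qed

lemma local_time_lipschitz: "\<bar>local_time p i a - local_time p i b\<bar> \<le> \<bar>a - b\<bar>"
  using local_time_mono[of a b i] local_time_mono[of b a i]
        local_time_diff_le[of a b i] local_time_diff_le[of b a i]
  by (cases "a \<le> b") auto

lemma local_time_continuous: "continuous_on A (local_time p i)"
proof (rule continuous_onI)
  fix a e :: real assume "0 < e"
  then show "\<exists>d>0. \<forall>b\<in>A. dist b a < d \<longrightarrow> dist (local_time p i b) (local_time p i a) \<le> e"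
    by (intro exI[of _ e]) (auto simp: dist_real_def intro!: order_trans[OF local_time_lipschitz])
qed

lemma local_time_const:
  assumes "a \<le> b" "0 \<le> a" and const: "\<And>s. a \<le> s \<Longrightarrow> s < b \<Longrightarrow> p s = j"
  shows "local_time p i b = local_time p i a + (if i = j then b - a else 0)"
proof -
  have [measurable]: "p -` {i} \<in> sets borel" using measurable_sets[OF p, of "{i}"] by simp
  have "AE s in lborel. s \<noteq> b" by (rule AE_lborel_singleton)
  then have "measure lborel ({a<..b} \<inter> p -` {i}) = measure lborel (if i = j then {a<..b} else {})"
    by (intro measure_eq_AE) (auto simp: const)
  then show ?thesis using local_time_split[OF \<open>0 \<le> a\<close> \<open>a \<le> b\<close>, of i] \<open>a \<le> b\<close> by simp
qed

end

lemma sum_local_time: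
  fixes p :: "real \<Rightarrow> 'v::finite"
  assumes p [measurable]: "p \<in> borel \<rightarrow>\<^sub>M count_space UNIV" and "0 \<le> t"
  shows "(\<Sum>i\<in>UNIV. local_time p i t) = t"
proof -
  have [measurable]: "p -` {i} \<in> sets borel" for i using measurable_sets[OF p, of "{i}"] by simp
  have "(\<Sum>i\<in>UNIV. local_time p i t) = measure lborel (\<Union>i. {0..t} \<inter> p -` {i})"
    unfolding local_time_eq_measure
  proof (rule measure_finite_Union[symmetric])
    fix i
    have "emeasure lborel ({0..t} \<inter> p -` {i}) \<le> emeasure lborel {0..t}"
      by (intro emeasure_mono) auto
    also have "\<dots> < \<infinity>" by (simp add: emeasure_lborel_Icc_eq)
    finally show "emeasure lborel ({0..t} \<inter> p -` {i}) \<noteq> \<infinity>" by simp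
  qed (auto simp: disjoint_family_on_def)
  also have "(\<Union>i. {0..t} \<inter> p -` {i}) = {0..t}" by auto
  finally show ?thesis using \<open>0 \<le> t\<close> by simp
qed

lemma traj_path_measurable [measurable]:
  fixes \<omega> :: "nat \<Rightarrow> 'v::finite event"
  shows "traj \<omega> \<in> borel \<rightarrow>\<^sub>M count_space UNIV"
  by (rule traj_measurable) (auto simp: space_PiM space_pair_measure)

lemma traj_freeze_after:
  assumes "fst (\<omega> m) \<le> ereal t"
  shows "traj (freeze m \<omega>) t = snd (\<omega> m)"
proof -
  have "Max {k. fst (freeze m \<omega> k) \<le> ereal t} = m"
    using assms by (intro Max_eqI) (auto simp: freeze_def split: if_splits)
  then show ?thesis by (simp add: traj_def freeze_def)
qed

lemma traj_freeze_before:
  assumes "ereal t < fst (\<omega> (Suc m))"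
  shows "traj (freeze (Suc m) \<omega>) t = traj (freeze m \<omega>) t \<or> (\<forall>k\<le>m. \<not> fst (\<omega> k) \<le> ereal t)"
proof -
  have *: "{k. fst (freeze (Suc m) \<omega> k) \<le> ereal t} = {k. k \<le> m \<and> fst (\<omega> k) \<le> ereal t}"
    "{k. fst (freeze m \<omega> k) \<le> ereal t} = {k. k \<le> m \<and> fst (\<omega> k) \<le> ereal t}"
    using assms by (auto simp: freeze_def le_Suc_eq split: if_splits)
  show ?thesis
  proof (cases "{k. k \<le> m \<and> fst (\<omega> k) \<le> ereal t} = {}")
    case False
    then have "Max {k. k \<le> m \<and> fst (\<omega> k) \<le> ereal t} \<in> {k. k \<le> m \<and> fst (\<omega> k) \<le> ereal t}"
      by (intro Max_in) auto
    then show ?thesis unfolding traj_def * by (simp add: freeze_def)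
  qed auto
qed

lemma traj_eq_freeze:
  assumes "\<And>k. m < k \<Longrightarrow> ereal t < fst (\<omega> k)" and "\<exists>k\<le>m. fst (\<omega> k) \<le> ereal t"
  shows "traj \<omega> t = traj (freeze m \<omega>) t"
proof -
  have *: "{k. fst (\<omega> k) \<le> ereal t} = {k. k \<le> m \<and> fst (\<omega> k) \<le> ereal t}"
    "{k. fst (freeze m \<omega> k) \<le> ereal t} = {k. k \<le> m \<and> fst (\<omega> k) \<le> ereal t}"
    using assms(1) by (auto simp: freeze_def not_le[symmetric] split: if_splits)
  have "Max {k. k \<le> m \<and> fst (\<omega> k) \<le> ereal t} \<in> {k. k \<le> m \<and> fst (\<omega> k) \<le> ereal t}"
    using assms(2) by (intro Max_in) auto
  then show ?thesis unfolding traj_def * by (simp add: freeze_def)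
qed

section \<open>Laws of jump processes\<close>

text \<open>A jump is a pair of a time and a target state; densities of paths are taken with respect to products of this measure.\<close>
abbreviation step_space :: "(real \<times> 'v) measure" where
  "step_space \<equiv> lborel \<Otimes>\<^sub>M count_space UNIV"

lemma nn_integral_step_space:
  fixes f :: "real \<times> 'v::finite \<Rightarrow> ennreal"
  assumes [measurable]: "f \<in> borel_measurable step_space"
  shows "(\<integral>\<^sup>+p. f p \<partial>step_space) = (\<integral>\<^sup>+t. (\<Sum>j\<in>UNIV. f (t, j)) \<partial>lborel)"
proof -
  interpret C: sigma_finite_measure "count_space (UNIV :: 'v set)"
    by (rule sigma_finite_measure_count_space)
  show ?thesis
    by (subst C.nn_integral_fst[symmetric]) (auto simp: nn_integral_count_space_finite)
qed

lemma sigma_finite_step_space: "sigma_finite_measure (step_space :: (real \<times> 'v::finite) measure)"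
proof -
  interpret C: sigma_finite_measure "count_space (UNIV :: 'v set)"
    by (rule sigma_finite_measure_count_space)
  interpret pair_sigma_finite lborel "count_space (UNIV :: 'v set)" ..
  show ?thesis by unfold_locales
qed

interpretation steps: product_sigma_finite "\<lambda>_::nat. step_space :: (real \<times> 'v::finite) measure"
  by (simp add: product_sigma_finite_def sigma_finite_step_space)

lemma jump_density_measurable:
  assumes R [measurable]: "\<And>k. (\<lambda>(x, t). R x t k) \<in> borel_measurable (M \<Otimes>\<^sub>M borel)"
    and [measurable]: "a \<in> borel_measurable M" "t \<in> borel_measurable M"
  shows "(\<lambda>x. jump_density (R x) (a x) (t x) j) \<in> borel_measurable M"
proof -
  have [measurable]: "(\<lambda>(x, t). R x t k) \<in> borel_measurable (M \<Otimes>\<^sub>M lborel)" for k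
    using R[of k] by (simp cong: measurable_cong_sets)
  have "(\<lambda>x. jump_density (R x) (a x) (t x) j) = (\<lambda>x. R x (t x) j *
      exp (- (\<integral>s. (if a x \<le> s \<and> s \<le> t x then \<Sum>k\<in>UNIV. R x s k else 0) \<partial>lborel)))"
    by (auto simp: jump_density_def set_lebesgue_integral_def fun_eq_iff indicator_def
             intro!: Bochner_Integration.integral_cong)
  also have "\<dots> \<in> borel_measurable M"
    by measurable
  finally show ?thesis .
qed

lemma jump_density_measurable1:
  assumes [measurable]: "\<And>k. (\<lambda>t. R t k) \<in> borel_measurable borel"
    and "a \<in> borel_measurable M" "t \<in> borel_measurable M"
  shows "(\<lambda>x. jump_density R (a x) (t x) j) \<in> borel_measurable M"
  using assms by (intro jump_density_measurable) auto

lemma jump_mass_eq_step: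
  assumes [measurable]: "\<And>k. (\<lambda>t. R t k) \<in> borel_measurable borel" "A \<in> sets event_space"
  shows "jump_mass R a A = (\<integral>\<^sup>+(t, j). ennreal (jump_density R a t j) * indicator {a<..} t * indicator A (ereal t, j) \<partial>step_space)"
proof -
  have [measurable]: "(\<lambda>t. jump_density R a t j) \<in> borel_measurable borel" for j
    by (intro jump_density_measurable1) auto
  show ?thesis
    unfolding jump_mass_def
    by (subst nn_integral_step_space)
       (auto intro!: nn_integral_cong simp: sum_distrib_right ac_simps)
qed

lemma jump_mass_measurable:
  assumes R [measurable]: "\<And>k. (\<lambda>(x, t). R x t k) \<in> borel_measurable (M \<Otimes>\<^sub>M borel)"
    and [measurable]: "a \<in> borel_measurable M" "A \<in> sets event_space"
  shows "(\<lambda>x. jump_mass (R x) (a x) A) \<in> borel_measurable M"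
proof -
  have [measurable]: "(\<lambda>y. jump_density (R (fst y)) (a (fst y)) (snd y) j) \<in> borel_measurable (M \<Otimes>\<^sub>M borel)" for j
    by (rule jump_density_measurable) measurable
  have [measurable]: "(\<lambda>(x, t). jump_density (R x) (a x) t j) \<in> borel_measurable (M \<Otimes>\<^sub>M lborel)" for j
    using jump_density_measurable[of "\<lambda>y. R (fst y)" "M \<Otimes>\<^sub>M borel" "\<lambda>y. a (fst y)" snd j]
    by (simp add: case_prod_beta' cong: measurable_cong_sets)
  have "(\<lambda>x. jump_mass (R x) (a x) A) = (\<lambda>x. \<integral>\<^sup>+t. (\<Sum>j\<in>UNIV. ennreal (jump_density (R x) (a x) t j)
      * indicator A (ereal t, j)) * (if a x < t then 1 else 0) \<partial>lborel)"
    unfolding jump_mass_def by (auto intro!: nn_integral_cong simp: fun_eq_iff indicator_def)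
  also have "\<dots> \<in> borel_measurable M"
    by measurable
  finally show ?thesis .
qed

lemma sets_next_event [simp, measurable_cong]: "sets (next_event R a i) = sets event_space"
  and space_next_event [simp]: "space (next_event R a i) = UNIV"
  using sets.sigma_sets_eq[of "event_space :: 'a event measure"]
  by (simp_all add: next_event_def space_pair_measure)

context
  fixes R :: "real \<Rightarrow> 'v::finite \<Rightarrow> real"
  assumes R [measurable]: "\<And>k. (\<lambda>t. R t k) \<in> borel_measurable borel"
begin

lemma emeasure_next_event:
  assumes A: "A \<in> sets event_space"
  shows "emeasure (next_event R a i) A = jump_mass R a A + (1 - jump_mass R a UNIV) * indicator A (\<infinity>, i)"
proof -
  define N where "N = distr (density step_space (\<lambda>(t, j). ennreal (jump_density R a t j) * indicator {a<..} t))
    event_space (\<lambda>(t, j). (ereal t, j))"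
  have [measurable]: "(\<lambda>t. jump_density R a t j) \<in> borel_measurable borel" for j
    by (intro jump_density_measurable1) auto
  have N: "jump_mass R a A = emeasure N A" if [measurable]: "A \<in> sets event_space" for A
  proof -
    have "emeasure N A = (\<integral>\<^sup>+e. indicator A e \<partial>N)"
      by (simp add: N_def)
    also have "\<dots> = (\<integral>\<^sup>+p. indicator A (case p of (t, j) \<Rightarrow> (ereal t, j))
        \<partial>density step_space (\<lambda>(t, j). ennreal (jump_density R a t j) * indicator {a<..} t))"
      unfolding N_def by (subst nn_integral_distr) auto
    also have "\<dots> = jump_mass R a A"
      by (subst nn_integral_density) (auto simp: jump_mass_eq_step intro!: nn_integral_cong)
    finally show ?thesis by simp
  qed
  define m where "m = (\<lambda>A. jump_mass R a A + (1 - jump_mass R a UNIV) * indicator A (\<infinity>, i))"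
  have m: "m A = emeasure N A + (1 - jump_mass R a UNIV) * emeasure (return event_space (\<infinity>, i)) A"
    if "A \<in> sets event_space" for A
    using that by (simp add: m_def N)
  have "emeasure (measure_of UNIV (sets event_space) m) A = m A"
  proof (rule emeasure_measure_of_sigma)
    show "sigma_algebra UNIV (sets (event_space :: 'v event measure))"
      using sets.sigma_algebra_axioms[of "event_space :: 'v event measure"] by (simp add: space_pair_measure)
    show "positive (sets event_space) m"
      by (simp add: positive_def m)
    show "countably_additive (sets event_space) m"
      unfolding countably_additive_def
    proof safe
      fix B :: "nat \<Rightarrow> 'v event set"
      assume B: "range B \<subseteq> sets event_space" "disjoint_family B"
      then have "(\<Sum>k. m (B k)) = (\<Sum>k. emeasure N (B k)
          + (1 - jump_mass R a UNIV) * emeasure (return event_space (\<infinity>, i)) (B k))"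
        by (intro suminf_cong m) auto
      also have "\<dots> = (\<Sum>k. emeasure N (B k))
          + (1 - jump_mass R a UNIV) * (\<Sum>k. emeasure (return event_space (\<infinity>, i)) (B k))"
        by (simp add: suminf_add[symmetric])
      also have "(\<Sum>k. emeasure N (B k)) = emeasure N (\<Union>k. B k)"
        using B by (intro suminf_emeasure) (auto simp: N_def)
      also have "(\<Sum>k. emeasure (return event_space (\<infinity>, i)) (B k)) = emeasure (return event_space (\<infinity>, i)) (\<Union>k. B k)"
        using B by (intro suminf_emeasure) auto
      also have "emeasure N (\<Union>k. B k) + (1 - jump_mass R a UNIV) * \<dots> = m (\<Union>k. B k)"
        using B by (subst m) auto
      finally show "(\<Sum>k. m (B k)) = m (\<Union>k. B k)" .
    qed
  qed fact
  then show ?thesis by (simp add: next_event_def m_def)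
qed

lemma prob_space_next_event:
  assumes "jump_mass R a UNIV \<le> 1"
  shows "prob_space (next_event R a i)"
proof
  have "emeasure (next_event R a i) UNIV = jump_mass R a UNIV + (1 - jump_mass R a UNIV)"
    using emeasure_next_event[of UNIV a i] sets.top[of "event_space :: 'v event measure"]
    by (simp add: space_pair_measure)
  also have "\<dots> = 1" using diff_add_cancel_ennreal[OF assms] by (simp add: add.commute)
  finally show "emeasure (next_event R a i) (space (next_event R a i)) = 1" by simp
qed

lemma nn_integral_next_event:
  assumes f: "f \<in> borel_measurable event_space"
  shows "(\<integral>\<^sup>+e. f e \<partial>next_event R a i) =
    (\<integral>\<^sup>+(t, j). ennreal (jump_density R a t j) * indicator {a<..} t * f (ereal t, j) \<partial>step_space)
      + (1 - jump_mass R a UNIV) * f (\<infinity>, i)"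
proof -
  have [measurable]: "(\<lambda>t. jump_density R a t j) \<in> borel_measurable borel" for j
    by (intro jump_density_measurable1) auto
  show ?thesis
    using f
  proof (induction rule: borel_measurable_induct)
    case (cong f g)
    then have "f = g" by (auto simp: space_pair_measure)
    with cong show ?case by simp
  next
    case (set A)
    then show ?case
      by (simp add: emeasure_next_event jump_mass_eq_step)
  next
    case (mult u c)
    then have [measurable]: "u \<in> borel_measurable event_space" by simp
    have "(\<integral>\<^sup>+(t, j). ennreal (jump_density R a t j) * indicator {a<..} t * (c * u (ereal t, j)) \<partial>step_space)
        = c * (\<integral>\<^sup>+(t, j). ennreal (jump_density R a t j) * indicator {a<..} t * u (ereal t, j) \<partial>step_space)"
      by (subst nn_integral_cmult[symmetric]) (auto intro!: nn_integral_cong simp: ac_simps)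
    then show ?case
      using mult by (simp add: nn_integral_cmult distrib_left ac_simps)
  next
    case (add u v)
    then have [measurable]: "u \<in> borel_measurable event_space" "v \<in> borel_measurable event_space" by simp_all
    have "(\<integral>\<^sup>+(t, j). ennreal (jump_density R a t j) * indicator {a<..} t * (v (ereal t, j) + u (ereal t, j)) \<partial>step_space)
        = (\<integral>\<^sup>+(t, j). ennreal (jump_density R a t j) * indicator {a<..} t * v (ereal t, j) \<partial>step_space)
        + (\<integral>\<^sup>+(t, j). ennreal (jump_density R a t j) * indicator {a<..} t * u (ereal t, j) \<partial>step_space)"
      by (subst nn_integral_add[symmetric]) (auto intro!: nn_integral_cong simp: distrib_left)
    then show ?case
      using add by (simp add: nn_integral_add distrib_left ac_simps)
  next
    case (seq U)
    then have [measurable]: "U k \<in> borel_measurable event_space" for k by simp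
    have mono: "U k x \<le> U l x" if "k \<le> l" for k l x using seq(3) that by (cases x) (auto simp: incseq_def le_fun_def)
    have "(\<integral>\<^sup>+e. (SUP k. U k) e \<partial>next_event R a i) = (SUP k. \<integral>\<^sup>+e. U k e \<partial>next_event R a i)"
      unfolding SUP_apply using seq by (intro nn_integral_monotone_convergence_SUP) auto
    also have "\<dots> = (SUP k. (\<integral>\<^sup>+(t, j). ennreal (jump_density R a t j) * indicator {a<..} t * U k (ereal t, j) \<partial>step_space)
      + (1 - jump_mass R a UNIV) * U k (\<infinity>, i))"
      using seq by simp
    also have "\<dots> = (SUP k. (\<integral>\<^sup>+(t, j). ennreal (jump_density R a t j) * indicator {a<..} t * U k (ereal t, j) \<partial>step_space))
      + (SUP k. (1 - jump_mass R a UNIV) * U k (\<infinity>, i))"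
      by (intro ennreal_SUP_add)
         (auto simp: incseq_def intro!: nn_integral_mono mult_left_mono mono)
    also have "(SUP k. (\<integral>\<^sup>+(t, j). ennreal (jump_density R a t j) * indicator {a<..} t * U k (ereal t, j) \<partial>step_space))
      = (\<integral>\<^sup>+y. (SUP k. case y of (t, j) \<Rightarrow> ennreal (jump_density R a t j) * indicator {a<..} t * U k (ereal t, j)) \<partial>step_space)"
      by (intro nn_integral_monotone_convergence_SUP[symmetric])
         (auto simp: incseq_def le_fun_def intro!: mult_left_mono mono)
    also have "\<dots> = (\<integral>\<^sup>+(t, j). ennreal (jump_density R a t j) * indicator {a<..} t * (SUP k. U k) (ereal t, j) \<partial>step_space)"
      by (intro nn_integral_cong) (auto simp: SUP_mult_left_ennreal SUP_apply image_image)
    finally show ?case by (simp add: SUP_mult_left_ennreal SUP_apply image_image)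
  qed
qed

end

subsection \<open>Finite-dimensional densities\<close>

definition increasing_upto :: "nat \<Rightarrow> (nat \<Rightarrow> 'v event) \<Rightarrow> bool" where
  "increasing_upto n \<omega> \<longleftrightarrow> (\<forall>k<n. fst (\<omega> k) < fst (\<omega> (Suc k))) \<and> fst (\<omega> n) < \<infinity>"

text \<open>A skeleton \<open>z\<close> lists the jumps \<open>1, 2, \<dots>\<close> with finite times. The start is not part of it, so that the
  coordinates of \<open>z\<close> are free and carry a Lebesgue density.\<close>
definition events :: "'v \<Rightarrow> (nat \<Rightarrow> real \<times> 'v) \<Rightarrow> nat \<Rightarrow> 'v event" where
  "events z0 z k = (if k = 0 then (0, z0) else (ereal (fst (z k)), snd (z k)))"

definition jump_time :: "(nat \<Rightarrow> real \<times> 'v) \<Rightarrow> nat \<Rightarrow> real" where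
  "jump_time z k = (if k = 0 then 0 else fst (z k))"

definition jump_state :: "'v \<Rightarrow> (nat \<Rightarrow> real \<times> 'v) \<Rightarrow> nat \<Rightarrow> 'v" where
  "jump_state z0 z k = (if k = 0 then z0 else snd (z k))"

lemma events_eq: "events z0 z k = (ereal (jump_time z k), jump_state z0 z k)"
  by (simp add: events_def jump_time_def jump_state_def)

lemma events_measurable [measurable (raw)]:
  assumes "\<And>k. 1 \<le> k \<Longrightarrow> k \<le> n \<Longrightarrow> (\<lambda>x. f x k) \<in> M \<rightarrow>\<^sub>M step_space" and "k \<le> n"
  shows "(\<lambda>x. events z0 (f x) k) \<in> M \<rightarrow>\<^sub>M event_space"
proof (cases "k = 0")
  case False
  then have [measurable]: "(\<lambda>x. f x k) \<in> M \<rightarrow>\<^sub>M step_space" using assms by simp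
  have [measurable]: "(\<lambda>x. fst (f x k)) \<in> borel_measurable M"
    using measurable_compose[OF \<open>(\<lambda>x. f x k) \<in> M \<rightarrow>\<^sub>M step_space\<close> measurable_fst] by simp
  show ?thesis using False by (simp add: events_def)
qed (simp add: events_def space_pair_measure)

text \<open>The bound on the jump mass is what makes \<open>next_event\<close> a probability measure: the mass that is missing
  to \<open>1\<close> is put on the absence of a further jump.\<close>
locale rate_process =
  fixes r :: "'v::finite rate" and z0 :: 'v
  assumes rate_measurable: "\<And>j. (\<lambda>(\<omega>, t). r (traj \<omega>) t j) \<in> borel_measurable (Pi\<^sub>M UNIV (\<lambda>_. event_space) \<Otimes>\<^sub>M borel)"
    and jump_mass_le: "\<And>\<omega> m. fst (\<omega> m) \<noteq> \<infinity> \<Longrightarrow>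
      jump_mass (r (traj (freeze m \<omega>))) (real_of_ereal (fst (\<omega> m))) UNIV \<le> 1"
begin

lemma rate_traj_measurable [measurable (raw)]:
  assumes [measurable]: "f \<in> M \<rightarrow>\<^sub>M Pi\<^sub>M UNIV (\<lambda>_. event_space)" "t \<in> borel_measurable M"
  shows "(\<lambda>x. r (traj (f x)) (t x) j) \<in> borel_measurable M"
  using measurable_compose[OF _ rate_measurable[of j], of "\<lambda>x. (f x, t x)" M] by simp

lemma rate_measurable1 [measurable]: "(\<lambda>t. r (traj \<omega>) t j) \<in> borel_measurable borel"
  by (rule rate_traj_measurable) (auto simp: space_PiM space_pair_measure)

lemma event_kernel_Suc_measurable:
  "event_kernel r z0 (Suc m) \<in> Pi\<^sub>M {0..<Suc m} (\<lambda>_. event_space) \<rightarrow>\<^sub>M subprob_algebra event_space"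
proof (rule measurable_subprob_algebra)
  fix \<omega> :: "nat \<Rightarrow> 'v event"
  show "subprob_space (event_kernel r z0 (Suc m) \<omega>)"
    by (auto simp: event_kernel_def space_pair_measure
             intro!: prob_space_imp_subprob_space prob_space_return prob_space_next_event jump_mass_le)
  show "sets (event_kernel r z0 (Suc m) \<omega>) = sets event_space"
    by (simp add: event_kernel_def)
next
  fix A :: "'v event set" assume A [measurable]: "A \<in> sets event_space"
  have [measurable]: "(\<lambda>\<omega>. \<omega> m) \<in> Pi\<^sub>M {0..<Suc m} (\<lambda>_. event_space) \<rightarrow>\<^sub>M event_space"
    by simp
  have freeze [measurable]: "freeze m \<in> Pi\<^sub>M {0..<Suc m} (\<lambda>_. event_space :: 'v event measure) \<rightarrow>\<^sub>M Pi\<^sub>M UNIV (\<lambda>_. event_space)"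
    by (rule freeze_measurable) simp
  have [measurable]: "(\<lambda>\<omega>. jump_mass (r (traj (freeze m \<omega>))) (real_of_ereal (fst (\<omega> m))) B)
      \<in> borel_measurable (Pi\<^sub>M {0..<Suc m} (\<lambda>_. event_space))" if "B \<in> sets event_space" for B
    using that by (intro jump_mass_measurable) measurable
  have [measurable]: "UNIV \<in> sets (event_space :: 'v event measure)"
    using sets.top[of "event_space :: 'v event measure"] by (simp add: space_pair_measure)
  have "(\<lambda>\<omega>. emeasure (event_kernel r z0 (Suc m) \<omega>) A) = (\<lambda>\<omega>.
      if fst (\<omega> m) = \<infinity> then indicator A (\<omega> m)
      else jump_mass (r (traj (freeze m \<omega>))) (real_of_ereal (fst (\<omega> m))) A
        + (1 - jump_mass (r (traj (freeze m \<omega>))) (real_of_ereal (fst (\<omega> m))) UNIV) * indicator A (\<infinity>, snd (\<omega> m)))"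
    by (auto simp: event_kernel_def fun_eq_iff emeasure_next_event A)
  also have "\<dots> \<in> borel_measurable (Pi\<^sub>M {0..<Suc m} (\<lambda>_. event_space))"
    by measurable
  finally show "(\<lambda>\<omega>. emeasure (event_kernel r z0 (Suc m) \<omega>) A) \<in> borel_measurable (Pi\<^sub>M {0..<Suc m} (\<lambda>_. event_space))" .
qed

sublocale IT: Ionescu_Tulcea "event_kernel r z0" "\<lambda>_. event_space"
proof (rule Ionescu_Tulcea.intro)
  fix n
  show "event_kernel r z0 n \<in> Pi\<^sub>M {0..<n} (\<lambda>_. event_space) \<rightarrow>\<^sub>M subprob_algebra event_space"
  proof (cases n)
    case 0
    have "event_kernel r z0 0 = (\<lambda>_. return event_space (0, z0))"
      by (simp add: event_kernel_def fun_eq_iff)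
    then show ?thesis using 0
      by (auto intro!: measurable_const simp: space_subprob_algebra space_pair_measure
               prob_space_return prob_space_imp_subprob_space)
  qed (simp add: event_kernel_Suc_measurable)
next
  fix n and \<omega> :: "nat \<Rightarrow> 'v event"
  show "prob_space (event_kernel r z0 n \<omega>)"
    by (cases n) (auto simp: event_kernel_def space_pair_measure
             intro!: prob_space_return prob_space_next_event jump_mass_le)
qed

abbreviation PP :: "(nat \<Rightarrow> 'v event) measure" where "PP \<equiv> jump_process r z0"

lemma PP_eq: "PP = IT.PF.lim"
  by (simp add: jump_process_def)

lemma sets_PP [simp, measurable_cong]: "sets PP = sets (Pi\<^sub>M UNIV (\<lambda>_. event_space))"
  and space_PP [simp]: "space PP = UNIV"
  by (auto simp: PP_eq space_PiM space_pair_measure)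

lemma nn_integral_PP_restrict:
  assumes [measurable]: "f \<in> borel_measurable (Pi\<^sub>M {0..<n} (\<lambda>_. event_space))"
  shows "(\<integral>\<^sup>+\<omega>. f (restrict \<omega> {0..<n}) \<partial>PP) = (\<integral>\<^sup>+\<omega>. f \<omega> \<partial>IT.C 0 n (\<lambda>_. undefined))"
proof -
  have und: "(\<lambda>_. undefined) \<in> space (Pi\<^sub>M {0..<0::nat} (\<lambda>_. event_space :: 'v event measure))"
    by (simp add: space_PiM)
  have [simp]: "IT.up_to {0..<n} = n"
    by (auto simp: IT.up_to_def intro!: Least_equality)
  have [measurable_cong]: "sets (IT.C 0 n (\<lambda>_. undefined)) = sets (Pi\<^sub>M {0..<n} (\<lambda>_. event_space))"
    using IT.sets_C[OF und, of n] by simp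
  have "(\<integral>\<^sup>+\<omega>. f (restrict \<omega> {0..<n}) \<partial>PP)
      = (\<integral>\<^sup>+\<omega>. f \<omega> \<partial>distr PP (Pi\<^sub>M {0..<n} (\<lambda>_. event_space)) (\<lambda>\<omega>. restrict \<omega> {0..<n}))"
    by (subst nn_integral_distr) (auto intro!: measurable_restrict simp: measurable_cong_sets[OF sets_PP refl])
  also have "distr PP (Pi\<^sub>M {0..<n} (\<lambda>_. event_space)) (\<lambda>\<omega>. restrict \<omega> {0..<n}) = IT.CI {0..<n}"
    unfolding PP_eq by (rule IT.distr_lim) simp
  also have "(\<integral>\<^sup>+\<omega>. f \<omega> \<partial>IT.CI {0..<n}) = (\<integral>\<^sup>+\<omega>. f (restrict \<omega> {0..<n}) \<partial>IT.C 0 n (\<lambda>_. undefined))"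
    unfolding IT.CI_def by (subst nn_integral_distr) (auto intro!: measurable_restrict)
  also have "\<dots> = (\<integral>\<^sup>+\<omega>. f \<omega> \<partial>IT.C 0 n (\<lambda>_. undefined))"
    using IT.space_C[OF und, of n] by (intro nn_integral_cong) (auto simp: space_PiM PiE_def extensional_restrict)
  finally show ?thesis .
qed

lemma prob_space_PP: "prob_space PP"
proof
  have und: "(\<lambda>_. undefined) \<in> space (Pi\<^sub>M {0..<0::nat} (\<lambda>_. event_space :: 'v event measure))"
    by (simp add: space_PiM)
  have "(\<integral>\<^sup>+\<omega>. 1 \<partial>PP) = (\<integral>\<^sup>+\<omega>. 1 \<partial>IT.C 0 0 (\<lambda>_. undefined))"
    by (rule nn_integral_PP_restrict) simp
  also have "\<dots> = 1"
    using prob_space.emeasure_space_1[OF IT.prob_space_C[OF und, of 0]] by (simp del: IT.C.simps)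
  finally show "emeasure PP (space PP) = 1" by simp
qed

lemma nn_integral_C_Suc:
  assumes [measurable]: "f \<in> borel_measurable (Pi\<^sub>M {0..<Suc n} (\<lambda>_. event_space))"
  shows "(\<integral>\<^sup>+\<omega>. f \<omega> \<partial>IT.C 0 (Suc n) (\<lambda>_. undefined))
    = (\<integral>\<^sup>+\<omega>. (\<integral>\<^sup>+e. f (fun_upd \<omega> n e) \<partial>event_kernel r z0 n \<omega>) \<partial>IT.C 0 n (\<lambda>_. undefined))"
proof -
  have und: "(\<lambda>_. undefined) \<in> space (Pi\<^sub>M {0..<0::nat} (\<lambda>_. event_space :: 'v event measure))"
    by (simp add: space_PiM)
  have [measurable_cong]: "sets (IT.C 0 n (\<lambda>_. undefined)) = sets (Pi\<^sub>M {0..<n} (\<lambda>_. event_space))"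
    using IT.sets_C[OF und, of n] by simp
  have "(\<integral>\<^sup>+\<omega>. f \<omega> \<partial>IT.C 0 (Suc n) (\<lambda>_. undefined)) = (\<integral>\<^sup>+\<omega>. (\<integral>\<^sup>+\<omega>'. f \<omega>' \<partial>IT.eP n \<omega>) \<partial>IT.C 0 n (\<lambda>_. undefined))"
    using IT.measurable_eP[of n]
    by (simp add: nn_integral_bind[where B = "Pi\<^sub>M {0..<Suc n} (\<lambda>_. event_space)"])
  also have "\<dots> = (\<integral>\<^sup>+\<omega>. (\<integral>\<^sup>+e. f (fun_upd \<omega> n e) \<partial>event_kernel r z0 n \<omega>) \<partial>IT.C 0 n (\<lambda>_. undefined))"
    using IT.space_C[OF und, of n] by (intro nn_integral_cong IT.nn_integral_eP) auto
  finally show ?thesis .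
qed

text \<open>The law of the first \<open>n\<close> jumps is not absolutely continuous, because paths may stop jumping; this is the density
  of its part with \<open>n\<close> jumps at finite times.\<close>
definition path_density :: "nat \<Rightarrow> (nat \<Rightarrow> real \<times> 'v) \<Rightarrow> ennreal" where
  "path_density n z = (\<Prod>k<n. if jump_time z k < jump_time z (Suc k)
     then ennreal (jump_density (r (traj (freeze k (events z0 z)))) (jump_time z k) (jump_time z (Suc k)) (snd (z (Suc k))))
     else 0)"

lemma jump_time_measurable [measurable (raw)]:
  assumes "\<And>k. 1 \<le> k \<Longrightarrow> k \<le> n \<Longrightarrow> (\<lambda>x. f x k) \<in> M \<rightarrow>\<^sub>M step_space" and "k \<le> n"
  shows "(\<lambda>x. jump_time (f x) k) \<in> borel_measurable M"
proof (cases "k = 0")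
  case False
  then have "(\<lambda>x. f x k) \<in> M \<rightarrow>\<^sub>M step_space" using assms by simp
  from measurable_compose[OF this measurable_fst] show ?thesis using False by (simp add: jump_time_def)
qed (simp add: jump_time_def)

lemma event_measurable_upto:
  "k \<le> n \<Longrightarrow> (\<lambda>\<omega>. \<omega> k) \<in> Pi\<^sub>M {0..<Suc n} (\<lambda>_. event_space :: 'v event measure) \<rightarrow>\<^sub>M event_space"
  by simp

lemma increasing_upto_measurable [measurable]:
  "Measurable.pred (Pi\<^sub>M {0..<Suc n} (\<lambda>_. event_space :: 'v event measure)) (increasing_upto n)"
proof -
  have [measurable]: "(\<lambda>\<omega>. fst (\<omega> k)) \<in> borel_measurable (Pi\<^sub>M {0..<Suc n} (\<lambda>_. event_space :: 'v event measure))"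
    if "k \<le> n" for k
    using measurable_compose[OF event_measurable_upto[OF that] measurable_fst] by simp
  have "Measurable.pred (Pi\<^sub>M {0..<Suc n} (\<lambda>_. event_space :: 'v event measure)) (\<lambda>\<omega>. fst (\<omega> k) < fst (\<omega> (Suc k)))"
    if "k < n" for k
  proof -
    have [measurable]: "(\<lambda>\<omega>. fst (\<omega> l)) \<in> borel_measurable (Pi\<^sub>M {0..<Suc n} (\<lambda>_. event_space :: 'v event measure))"
      if "l \<in> {k, Suc k}" for l
      using that \<open>k < n\<close> measurable_compose[OF event_measurable_upto[of l n] measurable_fst] by auto
    show ?thesis by measurable
  qed
  then have [measurable]: "Measurable.pred (Pi\<^sub>M {0..<Suc n} (\<lambda>_. event_space :: 'v event measure))
      (\<lambda>\<omega>. \<forall>k\<in>{..<n}. fst (\<omega> k) < fst (\<omega> (Suc k)))"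
    by (intro pred_intros_finite) auto
  have [measurable]: "Measurable.pred (Pi\<^sub>M {0..<Suc n} (\<lambda>_. event_space :: 'v event measure)) (\<lambda>\<omega>. fst (\<omega> n) < \<infinity>)"
    by measurable
  show ?thesis
    unfolding increasing_upto_def by (simp add: Ball_def[of "{..<n}", unfolded lessThan_iff, symmetric])
qed

lemma increasing_upto_restrict: "increasing_upto n (restrict \<omega> {0..<Suc n}) = increasing_upto n \<omega>"
  by (auto simp: increasing_upto_def)

lemma freeze_restrict: "k \<le> n \<Longrightarrow> freeze k (restrict \<omega> {0..<Suc n}) = freeze k \<omega>"
  by (auto simp: freeze_def fun_eq_iff)

lemma restrict_events_measurable [measurable]:
  "(\<lambda>z. restrict (events z0 z) {0..<Suc n}) \<in> Pi\<^sub>M {1..n} (\<lambda>_. step_space) \<rightarrow>\<^sub>M Pi\<^sub>M {0..<Suc n} (\<lambda>_. event_space)"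
  by (rule measurable_restrict) (rule events_measurable[where n = n], auto)

lemma step_density_measurable [measurable]:
  "(\<lambda>(z, p). ennreal (jump_density (r (traj (freeze n (events z0 z)))) (jump_time z n) (fst p) (snd p)))
    \<in> borel_measurable (Pi\<^sub>M {1..n} (\<lambda>_. step_space) \<Otimes>\<^sub>M step_space)"
proof -
  let ?M = "Pi\<^sub>M {1..n} (\<lambda>_. step_space :: (real \<times> 'v) measure) \<Otimes>\<^sub>M (step_space :: (real \<times> 'v) measure)"
  have c: "(\<lambda>x. fst x k) \<in> ?M \<rightarrow>\<^sub>M step_space" if "1 \<le> k" "k \<le> n" for k
    using that by (intro measurable_compose[OF measurable_fst]) auto
  have [measurable]: "(\<lambda>x. jump_time (fst x) n) \<in> borel_measurable ?M"
    by (rule jump_time_measurable[OF c]) auto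
  have [measurable]: "(\<lambda>x. snd (snd x)) \<in> ?M \<rightarrow>\<^sub>M count_space UNIV" "(\<lambda>x. fst (snd x)) \<in> borel_measurable ?M"
    by (auto intro!: measurable_compose[OF measurable_snd] simp: measurable_lborel1[symmetric] simp del: measurable_lborel1)
  have "(\<lambda>x. jump_density (r (traj (freeze n (events z0 (fst x))))) (jump_time (fst x) n) (fst (snd x)) j) \<in> borel_measurable ?M" for j
    by (rule jump_density_measurable) measurable
  then have "(\<lambda>x. jump_density (r (traj (freeze n (events z0 (fst x))))) (jump_time (fst x) n) (fst (snd x)) (snd (snd x))) \<in> borel_measurable ?M"
    by (rule measurable_compose_countable) measurable
  then show ?thesis by (simp add: case_prod_beta')
qed

lemma events_upd: "events z0 (z(Suc n := p)) = (events z0 z)(Suc n := (ereal (fst p), snd p))"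
  by (auto simp: events_def fun_eq_iff)

lemma jump_time_upd: "k \<noteq> i \<Longrightarrow> jump_time (z(i := p)) k = jump_time z k"
  by (simp add: jump_time_def)

lemma freeze_upd: "k \<le> n \<Longrightarrow> freeze k (w(Suc n := e)) = freeze k w"
  by (auto simp: freeze_def fun_eq_iff)

lemma path_density_Suc:
  "path_density (Suc n) (z(Suc n := p)) = path_density n z *
    (if jump_time z n < fst p
     then ennreal (jump_density (r (traj (freeze n (events z0 z)))) (jump_time z n) (fst p) (snd p)) else 0)"
proof -
  have "(\<Prod>k<n. if jump_time (z(Suc n := p)) k < jump_time (z(Suc n := p)) (Suc k)
     then ennreal (jump_density (r (traj (freeze k (events z0 (z(Suc n := p)))))) (jump_time (z(Suc n := p)) k)
        (jump_time (z(Suc n := p)) (Suc k)) (snd ((z(Suc n := p)) (Suc k)))) else 0) = path_density n z"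
    unfolding path_density_def
    by (intro prod.cong refl) (auto simp: jump_time_upd events_upd freeze_upd)
  then show ?thesis
    unfolding path_density_def by (simp add: jump_time_upd events_upd freeze_upd) (simp add: jump_time_def)
qed

lemma path_density_measurable [measurable]: "path_density n \<in> borel_measurable (Pi\<^sub>M {1..n} (\<lambda>_. step_space))"
proof -
  let ?M = "Pi\<^sub>M {1..n} (\<lambda>_. step_space :: (real \<times> 'v) measure)"
  have *: "(\<lambda>z. if jump_time z k < jump_time z (Suc k)
     then ennreal (jump_density (r (traj (freeze k (events z0 z)))) (jump_time z k) (jump_time z (Suc k)) (snd (z (Suc k))))
     else 0) \<in> borel_measurable ?M" if "k < n" for k
  proof -
    have [measurable]: "(\<lambda>z. restrict z {1..k}) \<in> ?M \<rightarrow>\<^sub>M Pi\<^sub>M {1..k} (\<lambda>_. step_space)"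
      using that by (intro measurable_restrict) auto
    have [measurable]: "(\<lambda>z. z (Suc k)) \<in> ?M \<rightarrow>\<^sub>M step_space" using that by auto
    have "(\<lambda>z. jump_time z l) \<in> borel_measurable ?M" if "l \<le> n" for l
      by (rule jump_time_measurable[where n = n]) (use that in auto)
    from this[of k] this[of "Suc k"]
    have [measurable]: "(\<lambda>z. jump_time z k) \<in> borel_measurable ?M" "(\<lambda>z. jump_time z (Suc k)) \<in> borel_measurable ?M"
      using that by auto
    have "(\<lambda>z. (\<lambda>(z, p). ennreal (jump_density (r (traj (freeze k (events z0 z)))) (jump_time z k) (fst p) (snd p)))
        (restrict z {1..k}, z (Suc k))) \<in> borel_measurable ?M"
      by measurable
    also have "(\<lambda>z. (\<lambda>(z, p). ennreal (jump_density (r (traj (freeze k (events z0 z)))) (jump_time z k) (fst p) (snd p)))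
        (restrict z {1..k}, z (Suc k))) = (\<lambda>z. ennreal (jump_density (r (traj (freeze k (events z0 z)))) (jump_time z k)
          (jump_time z (Suc k)) (snd (z (Suc k)))))"
    proof
      fix z
      have "freeze k (events z0 (restrict z {1..k})) = freeze k (events z0 z)"
        by (auto simp: freeze_def events_def fun_eq_iff)
      moreover have "jump_time (restrict z {1..k}) k = jump_time z k"
        by (auto simp: jump_time_def)
      ultimately show "(\<lambda>(z, p). ennreal (jump_density (r (traj (freeze k (events z0 z)))) (jump_time z k) (fst p) (snd p)))
          (restrict z {1..k}, z (Suc k)) = ennreal (jump_density (r (traj (freeze k (events z0 z)))) (jump_time z k)
          (jump_time z (Suc k)) (snd (z (Suc k))))"
        by (simp add: jump_time_def)
    qed
    finally show ?thesis using that by measurable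
  qed
  show ?thesis
    unfolding path_density_def by (intro borel_measurable_prod_ennreal *) auto
qed

lemma nn_integral_C_density:
  assumes "f \<in> borel_measurable (Pi\<^sub>M {0..<Suc n} (\<lambda>_. event_space))"
  shows "(\<integral>\<^sup>+w. f w * (if increasing_upto n w then 1 else 0) \<partial>IT.C 0 (Suc n) (\<lambda>_. undefined))
    = (\<integral>\<^sup>+z. path_density n z * f (restrict (events z0 z) {0..<Suc n}) \<partial>Pi\<^sub>M {1..n} (\<lambda>_. step_space))"
  using assms
proof (induction n arbitrary: f)
  case 0
  note [measurable] = 0
  have und: "(\<lambda>_. undefined) \<in> space (Pi\<^sub>M {0..<0::nat} (\<lambda>_. event_space :: 'v event measure))"
    by (simp add: space_PiM)
  have "(\<integral>\<^sup>+w. f w * (if increasing_upto 0 w then 1 else 0) \<partial>IT.C 0 (Suc 0) (\<lambda>_. undefined))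
    = (\<integral>\<^sup>+w. (\<integral>\<^sup>+e. f (fun_upd w 0 e) * (if increasing_upto 0 (fun_upd w 0 e) then 1 else 0)
        \<partial>event_kernel r z0 0 w) \<partial>IT.C 0 0 (\<lambda>_. undefined))"
    by (rule nn_integral_C_Suc) measurable
  also have "\<dots> = f ((\<lambda>_. undefined)(0 := (0, z0)))"
  proof -
    let ?u = "\<lambda>_. undefined :: 'v event"
    have upd: "(\<lambda>e. fun_upd ?u 0 e) \<in> event_space \<rightarrow>\<^sub>M Pi\<^sub>M {0..<Suc 0} (\<lambda>_. event_space)"
      using und by (intro measurable_fun_upd[where J = "{0..<0::nat}"]) auto
    have [measurable]: "(\<lambda>e. f (fun_upd ?u 0 e)) \<in> borel_measurable event_space"
      by (rule measurable_compose[OF upd 0])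
    have kernel: "event_kernel r z0 0 ?u = return event_space (0, z0)"
      by (simp add: event_kernel_def)
    have "(\<integral>\<^sup>+w. (\<integral>\<^sup>+e. f (fun_upd w 0 e) * (if increasing_upto 0 (fun_upd w 0 e) then 1 else 0)
        \<partial>event_kernel r z0 0 w) \<partial>IT.C 0 0 ?u)
      = (\<integral>\<^sup>+w. (\<integral>\<^sup>+e. f (fun_upd ?u 0 e) * (if fst e < \<infinity> then 1 else 0) \<partial>event_kernel r z0 0 ?u) \<partial>IT.C 0 0 ?u)"
      using IT.space_C[OF und, of 0]
      by (intro nn_integral_cong) (auto simp: space_PiM increasing_upto_def simp del: IT.C.simps)
    also have "\<dots> = (\<integral>\<^sup>+e. f (fun_upd ?u 0 e) * (if fst e < \<infinity> then 1 else 0) \<partial>event_kernel r z0 0 ?u)"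
      using prob_space.emeasure_space_1[OF IT.prob_space_C[OF und, of 0]] by (simp del: IT.C.simps)
    also have "\<dots> = f (fun_upd ?u 0 (0, z0))"
      unfolding kernel by (subst nn_integral_return) (auto simp: space_pair_measure)
    finally show ?thesis .
  qed
  also have "(\<lambda>_. undefined)(0 := (0, z0)) = restrict (events z0 (\<lambda>_. undefined)) {0..<Suc 0}"
    by (auto simp: events_def fun_eq_iff)
  finally show ?case
    by (simp add: path_density_def PiM_empty nn_integral_count_space_finite)
next
  case (Suc n)
  note [measurable] = Suc.prems
  let ?D = "Pi\<^sub>M {0..<Suc n} (\<lambda>_. event_space :: 'v event measure)"
  define g where "g w = (\<integral>\<^sup>+e. f (fun_upd w (Suc n) e) * (if fst (w n) < fst e \<and> fst e < \<infinity> then 1 else 0)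
    \<partial>event_kernel r z0 (Suc n) w)" for w
  have upd [measurable]: "(\<lambda>(w, e). fun_upd w (Suc n) e) \<in> ?D \<Otimes>\<^sub>M event_space \<rightarrow>\<^sub>M Pi\<^sub>M {0..<Suc (Suc n)} (\<lambda>_. event_space)"
    by (simp add: case_prod_beta') (intro measurable_fun_upd[where J = "{0..<Suc n}"], auto)
  have [measurable]: "(\<lambda>w. fst (w n)) \<in> borel_measurable ?D"
    using measurable_compose[OF event_measurable_upto[OF order_refl] measurable_fst] by simp
  have fupd [measurable]: "(\<lambda>(w, e). f (fun_upd w (Suc n) e)) \<in> borel_measurable (?D \<Otimes>\<^sub>M event_space)"
    using measurable_compose[OF upd Suc.prems] by (simp add: case_prod_beta')
  have g [measurable]: "g \<in> borel_measurable ?D"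
    unfolding g_def
    by (rule nn_integral_measurable_subprob_algebra2[where N = event_space])
       (auto intro!: event_kernel_Suc_measurable)
  have "(\<integral>\<^sup>+w. f w * (if increasing_upto (Suc n) w then 1 else 0) \<partial>IT.C 0 (Suc (Suc n)) (\<lambda>_. undefined))
    = (\<integral>\<^sup>+w. (\<integral>\<^sup>+e. f (fun_upd w (Suc n) e) * (if increasing_upto (Suc n) (fun_upd w (Suc n) e) then 1 else 0)
        \<partial>event_kernel r z0 (Suc n) w) \<partial>IT.C 0 (Suc n) (\<lambda>_. undefined))"
    by (rule nn_integral_C_Suc) measurable
  also have "\<dots> = (\<integral>\<^sup>+w. g w * (if increasing_upto n w then 1 else 0) \<partial>IT.C 0 (Suc n) (\<lambda>_. undefined))"
  proof (rule nn_integral_cong)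
    fix w :: "nat \<Rightarrow> 'v event"
    have "increasing_upto (Suc n) (fun_upd w (Suc n) e) \<longleftrightarrow> increasing_upto n w \<and> fst (w n) < fst e \<and> fst e < \<infinity>" for e
      by (auto simp: increasing_upto_def less_Suc_eq)
    then show "(\<integral>\<^sup>+e. f (fun_upd w (Suc n) e) * (if increasing_upto (Suc n) (fun_upd w (Suc n) e) then 1 else 0)
        \<partial>event_kernel r z0 (Suc n) w) = g w * (if increasing_upto n w then 1 else 0)"
      by (simp add: g_def)
  qed
  also have "\<dots> = (\<integral>\<^sup>+z. path_density n z * g (restrict (events z0 z) {0..<Suc n}) \<partial>Pi\<^sub>M {1..n} (\<lambda>_. step_space))"
    by (rule Suc.IH) measurable
  also have "\<dots> = (\<integral>\<^sup>+z. (\<integral>\<^sup>+p. path_density (Suc n) (z(Suc n := p)) *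
      f (restrict (events z0 (z(Suc n := p))) {0..<Suc (Suc n)}) \<partial>step_space) \<partial>Pi\<^sub>M {1..n} (\<lambda>_. step_space))"
  proof (rule nn_integral_cong)
    fix z :: "nat \<Rightarrow> real \<times> 'v" assume z: "z \<in> space (Pi\<^sub>M {1..n} (\<lambda>_. step_space))"
    define w where "w = restrict (events z0 z) {0..<Suc n}"
    let ?R = "r (traj (freeze n (events z0 z)))"
    have w: "w \<in> space ?D" by (simp add: w_def space_PiM space_pair_measure)
    have [simp]: "w n = (ereal (jump_time z n), jump_state z0 z n)" by (simp add: w_def events_eq)
    have K: "event_kernel r z0 (Suc n) w = next_event ?R (jump_time z n) (jump_state z0 z n)"
      unfolding w_def by (simp add: event_kernel_def freeze_restrict events_eq[of z0 z n])
    have upd_eq: "fun_upd w (Suc n) (ereal t, j) = restrict (events z0 (z(Suc n := (t, j)))) {0..<Suc (Suc n)}" for t j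
      by (auto simp: w_def events_def fun_eq_iff)
    have [measurable]: "(\<lambda>e. f (fun_upd w (Suc n) e)) \<in> borel_measurable event_space"
      using measurable_compose[OF measurable_Pair1'[OF w] fupd] by simp
    have [measurable]: "(\<lambda>p. f (fun_upd w (Suc n) (ereal (fst p), snd p))) \<in> borel_measurable step_space"
      by measurable
    have [measurable]: "(\<lambda>p. ennreal (jump_density ?R (jump_time z n) (fst p) (snd p))) \<in> borel_measurable step_space"
      using measurable_compose[OF measurable_Pair1'[OF z] step_density_measurable] by simp
    have "g w = (\<integral>\<^sup>+(t, j). ennreal (jump_density ?R (jump_time z n) t j) * indicator {jump_time z n<..} t *
        (f (fun_upd w (Suc n) (ereal t, j)) * (if ereal (jump_time z n) < ereal t \<and> ereal t < \<infinity> then 1 else 0)) \<partial>step_space)"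
      unfolding g_def K by (subst nn_integral_next_event) auto
    also have "\<dots> = (\<integral>\<^sup>+p. (if jump_time z n < fst p then ennreal (jump_density ?R (jump_time z n) (fst p) (snd p)) else 0) *
        f (fun_upd w (Suc n) (ereal (fst p), snd p)) \<partial>step_space)"
      by (intro nn_integral_cong) (auto simp: indicator_def)
    finally have gw: "g w = \<dots>" .
    have "path_density n z * g w = (\<integral>\<^sup>+p. path_density n z * ((if jump_time z n < fst p
        then ennreal (jump_density ?R (jump_time z n) (fst p) (snd p)) else 0) *
        f (fun_upd w (Suc n) (ereal (fst p), snd p))) \<partial>step_space)"
      unfolding gw by (rule nn_integral_cmult[symmetric]) measurable
    then show "path_density n z * g (restrict (events z0 z) {0..<Suc n}) = (\<integral>\<^sup>+p. path_density (Suc n) (z(Suc n := p)) *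
      f (restrict (events z0 (z(Suc n := p))) {0..<Suc (Suc n)}) \<partial>step_space)"
      unfolding w_def[symmetric] by (simp add: path_density_Suc upd_eq mult.assoc)
  qed
  also have "\<dots> = (\<integral>\<^sup>+z. path_density (Suc n) z * f (restrict (events z0 z) {0..<Suc (Suc n)})
      \<partial>Pi\<^sub>M (insert (Suc n) {1..n}) (\<lambda>_. step_space))"
    using path_density_measurable[of "Suc n"] restrict_events_measurable[of "Suc n"]
    by (intro steps.product_nn_integral_insert[symmetric]) (auto simp: atLeastAtMostSuc_conv)
  also have "insert (Suc n) {1..n} = {1..Suc n}" by auto
  finally show ?case .
qed

text \<open>The factor after the density is the probability of no further jump up to the level \<open>c\<close>, which is
  read off from the first \<open>n\<close> jumps. In this form the law is used throughout: all events of interest are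
  determined by finitely many jumps and a waiting time.\<close>
lemma nn_integral_PP_survive:
  assumes f [measurable]: "f \<in> borel_measurable (Pi\<^sub>M {0..<Suc n} (\<lambda>_. event_space))"
    and c [measurable]: "c \<in> borel_measurable (Pi\<^sub>M {0..<Suc n} (\<lambda>_. event_space))"
  shows "(\<integral>\<^sup>+w. f (restrict w {0..<Suc n}) *
        (if increasing_upto n w \<and> c (restrict w {0..<Suc n}) < fst (w (Suc n)) then 1 else 0) \<partial>PP)
    = (\<integral>\<^sup>+z. path_density n z * (f (restrict (events z0 z) {0..<Suc n}) *
        emeasure (next_event (r (traj (freeze n (events z0 z)))) (jump_time z n) (jump_state z0 z n))
          {e. (c (restrict (events z0 z) {0..<Suc n}) :: ereal) < fst e}) \<partial>Pi\<^sub>M {1..n} (\<lambda>_. step_space))"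
proof -
  let ?D = "\<lambda>n::nat. Pi\<^sub>M {0..<n} (\<lambda>_. event_space :: 'v event measure)"
  let ?C = "\<lambda>n. IT.C 0 n (\<lambda>_. undefined)"
  define h where "h w = f (restrict w {0..<Suc n}) *
        (if increasing_upto n (restrict w {0..<Suc n}) \<and> c (restrict w {0..<Suc n}) < fst (w (Suc n)) then 1 else 0)" for w
  have [measurable]: "(\<lambda>w. restrict w {0..<Suc n}) \<in> ?D (Suc (Suc n)) \<rightarrow>\<^sub>M ?D (Suc n)"
    by (intro measurable_restrict) auto
  have [measurable]: "(\<lambda>w. fst (w (Suc n))) \<in> borel_measurable (?D (Suc (Suc n)))"
    using measurable_compose[OF event_measurable_upto[of "Suc n" "Suc n"] measurable_fst] by simp
  have h [measurable]: "h \<in> borel_measurable (?D (Suc (Suc n)))"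
    unfolding h_def by measurable
  define g where "g w = f w * emeasure (event_kernel r z0 (Suc n) w) {e. c w < fst e}" for w
  have meas_set: "{x \<in> space (?D (Suc n) \<Otimes>\<^sub>M (event_space :: 'v event measure)). c (fst x) < fst (snd x)} \<in> sets (?D (Suc n) \<Otimes>\<^sub>M event_space)"
    by measurable
  have [measurable]: "(\<lambda>w. emeasure (event_kernel r z0 (Suc n) w) {e. c w < fst e}) \<in> borel_measurable (?D (Suc n))"
  proof (rule emeasure_measurable_subprob_algebra2[OF _ event_kernel_Suc_measurable])
    have eq: "(SIGMA w:space (?D (Suc n)). {e :: 'v event. c w < fst e})
      = {x \<in> space (?D (Suc n) \<Otimes>\<^sub>M (event_space :: 'v event measure)). c (fst x) < fst (snd x)}"
      by (auto simp: space_pair_measure)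
    show "(SIGMA w:space (?D (Suc n)). {e :: 'v event. c w < fst e}) \<in> sets (?D (Suc n) \<Otimes>\<^sub>M event_space)"
      unfolding eq by (rule meas_set)
  qed
  have g [measurable]: "g \<in> borel_measurable (?D (Suc n))"
    unfolding g_def by measurable
  have "(\<integral>\<^sup>+w. f (restrict w {0..<Suc n}) *
        (if increasing_upto n w \<and> c (restrict w {0..<Suc n}) < fst (w (Suc n)) then 1 else 0) \<partial>PP)
      = (\<integral>\<^sup>+w. h (restrict w {0..<Suc (Suc n)}) \<partial>PP)"
  proof (rule nn_integral_cong)
    fix w :: "nat \<Rightarrow> 'v event"
    have "restrict (restrict w {0..<Suc (Suc n)}) {0..<Suc n} = restrict w {0..<Suc n}"
      by (auto simp: fun_eq_iff)
    then show "f (restrict w {0..<Suc n}) *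
        (if increasing_upto n w \<and> c (restrict w {0..<Suc n}) < fst (w (Suc n)) then 1 else 0) = h (restrict w {0..<Suc (Suc n)})"
      unfolding h_def by (simp only: increasing_upto_restrict) simp
  qed
  also have "\<dots> = (\<integral>\<^sup>+w. h w \<partial>?C (Suc (Suc n)))"
    by (rule nn_integral_PP_restrict) measurable
  also have "\<dots> = (\<integral>\<^sup>+w. (\<integral>\<^sup>+e. h (fun_upd w (Suc n) e) \<partial>event_kernel r z0 (Suc n) w) \<partial>?C (Suc n))"
    by (rule nn_integral_C_Suc) measurable
  also have "\<dots> = (\<integral>\<^sup>+w. g w * (if increasing_upto n w then 1 else 0) \<partial>?C (Suc n))"
  proof (rule nn_integral_cong)
    fix w assume "w \<in> space (?C (Suc n))"
    moreover have und: "(\<lambda>_. undefined) \<in> space (?D 0)"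
      by (simp add: space_PiM)
    ultimately have w: "w \<in> space (?D (Suc n))"
      using IT.space_C[OF und, of "Suc n"] by simp
    have [simp]: "restrict (fun_upd w (Suc n) e) {0..<Suc n} = w" for e
      using w by (auto simp: space_PiM PiE_def extensional_def fun_eq_iff)
    have [measurable]: "{e. c w < fst e} \<in> sets (event_space :: 'v event measure)"
      using measurable_sets[OF measurable_fst, of "{c w<..}" "borel :: ereal measure" "count_space (UNIV :: 'v set)"]
      by (simp add: vimage_def space_pair_measure)
    have "(\<integral>\<^sup>+e. h (fun_upd w (Suc n) e) \<partial>event_kernel r z0 (Suc n) w)
        = (\<integral>\<^sup>+e. f w * (if increasing_upto n w then 1 else 0) * indicator {e. c w < fst e} e \<partial>event_kernel r z0 (Suc n) w)"
      by (intro nn_integral_cong) (auto simp: h_def indicator_def simp del: restrict_apply restrict_fupd)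
    also have "\<dots> = g w * (if increasing_upto n w then 1 else 0)"
      using IT.sets_P[OF w] by (subst nn_integral_cmult_indicator) (auto simp: g_def)
    finally show "(\<integral>\<^sup>+e. h (fun_upd w (Suc n) e) \<partial>event_kernel r z0 (Suc n) w) = g w * (if increasing_upto n w then 1 else 0)" .
  qed
  also have "\<dots> = (\<integral>\<^sup>+z. path_density n z * g (restrict (events z0 z) {0..<Suc n}) \<partial>Pi\<^sub>M {1..n} (\<lambda>_. step_space))"
    by (rule nn_integral_C_density) measurable
  also have "\<dots> = (\<integral>\<^sup>+z. path_density n z * (f (restrict (events z0 z) {0..<Suc n}) *
        emeasure (next_event (r (traj (freeze n (events z0 z)))) (jump_time z n) (jump_state z0 z n))
          {e. c (restrict (events z0 z) {0..<Suc n}) < fst e}) \<partial>Pi\<^sub>M {1..n} (\<lambda>_. step_space))"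
  proof (rule nn_integral_cong)
    fix z :: "nat \<Rightarrow> real \<times> 'v"
    have [simp]: "restrict (events z0 z) {0..<Suc n} n = (ereal (jump_time z n), jump_state z0 z n)"
      by (simp add: events_eq)
    have "event_kernel r z0 (Suc n) (restrict (events z0 z) {0..<Suc n})
        = next_event (r (traj (freeze n (events z0 z)))) (jump_time z n) (jump_state z0 z n)"
      by (simp add: event_kernel_def freeze_restrict del: restrict_apply)
    then show "path_density n z * g (restrict (events z0 z) {0..<Suc n}) =
      path_density n z * (f (restrict (events z0 z) {0..<Suc n}) *
        emeasure (next_event (r (traj (freeze n (events z0 z)))) (jump_time z n) (jump_state z0 z n))
          {e. c (restrict (events z0 z) {0..<Suc n}) < fst e})"
      by (simp add: g_def)
  qed
  finally show ?thesis .
qed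

text \<open>The first event is deterministic, and \<open>next_event\<close> charges only later times and \<open>\<infinity>\<close>.\<close>
lemma AE_PP_ordered: "AE w in PP. w 0 = (0, z0) \<and> (\<forall>k. fst (w k) \<le> fst (w (Suc k)))"
proof -
  let ?D = "\<lambda>n::nat. Pi\<^sub>M {0..<n} (\<lambda>_. event_space :: 'v event measure)"
  let ?C = "\<lambda>n. IT.C 0 n (\<lambda>_. undefined)"
  have und: "(\<lambda>_. undefined) \<in> space (?D 0)"
    by (simp add: space_PiM)
  have AE_kernel: "AE w in PP. Q (restrict w {0..<Suc n})"
    if Q [measurable]: "Measurable.pred (?D (Suc n)) Q"
      and K: "\<And>w. w \<in> space (?D n) \<Longrightarrow> AE e in event_kernel r z0 n w. Q (fun_upd w n e)" for Q n
  proof -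
    have [measurable]: "(\<lambda>w. restrict w {0..<Suc n}) \<in> PP \<rightarrow>\<^sub>M ?D (Suc n)"
      by (intro measurable_restrict) (simp add: measurable_cong_sets[OF sets_PP refl])
    have "(\<integral>\<^sup>+w. (if Q (restrict w {0..<Suc n}) then 0 else 1) \<partial>PP) = (\<integral>\<^sup>+w. (if Q w then 0 else 1) \<partial>?C (Suc n))"
      by (rule nn_integral_PP_restrict) measurable
    also have "\<dots> = (\<integral>\<^sup>+w. (\<integral>\<^sup>+e. (if Q (fun_upd w n e) then 0 else 1) \<partial>event_kernel r z0 n w) \<partial>?C n)"
      by (rule nn_integral_C_Suc) measurable
    also have "\<dots> = (\<integral>\<^sup>+w. 0 \<partial>?C n)"
    proof (rule nn_integral_cong)
      fix w assume "w \<in> space (?C n)"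
      then have w: "w \<in> space (?D n)"
        using IT.space_C[OF und, of n] by simp
      have "(\<integral>\<^sup>+e. (if Q (fun_upd w n e) then 0 else 1) \<partial>event_kernel r z0 n w) = (\<integral>\<^sup>+e. 0 \<partial>event_kernel r z0 n w)"
        using K[OF w] by (intro nn_integral_cong_AE) auto
      then show "(\<integral>\<^sup>+e. (if Q (fun_upd w n e) then 0 else 1) \<partial>event_kernel r z0 n w) = 0" by simp
    qed
    finally have "(\<integral>\<^sup>+w. (if Q (restrict w {0..<Suc n}) then 0 else 1) \<partial>PP) = 0" by simp
    then have "AE w in PP. (if Q (restrict w {0..<Suc n}) then 0 else 1 :: ennreal) = 0"
      by (subst (asm) nn_integral_0_iff_AE) measurable
    then show ?thesis by eventually_elim (simp split: if_splits)
  qed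
  have single: "{(0, z0)} \<in> sets (event_space :: 'v event measure)"
    using pair_measureI[of "{0 :: ereal}" borel "{z0}" "count_space UNIV"] by simp
  then have [measurable]: "Measurable.pred event_space (\<lambda>e :: 'v event. e = (0, z0))"
    by (simp add: pred_def space_pair_measure)
  have "AE w in PP. restrict w {0..<Suc 0} 0 = (0, z0)"
  proof (rule AE_kernel)
    have start: "AE e in return event_space (0, z0). e = (0, z0)"
      by (subst AE_return) (auto simp: space_pair_measure)
    have kernel: "event_kernel r z0 0 w = return event_space (0, z0)" for w
      by (simp add: event_kernel_def)
    show "AE e in event_kernel r z0 0 w. fun_upd w 0 e 0 = (0, z0)" for w
      unfolding kernel using start by simp
    have "(\<lambda>w. w 0) \<in> ?D (Suc 0) \<rightarrow>\<^sub>M event_space" by simp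
    with single show "Measurable.pred (?D (Suc 0)) (\<lambda>w. w 0 = (0, z0))"
      using measurable_sets[of "\<lambda>w. w 0" "?D (Suc 0)" event_space "{(0, z0)}"]
      by (simp add: pred_def vimage_def Int_def conj_commute)
  qed
  moreover have "AE w in PP. fst (restrict w {0..<Suc (Suc k)} k) \<le> fst (restrict w {0..<Suc (Suc k)} (Suc k))" for k
  proof (rule AE_kernel)
    have fst_meas: "(\<lambda>w. fst (w k)) \<in> borel_measurable (?D (Suc (Suc k)))" "(\<lambda>w. fst (w (Suc k))) \<in> borel_measurable (?D (Suc (Suc k)))"
      using measurable_compose[OF event_measurable_upto[of k "Suc k"] measurable_fst]
        measurable_compose[OF event_measurable_upto[of "Suc k" "Suc k"] measurable_fst] by simp_all
    show "Measurable.pred (?D (Suc (Suc k))) (\<lambda>w. fst (w k) \<le> fst (w (Suc k)))"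
      unfolding pred_def by (intro borel_measurable_le fst_meas)
    fix w :: "nat \<Rightarrow> 'v event"
    show "AE e in event_kernel r z0 (Suc k) w. fst (fun_upd w (Suc k) e k) \<le> fst (fun_upd w (Suc k) e (Suc k))"
    proof (cases "fst (w k) = \<infinity>")
      case True
      then have kernel: "event_kernel r z0 (Suc k) w = return event_space (w k)"
        by (simp add: event_kernel_def)
      have "AE e in return event_space (w k). fst (w k) \<le> fst e"
        by (subst AE_return) (auto simp: space_pair_measure)
      then show ?thesis unfolding kernel by simp
    next
      case False
      let ?R = "r (traj (freeze k w))"
      have m [measurable]: "(\<lambda>e. if fst (w k) \<le> fst e then 0 else 1 :: ennreal) \<in> borel_measurable (event_space :: 'v event measure)"
        by measurable
      have later: "fst (w k) \<le> ereal t" if "real_of_ereal (fst (w k)) < t" for t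
        using that False by (cases "fst (w k)") auto
      have z: "(case p of (t, j) \<Rightarrow> ennreal (jump_density ?R (real_of_ereal (fst (w k))) t j)
          * indicator {real_of_ereal (fst (w k))<..} t * (if fst (w k) \<le> fst (ereal t, j) then 0 else 1 :: ennreal)) = 0" for p
        using later by (cases p) (simp add: indicator_def)
      have "(\<integral>\<^sup>+e. (if fst (w k) \<le> fst e then 0 else 1) \<partial>next_event ?R (real_of_ereal (fst (w k))) (snd (w k)))
        = (\<integral>\<^sup>+p. 0 \<partial>(step_space :: (real \<times> 'v) measure)) + 0"
        unfolding nn_integral_next_event[OF rate_measurable1 m] z by simp
      then have "(\<integral>\<^sup>+e. (if fst (w k) \<le> fst e then 0 else 1) \<partial>next_event ?R (real_of_ereal (fst (w k))) (snd (w k))) = 0"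
        by simp
      then have "AE e in next_event ?R (real_of_ereal (fst (w k))) (snd (w k)). (if fst (w k) \<le> fst e then 0 else 1 :: ennreal) = 0"
        by (subst (asm) nn_integral_0_iff_AE) measurable
      moreover have kernel: "event_kernel r z0 (Suc k) w = next_event ?R (real_of_ereal (fst (w k))) (snd (w k))"
        using False by (simp add: event_kernel_def)
      ultimately show ?thesis
        unfolding kernel by (auto elim!: eventually_mono split: if_splits)
    qed
  qed
  then have "AE w in PP. \<forall>k. fst (restrict w {0..<Suc (Suc k)} k) \<le> fst (restrict w {0..<Suc (Suc k)} (Suc k))"
    by (simp add: AE_all_countable del: restrict_apply)
  ultimately show ?thesis
    by eventually_elim auto
qed

lemma nn_integral_path_density_Suc:
  assumes [measurable]: "F \<in> borel_measurable (Pi\<^sub>M {1..Suc n} (\<lambda>_. step_space))"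
  shows "(\<integral>\<^sup>+z. path_density (Suc n) z * F z \<partial>Pi\<^sub>M {1..Suc n} (\<lambda>_. step_space))
    = (\<integral>\<^sup>+z. path_density n z * (\<integral>\<^sup>+t. (\<Sum>j\<in>UNIV. ennreal (jump_density (r (traj (freeze n (events z0 z))))
          (jump_time z n) t j) * F (z(Suc n := (t, j)))) * indicator {jump_time z n<..} t \<partial>lborel)
        \<partial>Pi\<^sub>M {1..n} (\<lambda>_. step_space))"
proof -
  have ins: "{1..Suc n} = insert (Suc n) {1..n}" by auto
  have [measurable]: "path_density (Suc n) \<in> borel_measurable (Pi\<^sub>M (insert (Suc n) {1..n}) (\<lambda>_. step_space))"
    "F \<in> borel_measurable (Pi\<^sub>M (insert (Suc n) {1..n}) (\<lambda>_. step_space))"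
    using path_density_measurable[of "Suc n"] assms unfolding ins .
  have "(\<integral>\<^sup>+z. path_density (Suc n) z * F z \<partial>Pi\<^sub>M {1..Suc n} (\<lambda>_. step_space))
      = (\<integral>\<^sup>+z. (\<integral>\<^sup>+p. path_density (Suc n) (z(Suc n := p)) * F (z(Suc n := p)) \<partial>step_space) \<partial>Pi\<^sub>M {1..n} (\<lambda>_. step_space))"
    unfolding ins by (rule steps.product_nn_integral_insert) (simp, simp, measurable)
  also have "\<dots> = (\<integral>\<^sup>+z. path_density n z * (\<integral>\<^sup>+t. (\<Sum>j\<in>UNIV. ennreal (jump_density (r (traj (freeze n (events z0 z))))
          (jump_time z n) t j) * F (z(Suc n := (t, j)))) * indicator {jump_time z n<..} t \<partial>lborel)
        \<partial>Pi\<^sub>M {1..n} (\<lambda>_. step_space))"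
  proof (rule nn_integral_cong)
    fix z :: "nat \<Rightarrow> real \<times> 'v" assume z: "z \<in> space (Pi\<^sub>M {1..n} (\<lambda>_. step_space))"
    let ?R = "r (traj (freeze n (events z0 z)))"
    have [measurable]: "(\<lambda>p. z(Suc n := p)) \<in> step_space \<rightarrow>\<^sub>M Pi\<^sub>M (insert (Suc n) {1..n}) (\<lambda>_. step_space)"
      using z by (intro measurable_fun_upd[where J = "{1..n}"]) auto
    have [measurable]: "(\<lambda>t. jump_density ?R (jump_time z n) t j) \<in> borel_measurable borel" for j
      by (intro jump_density_measurable1) auto
    have [measurable]: "(\<lambda>p. ennreal (jump_density ?R (jump_time z n) (fst p) (snd p))) \<in> borel_measurable step_space"
      using measurable_compose[OF measurable_Pair1'[OF z] step_density_measurable] by simp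
    have "(\<integral>\<^sup>+p. path_density (Suc n) (z(Suc n := p)) * F (z(Suc n := p)) \<partial>step_space)
        = (\<integral>\<^sup>+p. path_density n z * (ennreal (jump_density ?R (jump_time z n) (fst p) (snd p)) * F (z(Suc n := p))
            * indicator {jump_time z n<..} (fst p)) \<partial>step_space)"
      by (intro nn_integral_cong) (auto simp: path_density_Suc indicator_def ac_simps)
    also have "\<dots> = path_density n z * (\<integral>\<^sup>+p. ennreal (jump_density ?R (jump_time z n) (fst p) (snd p)) * F (z(Suc n := p))
            * indicator {jump_time z n<..} (fst p) \<partial>step_space)"
      by (rule nn_integral_cmult) measurable
    also have "(\<integral>\<^sup>+p. ennreal (jump_density ?R (jump_time z n) (fst p) (snd p)) * F (z(Suc n := p))
            * indicator {jump_time z n<..} (fst p) \<partial>step_space)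
        = (\<integral>\<^sup>+t. (\<Sum>j\<in>UNIV. ennreal (jump_density ?R (jump_time z n) t j) * F (z(Suc n := (t, j)))) * indicator {jump_time z n<..} t \<partial>lborel)"
      by (subst nn_integral_step_space) (auto simp: sum_distrib_right)
    finally show "(\<integral>\<^sup>+p. path_density (Suc n) (z(Suc n := p)) * F (z(Suc n := p)) \<partial>step_space) =
        path_density n z * (\<integral>\<^sup>+t. (\<Sum>j\<in>UNIV. ennreal (jump_density ?R (jump_time z n) t j) * F (z(Suc n := (t, j)))) * indicator {jump_time z n<..} t \<partial>lborel)" .
  qed
  finally show ?thesis .
qed

end

subsection \<open>Survival probabilities\<close>

lemma exp_minus_integral_eq:
  fixes G :: "real \<Rightarrow> real"
  assumes "a \<le> t" and deriv: "\<And>s. s \<in> {a..t} \<Longrightarrow> (G has_real_derivative - h s * G s) (at s)"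
    and pos: "\<And>s. s \<in> {a..t} \<Longrightarrow> 0 < G s" and cont: "continuous_on {a..t} h"
  shows "exp (- (LINT s:{a..t}|lborel. h s)) = G t / G a"
proof -
  have "(h has_integral (- ln (G t) - - ln (G a))) {a..t}"
  proof (rule fundamental_theorem_of_calculus[OF \<open>a \<le> t\<close>])
    fix s assume s: "s \<in> {a..t}"
    have "((\<lambda>s. - ln (G s)) has_real_derivative h s) (at s)"
      using DERIV_minus[OF DERIV_chain2[OF DERIV_ln[OF pos[OF s]] deriv[OF s]]] pos[OF s]
      by (simp add: inverse_eq_divide)
    then show "((\<lambda>s. - ln (G s)) has_vector_derivative h s) (at s within {a..t})"
      by (metis has_real_derivative_iff_has_vector_derivative has_vector_derivative_at_within)
  qed
  then have "(LINT s:{a..t}|lborel. h s) = ln (G a) - ln (G t)"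
    using set_borel_integral_eq_integral(2)[OF borel_integrable_atLeastAtMost'[OF cont]]
    by (simp add: integral_unique)
  then show ?thesis using pos[of a] pos[of t] \<open>a \<le> t\<close> by (simp add: exp_diff)
qed

lemma nn_integral_derivative:
  fixes G :: "real \<Rightarrow> real"
  assumes "a \<le> b" and deriv: "\<And>s. s \<in> {a..b} \<Longrightarrow> (G has_real_derivative - g s) (at s)"
    and nonneg: "\<And>s. s \<in> {a..b} \<Longrightarrow> 0 \<le> g s"
  shows "(\<integral>\<^sup>+t. ennreal (g t) * indicator {a..b} t \<partial>lborel) = ennreal (G a - G b)"
proof (rule nn_integral_has_integral_lebesgue'[OF nonneg])
  have "((\<lambda>s. g s) has_integral (- G b - - G a)) {a..b}"
  proof (rule fundamental_theorem_of_calculus[OF \<open>a \<le> b\<close>])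
    fix s assume s: "s \<in> {a..b}"
    have "((\<lambda>s. - G s) has_real_derivative g s) (at s)"
      using DERIV_minus[OF deriv[OF s]] by simp
    then show "((\<lambda>s. - G s) has_vector_derivative g s) (at s within {a..b})"
      by (metis has_real_derivative_iff_has_vector_derivative has_vector_derivative_at_within)
  qed
  then show "(g has_integral (G a - G b)) {a..b}" by simp
qed

text \<open>The total jump mass over \<open>[l, u]\<close> is a difference of values of the survival function
  \<open>exp (- \<integral> r)\<close>; the rates only need to be continuous up to the time \<open>b\<close> at which they vanish.\<close>
lemma jump_mass_le_1:
  fixes R :: "real \<Rightarrow> 'v::finite \<Rightarrow> real" and b :: ereal
  assumes R [measurable]: "\<And>k. (\<lambda>t. R t k) \<in> borel_measurable borel"
    and nonneg: "\<And>t k. 0 \<le> R t k"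
    and zero: "\<And>t k. a < t \<Longrightarrow> b \<le> ereal t \<Longrightarrow> R t k = 0"
    and cont: "\<And>c. a < c \<Longrightarrow> ereal c < b \<Longrightarrow> continuous_on {a..c} (\<lambda>s. \<Sum>k\<in>UNIV. R s k)"
  shows "jump_mass R a UNIV \<le> 1"
proof (cases "ereal a < b")
  case False
  have "jump_mass R a UNIV = (\<integral>\<^sup>+t. 0 \<partial>(lborel :: real measure))"
    unfolding jump_mass_def
  proof (intro nn_integral_cong)
    fix t
    show "(\<Sum>j\<in>UNIV. ennreal (jump_density R a t j) * indicator UNIV (ereal t, j)) * indicator {a<..} t = 0"
    proof (cases "a < t")
      case True
      then have "b \<le> ereal t" using False by (meson ereal_less_eq(3) less_imp_le not_less order_trans)
      then show ?thesis using True by (simp add: jump_density_def zero)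
    qed simp
  qed
  then show ?thesis by simp
next
  case True
  define h where "h s = (\<Sum>k\<in>UNIV. R s k)" for s
  have h_nonneg: "0 \<le> h s" for s unfolding h_def by (intro sum_nonneg nonneg)
  have [measurable]: "(\<lambda>t. jump_density R a t j) \<in> borel_measurable borel" for j
    by (intro jump_density_measurable1) auto
  define G where "G t = exp (- (LINT s:{a..t}|lborel. h s))" for t
  have sum_density: "(\<Sum>j\<in>UNIV. ennreal (jump_density R a t j)) = ennreal (h t * G t)" for t
    by (simp add: jump_density_def G_def h_def nonneg sum_distrib_right)
  have G_borel [measurable]: "(\<lambda>t. h t * G t) \<in> borel_measurable borel"
  proof -
    have "(\<lambda>t. h t * G t) = (\<lambda>t. \<Sum>j\<in>UNIV. jump_density R a t j)"
      by (simp add: jump_density_def G_def h_def sum_distrib_right)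
    then show ?thesis by simp
  qed
  obtain u l where ul: "einterval a b = (\<Union>i. {l i..u i})" "incseq u" "decseq l"
    "\<And>i. l i < u i" "\<And>i. ereal a < ereal (l i)" "\<And>i. ereal (u i) < b"
    by (rule einterval_Icc_approximation[OF True]) (rule that)
  have "jump_mass R a UNIV = (\<integral>\<^sup>+t. ennreal (h t * G t) * indicator (einterval a b) t \<partial>lborel)"
    unfolding jump_mass_def
  proof (intro nn_integral_cong)
    fix t
    have "h t = 0" if "a < t" "\<not> ereal t < b"
      using that by (simp add: h_def zero not_less)
    then show "(\<Sum>j\<in>UNIV. ennreal (jump_density R a t j) * indicator UNIV (ereal t, j)) * indicator {a<..} t
        = ennreal (h t * G t) * indicator (einterval a b) t"
      by (cases "a < t"; cases "ereal t < b") (simp_all add: sum_density einterval_def)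
  qed
  also have "\<dots> = (\<integral>\<^sup>+t. (SUP i. ennreal (h t * G t) * indicator {l i..u i} t) \<partial>lborel)"
  proof (rule nn_integral_cong)
    fix t
    show "ennreal (h t * G t) * indicator (einterval a b) t = (SUP i. ennreal (h t * G t) * indicator {l i..u i} t)"
    proof (cases "t \<in> einterval a b")
      case True
      then obtain i where "t \<in> {l i..u i}" using ul(1) by auto
      then show ?thesis using True
        by (intro antisym SUP_upper2[of i] SUP_least) (auto simp: indicator_def)
    next
      case False
      then have out: "t \<notin> {l i..u i}" for i using ul(1) by auto
      show ?thesis
        unfolding indicator_simps(2)[OF out] indicator_simps(2)[OF False] by simp
    qed
  qed
  also have "\<dots> = (SUP i. \<integral>\<^sup>+t. ennreal (h t * G t) * indicator {l i..u i} t \<partial>lborel)"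
  proof (rule nn_integral_monotone_convergence_SUP)
    have "l (Suc n) \<le> l n" "u n \<le> u (Suc n)" for n
      using incseqD[OF ul(2), of n "Suc n"] decseqD[OF ul(3), of n "Suc n"] by auto
    then show "incseq (\<lambda>i t. ennreal (h t * G t) * indicator {l i..u i} t)"
      by (intro incseq_SucI le_funI mult_left_mono indicator_leI) (auto intro: order_trans)
  qed simp
  also have "\<dots> \<le> 1"
  proof (rule SUP_least)
    fix i
    have au: "a < u i" using ul(4,5)[of i] by simp
    have "\<exists>c. u i < c \<and> ereal c < b"
      using ul(6)[of i] ereal_dense2[of "ereal (u i)" b] by auto
    then obtain c where c: "u i < c" "ereal c < b" by blast
    have hc: "continuous_on {a..c} h"
      using cont[of c] au c by (simp add: h_def[abs_def])
    have G_eq: "G t = exp (- integral {a..t} h)" if "t \<in> {a..c}" for t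
    proof -
      have "continuous_on {a..t} h" using hc by (rule continuous_on_subset) (use that in auto)
      then show ?thesis
        unfolding G_def using set_borel_integral_eq_integral(2)[OF borel_integrable_atLeastAtMost'] by simp
    qed
    have "(\<integral>\<^sup>+t. ennreal (h t * G t) * indicator {l i..u i} t \<partial>lborel)
        = (\<integral>\<^sup>+t. ennreal (h t * exp (- integral {a..t} h)) * indicator {l i..u i} t \<partial>lborel)"
      using ul(5)[of i] c by (intro nn_integral_cong) (auto simp: G_eq indicator_def)
    also have "\<dots> = ennreal (exp (- integral {a..l i} h) - exp (- integral {a..u i} h))"
    proof (rule nn_integral_derivative)
      fix s assume s: "s \<in> {l i..u i}"
      then have s': "a < s" "s < c" using ul(5)[of i] c by auto
      have "((\<lambda>t. integral {a..t} h) has_real_derivative h s) (at s within {a..c})"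
        using integral_has_real_derivative[OF hc, of s] s' by simp
      then have "((\<lambda>t. integral {a..t} h) has_real_derivative h s) (at s)"
        using s' by (simp add: at_within_Icc_at)
      from DERIV_chain2[OF DERIV_exp DERIV_minus[OF this]]
      show "((\<lambda>t. exp (- integral {a..t} h)) has_real_derivative - (h s * exp (- integral {a..s} h))) (at s)"
        by (simp add: mult.commute)
    qed (use ul(4)[of i] h_nonneg in auto)
    also have "\<dots> \<le> ennreal 1"
    proof (rule ennreal_leI)
      have "0 \<le> integral {a..l i} h"
        by (rule integral_nonneg) (use h_nonneg hc ul(4,5)[of i] c in \<open>auto intro!: integrable_continuous_real intro: continuous_on_subset\<close>)
      then have "exp (- integral {a..l i} h) \<le> 1" by simp
      moreover have "0 < exp (- integral {a..u i} h)" by (rule exp_gt_zero)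
      ultimately show "exp (- integral {a..l i} h) - exp (- integral {a..u i} h) \<le> 1" by linarith
    qed
    finally show "(\<integral>\<^sup>+t. ennreal (h t * G t) * indicator {l i..u i} t \<partial>lborel) \<le> 1" by simp
  qed
  finally show ?thesis .
qed

lemma emeasure_next_event_survive:
  fixes R :: "real \<Rightarrow> 'v::finite \<Rightarrow> real"
  assumes R [measurable]: "\<And>k. (\<lambda>t. R t k) \<in> borel_measurable borel"
    and le: "jump_mass R a UNIV \<le> 1"
    and mass: "(\<integral>\<^sup>+t. (\<Sum>j\<in>UNIV. ennreal (jump_density R a t j)) * indicator {a<..c} t \<partial>lborel) = ennreal (1 - q)"
    and q: "0 \<le> q" "q \<le> 1"
  shows "emeasure (next_event R a i) {e. ereal c < fst e} = ennreal q"
proof -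
  interpret P: prob_space "next_event R a i"
    by (rule prob_space_next_event[OF R le])
  have A: "{e :: 'v event. fst e \<le> ereal c} \<in> sets event_space"
  proof -
    have "Measurable.pred (event_space :: 'v event measure) (\<lambda>e. fst e \<le> ereal c)" by measurable
    then show ?thesis by (simp add: pred_def space_pair_measure)
  qed
  have "emeasure (next_event R a i) {e. fst e \<le> ereal c} = jump_mass R a {e. fst e \<le> ereal c}"
    using A by (subst emeasure_next_event[OF R]) auto
  also have "\<dots> = (\<integral>\<^sup>+t. (\<Sum>j\<in>UNIV. ennreal (jump_density R a t j)) * indicator {a<..c} t \<partial>lborel)"
    unfolding jump_mass_def by (intro nn_integral_cong) (auto simp: indicator_def)
  finally have "emeasure (next_event R a i) {e. fst e \<le> ereal c} = ennreal (1 - q)" using mass by simp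
  moreover have "{e :: 'v event. ereal c < fst e} = space (next_event R a i) - {e. fst e \<le> ereal c}" by auto
  ultimately have "emeasure (next_event R a i) {e. ereal c < fst e} = 1 - ennreal (1 - q)"
    using A P.emeasure_space_1 emeasure_compl[of "{e. fst e \<le> ereal c}" "next_event R a i"] by simp
  also have "1 - ennreal (1 - q) = ennreal (1 - (1 - q))"
    using q ennreal_minus[of "1 - q" 1] by simp
  also have "1 - (1 - q) = q" by simp
  finally show ?thesis .
qed

section \<open>Occupation times of a path with finitely many jumps\<close>

text \<open>The path is frozen after its \<open>n\<close>-th jump, which does not affect local times up to then.\<close>
definition occ :: "'v::finite \<Rightarrow> nat \<Rightarrow> (nat \<Rightarrow> real \<times> 'v) \<Rightarrow> 'v \<Rightarrow> real" where
  "occ z0 n z x = local_time (traj (freeze n (events z0 z))) x (jump_time z n)"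

definition increasing_times :: "nat \<Rightarrow> (nat \<Rightarrow> real \<times> 'v) \<Rightarrow> bool" where
  "increasing_times n z \<longleftrightarrow> (\<forall>k<n. jump_time z k < jump_time z (Suc k))"

lemma increasing_times_0 [simp]: "increasing_times 0 z"
  by (simp add: increasing_times_def)

lemma increasing_times_Suc:
  "increasing_times (Suc n) z \<longleftrightarrow> increasing_times n z \<and> jump_time z n < jump_time z (Suc n)"
  by (auto simp: increasing_times_def less_Suc_eq)

lemma jump_time_0 [simp]: "jump_time z 0 = 0" and jump_state_0 [simp]: "jump_state z0 z 0 = z0"
  by (simp_all add: jump_time_def jump_state_def)

lemma jump_time_Suc_upd [simp]: "jump_time (z(Suc n := p)) (Suc n) = fst p"
  and jump_state_Suc_upd [simp]: "jump_state z0 (z(Suc n := p)) (Suc n) = snd p"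
  by (simp_all add: jump_time_def jump_state_def)

lemma jump_time_upd_le [simp]: "k \<le> n \<Longrightarrow> jump_time (z(Suc n := p)) k = jump_time z k"
  and jump_state_upd_le [simp]: "k \<le> n \<Longrightarrow> jump_state z0 (z(Suc n := p)) k = jump_state z0 z k"
  by (simp_all add: jump_time_def jump_state_def)

lemma freeze_events_upd [simp]: "k \<le> n \<Longrightarrow> freeze k (events z0 (z(Suc n := p))) = freeze k (events z0 z)"
  by (auto simp: freeze_def events_def fun_eq_iff)

lemma occ_upd [simp]: "occ z0 n (z(Suc n := p)) x = occ z0 n z x"
  by (simp add: occ_def)

lemma increasing_times_upd:
  "increasing_times (Suc n) (z(Suc n := p)) \<longleftrightarrow> increasing_times n z \<and> jump_time z n < fst p"
proof -
  have "increasing_times n (z(Suc n := p)) \<longleftrightarrow> increasing_times n z"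
    by (auto simp: increasing_times_def)
  then show ?thesis by (simp add: increasing_times_Suc)
qed

lemma occ_0 [simp]: "occ z0 0 z x = 0"
  by (simp add: occ_def)

lemma occ_nonneg: "0 \<le> occ z0 n z x"
  by (simp add: occ_def local_time_nonneg)

lemma jump_time_mono: "increasing_times n z \<Longrightarrow> k \<le> l \<Longrightarrow> l \<le> n \<Longrightarrow> jump_time z k \<le> jump_time z l"
proof (induction l)
  case (Suc l)
  show ?case
  proof (cases "k = Suc l")
    case False
    then have "jump_time z k \<le> jump_time z l" using Suc by simp
    also have "jump_time z l < jump_time z (Suc l)" using Suc.prems by (simp add: increasing_times_def)
    finally show ?thesis by simp
  qed simp
qed simp

lemma jump_time_nonneg: "increasing_times n z \<Longrightarrow> k \<le> n \<Longrightarrow> 0 \<le> jump_time z k"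
  using jump_time_mono[of n z 0 k] by simp

lemma traj_events_after: "jump_time z n \<le> t \<Longrightarrow> traj (freeze n (events z0 z)) t = jump_state z0 z n"
  using traj_freeze_after[of "events z0 z" n t] by (simp add: events_eq)

lemma traj_events_before:
  assumes "0 \<le> t" "t < jump_time z (Suc n)"
  shows "traj (freeze (Suc n) (events z0 z)) t = traj (freeze n (events z0 z)) t"
  using traj_freeze_before[of t "events z0 z" n] assms
  by (auto simp: events_eq dest: spec[where x = 0])

lemma local_time_events:
  assumes "increasing_times n z" "jump_time z n \<le> t"
  shows "local_time (traj (freeze n (events z0 z))) x t
    = occ z0 n z x + (if x = jump_state z0 z n then t - jump_time z n else 0)"
  unfolding occ_def using assms jump_time_nonneg[of n z n]
  by (intro local_time_const traj_path_measurable traj_events_after) auto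

lemma occ_Suc:
  assumes "increasing_times (Suc n) z"
  shows "occ z0 (Suc n) z x = occ z0 n z x + (if x = jump_state z0 z n then jump_time z (Suc n) - jump_time z n else 0)"
proof -
  have "occ z0 (Suc n) z x = local_time (traj (freeze n (events z0 z))) x (jump_time z (Suc n))"
    unfolding occ_def using traj_events_before by (intro local_time_cong) auto
  then show ?thesis
    using assms by (subst (asm) local_time_events) (auto simp: increasing_times_Suc)
qed

lemma jump_state_measurable [measurable (raw)]:
  assumes "\<And>k. 1 \<le> k \<Longrightarrow> k \<le> n \<Longrightarrow> (\<lambda>x. f x k) \<in> M \<rightarrow>\<^sub>M step_space" and "k \<le> n"
  shows "(\<lambda>x. jump_state z0 (f x) k) \<in> M \<rightarrow>\<^sub>M count_space UNIV"
proof (cases "k = 0")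
  case False
  then have "(\<lambda>x. f x k) \<in> M \<rightarrow>\<^sub>M step_space" using assms by simp
  from measurable_compose[OF this measurable_snd] show ?thesis using False by (simp add: jump_state_def)
qed simp

context
  fixes f :: "'a \<Rightarrow> nat \<Rightarrow> real \<times> 'v::finite" and M n
  assumes f: "\<And>k. 1 \<le> k \<Longrightarrow> k \<le> n \<Longrightarrow> (\<lambda>x. f x k) \<in> M \<rightarrow>\<^sub>M step_space"
begin

lemma skeleton_jump_time: "k \<le> n \<Longrightarrow> (\<lambda>x. jump_time (f x) k) \<in> borel_measurable M"
proof (cases "k = 0")
  case False
  moreover assume "k \<le> n"
  ultimately have "(\<lambda>x. f x k) \<in> M \<rightarrow>\<^sub>M step_space" using f by simp
  from measurable_compose[OF this measurable_fst] show ?thesis using False by (simp add: jump_time_def)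
qed simp

lemma skeleton_jump_state: "k \<le> n \<Longrightarrow> (\<lambda>x. jump_state z0 (f x) k) \<in> M \<rightarrow>\<^sub>M count_space UNIV"
  by (rule jump_state_measurable[OF f])

lemma skeleton_freeze: "k \<le> n \<Longrightarrow> (\<lambda>x. freeze k (events z0 (f x))) \<in> M \<rightarrow>\<^sub>M Pi\<^sub>M UNIV (\<lambda>_. event_space)"
  by (rule freeze_measurable, rule events_measurable[where n = k]) (use f in auto)

lemma skeleton_occ: "k \<le> n \<Longrightarrow> (\<lambda>x. occ z0 k (f x) y) \<in> borel_measurable M"
  unfolding occ_def by (intro local_time_traj_measurable skeleton_freeze skeleton_jump_time)

lemma skeleton_increasing: "Measurable.pred M (\<lambda>x. increasing_times n (f x))"
proof -
  have "Measurable.pred M (\<lambda>x. \<forall>k\<in>{..<n}. jump_time (f x) k < jump_time (f x) (Suc k))"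
  proof (rule pred_intros_finite)
    fix k assume "k \<in> {..<n}"
    then have "(\<lambda>x. jump_time (f x) k) \<in> borel_measurable M" "(\<lambda>x. jump_time (f x) (Suc k)) \<in> borel_measurable M"
      by (simp_all add: skeleton_jump_time)
    then show "Measurable.pred M (\<lambda>x. jump_time (f x) k < jump_time (f x) (Suc k))"
      unfolding pred_def by (rule borel_measurable_less)
  qed simp
  moreover have "increasing_times n z \<longleftrightarrow> (\<forall>k\<in>{..<n}. jump_time z k < jump_time z (Suc k))" for z :: "nat \<Rightarrow> real \<times> 'v"
    by (auto simp: increasing_times_def)
  ultimately show ?thesis by presburger
qed

end

lemma component_step: "1 \<le> k \<Longrightarrow> k \<le> n \<Longrightarrow> (\<lambda>z. z k) \<in> Pi\<^sub>M {1..n} (\<lambda>_. step_space) \<rightarrow>\<^sub>M step_space"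
  by simp

lemmas skeleton_measurable [measurable] =
  skeleton_jump_time[of n "\<lambda>z. z" "Pi\<^sub>M {1..n} (\<lambda>_. step_space)" n, OF component_step order_refl]
  skeleton_jump_state[of n "\<lambda>z. z" "Pi\<^sub>M {1..n} (\<lambda>_. step_space)" n, OF component_step order_refl]
  skeleton_freeze[of n "\<lambda>z. z" "Pi\<^sub>M {1..n} (\<lambda>_. step_space)" n, OF component_step order_refl]
  skeleton_occ[of n "\<lambda>z. z" "Pi\<^sub>M {1..n} (\<lambda>_. step_space)" n, OF component_step order_refl]
  skeleton_increasing[of n "\<lambda>z. z" "Pi\<^sub>M {1..n} (\<lambda>_. step_space)", OF component_step]
  for n

section \<open>The Markov jump process\<close>

context conductance_network
begin

definition vertex_rate :: "'v \<Rightarrow> real" where "vertex_rate x = (\<Sum>y\<in>UNIV. cond x y)"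

lemma vertex_rate_nonneg: "0 \<le> vertex_rate x"
  unfolding vertex_rate_def by (intro sum_nonneg cond_nonneg)

lemma markov_rate_frozen: "jump_time z n \<le> t \<Longrightarrow>
    markov_rate E W (traj (freeze n (events x0 z))) t j = cond (jump_state x0 z n) j"
  by (simp add: markov_rate_def traj_events_after)

lemma markov_rate_measurable:
  "(\<lambda>(\<omega>, t). markov_rate E W (traj \<omega>) t j) \<in> borel_measurable (Pi\<^sub>M UNIV (\<lambda>_. event_space) \<Otimes>\<^sub>M borel)"
proof -
  have "(\<lambda>x. (\<lambda>i. cond i j) (traj (fst x) (snd x))) \<in> borel_measurable (Pi\<^sub>M UNIV (\<lambda>_. event_space) \<Otimes>\<^sub>M borel)"
    by (rule measurable_compose[where N = "count_space UNIV"]) measurable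
  then show ?thesis by (simp add: markov_rate_def case_prod_beta')
qed

sublocale X: rate_process "markov_rate E W" x0
proof (rule rate_process.intro)
  show "(\<lambda>(\<omega>, t). markov_rate E W (traj \<omega>) t j) \<in> borel_measurable (Pi\<^sub>M UNIV (\<lambda>_. event_space) \<Otimes>\<^sub>M borel)" for j
    by (rule markov_rate_measurable)
next
  fix \<omega> :: "nat \<Rightarrow> 'v event" and m assume fin: "fst (\<omega> m) \<noteq> \<infinity>"
  show "jump_mass (markov_rate E W (traj (freeze m \<omega>))) (real_of_ereal (fst (\<omega> m))) UNIV \<le> 1"
  proof (rule jump_mass_le_1[where b = \<infinity>])
    show "(\<lambda>t. markov_rate E W (traj (freeze m \<omega>)) t k) \<in> borel_measurable borel" for k
      using measurable_compose[OF measurable_Pair1' markov_rate_measurable[of k], of "freeze m \<omega>"]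
      by (simp add: space_PiM space_pair_measure)
    show "0 \<le> markov_rate E W (traj (freeze m \<omega>)) t k" for t k
      by (simp add: markov_rate_def cond_nonneg)
    have "fst (\<omega> m) \<le> ereal t" if "real_of_ereal (fst (\<omega> m)) \<le> t" for t
      using that fin by (cases "fst (\<omega> m)") auto
    then have "(\<Sum>k\<in>UNIV. markov_rate E W (traj (freeze m \<omega>)) s k) = (\<Sum>k\<in>UNIV. cond (snd (\<omega> m)) k)"
      if "real_of_ereal (fst (\<omega> m)) \<le> s" for s
      using that by (simp add: markov_rate_def traj_freeze_after)
    then show "continuous_on {real_of_ereal (fst (\<omega> m))..c} (\<lambda>s. \<Sum>k\<in>UNIV. markov_rate E W (traj (freeze m \<omega>)) s k)" for c
      by (subst continuous_on_cong[OF refl]) auto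
  qed simp
qed

lemma markov_jump_density:
  assumes "jump_time z n \<le> t"
  shows "jump_density (markov_rate E W (traj (freeze n (events x0 z)))) (jump_time z n) t j
    = cond (jump_state x0 z n) j * exp (- (vertex_rate (jump_state x0 z n) * (t - jump_time z n)))"
proof -
  have "(LINT s:{jump_time z n..t}|lborel. (\<Sum>k\<in>UNIV. markov_rate E W (traj (freeze n (events x0 z))) s k))
      = (LINT s:{jump_time z n..t}|lborel. vertex_rate (jump_state x0 z n))"
    by (intro set_lebesgue_integral_cong) (auto simp: markov_rate_frozen vertex_rate_def)
  also have "\<dots> = vertex_rate (jump_state x0 z n) * (t - jump_time z n)"
    using assms by (subst set_integral_const) auto
  finally show ?thesis
    using assms by (simp add: jump_density_def markov_rate_frozen)
qed

lemma markov_path_density: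
  "X.path_density n z = (if increasing_times n z then
     ennreal ((\<Prod>k<n. cond (jump_state x0 z k) (jump_state x0 z (Suc k))) * exp (- (\<Sum>x\<in>UNIV. vertex_rate x * occ x0 n z x)))
   else 0)"
proof (induction n)
  case 0
  show ?case by (simp add: X.path_density_def)
next
  case (Suc n)
  have Suc_z: "X.path_density (Suc n) z = X.path_density n z *
    (if jump_time z n < fst (z (Suc n)) then ennreal (jump_density (markov_rate E W (traj (freeze n (events x0 z))))
      (jump_time z n) (fst (z (Suc n))) (snd (z (Suc n)))) else 0)"
    using X.path_density_Suc[of n z "z (Suc n)"] by simp
  have [simp]: "fst (z (Suc n)) = jump_time z (Suc n)" "snd (z (Suc n)) = jump_state x0 z (Suc n)"
    by (simp_all add: jump_time_def jump_state_def)
  show ?case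
  proof (cases "increasing_times (Suc n) z")
    case True
    have "(\<Sum>x\<in>UNIV. vertex_rate x * occ x0 (Suc n) z x) = (\<Sum>x\<in>UNIV. vertex_rate x * occ x0 n z x)
        + vertex_rate (jump_state x0 z n) * (jump_time z (Suc n) - jump_time z n)"
    proof -
      have "(\<Sum>x\<in>UNIV. vertex_rate x * (if x = jump_state x0 z n then d else 0)) = vertex_rate (jump_state x0 z n) * d" for d
        by (subst sum.remove[of _ "jump_state x0 z n"]) auto
      then show ?thesis by (simp only: occ_Suc[OF True] distrib_left sum.distrib)
    qed
    moreover have "jump_density (markov_rate E W (traj (freeze n (events x0 z)))) (jump_time z n) (jump_time z (Suc n)) (jump_state x0 z (Suc n))
        = cond (jump_state x0 z n) (jump_state x0 z (Suc n))
          * exp (- (vertex_rate (jump_state x0 z n) * (jump_time z (Suc n) - jump_time z n)))"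
      using True by (intro markov_jump_density) (simp add: increasing_times_Suc)
    moreover have "0 \<le> (\<Prod>k<n. cond (jump_state x0 z k) (jump_state x0 z (Suc k)))"
      by (intro prod_nonneg cond_nonneg)
    moreover have "ennreal (P * exp (- S)) * ennreal (c * exp (- d)) = ennreal (P * c * exp (- (S + d)))"
      if "0 \<le> P" "0 \<le> c" for P S c d :: real
      using that by (subst ennreal_mult[symmetric]) (auto simp: exp_diff exp_minus exp_add divide_simps)
    ultimately show ?thesis
      using True unfolding Suc_z Suc.IH
      by (simp add: increasing_times_Suc cond_nonneg)
  next
    case False
    then show ?thesis unfolding Suc_z Suc.IH by (auto simp: increasing_times_Suc)
  qed
qed

subsection \<open>The local time at the base vertex grows without bound\<close>

lemma exists_closer_neighbour:
  "\<exists>d :: 'v \<Rightarrow> nat. \<forall>x. x \<noteq> x0 \<longrightarrow> (\<exists>y. {x, y} \<in> E \<and> d y < d x)"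
proof -
  let ?R = "\<lambda>a b. {a, b} \<in> E"
  define d where "d x = (LEAST n. (?R ^^ n) x0 x)" for x
  have "\<exists>y. {x, y} \<in> E \<and> d y < d x" if "x \<noteq> x0" for x
  proof -
    have "\<exists>n. (?R ^^ n) x0 x" using connected_graph[of x0 x] by (simp add: rtranclp_power)
    then have dx: "(?R ^^ d x) x0 x" unfolding d_def by (rule LeastI_ex)
    then have "d x \<noteq> 0" using that by (auto intro: ccontr)
    then obtain m where m: "d x = Suc m" by (cases "d x") auto
    then obtain y where y: "(?R ^^ m) x0 y" "{y, x} \<in> E" using dx by auto
    have "d y \<le> m" unfolding d_def by (rule Least_le) (rule y(1))
    then show ?thesis using y m by (auto simp: insert_commute intro!: exI[of _ y])
  qed
  then show ?thesis by blast
qed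

lemma vertex_rate_pos: "x \<noteq> x0 \<Longrightarrow> 0 < vertex_rate x"
proof -
  assume "x \<noteq> x0"
  then obtain y where "{x, y} \<in> E" using exists_closer_neighbour by blast
  then have "0 < cond x y" by (simp add: conductance_def edge_pos)
  also have "cond x y \<le> vertex_rate x"
    unfolding vertex_rate_def by (rule member_le_sum) (auto simp: cond_nonneg)
  finally show ?thesis .
qed

text \<open>With \<open>d\<close> the distance to \<open>x0\<close>, the function \<open>2 - \<delta> ^ d\<close> is strictly superharmonic off \<open>x0\<close> once
  \<open>\<delta>\<close> is small: the gain \<open>\<delta> ^ (d x - 1)\<close> at one closer neighbour outweighs the loss \<open>\<delta> ^ d x\<close> at all
  others.\<close>
lemma exists_strictly_superharmonic:
  "\<exists>\<psi> \<theta>. (\<forall>x. 1 \<le> \<psi> x) \<and> 0 < \<theta> \<and> \<theta> < 1 \<and>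
     (\<forall>x. x \<noteq> x0 \<longrightarrow> (\<Sum>y\<in>UNIV. cond x y * \<psi> y) \<le> \<theta> * vertex_rate x * \<psi> x)"
proof -
  obtain d :: "'v \<Rightarrow> nat" where d: "\<And>x. x \<noteq> x0 \<Longrightarrow> \<exists>y. {x, y} \<in> E \<and> d y < d x"
    using exists_closer_neighbour by blast
  define w where "w = Min (insert 1 (W ` E))"
  define D where "D = (\<Sum>x\<in>UNIV. vertex_rate x)"
  have w: "0 < w" "w \<le> 1" "\<And>e. e \<in> E \<Longrightarrow> w \<le> W e"
    unfolding w_def by (auto simp: edge_pos)
  have D: "0 \<le> D" "\<And>x. vertex_rate x \<le> D"
    unfolding D_def by (auto intro!: sum_nonneg member_le_sum vertex_rate_nonneg)
  define \<delta> where "\<delta> = w / (1 + D)"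
  have \<delta>: "0 < \<delta>" "\<delta> \<le> 1" "\<delta> * vertex_rate x < w" for x
  proof -
    show "0 < \<delta>" using w D by (simp add: \<delta>_def)
    show "\<delta> \<le> 1" using w D by (simp add: \<delta>_def)
    have "\<delta> * vertex_rate x \<le> \<delta> * D" using \<open>0 < \<delta>\<close> D by (intro mult_left_mono) auto
    also have "\<delta> * D < w" using w D by (simp add: \<delta>_def field_simps)
    finally show "\<delta> * vertex_rate x < w" .
  qed
  define \<psi> where "\<psi> x = 2 - \<delta> ^ d x" for x
  have \<psi>: "1 \<le> \<psi> x" for x
    using power_le_one[of \<delta> "d x"] \<delta> by (simp add: \<psi>_def)
  have strict: "(\<Sum>y\<in>UNIV. cond x y * \<psi> y) < vertex_rate x * \<psi> x" if x: "x \<noteq> x0" for x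
  proof -
    obtain y where y: "{x, y} \<in> E" "d y < d x" using d[OF x] by blast
    have "\<delta> ^ d x = \<delta> ^ (d x - Suc 0) * \<delta>"
      using y(2) by (cases "d x") auto
    then have "vertex_rate x * \<delta> ^ d x = \<delta> ^ (d x - Suc 0) * (\<delta> * vertex_rate x)" by simp
    also have "\<dots> < \<delta> ^ (d x - Suc 0) * w" using \<delta> by (intro mult_strict_left_mono) auto
    also have "\<dots> \<le> \<delta> ^ d y * cond x y"
      using y \<delta> w by (intro mult_mono power_decreasing) (auto simp: conductance_def)
    also have "\<dots> \<le> (\<Sum>y\<in>UNIV. \<delta> ^ d y * cond x y)"
      by (rule member_le_sum) (use \<delta> in \<open>auto intro!: mult_nonneg_nonneg cond_nonneg\<close>)
    finally have less: "vertex_rate x * \<delta> ^ d x < (\<Sum>y\<in>UNIV. \<delta> ^ d y * cond x y)" .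
    have "(\<Sum>y\<in>UNIV. cond x y * \<psi> y) = 2 * vertex_rate x - (\<Sum>y\<in>UNIV. \<delta> ^ d y * cond x y)"
      by (simp add: \<psi>_def vertex_rate_def algebra_simps sum_subtractf sum_distrib_left)
    also have "\<dots> < 2 * vertex_rate x - vertex_rate x * \<delta> ^ d x" using less by simp
    also have "\<dots> = vertex_rate x * \<psi> x" by (simp add: \<psi>_def algebra_simps)
    finally show ?thesis .
  qed
  define \<theta> where "\<theta> = Max (insert (1/2) ((\<lambda>x. (\<Sum>y\<in>UNIV. cond x y * \<psi> y) / (vertex_rate x * \<psi> x)) ` (UNIV - {x0})))"
  have pos: "0 < vertex_rate x * \<psi> x" if "x \<noteq> x0" for x
    using vertex_rate_pos[OF that] \<psi>[of x] by (intro mult_pos_pos) auto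
  have "1/2 \<le> \<theta>" unfolding \<theta>_def by (rule Max_ge) auto
  moreover have "\<theta> < 1"
    unfolding \<theta>_def using strict pos by (subst Max_less_iff) auto
  moreover have "(\<Sum>y\<in>UNIV. cond x y * \<psi> y) \<le> \<theta> * vertex_rate x * \<psi> x" if "x \<noteq> x0" for x
  proof -
    have "(\<Sum>y\<in>UNIV. cond x y * \<psi> y) / (vertex_rate x * \<psi> x) \<le> \<theta>"
      unfolding \<theta>_def using that by (intro Max_ge) auto
    then show ?thesis using pos[OF that] by (simp add: pos_divide_le_eq mult.assoc)
  qed
  ultimately show ?thesis
    using \<psi> by (intro exI[of _ \<psi>] exI[of _ \<theta>]) auto
qed

lemma nn_integral_exp_ray:
  fixes \<kappa> :: real assumes "0 < \<kappa>"
  shows "(\<integral>\<^sup>+t. ennreal (exp (- (\<kappa> * (t - a)))) * indicator {a<..} t \<partial>lborel) = ennreal (1 / \<kappa>)"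
proof -
  have "(\<integral>\<^sup>+t. ennreal (exp (- (\<kappa> * (t - a)))) * indicator {a<..} t \<partial>lborel)
      = (\<integral>\<^sup>+t. ennreal (exp (- (\<kappa> * (t - a)))) * indicator {a..} t \<partial>lborel)"
    using AE_lborel_singleton[of a] by (intro nn_integral_cong_AE) (auto simp: indicator_def)
  also have "\<dots> = ennreal (0 - (- exp (- (\<kappa> * (a - a))) / \<kappa>))"
  proof (rule nn_integral_FTC_atLeast[where F = "\<lambda>t. - exp (- (\<kappa> * (t - a))) / \<kappa>"])
    show "((\<lambda>t. - exp (- (\<kappa> * (t - a))) / \<kappa>) has_real_derivative exp (- (\<kappa> * (x - a)))) (at x)" for x
      using assms by (auto intro!: derivative_eq_intros)
    have "filterlim (\<lambda>t. - (\<kappa> * (t - a))) at_bot at_top"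
      using assms by real_asymp
    then have "((\<lambda>t. - exp (- (\<kappa> * (t - a))) / \<kappa>) \<longlongrightarrow> - 0 / \<kappa>) at_top"
      by (intro tendsto_intros filterlim_compose[OF exp_at_bot]) (use assms in auto)
    then show "((\<lambda>t. - exp (- (\<kappa> * (t - a))) / \<kappa>) \<longlongrightarrow> 0) at_top" by simp
  qed auto
  finally show ?thesis by simp
qed

lemma measurable_occ_state:
  assumes g: "(\<lambda>x. g (fst x) (snd x)) \<in> borel_measurable (borel \<Otimes>\<^sub>M count_space UNIV)"
  shows "(\<lambda>z. g (occ x0 n z x0) (jump_state x0 z n)) \<in> borel_measurable (Pi\<^sub>M {1..n} (\<lambda>_. step_space))"
proof -
  have "(\<lambda>z. (occ x0 n z x0, jump_state x0 z n)) \<in> Pi\<^sub>M {1..n} (\<lambda>_. step_space) \<rightarrow>\<^sub>M borel \<Otimes>\<^sub>M count_space UNIV"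
    by measurable
  from measurable_compose[OF this g] show ?thesis by simp
qed

text \<open>The local time at \<open>x0\<close> and the state at the next jump are functions of their current values,
  the waiting time and the target, so they form a Markov chain.\<close>
lemma nn_integral_markov_Suc:
  assumes [measurable]: "(\<lambda>x. g (fst x) (snd x)) \<in> borel_measurable (borel \<Otimes>\<^sub>M count_space UNIV)"
  shows "(\<integral>\<^sup>+z. X.path_density (Suc n) z * g (occ x0 (Suc n) z x0) (jump_state x0 z (Suc n)) \<partial>Pi\<^sub>M {1..Suc n} (\<lambda>_. step_space))
    = (\<integral>\<^sup>+z. X.path_density n z * (\<integral>\<^sup>+t. (\<Sum>j\<in>UNIV. ennreal (cond (jump_state x0 z n) j
          * exp (- (vertex_rate (jump_state x0 z n) * (t - jump_time z n))))
          * g (occ x0 n z x0 + (if jump_state x0 z n = x0 then t - jump_time z n else 0)) j) * indicator {jump_time z n<..} t \<partial>lborel)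
        \<partial>Pi\<^sub>M {1..n} (\<lambda>_. step_space))"
proof -
  have [measurable]: "(\<lambda>z. g (occ x0 (Suc n) z x0) (jump_state x0 z (Suc n))) \<in> borel_measurable (Pi\<^sub>M {1..Suc n} (\<lambda>_. step_space))"
    by (rule measurable_occ_state[OF assms])
  have "(\<integral>\<^sup>+z. X.path_density (Suc n) z * g (occ x0 (Suc n) z x0) (jump_state x0 z (Suc n)) \<partial>Pi\<^sub>M {1..Suc n} (\<lambda>_. step_space))
    = (\<integral>\<^sup>+z. X.path_density n z * (\<integral>\<^sup>+t. (\<Sum>j\<in>UNIV. ennreal (jump_density (markov_rate E W (traj (freeze n (events x0 z))))
          (jump_time z n) t j) * g (occ x0 (Suc n) (z(Suc n := (t, j))) x0) (jump_state x0 (z(Suc n := (t, j))) (Suc n)))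
          * indicator {jump_time z n<..} t \<partial>lborel) \<partial>Pi\<^sub>M {1..n} (\<lambda>_. step_space))"
    by (rule X.nn_integral_path_density_Suc) measurable
  also have "\<dots> = (\<integral>\<^sup>+z. X.path_density n z * (\<integral>\<^sup>+t. (\<Sum>j\<in>UNIV. ennreal (cond (jump_state x0 z n) j
          * exp (- (vertex_rate (jump_state x0 z n) * (t - jump_time z n))))
          * g (occ x0 n z x0 + (if jump_state x0 z n = x0 then t - jump_time z n else 0)) j) * indicator {jump_time z n<..} t \<partial>lborel)
        \<partial>Pi\<^sub>M {1..n} (\<lambda>_. step_space))"
  proof (rule nn_integral_cong)
    fix z :: "nat \<Rightarrow> real \<times> 'v"
    show "X.path_density n z * (\<integral>\<^sup>+t. (\<Sum>j\<in>UNIV. ennreal (jump_density (markov_rate E W (traj (freeze n (events x0 z))))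
          (jump_time z n) t j) * g (occ x0 (Suc n) (z(Suc n := (t, j))) x0) (jump_state x0 (z(Suc n := (t, j))) (Suc n)))
          * indicator {jump_time z n<..} t \<partial>lborel)
      = X.path_density n z * (\<integral>\<^sup>+t. (\<Sum>j\<in>UNIV. ennreal (cond (jump_state x0 z n) j
          * exp (- (vertex_rate (jump_state x0 z n) * (t - jump_time z n))))
          * g (occ x0 n z x0 + (if jump_state x0 z n = x0 then t - jump_time z n else 0)) j) * indicator {jump_time z n<..} t \<partial>lborel)"
    proof (cases "increasing_times n z")
      case True
      show ?thesis
      proof (rule arg_cong2[where f = "(*)", OF refl], rule nn_integral_cong)
        fix t
        show "(\<Sum>j\<in>UNIV. ennreal (jump_density (markov_rate E W (traj (freeze n (events x0 z))))
            (jump_time z n) t j) * g (occ x0 (Suc n) (z(Suc n := (t, j))) x0) (jump_state x0 (z(Suc n := (t, j))) (Suc n)))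
            * indicator {jump_time z n<..} t
          = (\<Sum>j\<in>UNIV. ennreal (cond (jump_state x0 z n) j
            * exp (- (vertex_rate (jump_state x0 z n) * (t - jump_time z n))))
            * g (occ x0 n z x0 + (if jump_state x0 z n = x0 then t - jump_time z n else 0)) j) * indicator {jump_time z n<..} t"
        proof (cases "jump_time z n < t")
          case less: True
          have inc: "increasing_times (Suc n) (z(Suc n := (t, j)))" for j
            using True less by (simp add: increasing_times_upd)
          have "occ x0 (Suc n) (z(Suc n := (t, j))) x0
              = occ x0 n z x0 + (if jump_state x0 z n = x0 then t - jump_time z n else 0)" for j
            using occ_Suc[OF inc, of x0 j x0] by (auto simp: eq_commute)
          then show ?thesis
            using less by (simp add: markov_jump_density)
        qed simp
      qed
    qed (simp add: markov_path_density)
  qed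
  finally show ?thesis .
qed

text \<open>The function \<open>exp (- kill * l) * \<psi> i\<close> of local time \<open>l\<close> at \<open>x0\<close> and state \<open>i\<close> decreases in mean by the factor \<open>\<theta>\<close>
  at each jump: off \<open>x0\<close> because \<open>\<psi>\<close> is strictly superharmonic, and at \<open>x0\<close> because of the time spent
  there. It is bounded below as long as \<open>l < u\<close>.\<close>
lemma local_time_decay:
  "\<exists>C \<theta>. 0 \<le> \<theta> \<and> \<theta> < 1 \<and> 0 \<le> C \<and> (\<forall>n. (\<integral>\<^sup>+z. X.path_density n z * (if occ x0 n z x0 < u then 1 else 0)
     \<partial>Pi\<^sub>M {1..n} (\<lambda>_. step_space)) \<le> ennreal (C * \<theta> ^ n))"
proof -
  obtain \<psi> \<theta> where \<psi>: "\<And>x. 1 \<le> \<psi> x" and \<theta>: "0 < \<theta>" "\<theta> < 1"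
    and super: "\<And>x. x \<noteq> x0 \<Longrightarrow> (\<Sum>y\<in>UNIV. cond x y * \<psi> y) \<le> \<theta> * vertex_rate x * \<psi> x"
    using exists_strictly_superharmonic by auto
  have \<psi>0: "0 \<le> \<psi> x" for x using \<psi>[of x] by simp
  \<comment> \<open>Killing at rate \<open>kill\<close> at \<open>x0\<close> makes the function superharmonic there as well.\<close>
  define kill where "kill = (1 + (\<Sum>y\<in>UNIV. cond x0 y * \<psi> y)) / \<theta>"
  have sum_nonneg0: "0 \<le> (\<Sum>y\<in>UNIV. cond x y * \<psi> y)" for x
    by (intro sum_nonneg mult_nonneg_nonneg cond_nonneg \<psi>0)
  have kill: "0 < kill" using sum_nonneg0[of x0] \<theta> by (simp add: kill_def add_pos_nonneg)
  define \<kappa> where "\<kappa> x = vertex_rate x + (if x = x0 then kill else 0)" for x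
  have \<kappa>: "0 < \<kappa> x" for x
    using kill vertex_rate_pos[of x] vertex_rate_nonneg[of x] by (auto simp: \<kappa>_def)
  have super': "(\<Sum>y\<in>UNIV. cond x y * \<psi> y) / \<kappa> x \<le> \<theta> * \<psi> x" for x
  proof (cases "x = x0")
    case True
    have "(\<Sum>y\<in>UNIV. cond x y * \<psi> y) \<le> \<theta> * kill * 1"
      using \<theta> True by (simp add: kill_def)
    also have "\<dots> \<le> \<theta> * \<kappa> x * \<psi> x"
      using \<theta> kill True vertex_rate_nonneg[of x] \<psi>[of x] by (intro mult_mono) (auto simp: \<kappa>_def)
    finally show ?thesis using \<kappa>[of x] by (simp add: pos_divide_le_eq ac_simps)
  next
    case False
    then show ?thesis using super[OF False] \<kappa>[of x] by (simp add: \<kappa>_def pos_divide_le_eq ac_simps)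
  qed
  define g where "g l x = ennreal (exp (- (kill * l)) * \<psi> x)" for l x
  have g_meas [measurable]: "(\<lambda>x. g (fst x) (snd x)) \<in> borel_measurable (borel \<Otimes>\<^sub>M count_space UNIV)"
    unfolding g_def by measurable
  let ?Q = "\<lambda>n. Pi\<^sub>M {1..n} (\<lambda>_. step_space)"
  define v where "v n = (\<integral>\<^sup>+z. X.path_density n z * g (occ x0 n z x0) (jump_state x0 z n) \<partial>?Q n)" for n
  have g_z [measurable]: "(\<lambda>z. g (occ x0 n z x0) (jump_state x0 z n)) \<in> borel_measurable (?Q n)" for n
    by (rule measurable_occ_state[OF g_meas])
  have v_Suc: "v (Suc n) \<le> ennreal \<theta> * v n" for n
  proof -
    have "v (Suc n) = (\<integral>\<^sup>+z. X.path_density n z * (\<integral>\<^sup>+t. (\<Sum>j\<in>UNIV. ennreal (cond (jump_state x0 z n) j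
          * exp (- (vertex_rate (jump_state x0 z n) * (t - jump_time z n))))
          * g (occ x0 n z x0 + (if jump_state x0 z n = x0 then t - jump_time z n else 0)) j) * indicator {jump_time z n<..} t \<partial>lborel)
        \<partial>?Q n)"
      unfolding v_def by (rule nn_integral_markov_Suc) measurable
    also have "\<dots> \<le> (\<integral>\<^sup>+z. ennreal \<theta> * (X.path_density n z * g (occ x0 n z x0) (jump_state x0 z n)) \<partial>?Q n)"
    proof (rule nn_integral_mono)
      fix z :: "nat \<Rightarrow> real \<times> 'v"
      let ?i = "jump_state x0 z n" and ?a = "jump_time z n" and ?l = "occ x0 n z x0"
      have "(\<integral>\<^sup>+t. (\<Sum>j\<in>UNIV. ennreal (cond ?i j * exp (- (vertex_rate ?i * (t - ?a))))
          * g (?l + (if ?i = x0 then t - ?a else 0)) j) * indicator {?a<..} t \<partial>lborel)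
        = (\<integral>\<^sup>+t. ennreal (exp (- (kill * ?l)) * (\<Sum>j\<in>UNIV. cond ?i j * \<psi> j)) *
            (ennreal (exp (- (\<kappa> ?i * (t - ?a)))) * indicator {?a<..} t) \<partial>lborel)"
      proof (rule nn_integral_cong)
        fix t
        have "(\<Sum>j\<in>UNIV. ennreal (cond ?i j * exp (- (vertex_rate ?i * (t - ?a))))
            * g (?l + (if ?i = x0 then t - ?a else 0)) j)
          = (\<Sum>j\<in>UNIV. ennreal (exp (- (kill * ?l)) * (cond ?i j * \<psi> j) * exp (- (\<kappa> ?i * (t - ?a)))))"
          unfolding g_def
          by (intro sum.cong refl, subst ennreal_mult[symmetric])
             (auto simp: cond_nonneg \<psi>0 \<kappa>_def exp_minus exp_add exp_diff field_simps)
        also have "\<dots> = ennreal (\<Sum>j\<in>UNIV. exp (- (kill * ?l)) * (cond ?i j * \<psi> j) * exp (- (\<kappa> ?i * (t - ?a))))"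
          by (intro sum_ennreal mult_nonneg_nonneg cond_nonneg \<psi>0) auto
        also have "(\<Sum>j\<in>UNIV. exp (- (kill * ?l)) * (cond ?i j * \<psi> j) * exp (- (\<kappa> ?i * (t - ?a))))
            = (exp (- (kill * ?l)) * (\<Sum>j\<in>UNIV. cond ?i j * \<psi> j)) * exp (- (\<kappa> ?i * (t - ?a)))"
          by (simp add: sum_distrib_left sum_distrib_right)
        also have "ennreal \<dots> = ennreal (exp (- (kill * ?l)) * (\<Sum>j\<in>UNIV. cond ?i j * \<psi> j)) * ennreal (exp (- (\<kappa> ?i * (t - ?a))))"
          by (intro ennreal_mult mult_nonneg_nonneg sum_nonneg0) auto
        finally show "(\<Sum>j\<in>UNIV. ennreal (cond ?i j * exp (- (vertex_rate ?i * (t - ?a))))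
            * g (?l + (if ?i = x0 then t - ?a else 0)) j) * indicator {?a<..} t
          = ennreal (exp (- (kill * ?l)) * (\<Sum>j\<in>UNIV. cond ?i j * \<psi> j)) *
            (ennreal (exp (- (\<kappa> ?i * (t - ?a)))) * indicator {?a<..} t)"
          by (simp add: mult.assoc)
      qed
      also have "\<dots> = ennreal (exp (- (kill * ?l)) * (\<Sum>j\<in>UNIV. cond ?i j * \<psi> j)) * ennreal (1 / \<kappa> ?i)"
        by (subst nn_integral_cmult) (auto simp: nn_integral_exp_ray[OF \<kappa>])
      also have "\<dots> = ennreal (exp (- (kill * ?l)) * ((\<Sum>j\<in>UNIV. cond ?i j * \<psi> j) / \<kappa> ?i))"
        using \<kappa>[of ?i] by (subst ennreal_mult[symmetric]) (auto intro!: mult_nonneg_nonneg sum_nonneg0)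
      also have "\<dots> \<le> ennreal (exp (- (kill * ?l)) * (\<theta> * \<psi> ?i))"
        by (intro ennreal_leI mult_left_mono super') auto
      also have "\<dots> = ennreal \<theta> * g ?l ?i"
        unfolding g_def using \<theta> by (subst ennreal_mult[symmetric]) (auto simp: \<psi>0 ac_simps)
      finally show "X.path_density n z * (\<integral>\<^sup>+t. (\<Sum>j\<in>UNIV. ennreal (cond ?i j * exp (- (vertex_rate ?i * (t - ?a))))
          * g (?l + (if ?i = x0 then t - ?a else 0)) j) * indicator {?a<..} t \<partial>lborel)
        \<le> ennreal \<theta> * (X.path_density n z * g ?l ?i)"
        by (subst mult.left_commute) (rule mult_left_mono, auto)
    qed
    also have "\<dots> = ennreal \<theta> * v n"
      unfolding v_def by (rule nn_integral_cmult) measurable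
    finally show ?thesis .
  qed
  have "v 0 = ennreal (\<psi> x0)"
    by (simp add: v_def g_def X.path_density_def PiM_empty nn_integral_count_space_finite)
  then have v: "v n \<le> ennreal (\<theta> ^ n * \<psi> x0)" for n
  proof (induction n)
    case (Suc n)
    have "v (Suc n) \<le> ennreal \<theta> * v n" by (rule v_Suc)
    also have "\<dots> \<le> ennreal \<theta> * ennreal (\<theta> ^ n * \<psi> x0)" using Suc by (intro mult_left_mono) auto
    also have "\<dots> = ennreal (\<theta> ^ Suc n * \<psi> x0)"
      using \<theta> \<psi>0[of x0] by (subst ennreal_mult[symmetric]) (auto simp: ac_simps)
    finally show ?case .
  qed simp
  have "(\<integral>\<^sup>+z. X.path_density n z * (if occ x0 n z x0 < u then 1 else 0) \<partial>?Q n) \<le> ennreal (exp (kill * u) * \<psi> x0 * \<theta> ^ n)" for n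
  proof -
    have "(\<integral>\<^sup>+z. X.path_density n z * (if occ x0 n z x0 < u then 1 else 0) \<partial>?Q n)
        \<le> (\<integral>\<^sup>+z. ennreal (exp (kill * u)) * (X.path_density n z * g (occ x0 n z x0) (jump_state x0 z n)) \<partial>?Q n)"
    proof (rule nn_integral_mono)
      fix z :: "nat \<Rightarrow> real \<times> 'v"
      have "(if occ x0 n z x0 < u then 1 else 0) \<le> ennreal (exp (kill * u)) * g (occ x0 n z x0) (jump_state x0 z n)"
      proof (cases "occ x0 n z x0 < u")
        case True
        have "1 * 1 \<le> exp (kill * u - kill * occ x0 n z x0) * \<psi> (jump_state x0 z n)"
          using True kill \<psi> by (intro mult_mono) auto
        then have "ennreal 1 \<le> ennreal (exp (kill * u - kill * occ x0 n z x0) * \<psi> (jump_state x0 z n))"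
          by (intro ennreal_leI) simp
        also have "\<dots> = ennreal (exp (kill * u)) * g (occ x0 n z x0) (jump_state x0 z n)"
          unfolding g_def by (subst ennreal_mult[symmetric]) (auto simp: \<psi>0 exp_diff exp_minus field_simps)
        finally show ?thesis using True by simp
      qed simp
      then show "X.path_density n z * (if occ x0 n z x0 < u then 1 else 0)
          \<le> ennreal (exp (kill * u)) * (X.path_density n z * g (occ x0 n z x0) (jump_state x0 z n))"
        by (subst mult.left_commute) (rule mult_left_mono, auto)
    qed
    also have "\<dots> = ennreal (exp (kill * u)) * v n"
      unfolding v_def by (rule nn_integral_cmult) measurable
    also have "\<dots> \<le> ennreal (exp (kill * u)) * ennreal (\<theta> ^ n * \<psi> x0)" by (intro mult_left_mono v) auto
    also have "\<dots> = ennreal (exp (kill * u) * \<psi> x0 * \<theta> ^ n)"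
      using \<theta> \<psi>0[of x0] by (subst ennreal_mult[symmetric]) (auto simp: ac_simps)
    finally show ?thesis .
  qed
  then show ?thesis
    using \<theta> \<psi>0[of x0] by (intro exI[of _ "exp (kill * u) * \<psi> x0"] exI[of _ \<theta>]) auto
qed

text \<open>A path whose local time at \<open>x0\<close> is below \<open>u\<close> at its \<open>n\<close>-th jump either reaches local time \<open>u\<close>
  before jumping again, or has local time below \<open>u\<close> at the next jump.\<close>
lemma completion_balance:
  "(\<integral>\<^sup>+z. X.path_density n z * (if jump_state x0 z n = x0 \<and> occ x0 n z x0 < u
       then ennreal (exp (- (vertex_rate x0 * (u - occ x0 n z x0)))) else 0) \<partial>Pi\<^sub>M {1..n} (\<lambda>_. step_space))
   + (\<integral>\<^sup>+z. X.path_density (Suc n) z * (if occ x0 (Suc n) z x0 < u then 1 else 0) \<partial>Pi\<^sub>M {1..Suc n} (\<lambda>_. step_space))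
   = (\<integral>\<^sup>+z. X.path_density n z * (if occ x0 n z x0 < u then 1 else 0) \<partial>Pi\<^sub>M {1..n} (\<lambda>_. step_space))"
proof -
  let ?Q = "\<lambda>n. Pi\<^sub>M {1..n} (\<lambda>_. step_space)"
  let ?J = "\<lambda>z. \<integral>\<^sup>+t. (\<Sum>j\<in>UNIV. ennreal (cond (jump_state x0 z n) j
          * exp (- (vertex_rate (jump_state x0 z n) * (t - jump_time z n))))
          * (if occ x0 n z x0 + (if jump_state x0 z n = x0 then t - jump_time z n else 0) < u then 1 else 0)) * indicator {jump_time z n<..} t \<partial>lborel"
  have [measurable]: "Measurable.pred (?Q n) (\<lambda>z. jump_state x0 z n = x0)"
    by measurable
  have J: "?J z = (\<integral>\<^sup>+t. ennreal (vertex_rate (jump_state x0 z n) * exp (- (vertex_rate (jump_state x0 z n) * (t - jump_time z n))))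
      * (if occ x0 n z x0 + (if jump_state x0 z n = x0 then t - jump_time z n else 0) < u then 1 else 0) * indicator {jump_time z n<..} t \<partial>lborel)" for z
    unfolding vertex_rate_def
    by (intro nn_integral_cong) (simp add: sum_distrib_right[symmetric] cond_nonneg)
  have balance: "(if jump_state x0 z n = x0 \<and> occ x0 n z x0 < u
       then ennreal (exp (- (vertex_rate x0 * (u - occ x0 n z x0)))) else 0) + ?J z = (if occ x0 n z x0 < u then 1 else 0)" for z
  proof -
    let ?i = "jump_state x0 z n" and ?a = "jump_time z n" and ?l = "occ x0 n z x0"
    consider "\<not> ?l < u" | "?l < u" "?i \<noteq> x0" | "?l < u" "?i = x0" by blast
    then show ?thesis
    proof cases
      case 1
      then have "?J z = (\<integral>\<^sup>+t. 0 \<partial>(lborel :: real measure))"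
        unfolding J by (intro nn_integral_cong) (auto simp: indicator_def)
      then show ?thesis using 1 by simp
    next
      case 2
      then have "?J z = (\<integral>\<^sup>+t. ennreal (vertex_rate ?i) * (ennreal (exp (- (vertex_rate ?i * (t - ?a)))) * indicator {?a<..} t) \<partial>lborel)"
        unfolding J by (intro nn_integral_cong) (auto simp: ennreal_mult vertex_rate_nonneg ac_simps)
      also have "\<dots> = ennreal (vertex_rate ?i) * ennreal (1 / vertex_rate ?i)"
        by (subst nn_integral_cmult) (auto simp: nn_integral_exp_ray[OF vertex_rate_pos[OF 2(2)]])
      also have "\<dots> = 1"
        using vertex_rate_pos[OF 2(2)] by (subst ennreal_mult[symmetric]) auto
      finally show ?thesis using 2 by simp
    next
      case 3
      have "?J z = (\<integral>\<^sup>+t. ennreal (vertex_rate x0 * exp (- (vertex_rate x0 * (t - ?a)))) * indicator {?a..?a + (u - ?l)} t \<partial>lborel)"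
        unfolding J using 3 AE_lborel_singleton[of ?a] AE_lborel_singleton[of "?a + (u - ?l)"]
        by (intro nn_integral_cong_AE) (auto simp: indicator_def)
      also have "\<dots> = ennreal (exp (- (vertex_rate x0 * (?a - ?a))) - exp (- (vertex_rate x0 * (?a + (u - ?l) - ?a))))"
        using 3 by (intro nn_integral_derivative) (auto intro!: derivative_eq_intros simp: vertex_rate_nonneg)
      finally have "?J z = ennreal (1 - exp (- (vertex_rate x0 * (u - ?l))))" by simp
      moreover have "exp (- (vertex_rate x0 * (u - ?l))) \<le> 1" using 3 vertex_rate_nonneg[of x0] by simp
      ultimately show ?thesis using 3 by (simp flip: ennreal_plus)
    qed
  qed
  have step: "(\<integral>\<^sup>+z. X.path_density (Suc n) z * (if occ x0 (Suc n) z x0 < u then 1 else 0) \<partial>?Q (Suc n))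
      = (\<integral>\<^sup>+z. X.path_density n z * ?J z \<partial>?Q n)"
    by (rule nn_integral_markov_Suc) measurable
  have J_meas: "(\<lambda>z. X.path_density n z * ?J z) \<in> borel_measurable (?Q n)"
  proof -
    have [measurable]: "(\<lambda>z. cond (jump_state x0 z n) j) \<in> borel_measurable (?Q n)"
      "(\<lambda>z. vertex_rate (jump_state x0 z n)) \<in> borel_measurable (?Q n)" for j
      by (rule measurable_compose[where N = "count_space UNIV"], measurable)+
    have "(\<lambda>z. ?J z) = (\<lambda>z. \<integral>\<^sup>+t. (\<Sum>j\<in>UNIV. ennreal (cond (jump_state x0 z n) j
          * exp (- (vertex_rate (jump_state x0 z n) * (t - jump_time z n))))
          * (if occ x0 n z x0 + (if jump_state x0 z n = x0 then t - jump_time z n else 0) < u then 1 else 0)) * (if jump_time z n < t then 1 else 0) \<partial>lborel)"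
      by (auto simp: fun_eq_iff indicator_def intro!: nn_integral_cong)
    also have "\<dots> \<in> borel_measurable (?Q n)"
      by measurable
    finally have "(\<lambda>z. ?J z) \<in> borel_measurable (?Q n)" .
    then show ?thesis by (rule borel_measurable_times_ennreal[OF X.path_density_measurable])
  qed
  have add: "(\<integral>\<^sup>+z. X.path_density n z * (if jump_state x0 z n = x0 \<and> occ x0 n z x0 < u
       then ennreal (exp (- (vertex_rate x0 * (u - occ x0 n z x0)))) else 0) \<partial>?Q n) + (\<integral>\<^sup>+z. X.path_density n z * ?J z \<partial>?Q n)
      = (\<integral>\<^sup>+z. X.path_density n z * (if jump_state x0 z n = x0 \<and> occ x0 n z x0 < u
       then ennreal (exp (- (vertex_rate x0 * (u - occ x0 n z x0)))) else 0) + X.path_density n z * ?J z \<partial>?Q n)"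
    by (rule nn_integral_add[symmetric, OF _ J_meas]) measurable
  also have "\<dots> = (\<integral>\<^sup>+z. X.path_density n z * (if occ x0 n z x0 < u then 1 else 0) \<partial>?Q n)"
    by (rule nn_integral_cong) (simp only: distrib_left[symmetric] balance)
  finally show ?thesis unfolding step .
qed

text \<open>The sum of \<open>completion_balance\<close> over \<open>n\<close> telescopes, and \<open>local_time_decay\<close> removes the last term.\<close>
lemma completion_mass:
  assumes "0 < u"
  shows "(\<Sum>n. \<integral>\<^sup>+z. X.path_density n z * (if jump_state x0 z n = x0 \<and> occ x0 n z x0 < u
       then ennreal (exp (- (vertex_rate x0 * (u - occ x0 n z x0)))) else 0) \<partial>Pi\<^sub>M {1..n} (\<lambda>_. step_space)) = 1"
proof -
  let ?Q = "\<lambda>n. Pi\<^sub>M {1..n} (\<lambda>_. step_space)"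
  define S where "S n = (\<integral>\<^sup>+z. X.path_density n z * (if jump_state x0 z n = x0 \<and> occ x0 n z x0 < u
       then ennreal (exp (- (vertex_rate x0 * (u - occ x0 n z x0)))) else 0) \<partial>?Q n)" for n
  define A where "A n = (\<integral>\<^sup>+z. X.path_density n z * (if occ x0 n z x0 < u then 1 else 0) \<partial>?Q n)" for n
  have "A 0 = 1"
    using assms by (simp add: A_def X.path_density_def PiM_empty nn_integral_count_space_finite)
  have partial: "(\<Sum>n<N. S n) + A N = 1" for N
  proof (induction N)
    case (Suc N)
    have "S N + A (Suc N) = A N" unfolding S_def A_def by (rule completion_balance)
    then show ?case using Suc by (simp add: add.assoc)
  qed (simp add: \<open>A 0 = 1\<close>)
  obtain C \<theta> where \<theta>: "0 \<le> \<theta>" "\<theta> < 1" "0 \<le> C" and A: "\<And>n. A n \<le> ennreal (C * \<theta> ^ n)"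
    unfolding A_def using local_time_decay[of u] by blast
  have "suminf S \<le> 1"
    unfolding suminf_eq_SUP using partial by (intro SUP_least) (metis le_iff_add)
  moreover have "1 \<le> suminf S"
  proof -
    have "(\<lambda>N. ennreal (C * \<theta> ^ N)) \<longlonglongrightarrow> ennreal (C * 0)"
      using \<theta> by (intro tendsto_ennrealI tendsto_mult tendsto_const LIMSEQ_realpow_zero) auto
    then have "(\<lambda>N. suminf S + ennreal (C * \<theta> ^ N)) \<longlonglongrightarrow> suminf S + ennreal (C * 0)"
      by (intro tendsto_add tendsto_const)
    moreover have "1 \<le> suminf S + ennreal (C * \<theta> ^ N)" for N
    proof -
      have "1 = (\<Sum>n<N. S n) + A N" using partial by simp
      also have "\<dots> \<le> suminf S + ennreal (C * \<theta> ^ N)"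
        by (intro add_mono sum_le_suminf A) auto
      finally show ?thesis .
    qed
    ultimately have "1 \<le> suminf S + ennreal (C * 0)"
      by (intro LIMSEQ_le_const) auto
    then show ?thesis by simp
  qed
  ultimately have "suminf S = 1" by (rule antisym)
  then show ?thesis unfolding S_def .
qed

end

section \<open>The self-interacting jump process\<close>

locale positive_field = conductance_network E W x0
  for E :: "'v::finite set set" and W :: "'v set \<Rightarrow> real" and x0 :: 'v +
  fixes \<Phi> :: "'v \<Rightarrow> real"
  assumes \<Phi>_pos: "\<And>x. 0 < \<Phi> x"
begin

lemma Y_rate_eq:
  "Y_rate E W x0 \<Phi> y s j = (if \<forall>i. 0 < L_check \<Phi> y s i
     then cond (y s) j * L_check \<Phi> y s j * (moment j (L_check \<Phi> y s) / moment (y s) (L_check \<Phi> y s)) else 0)"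
  using ising_partition_pos[of E W x0 "L_check \<Phi> y s"]
  by (simp add: Y_rate_def Let_def spin_mean_eq)

lemma Y_rate_nonneg: "0 \<le> Y_rate E W x0 \<Phi> y s j"
  unfolding Y_rate_eq
  by (auto intro!: mult_nonneg_nonneg divide_nonneg_nonneg cond_nonneg less_imp_le[OF moment_pos] simp: less_imp_le)

lemma Y_rate_measurable:
  "(\<lambda>(\<omega>, t). Y_rate E W x0 \<Phi> (traj \<omega>) t j) \<in> borel_measurable (Pi\<^sub>M UNIV (\<lambda>_. event_space) \<Otimes>\<^sub>M borel)"
proof -
  let ?M = "Pi\<^sub>M UNIV (\<lambda>_. event_space :: 'v event measure) \<Otimes>\<^sub>M (borel :: real measure)"
  have L [measurable]: "(\<lambda>x. L_check \<Phi> (traj (fst x)) (snd x) i) \<in> borel_measurable ?M" for i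
    unfolding L_check_def by measurable
  have [measurable]: "(\<lambda>x. (\<lambda>i. cond i j) (traj (fst x) (snd x))) \<in> borel_measurable ?M"
    by (rule measurable_compose[where N = "count_space UNIV"]) measurable
  have [measurable]: "(\<lambda>x. moment i (L_check \<Phi> (traj (fst x)) (snd x))) \<in> borel_measurable ?M" for i
    by (rule moment_measurable) (rule L)
  have [measurable]: "(\<lambda>x. moment (traj (fst x) (snd x)) (L_check \<Phi> (traj (fst x)) (snd x))) \<in> borel_measurable ?M"
    by (rule measurable_compose_countable[where f = "\<lambda>i x. moment i (L_check \<Phi> (traj (fst x)) (snd x))"]) measurable
  show ?thesis
    unfolding Y_rate_eq case_prod_beta' by measurable
qed

sublocale Y: rate_process "Y_rate E W x0 \<Phi>" x0
proof (rule rate_process.intro)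
  show "(\<lambda>(\<omega>, t). Y_rate E W x0 \<Phi> (traj \<omega>) t j) \<in> borel_measurable (Pi\<^sub>M UNIV (\<lambda>_. event_space) \<Otimes>\<^sub>M borel)" for j
    by (rule Y_rate_measurable)
next
  fix \<omega> :: "nat \<Rightarrow> 'v event" and m assume fin: "fst (\<omega> m) \<noteq> \<infinity>"
  define p where "p = traj (freeze m \<omega>)"
  define a where "a = real_of_ereal (fst (\<omega> m))"
  define i where "i = snd (\<omega> m)"
  have p [measurable]: "p \<in> borel \<rightarrow>\<^sub>M count_space UNIV" unfolding p_def by (rule traj_path_measurable)
  have p_after: "p t = i" if "a \<le> t" for t
    unfolding p_def i_def using that fin
    by (intro traj_freeze_after) (cases "fst (\<omega> m)", auto simp: a_def)
  define L where "L = L_check \<Phi> p"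
  \<comment> \<open>Local times only start to accumulate at time \<open>0\<close>, also when the last event is dated earlier.\<close>
  define a' where "a' = max a 0"
  have L_cases: "L t = (L a)(i := L a i - (if a' \<le> t then t - a' else 0))" if "a \<le> t" for t
  proof (rule ext)
    fix k
    have a': "local_time p k a' = local_time p k a"
      by (cases "0 \<le> a") (auto simp: a'_def max_def)
    show "L t k = ((L a)(i := L a i - (if a' \<le> t then t - a' else 0))) k"
    proof (cases "a' \<le> t")
      case True
      have "local_time p k t = local_time p k a' + (if k = i then t - a' else 0)"
        using True by (intro local_time_const p p_after) (auto simp: a'_def)
      then show ?thesis using True a' by (simp add: L_def L_check_def)
    next
      case False
      then have "t \<le> 0" "a \<le> 0" using that by (auto simp: a'_def max_def split: if_splits)
      then show ?thesis using False by (simp add: L_def L_check_def)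
    qed
  qed
  define b where "b = (if \<forall>k. 0 < L a k then a' + L a i else a)"
  show "jump_mass (Y_rate E W x0 \<Phi> (traj (freeze m \<omega>))) (real_of_ereal (fst (\<omega> m))) UNIV \<le> 1"
    unfolding p_def[symmetric] a_def[symmetric]
  proof (rule jump_mass_le_1[where b = "ereal b"])
    show "(\<lambda>t. Y_rate E W x0 \<Phi> p t k) \<in> borel_measurable borel" for k
      using measurable_compose[OF measurable_Pair1' Y_rate_measurable[of k], of "freeze m \<omega>"]
      by (simp add: space_PiM space_pair_measure p_def)
    show "0 \<le> Y_rate E W x0 \<Phi> p t k" for t k by (rule Y_rate_nonneg)
    show "Y_rate E W x0 \<Phi> p t k = 0" if "a < t" "ereal b \<le> ereal t" for t k
    proof -
      have "\<exists>k. L t k \<le> 0"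
      proof (cases "\<forall>k. 0 < L a k")
        case True
        then have "a' + L a i \<le> t" using that by (simp add: b_def)
        moreover have "0 < L a i" using True by simp
        ultimately have "L t i \<le> 0" using L_cases[of t] that by simp
        then show ?thesis by blast
      next
        case False
        then obtain k where "L a k \<le> 0" by (auto simp: not_less)
        moreover have "L t k \<le> L a k"
          using local_time_mono[OF p, of a t k] that by (simp add: L_def L_check_def)
        ultimately show ?thesis by (auto intro!: exI[of _ k])
      qed
      then have "\<not> (\<forall>i. 0 < L t i)" by (meson not_less)
      then show ?thesis unfolding Y_rate_eq L_def[symmetric] by (rule if_not_P)
    qed
    show "continuous_on {a..c} (\<lambda>s. \<Sum>k\<in>UNIV. Y_rate E W x0 \<Phi> p s k)" if "a < c" "ereal c < ereal b" for c
    proof -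
      have alive_a: "\<forall>k. 0 < L a k" using that by (auto simp: b_def split: if_splits)
      then have b: "b = a' + L a i" by (simp add: b_def)
      have alive: "0 < L s k" if s: "s \<in> {a..c}" for s k
      proof -
        have "a \<le> s" "s < a' + L a i" using s \<open>ereal c < ereal b\<close> b by auto
        then show ?thesis using L_cases[of s] alive_a[rule_format, of k] by auto
      qed
      have cont_L: "continuous_on {a..c} (\<lambda>s. L s k)" for k
        unfolding L_def L_check_def by (intro continuous_intros local_time_continuous[OF p])
      have "continuous_on {a..c} (\<lambda>s. \<Sum>k\<in>UNIV. cond i k * L s k * (moment k (L s) / moment i (L s)))"
        using moment_pos[OF alive, of _ i]
        by (intro continuous_intros cont_L) (auto simp: less_imp_neq[symmetric])
      then show ?thesis
        by (rule continuous_on_cong[THEN iffD1, rotated 2])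
           (auto simp: Y_rate_eq L_def[symmetric] p_after alive)
    qed
  qed
qed

text \<open>The field left over at the \<open>n\<close>-th jump.\<close>
definition left :: "nat \<Rightarrow> (nat \<Rightarrow> real \<times> 'v) \<Rightarrow> 'v \<Rightarrow> real" where
  "left n z x = \<Phi> x - occ x0 n z x"

lemma left_0 [simp]: "left 0 z = \<Phi>"
  by (simp add: left_def fun_eq_iff)

lemma left_upd [simp]: "left n (z(Suc n := p)) = left n z"
  by (simp add: left_def fun_eq_iff)

lemma left_Suc:
  assumes "increasing_times (Suc n) z"
  shows "left (Suc n) z = (left n z)(jump_state x0 z n := left n z (jump_state x0 z n) - (jump_time z (Suc n) - jump_time z n))"
  by (auto simp: left_def fun_eq_iff occ_Suc[OF assms])

lemma left_antimono: "increasing_times n z \<Longrightarrow> k \<le> n \<Longrightarrow> left n z x \<le> left k z x"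
proof (induction n)
  case (Suc m)
  show ?case
  proof (cases "k = Suc m")
    case False
    then have "left m z x \<le> left k z x" using Suc by (simp add: increasing_times_Suc)
    then show ?thesis using Suc.prems by (auto simp: left_Suc increasing_times_Suc)
  qed simp
qed simp

lemma L_check_events:
  assumes "increasing_times n z" "jump_time z n \<le> t"
  shows "L_check \<Phi> (traj (freeze n (events x0 z))) t
    = (left n z)(jump_state x0 z n := left n z (jump_state x0 z n) - (t - jump_time z n))"
  by (auto simp: L_check_def left_def fun_eq_iff local_time_events[OF assms])

lemma moment_nonneg: "(\<And>x. 0 \<le> L x) \<Longrightarrow> 0 \<le> moment y L"
  unfolding ising_moment_def
  by (intro ising_spin_nonneg) (auto simp: interaction_def intro!: mult_nonneg_nonneg prod_nonneg less_imp_le[OF edge_pos])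

text \<open>While the process sits at \<open>i\<close>, the moment at \<open>i\<close> of the remaining field is its survival function,
  up to normalisation.\<close>
lemma moment_decreasing_derivative:
  "((\<lambda>s. moment i (L(i := c - (s - a)))) has_real_derivative
     - (\<Sum>k\<in>UNIV. cond i k * L k * moment k (L(i := c - (s - a))))) (at s)"
proof -
  have "((\<lambda>s. c - (s - a)) has_real_derivative -1) (at s)"
    by (auto intro!: derivative_eq_intros)
  from DERIV_chain2[OF moment_has_derivative[of i L "c - (s - a)"] this]
  show ?thesis by simp
qed

lemma cond_mult_upd [simp]: "cond i k * (L(i := c)) k = cond i k * L k"
  by (cases "k = i") auto

text \<open>The survival function cancels the moment in the denominator of the rate at the time of the jump, and leaves
  the one at the beginning of the waiting time.\<close>
lemma Y_jump_density:
  assumes inc: "increasing_times n z" and t: "jump_time z n < t"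
  shows "jump_density (Y_rate E W x0 \<Phi> (traj (freeze n (events x0 z)))) (jump_time z n) t j =
    (let i = jump_state x0 z n; L = (left n z)(i := left n z i - (t - jump_time z n)) in
     if \<forall>x. 0 < L x then cond i j * L j * moment j L / moment i (left n z) else 0)"
proof -
  let ?p = "traj (freeze n (events x0 z))" and ?i = "jump_state x0 z n" and ?a = "jump_time z n"
  define Lt where "Lt s = (left n z)(?i := left n z ?i - (s - ?a))" for s
  have L: "L_check \<Phi> ?p s = Lt s" if "?a \<le> s" for s
    using L_check_events[OF inc that] by (simp add: Lt_def)
  have p: "?p s = ?i" if "?a \<le> s" for s
    by (rule traj_events_after[OF that])
  show ?thesis
  proof (cases "\<forall>x. 0 < Lt t x")
    case False
    then have "Y_rate E W x0 \<Phi> ?p t j = 0"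
      using t by (simp only: Y_rate_eq L less_imp_le if_False)
    then show ?thesis
      unfolding Let_def Lt_def[symmetric] if_not_P[OF False] by (simp add: jump_density_def)
  next
    case True
    have alive: "0 < Lt s x" if "s \<in> {?a..t}" for s x
      using True[rule_format, of x] that by (auto simp: Lt_def split: if_splits)
    define G where "G s = moment ?i (Lt s)" for s
    define h where "h s = (\<Sum>k\<in>UNIV. cond ?i k * left n z k * moment k (Lt s)) / moment ?i (Lt s)" for s
    have G_pos: "0 < G s" if "s \<in> {?a..t}" for s
      unfolding G_def by (rule moment_pos) (rule alive[OF that])
    have "exp (- (LINT s:{?a..t}|lborel. h s)) = G t / G ?a"
    proof (rule exp_minus_integral_eq)
      fix s assume s: "s \<in> {?a..t}"
      show "(G has_real_derivative - h s * G s) (at s)"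
        using moment_decreasing_derivative[of ?i "left n z" "left n z ?i" ?a s] G_pos[OF s]
        unfolding G_def h_def Lt_def by simp
    next
      have "continuous_on {?a..t} (\<lambda>s. Lt s x)" for x
        unfolding Lt_def by (cases "x = ?i") (auto intro!: continuous_intros)
      then show "continuous_on {?a..t} h"
        unfolding h_def using G_pos unfolding G_def by (intro continuous_intros) (auto simp: less_imp_neq[symmetric])
    qed (use t G_pos in auto)
    moreover have "(LINT s:{?a..t}|lborel. (\<Sum>k\<in>UNIV. Y_rate E W x0 \<Phi> ?p s k)) = (LINT s:{?a..t}|lborel. h s)"
    proof (rule set_lebesgue_integral_cong)
      show "\<forall>s. s \<in> {?a..t} \<longrightarrow> (\<Sum>k\<in>UNIV. Y_rate E W x0 \<Phi> ?p s k) = h s"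
      proof safe
        fix s assume s: "s \<in> {?a..t}"
        then have "Y_rate E W x0 \<Phi> ?p s k = cond ?i k * left n z k * moment k (Lt s) / moment ?i (Lt s)" for k
          using alive[OF s] cond_mult_upd[of ?i k "left n z"] by (simp add: Y_rate_eq L p Lt_def)
        then show "(\<Sum>k\<in>UNIV. Y_rate E W x0 \<Phi> ?p s k) = h s"
          by (simp add: h_def sum_divide_distrib)
      qed
    qed simp
    ultimately have "jump_density (Y_rate E W x0 \<Phi> ?p) ?a t j
        = cond ?i j * Lt t j * (moment j (Lt t) / moment ?i (Lt t)) * (G t / G ?a)"
      using t True by (simp add: jump_density_def Y_rate_eq L p)
    also have "\<dots> = cond ?i j * Lt t j * moment j (Lt t) / moment ?i (left n z)"
      using G_pos[of t] t by (simp add: G_def) (simp add: Lt_def)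
    finally show ?thesis using True by (simp add: Lt_def Let_def)
  qed
qed

text \<open>The numerator of each jump density is the denominator of the next, so the moments telescope; the first one
  is the partition function of \<open>\<Phi>\<close>, since \<open>\<sigma> x0 = 1\<close>.\<close>
lemma Y_path_density:
  "Y.path_density n z = (if increasing_times n z \<and> (\<forall>x. 0 < left n z x) then
     ennreal ((\<Prod>k<n. cond (jump_state x0 z k) (jump_state x0 z (Suc k)) * left (Suc k) z (jump_state x0 z (Suc k)))
       * moment (jump_state x0 z n) (left n z) / partition_fun \<Phi>)
   else 0)"
proof (induction n)
  case 0
  show ?case using \<Phi>_pos ising_partition_pos[of E W x0 \<Phi>] by (simp add: Y.path_density_def)
next
  case (Suc n)
  have Suc_z: "Y.path_density (Suc n) z = Y.path_density n z *
    (if jump_time z n < fst (z (Suc n)) then ennreal (jump_density (Y_rate E W x0 \<Phi> (traj (freeze n (events x0 z))))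
      (jump_time z n) (fst (z (Suc n))) (snd (z (Suc n)))) else 0)"
    using Y.path_density_Suc[of n z "z (Suc n)"] by simp
  have [simp]: "fst (z (Suc n)) = jump_time z (Suc n)" "snd (z (Suc n)) = jump_state x0 z (Suc n)"
    by (simp_all add: jump_time_def jump_state_def)
  show ?case
  proof (cases "increasing_times (Suc n) z")
    case False
    then show ?thesis unfolding Suc_z Suc.IH by (auto simp: increasing_times_Suc)
  next
    case inc: True
    then have inc_n: "increasing_times n z" "jump_time z n < jump_time z (Suc n)"
      by (simp_all add: increasing_times_Suc)
    let ?i = "jump_state x0 z n" and ?j = "jump_state x0 z (Suc n)"
    have density: "jump_density (Y_rate E W x0 \<Phi> (traj (freeze n (events x0 z)))) (jump_time z n) (jump_time z (Suc n)) ?j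
        = (if \<forall>x. 0 < left (Suc n) z x
           then cond ?i ?j * left (Suc n) z ?j * moment ?j (left (Suc n) z) / moment ?i (left n z) else 0)"
      using Y_jump_density[OF inc_n, of ?j] by (simp add: Let_def left_Suc[OF inc])
    show ?thesis
    proof (cases "\<forall>x. 0 < left (Suc n) z x")
      case False
      then have "jump_density (Y_rate E W x0 \<Phi> (traj (freeze n (events x0 z)))) (jump_time z n) (jump_time z (Suc n)) ?j = 0"
        by (simp only: density if_False)
      moreover have "\<not> (increasing_times (Suc n) z \<and> (\<forall>x. 0 < left (Suc n) z x))" using False by blast
      ultimately show ?thesis unfolding Suc_z by (simp only: if_False) simp
    next
      case True
      have le: "left (Suc n) z x \<le> left n z x" for x
        using inc_n by (simp add: left_Suc[OF inc])
      then have pos_n: "0 < left n z x" for x using True by (meson less_le_trans)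
      have prod_nonneg: "0 \<le> (\<Prod>k<n. cond (jump_state x0 z k) (jump_state x0 z (Suc k)) * left (Suc k) z (jump_state x0 z (Suc k)))"
      proof (intro prod_nonneg mult_nonneg_nonneg cond_nonneg)
        fix k assume "k \<in> {..<n}"
        then have k: "Suc k \<le> n" by simp
        show "0 \<le> left (Suc k) z (jump_state x0 z (Suc k))"
          using pos_n[of "jump_state x0 z (Suc k)"] left_antimono[OF inc_n(1) k, of "jump_state x0 z (Suc k)"] by simp
      qed
      have pos: "0 < partition_fun \<Phi>" "0 < moment ?i (left n z)" "0 < moment ?j (left (Suc n) z)"
        using True pos_n by (auto intro!: ising_partition_pos moment_pos)
      have "Y.path_density (Suc n) z = ennreal ((\<Prod>k<n. cond (jump_state x0 z k) (jump_state x0 z (Suc k)) * left (Suc k) z (jump_state x0 z (Suc k)))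
            * moment ?i (left n z) / partition_fun \<Phi>)
          * ennreal (cond ?i ?j * left (Suc n) z ?j * moment ?j (left (Suc n) z) / moment ?i (left n z))"
        unfolding Suc_z Suc.IH using True pos_n inc_n by (simp add: density)
      also have "\<dots> = ennreal ((\<Prod>k<n. cond (jump_state x0 z k) (jump_state x0 z (Suc k)) * left (Suc k) z (jump_state x0 z (Suc k)))
            * moment ?i (left n z) / partition_fun \<Phi>
          * (cond ?i ?j * left (Suc n) z ?j * moment ?j (left (Suc n) z) / moment ?i (left n z)))"
        using pos prod_nonneg True
        by (intro ennreal_mult[symmetric] divide_nonneg_nonneg mult_nonneg_nonneg cond_nonneg) (auto simp: less_imp_le)
      also have "(\<Prod>k<n. cond (jump_state x0 z k) (jump_state x0 z (Suc k)) * left (Suc k) z (jump_state x0 z (Suc k)))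
            * moment ?i (left n z) / partition_fun \<Phi>
          * (cond ?i ?j * left (Suc n) z ?j * moment ?j (left (Suc n) z) / moment ?i (left n z))
        = (\<Prod>k<Suc n. cond (jump_state x0 z k) (jump_state x0 z (Suc k)) * left (Suc k) z (jump_state x0 z (Suc k)))
            * moment ?j (left (Suc n) z) / partition_fun \<Phi>"
        using pos by (simp add: field_simps)
      finally show ?thesis using True inc by simp
    qed
  qed
qed

text \<open>Once the process sits at \<open>x0\<close>, it stays there until \<open>left x0\<close> is used up with a probability that is a ratio of
  partition functions: that of the remaining field without \<open>x0\<close>, to that of the remaining field.\<close>
lemma Y_survival:
  assumes inc: "increasing_times n z" and pos: "\<And>x. 0 < left n z x" and x0: "jump_state x0 z n = x0"
  shows "emeasure (next_event (Y_rate E W x0 \<Phi> (traj (freeze n (events x0 z)))) (jump_time z n) x0)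
     {e. ereal (jump_time z n + left n z x0) < fst e}
   = ennreal (partition_fun ((left n z)(x0 := 0)) / partition_fun (left n z))"
proof -
  let ?R = "Y_rate E W x0 \<Phi> (traj (freeze n (events x0 z)))" and ?a = "jump_time z n"
  let ?c = "?a + left n z x0"
  define Lt where "Lt s = (left n z)(x0 := left n z x0 - (s - ?a))" for s
  have Lt_nonneg: "0 \<le> Lt s x" if "s \<in> {?a..?c}" for s x
    using that pos[of x] by (auto simp: Lt_def less_imp_le)
  have part: "0 < partition_fun (left n z)" by (rule ising_partition_pos)
  define g where "g s = (\<Sum>k\<in>UNIV. cond x0 k * left n z k * moment k (Lt s)) / partition_fun (left n z)" for s
  have g_nonneg: "0 \<le> g s" if "s \<in> {?a..?c}" for s
    unfolding g_def
    by (intro divide_nonneg_nonneg sum_nonneg mult_nonneg_nonneg cond_nonneg moment_nonneg Lt_nonneg[OF that] less_imp_le[OF pos] less_imp_le[OF part])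
  define G where "G s = partition_fun (Lt s) / partition_fun (left n z)" for s
  have G': "(G has_real_derivative - g s) (at s)" for s
    unfolding G_def g_def Lt_def
    using DERIV_cdivide[OF moment_decreasing_derivative[of x0 "left n z" "left n z x0" ?a s], of "partition_fun (left n z)"] by simp
  have G_a: "G ?a = 1" and G_c: "G ?c = partition_fun ((left n z)(x0 := 0)) / partition_fun (left n z)"
    using part by (simp_all add: G_def Lt_def)
  have "G ?c \<le> G ?a"
    using pos[of x0] g_nonneg G' by (intro DERIV_nonpos_imp_nonincreasing[of ?a ?c G]) force+
  then have G_c_le: "G ?c \<le> 1" using G_a by simp
  have "(\<integral>\<^sup>+t. (\<Sum>j\<in>UNIV. ennreal (jump_density ?R ?a t j)) * indicator {?a<..?c} t \<partial>lborel)
      = (\<integral>\<^sup>+t. ennreal (g t) * indicator {?a..?c} t \<partial>lborel)"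
  proof (rule nn_integral_cong_AE)
    show "AE t in lborel. (\<Sum>j\<in>UNIV. ennreal (jump_density ?R ?a t j)) * indicator {?a<..?c} t = ennreal (g t) * indicator {?a..?c} t"
      using AE_lborel_singleton[of ?a] AE_lborel_singleton[of ?c]
    proof eventually_elim
      case (elim t)
      show ?case
      proof (cases "t \<in> {?a<..?c}")
        case True
        then have t: "?a < t" "t < ?c" using elim by auto
        have alive: "0 < Lt t x" for x using t pos[of x] by (auto simp: Lt_def)
        have "jump_density ?R ?a t j = cond x0 j * left n z j * moment j (Lt t) / partition_fun (left n z)" for j
          using Y_jump_density[OF inc t(1), of j] alive cond_mult_upd[of x0 j "left n z"]
          by (simp add: x0 Let_def Lt_def)
        moreover have "0 \<le> cond x0 j * left n z j * moment j (Lt t) / partition_fun (left n z)" for j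
          using alive part
          by (intro divide_nonneg_nonneg mult_nonneg_nonneg cond_nonneg moment_nonneg less_imp_le[OF pos]) (auto simp: less_imp_le)
        ultimately have "(\<Sum>j\<in>UNIV. ennreal (jump_density ?R ?a t j)) = ennreal (g t)"
          by (simp add: g_def sum_divide_distrib)
        then show ?thesis using True by simp
      next
        case False
        then have "t \<notin> {?a..?c}" using elim by auto
        then show ?thesis using False by simp
      qed
    qed
  qed
  also have "\<dots> = ennreal (G ?a - G ?c)"
    using pos[of x0] G' g_nonneg by (intro nn_integral_derivative) auto
  finally have mass: "(\<integral>\<^sup>+t. (\<Sum>j\<in>UNIV. ennreal (jump_density ?R ?a t j)) * indicator {?a<..?c} t \<partial>lborel) = ennreal (1 - G ?c)"
    by (simp add: G_a)
  show ?thesis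
    unfolding G_c[symmetric]
  proof (rule emeasure_next_event_survive[OF _ _ mass _ G_c_le])
    show "(\<lambda>t. ?R t k) \<in> borel_measurable borel" for k by (rule Y.rate_measurable1)
    show "jump_mass ?R ?a UNIV \<le> 1"
      using Y.jump_mass_le[of "events x0 z" n] by (simp add: events_eq)
    show "0 \<le> G ?c"
      unfolding G_c by (intro divide_nonneg_nonneg less_imp_le[OF ising_partition_pos])
  qed
qed

text \<open>Every visit to \<open>x\<close> but the first starts with the value of \<open>left x\<close> with which the previous one ended.
  So the product over arrivals and the product over departures differ only by boundary terms.\<close>
lemma arrivals_departures:
  assumes "increasing_times n z" "\<And>x. 0 < left n z x"
  shows "(\<Prod>k<n. left (Suc k) z (jump_state x0 z (Suc k))) * (\<Prod>x\<in>UNIV. left n z x) * \<Phi> x0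
    = (\<Prod>k<n. left (Suc k) z (jump_state x0 z k)) * (\<Prod>x\<in>UNIV. \<Phi> x) * left n z (jump_state x0 z n)"
  using assms
proof (induction n)
  case (Suc n)
  let ?i = "jump_state x0 z n"
  have inc: "increasing_times n z" "jump_time z n < jump_time z (Suc n)"
    using Suc.prems by (simp_all add: increasing_times_Suc)
  have left: "left (Suc n) z = (left n z)(?i := left (Suc n) z ?i)"
    by (subst (1 2) left_Suc[OF Suc.prems(1)]) simp
  have "left (Suc n) z x \<le> left n z x" for x
    using inc by (simp add: left_Suc[OF Suc.prems(1)])
  then have pos: "0 < left n z x" for x using Suc.prems(2) by (meson less_le_trans)
  have "(\<Prod>x\<in>UNIV. left (Suc n) z x) * left n z ?i = (\<Prod>x\<in>UNIV. left n z x) * left (Suc n) z ?i"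
  proof -
    have "(\<Prod>x\<in>UNIV - {?i}. left (Suc n) z x) = (\<Prod>x\<in>UNIV - {?i}. left n z x)"
      by (intro prod.cong refl) (subst left, simp)
    then show ?thesis
      by (simp add: prod.remove[of UNIV ?i "left (Suc n) z"] prod.remove[of UNIV ?i "left n z"])
  qed
  moreover note Suc.IH[OF inc(1) pos]
  moreover have "left n z ?i \<noteq> 0" using pos[of ?i] by simp
  moreover have "A1 * a * (P' * c) = B1 * b * Q * a"
    if "P' * l = P * b" "A1 * P * c = B1 * Q * l" "l \<noteq> 0" for A1 a P' c B1 b Q l P :: real
  proof -
    have "(A1 * a * (P' * c)) * l = (A1 * P * c) * (a * b)" using that(1) by (metis mult.assoc mult.commute)
    also have "\<dots> = (B1 * b * Q * a) * l" unfolding that(2) by simp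
    finally show ?thesis using that(3) by simp
  qed
  ultimately show ?case by (simp add: mult.assoc)
qed simp

lemma arrivals_departures_closed:
  assumes "increasing_times n z" "\<And>x. 0 < left n z x" "jump_state x0 z n = x0"
  shows "(\<Prod>k<n. left (Suc k) z (jump_state x0 z (Suc k)))
    = (\<Prod>k<n. left (Suc k) z (jump_state x0 z k)) * (\<Prod>x\<in>UNIV - {x0}. \<Phi> x / left n z x)"
proof -
  define A B where "A = (\<Prod>k<n. left (Suc k) z (jump_state x0 z (Suc k)))" and "B = (\<Prod>k<n. left (Suc k) z (jump_state x0 z k))"
  define P Q where "P = (\<Prod>x\<in>UNIV - {x0}. left n z x)" and "Q = (\<Prod>x\<in>UNIV - {x0}. \<Phi> x)"
  have "A * (left n z x0 * P) * \<Phi> x0 = B * (\<Phi> x0 * Q) * left n z x0"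
    using arrivals_departures[OF assms(1,2)] assms(3)
    by (simp add: A_def B_def P_def Q_def prod.remove[of UNIV x0 "left n z"] prod.remove[of UNIV x0 \<Phi>])
  moreover have "0 < left n z x0" "0 < \<Phi> x0" using assms(2) \<Phi>_pos by auto
  ultimately have "A * P = B * Q" by simp
  moreover have "0 < P" unfolding P_def using assms(2) by (intro prod_pos) auto
  ultimately have "A = B * (Q / P)" by (simp add: field_simps)
  then show ?thesis by (simp add: A_def B_def P_def Q_def prod_dividef)
qed

end

section \<open>The time change\<close>

text \<open>While the process sits at a vertex whose remaining field starts at \<open>l\<close>, the new clock is this quadratic function of time.\<close>
lemma nn_integral_quadratic_substitution:
  fixes F :: "real \<Rightarrow> ennreal"
  assumes [measurable]: "F \<in> borel_measurable borel" and "0 < l"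
  shows "(\<integral>\<^sup>+t. F (D + l * (t - a) - (t - a)\<^sup>2 / 2) * ennreal (l - (t - a)) * indicator {a<..<a + l} t \<partial>lborel)
    = (\<integral>\<^sup>+s. F s * indicator {D<..<D + l\<^sup>2 / 2} s \<partial>lborel)"
proof -
  let ?g = "\<lambda>t. D + l * (t - a) - (t - a)\<^sup>2 / 2"
  have g: "?g a = D" "?g (a + l) = D + l\<^sup>2 / 2"
    by (simp_all add: power2_eq_square)
  have "(\<integral>\<^sup>+s. F s * indicator {D<..<D + l\<^sup>2 / 2} s \<partial>lborel) = (\<integral>\<^sup>+s. F s * indicator {?g a..?g (a + l)} s \<partial>lborel)"
    unfolding g using AE_lborel_singleton[of D] AE_lborel_singleton[of "D + l\<^sup>2 / 2"]
    by (intro nn_integral_cong_AE) (auto simp: indicator_def)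
  also have "\<dots> = (\<integral>\<^sup>+t. F (?g t) * ennreal (l - (t - a)) * indicator {a..a + l} t \<partial>lborel)"
    using \<open>0 < l\<close> by (intro nn_integral_substitution_aux) (auto intro!: derivative_eq_intros continuous_intros simp: diff_divide_distrib)
  also have "\<dots> = (\<integral>\<^sup>+t. F (?g t) * ennreal (l - (t - a)) * indicator {a<..<a + l} t \<partial>lborel)"
    using AE_lborel_singleton[of a] AE_lborel_singleton[of "a + l"]
    by (intro nn_integral_cong_AE) (auto simp: indicator_def)
  finally show ?thesis by simp
qed

lemma occ_upd_le [simp]: "k \<le> n \<Longrightarrow> occ z0 k (z(Suc n := p)) x = occ z0 k z x"
  by (simp add: occ_def)

context positive_field
begin

text \<open>The value of \<open>D_check\<close> at the \<open>n\<close>-th jump.\<close>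
definition clock :: "nat \<Rightarrow> (nat \<Rightarrow> real \<times> 'v) \<Rightarrow> real" where
  "clock n z = (1/2) * (\<Sum>x\<in>UNIV. (\<Phi> x)\<^sup>2 - (left n z x)\<^sup>2)"

definition time_changed :: "nat \<Rightarrow> (nat \<Rightarrow> real \<times> 'v) \<Rightarrow> nat \<Rightarrow> real \<times> 'v" where
  "time_changed n z = (\<lambda>k\<in>{1..n}. (clock k z, snd (z k)))"

lemma left_upd_le [simp]: "k \<le> n \<Longrightarrow> left k (z(Suc n := p)) = left k z"
  by (simp add: left_def fun_eq_iff)

lemma clock_0 [simp]: "clock 0 z = 0"
  by (simp add: clock_def)

lemma clock_upd_le [simp]: "k \<le> n \<Longrightarrow> clock k (z(Suc n := p)) = clock k z"
  by (simp add: clock_def)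

lemma sum_squares_upd:
  "(\<Sum>x\<in>UNIV. (\<Phi> x)\<^sup>2 - ((f(i := c)) x)\<^sup>2) = (\<Sum>x\<in>UNIV. (\<Phi> x)\<^sup>2 - (f x)\<^sup>2) + ((f i)\<^sup>2 - c\<^sup>2)"
  for f :: "'v \<Rightarrow> real"
proof -
  have rest: "(\<Sum>x\<in>UNIV - {i}. (\<Phi> x)\<^sup>2 - ((f(i := c)) x)\<^sup>2) = (\<Sum>x\<in>UNIV - {i}. (\<Phi> x)\<^sup>2 - (f x)\<^sup>2)"
    by (intro sum.cong) auto
  have split: "(\<Sum>x\<in>UNIV. h x) = h i + (\<Sum>x\<in>UNIV - {i}. h x)" for h :: "'v \<Rightarrow> real"
    by (rule sum.remove) auto
  show ?thesis
    unfolding split[of "\<lambda>x. (\<Phi> x)\<^sup>2 - ((f(i := c)) x)\<^sup>2"] split[of "\<lambda>x. (\<Phi> x)\<^sup>2 - (f x)\<^sup>2"] rest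
    by simp
qed

lemma clock_Suc:
  assumes "increasing_times (Suc n) z"
  shows "clock (Suc n) z = clock n z + ((left n z (jump_state x0 z n))\<^sup>2 - (left (Suc n) z (jump_state x0 z n))\<^sup>2) / 2"
  unfolding clock_def left_Suc[OF assms] sum_squares_upd by (simp add: field_simps)

lemma jump_time_time_changed: "k \<le> n \<Longrightarrow> jump_time (time_changed n z) k = clock k z"
  by (auto simp: jump_time_def time_changed_def)

lemma jump_state_time_changed: "k \<le> n \<Longrightarrow> jump_state x0 (time_changed n z) k = jump_state x0 z k"
  by (auto simp: jump_state_def time_changed_def)

lemma time_changed_upto:
  assumes "increasing_times n z" "\<And>x. 0 < left n z x" "m \<le> n"
  shows "increasing_times m (time_changed n z) \<and> (\<forall>x. occ x0 m (time_changed n z) x = ((\<Phi> x)\<^sup>2 - (left m z x)\<^sup>2) / 2)"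
  using \<open>m \<le> n\<close>
proof (induction m)
  case (Suc m)
  let ?i = "jump_state x0 z m" and ?z = "time_changed n z"
  have inc: "increasing_times (Suc m) z" using assms(1) Suc.prems by (auto simp: increasing_times_def)
  then have lt: "jump_time z m < jump_time z (Suc m)" by (simp add: increasing_times_Suc)
  have l: "0 < left (Suc m) z ?i" "left (Suc m) z ?i < left m z ?i"
    using assms(2)[of ?i] left_antimono[OF assms(1) Suc.prems, of ?i] lt by (auto simp: left_Suc[OF inc])
  then have "(left (Suc m) z ?i)\<^sup>2 < (left m z ?i)\<^sup>2" by (intro power_strict_mono) auto
  then have "clock m z < clock (Suc m) z" by (simp add: clock_Suc[OF inc])
  then have inc': "increasing_times (Suc m) ?z"
    using Suc by (simp add: increasing_times_Suc jump_time_time_changed)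
  have "occ x0 (Suc m) ?z x = ((\<Phi> x)\<^sup>2 - (left (Suc m) z x)\<^sup>2) / 2" for x
  proof -
    have "occ x0 (Suc m) ?z x = ((\<Phi> x)\<^sup>2 - (left m z x)\<^sup>2) / 2 + (if x = ?i then clock (Suc m) z - clock m z else 0)"
      using Suc by (simp add: occ_Suc[OF inc'] jump_time_time_changed jump_state_time_changed)
    also have "\<dots> = ((\<Phi> x)\<^sup>2 - (left (Suc m) z x)\<^sup>2) / 2"
      by (cases "x = ?i") (simp_all add: clock_Suc[OF inc] left_Suc[OF inc] field_simps)
    finally show ?thesis .
  qed
  with inc' show ?case by blast
qed simp

lemma increasing_time_changed: "increasing_times n z \<Longrightarrow> (\<And>x. 0 < left n z x) \<Longrightarrow> increasing_times n (time_changed n z)"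
  and occ_time_changed: "increasing_times n z \<Longrightarrow> (\<And>x. 0 < left n z x) \<Longrightarrow>
    occ x0 n (time_changed n z) x = ((\<Phi> x)\<^sup>2 - (left n z x)\<^sup>2) / 2"
  using time_changed_upto[of n z n] by auto

lemma time_changed_upd:
  "time_changed (Suc n) (z(Suc n := (t, j))) = (time_changed n z)(Suc n := (clock (Suc n) (z(Suc n := (t, j))), j))"
  by (auto simp: time_changed_def fun_eq_iff)

lemma left_measurable: "k \<le> n \<Longrightarrow> (\<lambda>z. left k z x) \<in> borel_measurable (Pi\<^sub>M {1..n} (\<lambda>_. step_space))"
  unfolding left_def by (intro borel_measurable_diff borel_measurable_const skeleton_occ[where n = n] component_step)

lemma left_state_measurable:
  assumes "k \<le> n" "l \<le> n"
  shows "(\<lambda>z. left k z (jump_state x0 z l)) \<in> borel_measurable (Pi\<^sub>M {1..n} (\<lambda>_. step_space))"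
  by (rule measurable_compose_countable[where f = "\<lambda>x z. left k z x"])
     (intro left_measurable assms skeleton_jump_state[where n = n] component_step | assumption)+

lemma time_changed_measurable [measurable]:
  "time_changed n \<in> Pi\<^sub>M {1..n} (\<lambda>_. step_space) \<rightarrow>\<^sub>M Pi\<^sub>M {1..n} (\<lambda>_. step_space)"
  unfolding time_changed_def
proof (rule measurable_restrict)
  fix k assume k: "k \<in> {1..n}"
  let ?Q = "Pi\<^sub>M {1..n} (\<lambda>_. step_space :: (real \<times> 'v) measure)"
  have [measurable]: "(\<lambda>z. clock k z) \<in> borel_measurable ?Q"
    unfolding clock_def using k
    by (intro borel_measurable_times borel_measurable_const borel_measurable_sum borel_measurable_diff
        borel_measurable_power left_measurable) auto
  have "(\<lambda>z. z k) \<in> ?Q \<rightarrow>\<^sub>M step_space" using k by auto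
  from measurable_compose[OF this measurable_snd] have [measurable]: "(\<lambda>z. snd (z k)) \<in> ?Q \<rightarrow>\<^sub>M count_space UNIV" .
  show "(\<lambda>z. (clock k z, snd (z k))) \<in> ?Q \<rightarrow>\<^sub>M step_space" by measurable
qed

text \<open>While the process sits at \<open>i\<close>, the new clock runs at speed \<open>left i\<close>. So the Jacobian of the time
  change is the product of the values of \<open>left\<close> at the departures.\<close>
lemma nn_integral_time_change:
  assumes "f \<in> borel_measurable (Pi\<^sub>M {1..n} (\<lambda>_. step_space))"
  shows "(\<integral>\<^sup>+z. (if increasing_times n z \<and> (\<forall>x. 0 < left n z x)
        then ennreal (\<Prod>k<n. left (Suc k) z (jump_state x0 z k)) * f (time_changed n z) else 0) \<partial>Pi\<^sub>M {1..n} (\<lambda>_. step_space))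
    = (\<integral>\<^sup>+z. (if increasing_times n z \<and> (\<forall>x. 2 * occ x0 n z x < (\<Phi> x)\<^sup>2) then f z else 0) \<partial>Pi\<^sub>M {1..n} (\<lambda>_. step_space))"
  using assms
proof (induction n arbitrary: f)
  case 0
  have "time_changed 0 z = (\<lambda>_. undefined)" for z by (simp add: time_changed_def restrict_def)
  then show ?case
    by (simp add: PiM_empty nn_integral_count_space_finite \<Phi>_pos less_imp_neq[OF \<Phi>_pos, symmetric])
next
  case (Suc n)
  let ?Q = "\<lambda>n. Pi\<^sub>M {1..n} (\<lambda>_. step_space :: (real \<times> 'v) measure)"
  have ins: "{1..Suc n} = insert (Suc n) {1..n}" by auto
  note f [measurable] = Suc.prems
  have upd: "(\<lambda>x. (fst x)(Suc n := snd x)) \<in> ?Q n \<Otimes>\<^sub>M step_space \<rightarrow>\<^sub>M ?Q (Suc n)"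
    unfolding ins by (intro measurable_fun_upd[where J = "{1..n}"]) auto
  have f_upd [measurable]: "(\<lambda>x. f ((fst x)(Suc n := snd x))) \<in> borel_measurable (?Q n \<Otimes>\<^sub>M step_space)"
    by (rule measurable_compose[OF upd f])
  define slot where "slot z t \<longleftrightarrow> jump_time z n < t \<and>
      2 * (occ x0 n z (jump_state x0 z n) + (t - jump_time z n)) < (\<Phi> (jump_state x0 z n))\<^sup>2" for z t
  define H where "H z = (\<integral>\<^sup>+p. f (z(Suc n := p)) * (if slot z (fst p) then 1 else 0) \<partial>step_space)" for z
  have occ_state [measurable]: "(\<lambda>z. occ x0 n z (jump_state x0 z n)) \<in> borel_measurable (?Q n)"
    by (rule measurable_compose_countable[where f = "\<lambda>x z. occ x0 n z x"]) measurable
  have \<Phi>_state [measurable]: "(\<lambda>z. \<Phi> (jump_state x0 z n)) \<in> borel_measurable (?Q n)"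
    by (rule measurable_compose[where N = "count_space UNIV"]) measurable
  have H_meas: "H \<in> borel_measurable (?Q n)"
  proof -
    have [measurable]: "(\<lambda>x. fst (snd x)) \<in> borel_measurable (?Q n \<Otimes>\<^sub>M step_space)"
      using measurable_compose[OF measurable_snd measurable_fst] by simp
    note [measurable] = measurable_compose[OF measurable_fst skeleton_measurable(1)]
      measurable_compose[OF measurable_fst occ_state] measurable_compose[OF measurable_fst \<Phi>_state]
    have "(\<lambda>x. f ((fst x)(Suc n := snd x)) * (if slot (fst x) (fst (snd x)) then 1 else 0)) \<in> borel_measurable (?Q n \<Otimes>\<^sub>M step_space)"
      unfolding slot_def by measurable
    then show ?thesis
      unfolding H_def by (intro sigma_finite_measure.borel_measurable_nn_integral[OF sigma_finite_step_space]) (simp add: case_prod_beta')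
  qed
  have all_pos: "Measurable.pred (?Q m) (\<lambda>z. \<forall>x. 0 < left m z x)" for m
  proof (rule pred_intros_countable)
    show "Measurable.pred (?Q m) (\<lambda>z. 0 < left m z x)" for x
      unfolding pred_def by (intro borel_measurable_less borel_measurable_const left_measurable order_refl)
  qed
  have all_occ: "Measurable.pred (?Q m) (\<lambda>z. \<forall>x. 2 * occ x0 m z x < (\<Phi> x)\<^sup>2)" for m
    by measurable
  have prod_meas: "(\<lambda>z. \<Prod>k<m. left (Suc k) z (jump_state x0 z k)) \<in> borel_measurable (?Q m)" for m
    by (intro borel_measurable_prod left_state_measurable) auto
  have ft: "(\<lambda>z. f (time_changed (Suc n) z)) \<in> borel_measurable (?Q (Suc n))"
    by (rule measurable_compose[OF time_changed_measurable f])
  have "(\<lambda>z. if increasing_times (Suc n) z \<and> (\<forall>x. 0 < left (Suc n) z x)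
        then ennreal (\<Prod>k<Suc n. left (Suc k) z (jump_state x0 z k)) * f (time_changed (Suc n) z) else 0) \<in> borel_measurable (?Q (Suc n))"
    using ft all_pos[of "Suc n"] prod_meas[of "Suc n"] by measurable
  then have "(\<integral>\<^sup>+z. (if increasing_times (Suc n) z \<and> (\<forall>x. 0 < left (Suc n) z x)
        then ennreal (\<Prod>k<Suc n. left (Suc k) z (jump_state x0 z k)) * f (time_changed (Suc n) z) else 0) \<partial>?Q (Suc n))
      = (\<integral>\<^sup>+z. (\<integral>\<^sup>+p. (if increasing_times (Suc n) (z(Suc n := p)) \<and> (\<forall>x. 0 < left (Suc n) (z(Suc n := p)) x)
        then ennreal (\<Prod>k<Suc n. left (Suc k) (z(Suc n := p)) (jump_state x0 (z(Suc n := p)) k))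
          * f (time_changed (Suc n) (z(Suc n := p))) else 0) \<partial>step_space) \<partial>?Q n)"
    unfolding ins by (intro steps.product_nn_integral_insert) simp_all
  also have "\<dots> = (\<integral>\<^sup>+z. (if increasing_times n z \<and> (\<forall>x. 0 < left n z x)
        then ennreal (\<Prod>k<n. left (Suc k) z (jump_state x0 z k)) * H (time_changed n z) else 0) \<partial>?Q n)"
  proof (rule nn_integral_cong)
    fix z :: "nat \<Rightarrow> real \<times> 'v" assume z: "z \<in> space (?Q n)"
    let ?i = "jump_state x0 z n" and ?a = "jump_time z n" and ?l = "left n z (jump_state x0 z n)"
    let ?P = "\<Prod>k<n. left (Suc k) z (jump_state x0 z k)"
    let ?z' = "time_changed n z"
    let ?G = "\<lambda>p. (if increasing_times (Suc n) (z(Suc n := p)) \<and> (\<forall>x. 0 < left (Suc n) (z(Suc n := p)) x)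
        then ennreal (\<Prod>k<Suc n. left (Suc k) (z(Suc n := p)) (jump_state x0 (z(Suc n := p)) k))
          * f (time_changed (Suc n) (z(Suc n := p))) else 0)"
    have left_S: "left (Suc n) (z(Suc n := p)) = (left n z)(?i := ?l - (fst p - ?a))"
      if "increasing_times (Suc n) (z(Suc n := p))" for p
      using left_Suc[OF that] by simp
    show "(\<integral>\<^sup>+p. ?G p \<partial>step_space) = (if increasing_times n z \<and> (\<forall>x. 0 < left n z x) then ennreal ?P * H ?z' else 0)"
    proof (cases "increasing_times n z \<and> (\<forall>x. 0 < left n z x)")
      case False
      have "?G p = 0" for p
      proof -
        have "\<not> (increasing_times (Suc n) (z(Suc n := p)) \<and> (\<forall>x. 0 < left (Suc n) (z(Suc n := p)) x))"
        proof
          assume A: "increasing_times (Suc n) (z(Suc n := p)) \<and> (\<forall>x. 0 < left (Suc n) (z(Suc n := p)) x)"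
          have le: "left (Suc n) (z(Suc n := p)) x \<le> left n (z(Suc n := p)) x" for x
            using A by (intro left_antimono) auto
          have "0 < left n z x" for x
            using A[THEN conjunct2, rule_format, of x] le[of x] by simp
          then show False using A False by (simp add: increasing_times_upd)
        qed
        then show ?thesis by (rule if_not_P)
      qed
      then show ?thesis unfolding if_not_P[OF False] by simp
    next
      case True
      then have inc: "increasing_times n z" and pos: "\<And>x. 0 < left n z x" by auto
      have P_nonneg: "0 \<le> ?P"
        using left_antimono[OF inc] pos by (intro prod_nonneg) (meson Suc_leI lessThan_iff less_imp_le less_le_trans)
      have z': "?z' \<in> space (?Q n)" using measurable_space[OF time_changed_measurable z] .
      have upd': "(\<lambda>p. ?z'(Suc n := p)) \<in> step_space \<rightarrow>\<^sub>M ?Q (Suc n)"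
        unfolding ins using z' by (intro measurable_fun_upd[where J = "{1..n}"]) auto
      have fz' [measurable]: "(\<lambda>p. f (?z'(Suc n := p))) \<in> borel_measurable step_space"
        by (rule measurable_compose[OF upd' f])
      define F where "F s = (\<Sum>j\<in>UNIV. f (?z'(Suc n := (s, j))))" for s
      have F [measurable]: "F \<in> borel_measurable borel"
      proof -
        have "(\<lambda>s. f (?z'(Suc n := (s, j)))) \<in> borel_measurable borel" for j
          using measurable_compose[OF _ fz', of "\<lambda>s. (s, j)" borel] by simp
        then show ?thesis unfolding F_def by measurable
      qed
      have G_cases: "?G (t, j) = ennreal ?P * (f (?z'(Suc n := (clock n z + ?l * (t - ?a) - (t - ?a)\<^sup>2 / 2, j)))
          * ennreal (?l - (t - ?a)) * indicator {?a<..<?a + ?l} t)" for t j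
      proof (cases "t \<in> {?a<..<?a + ?l}")
        case inside: True
        then have inc': "increasing_times (Suc n) (z(Suc n := (t, j)))"
          using inc by (simp add: increasing_times_upd)
        have pos': "\<forall>x. 0 < left (Suc n) (z(Suc n := (t, j))) x"
          using inside pos by (auto simp: left_S[OF inc'])
        have clock: "clock (Suc n) (z(Suc n := (t, j))) = clock n z + ?l * (t - ?a) - (t - ?a)\<^sup>2 / 2"
          using clock_Suc[OF inc'] by (simp add: left_S[OF inc'] power2_eq_square field_simps)
        have prod: "(\<Prod>k<Suc n. left (Suc k) (z(Suc n := (t, j))) (jump_state x0 (z(Suc n := (t, j))) k)) = ?P * (?l - (t - ?a))"
        proof -
          have "(\<Prod>k<n. left (Suc k) (z(Suc n := (t, j))) (jump_state x0 (z(Suc n := (t, j))) k)) = ?P"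
            by (intro prod.cong refl) simp
          then show ?thesis by (simp add: left_S[OF inc'])
        qed
        have "?G (t, j) = ennreal (?P * (?l - (t - ?a))) * f (time_changed (Suc n) (z(Suc n := (t, j))))"
          using inc' pos' by (simp only: prod if_True simp_thms)
        also have "\<dots> = ennreal ?P * ennreal (?l - (t - ?a)) * f (?z'(Suc n := (clock n z + ?l * (t - ?a) - (t - ?a)\<^sup>2 / 2, j)))"
          using P_nonneg inside by (simp only: time_changed_upd clock) (simp add: ennreal_mult)
        finally show ?thesis using inside by (simp add: mult.assoc mult.commute mult.left_commute)
      next
        case False
        have "\<not> (increasing_times (Suc n) (z(Suc n := (t, j))) \<and> (\<forall>x. 0 < left (Suc n) (z(Suc n := (t, j))) x))"
        proof
          assume A: "increasing_times (Suc n) (z(Suc n := (t, j))) \<and> (\<forall>x. 0 < left (Suc n) (z(Suc n := (t, j))) x)"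
          then have "0 < left (Suc n) (z(Suc n := (t, j))) ?i" by blast
          then have "0 < ?l - (t - ?a)" using left_S[of "(t, j)"] A by simp
          moreover have "?a < t" using A by (simp add: increasing_times_upd)
          ultimately show False using False by simp
        qed
        then have "?G (t, j) = 0" by (rule if_not_P)
        then show ?thesis unfolding indicator_simps(2)[OF False] by (simp only: mult_zero_right)
      qed
      have "(\<integral>\<^sup>+p. ?G p \<partial>step_space) = (\<integral>\<^sup>+p. ennreal ?P * (f (?z'(Suc n := (clock n z + ?l * (fst p - ?a) - (fst p - ?a)\<^sup>2 / 2, snd p)))
          * ennreal (?l - (fst p - ?a)) * indicator {?a<..<?a + ?l} (fst p)) \<partial>step_space)"
      proof (rule nn_integral_cong)
        fix p :: "real \<times> 'v"
        show "?G p = ennreal ?P * (f (?z'(Suc n := (clock n z + ?l * (fst p - ?a) - (fst p - ?a)\<^sup>2 / 2, snd p)))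
          * ennreal (?l - (fst p - ?a)) * indicator {?a<..<?a + ?l} (fst p))"
          by (cases p) (simp only: G_cases fst_conv snd_conv)
      qed
      also have "\<dots> = (\<integral>\<^sup>+t. (\<Sum>j\<in>UNIV. ennreal ?P * (f (?z'(Suc n := (clock n z + ?l * (t - ?a) - (t - ?a)\<^sup>2 / 2, j)))
          * ennreal (?l - (t - ?a)) * indicator {?a<..<?a + ?l} t)) \<partial>lborel)"
      proof -
        have "(\<lambda>p. (clock n z + ?l * (fst p - ?a) - (fst p - ?a)\<^sup>2 / 2, snd p)) \<in> step_space \<rightarrow>\<^sub>M (step_space :: (real \<times> 'v) measure)"
          by measurable
        from measurable_compose[OF this fz']
        have [measurable]: "(\<lambda>p. f (?z'(Suc n := (clock n z + ?l * (fst p - ?a) - (fst p - ?a)\<^sup>2 / 2, snd p)))) \<in> borel_measurable step_space" .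
        show ?thesis by (subst nn_integral_step_space) simp_all
      qed
      also have "\<dots> = (\<integral>\<^sup>+t. ennreal ?P * (F (clock n z + ?l * (t - ?a) - (t - ?a)\<^sup>2 / 2) * ennreal (?l - (t - ?a)) * indicator {?a<..<?a + ?l} t) \<partial>lborel)"
        by (simp only: F_def sum_distrib_left sum_distrib_right)
      also have "\<dots> = ennreal ?P * (\<integral>\<^sup>+t. F (clock n z + ?l * (t - ?a) - (t - ?a)\<^sup>2 / 2) * ennreal (?l - (t - ?a)) * indicator {?a<..<?a + ?l} t \<partial>lborel)"
        by (rule nn_integral_cmult) measurable
      also have "(\<integral>\<^sup>+t. F (clock n z + ?l * (t - ?a) - (t - ?a)\<^sup>2 / 2) * ennreal (?l - (t - ?a)) * indicator {?a<..<?a + ?l} t \<partial>lborel)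
          = (\<integral>\<^sup>+s. F s * indicator {clock n z<..<clock n z + ?l\<^sup>2 / 2} s \<partial>lborel)"
        by (rule nn_integral_quadratic_substitution[OF F pos])
      also have "\<dots> = H ?z'"
      proof -
        have slot: "slot ?z' t \<longleftrightarrow> t \<in> {clock n z<..<clock n z + ?l\<^sup>2 / 2}" for t
          unfolding slot_def using occ_time_changed[OF inc pos, of ?i]
          by (auto simp: jump_time_time_changed jump_state_time_changed field_simps)
        have "H ?z' = (\<integral>\<^sup>+p. f (?z'(Suc n := p)) * indicator {clock n z<..<clock n z + ?l\<^sup>2 / 2} (fst p) \<partial>step_space)"
          unfolding H_def slot by (intro nn_integral_cong) (simp add: indicator_def)
        also have "\<dots> = (\<integral>\<^sup>+s. F s * indicator {clock n z<..<clock n z + ?l\<^sup>2 / 2} s \<partial>lborel)"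
          by (subst nn_integral_step_space) (simp, simp only: F_def sum_distrib_right fst_conv)
        finally show ?thesis by simp
      qed
      finally show ?thesis unfolding if_P[OF True] .
    qed
  qed
  also have "\<dots> = (\<integral>\<^sup>+z. (if increasing_times n z \<and> (\<forall>x. 2 * occ x0 n z x < (\<Phi> x)\<^sup>2) then H z else 0) \<partial>?Q n)"
    by (rule Suc.IH[OF H_meas])
  also have "\<dots> = (\<integral>\<^sup>+z. (\<integral>\<^sup>+p. (if increasing_times (Suc n) (z(Suc n := p)) \<and> (\<forall>x. 2 * occ x0 (Suc n) (z(Suc n := p)) x < (\<Phi> x)\<^sup>2)
      then f (z(Suc n := p)) else 0) \<partial>step_space) \<partial>?Q n)"
  proof (rule nn_integral_cong)
    fix z :: "nat \<Rightarrow> real \<times> 'v"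
    let ?i = "jump_state x0 z n" and ?a = "jump_time z n"
    have equiv: "increasing_times (Suc n) (z(Suc n := p)) \<and> (\<forall>x. 2 * occ x0 (Suc n) (z(Suc n := p)) x < (\<Phi> x)\<^sup>2)
        \<longleftrightarrow> (increasing_times n z \<and> (\<forall>x. 2 * occ x0 n z x < (\<Phi> x)\<^sup>2)) \<and> slot z (fst p)" for p
    proof (cases "increasing_times (Suc n) (z(Suc n := p))")
      case True
      then have inc: "increasing_times n z" "?a < fst p" by (auto simp: increasing_times_upd)
      have occ: "occ x0 (Suc n) (z(Suc n := p)) x = occ x0 n z x + (if x = ?i then fst p - ?a else 0)" for x
        using occ_Suc[OF True] by simp
      show ?thesis
      proof
        assume R: "increasing_times (Suc n) (z(Suc n := p)) \<and> (\<forall>x. 2 * occ x0 (Suc n) (z(Suc n := p)) x < (\<Phi> x)\<^sup>2)"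
        have "2 * occ x0 n z x < (\<Phi> x)\<^sup>2" for x
          using R[THEN conjunct2, rule_format, of x] inc(2) by (auto simp: occ split: if_splits)
        moreover have "slot z (fst p)"
          using R[THEN conjunct2, rule_format, of ?i] inc(2) by (simp add: occ slot_def)
        ultimately show "(increasing_times n z \<and> (\<forall>x. 2 * occ x0 n z x < (\<Phi> x)\<^sup>2)) \<and> slot z (fst p)" using inc by blast
      next
        assume "(increasing_times n z \<and> (\<forall>x. 2 * occ x0 n z x < (\<Phi> x)\<^sup>2)) \<and> slot z (fst p)"
        then show "increasing_times (Suc n) (z(Suc n := p)) \<and> (\<forall>x. 2 * occ x0 (Suc n) (z(Suc n := p)) x < (\<Phi> x)\<^sup>2)"
          using True by (auto simp: occ slot_def)
      qed
    next
      case False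
      then show ?thesis by (auto simp: increasing_times_upd slot_def)
    qed
    show "(if increasing_times n z \<and> (\<forall>x. 2 * occ x0 n z x < (\<Phi> x)\<^sup>2) then H z else 0)
      = (\<integral>\<^sup>+p. (if increasing_times (Suc n) (z(Suc n := p)) \<and> (\<forall>x. 2 * occ x0 (Suc n) (z(Suc n := p)) x < (\<Phi> x)\<^sup>2)
      then f (z(Suc n := p)) else 0) \<partial>step_space)"
      unfolding equiv
      by (cases "increasing_times n z \<and> (\<forall>x. 2 * occ x0 n z x < (\<Phi> x)\<^sup>2)")
         (simp_all only: H_def if_True if_False simp_thms, auto intro!: nn_integral_cong)
  qed
  also have "\<dots> = (\<integral>\<^sup>+z. (if increasing_times (Suc n) z \<and> (\<forall>x. 2 * occ x0 (Suc n) z x < (\<Phi> x)\<^sup>2) then f z else 0) \<partial>?Q (Suc n))"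
  proof -
    have "(\<lambda>z. if increasing_times (Suc n) z \<and> (\<forall>x. 2 * occ x0 (Suc n) z x < (\<Phi> x)\<^sup>2) then f z else 0) \<in> borel_measurable (?Q (Suc n))"
      using all_occ[of "Suc n"] by measurable
    then show ?thesis
      unfolding ins by (intro steps.product_nn_integral_insert[symmetric]) simp_all
  qed
  finally show ?case .
qed

end

section \<open>Reading off the stopped path\<close>

definition skeleton :: "nat \<Rightarrow> (nat \<Rightarrow> 'v event) \<Rightarrow> nat \<Rightarrow> real \<times> 'v" where
  "skeleton n w = (\<lambda>k\<in>{1..n}. (real_of_ereal (fst (w k)), snd (w k)))"

lemma skeleton_measurable_restrict [measurable]:
  "skeleton n \<in> Pi\<^sub>M {0..<Suc n} (\<lambda>_. event_space :: 'v event measure) \<rightarrow>\<^sub>M Pi\<^sub>M {1..n} (\<lambda>_. step_space :: (real \<times> 'v::finite) measure)"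
  unfolding skeleton_def
proof (rule measurable_restrict)
  fix k assume "k \<in> {1..n}"
  then have k: "(\<lambda>w. w k) \<in> Pi\<^sub>M {0..<Suc n} (\<lambda>_. event_space :: 'v event measure) \<rightarrow>\<^sub>M event_space" by simp
  have "(\<lambda>e. (real_of_ereal (fst e), snd e)) \<in> (event_space :: 'v event measure) \<rightarrow>\<^sub>M step_space"
    by measurable
  from measurable_compose[OF k this]
  show "(\<lambda>w. (real_of_ereal (fst (w k)), snd (w k))) \<in> Pi\<^sub>M {0..<Suc n} (\<lambda>_. event_space :: 'v event measure) \<rightarrow>\<^sub>M step_space" by simp
qed

lemma skeleton_restrict: "skeleton n (restrict w {0..<Suc n}) = skeleton n w"
  by (auto simp: skeleton_def fun_eq_iff)

lemma skeleton_events: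
  assumes "z \<in> space (Pi\<^sub>M {1..n} (\<lambda>_. step_space))"
  shows "skeleton n (events z0 z) = z"
  using assms by (auto simp: skeleton_def events_def fun_eq_iff space_PiM PiE_def extensional_def)

lemma (in rate_process) nn_integral_PP_skeleton:
  assumes g [measurable]: "g \<in> borel_measurable (Pi\<^sub>M {1..n} (\<lambda>_. step_space))"
    and c [measurable]: "c \<in> borel_measurable (Pi\<^sub>M {1..n} (\<lambda>_. step_space))"
  shows "(\<integral>\<^sup>+w. g (skeleton n w) * (if increasing_upto n w \<and> ereal (c (skeleton n w)) < fst (w (Suc n)) then 1 else 0) \<partial>PP)
    = (\<integral>\<^sup>+z. path_density n z * (g z *
        emeasure (next_event (r (traj (freeze n (events z0 z)))) (jump_time z n) (jump_state z0 z n)) {e. ereal (c z) < fst e})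
        \<partial>Pi\<^sub>M {1..n} (\<lambda>_. step_space))"
proof -
  have g': "(\<lambda>w. g (skeleton n w)) \<in> borel_measurable (Pi\<^sub>M {0..<Suc n} (\<lambda>_. event_space))" by measurable
  have c': "(\<lambda>w. ereal (c (skeleton n w))) \<in> borel_measurable (Pi\<^sub>M {0..<Suc n} (\<lambda>_. event_space))" by measurable
  show ?thesis
    unfolding nn_integral_PP_survive[OF g' c', unfolded skeleton_restrict]
    by (intro nn_integral_cong) (simp add: skeleton_events)
qed

text \<open>The path has exactly \<open>n\<close> jumps before its local time at \<open>z0\<close> reaches \<open>u\<close>; this happens at time
  \<open>completion_time u z0 n\<close>.\<close>
definition completion_time :: "real \<Rightarrow> 'v::finite \<Rightarrow> nat \<Rightarrow> (nat \<Rightarrow> real \<times> 'v) \<Rightarrow> real" where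
  "completion_time u z0 n z = jump_time z n + u - occ z0 n z z0"

definition completes :: "real \<Rightarrow> 'v::finite \<Rightarrow> nat \<Rightarrow> (nat \<Rightarrow> 'v event) \<Rightarrow> bool" where
  "completes u z0 n w \<longleftrightarrow> increasing_upto n w \<and> ereal (completion_time u z0 n (skeleton n w)) < fst (w (Suc n)) \<and>
     jump_state z0 (skeleton n w) n = z0 \<and> occ z0 n (skeleton n w) z0 < u"

abbreviation skeleton_path :: "'v::finite \<Rightarrow> nat \<Rightarrow> (nat \<Rightarrow> real \<times> 'v) \<Rightarrow> real \<Rightarrow> 'v" where
  "skeleton_path z0 n z \<equiv> traj (freeze n (events z0 z))"

lemma completion_time_measurable [measurable]:
  "completion_time u z0 n \<in> borel_measurable (Pi\<^sub>M {1..n} (\<lambda>_. step_space))"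
  unfolding completion_time_def by measurable

lemma ordered_events_mono:
  fixes w :: "nat \<Rightarrow> 'v event"
  assumes "\<forall>k. fst (w k) \<le> fst (w (Suc k))" "k \<le> l"
  shows "fst (w k) \<le> fst (w l)"
  using lift_Suc_mono_le[of "\<lambda>k. fst (w k)" k l] assms by simp

lemma increasing_upto_less:
  fixes w :: "nat \<Rightarrow> 'v event"
  shows "increasing_upto n w \<Longrightarrow> k < l \<Longrightarrow> l \<le> n \<Longrightarrow> fst (w k) < fst (w l)"
proof (induction l)
  case (Suc l)
  then have "fst (w l) < fst (w (Suc l))" by (simp add: increasing_upto_def)
  then show ?case using Suc by (cases "k = l") (auto intro: less_trans)
qed simp

lemma events_skeleton:
  assumes "increasing_upto n w" "w 0 = (0, z0)" "k \<le> n"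
  shows "events z0 (skeleton n w) k = w k"
proof (cases "k = 0")
  case False
  have "fst (w 0) < fst (w k)" using increasing_upto_less[OF assms(1), of 0 k] False assms(3) by simp
  moreover have "fst (w k) < \<infinity>"
    using increasing_upto_less[OF assms(1), of k n] assms by (cases "k = n") (auto simp: increasing_upto_def)
  ultimately have "ereal (real_of_ereal (fst (w k))) = fst (w k)" using assms(2) by (cases "fst (w k)") auto
  then show ?thesis using False assms(3) by (auto simp: events_def skeleton_def prod_eq_iff)
qed (use assms in \<open>simp add: events_def\<close>)

lemma freeze_skeleton:
  assumes "increasing_upto n w" "w 0 = (0, z0)"
  shows "freeze n w = freeze n (events z0 (skeleton n w))"
  using events_skeleton[OF assms] by (auto simp: freeze_def fun_eq_iff)

lemma increasing_times_skeleton: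
  assumes "increasing_upto n w" "w 0 = (0, z0)"
  shows "increasing_times n (skeleton n w)"
proof -
  have "ereal (jump_time (skeleton n w) k) < ereal (jump_time (skeleton n w) (Suc k))" if "k < n" for k
    using events_skeleton[OF assms, of k] events_skeleton[OF assms, of "Suc k"] that assms(1)
    by (auto simp: events_eq increasing_upto_def prod_eq_iff)
  then show ?thesis by (simp add: increasing_times_def)
qed

lemma traj_skeleton:
  assumes inc: "increasing_upto n w" and start: "w 0 = (0, z0)" and mono: "\<forall>k. fst (w k) \<le> fst (w (Suc k))"
    and T: "ereal T < fst (w (Suc n))" and s: "0 \<le> s" "s \<le> T"
  shows "traj w s = skeleton_path z0 n (skeleton n w) s"
proof -
  have "traj w s = traj (freeze n w) s"
  proof (rule traj_eq_freeze)
    fix k assume "n < k"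
    have "ereal s \<le> ereal T" using s by simp
    also note T
    also have "fst (w (Suc n)) \<le> fst (w k)" using ordered_events_mono[OF mono, of "Suc n" k] \<open>n < k\<close> by simp
    finally show "ereal s < fst (w k)" .
  qed (use start s in \<open>auto intro!: exI[of _ 0]\<close>)
  then show ?thesis by (simp add: freeze_skeleton[OF inc start])
qed

lemma local_time_agree:
  assumes "\<And>s. 0 \<le> s \<Longrightarrow> s \<le> t \<Longrightarrow> p s = q s"
  shows "local_time p i t = local_time q i t"
  unfolding local_time_def using assms by (intro set_lebesgue_integral_cong) auto

text \<open>The number of jumps before completion is determined by the path: completion after \<open>n\<close> jumps leaves no
  room for a later jump at which the local time is still below \<open>u\<close>.\<close>
lemma completes_unique:
  assumes start: "w 0 = (0, z0)" and mono: "\<forall>k. fst (w k) \<le> fst (w (Suc k))"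
    and n: "completes u z0 n w" and m: "completes u z0 m w"
  shows "n = m"
proof -
  have False if less: "n < m" and n: "completes u z0 n w" and m: "completes u z0 m w" for n m
  proof -
    let ?T = "completion_time u z0 n (skeleton n w)" and ?t = "jump_time (skeleton m w) m"
    have inc_n: "increasing_upto n w" and inc_m: "increasing_upto m w" and T: "ereal ?T < fst (w (Suc n))"
      and x0: "jump_state z0 (skeleton n w) n = z0" and below: "occ z0 n (skeleton n w) z0 < u"
      and below_m: "occ z0 m (skeleton m w) z0 < u" and Tm: "ereal (completion_time u z0 m (skeleton m w)) < fst (w (Suc m))"
      using n m by (auto simp: completes_def)
    have inc_z: "increasing_times n (skeleton n w)" "increasing_times m (skeleton m w)"
      using increasing_times_skeleton[OF inc_n start] increasing_times_skeleton[OF inc_m start] by auto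
    have T_ge: "jump_time (skeleton n w) n \<le> ?T" using below by (simp add: completion_time_def)
    then have T0: "0 \<le> ?T" using jump_time_nonneg[OF inc_z(1), of n] by simp
    have "local_time (traj w) z0 ?T = local_time (skeleton_path z0 n (skeleton n w)) z0 ?T"
      using traj_skeleton[OF inc_n start mono T] by (intro local_time_agree)
    also have "\<dots> = u"
      using local_time_events[OF inc_z(1) T_ge, of z0 z0] x0 by (simp add: completion_time_def)
    finally have lt_T: "local_time (traj w) z0 ?T = u" .
    have t_m: "w m = (ereal ?t, jump_state z0 (skeleton m w) m)"
      using events_skeleton[OF inc_m start, of m] by (simp add: events_eq)
    have tm_le: "?t \<le> completion_time u z0 m (skeleton m w)" using below_m by (simp add: completion_time_def)
    have "local_time (traj w) z0 ?t = local_time (skeleton_path z0 m (skeleton m w)) z0 ?t"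
      using traj_skeleton[OF inc_m start mono Tm] tm_le by (intro local_time_agree) auto
    then have "local_time (traj w) z0 ?t < u" using below_m by (simp add: occ_def)
    moreover have "?T \<le> ?t"
    proof -
      have "ereal ?T < fst (w (Suc n))" by (rule T)
      also have "\<dots> \<le> fst (w m)" using ordered_events_mono[OF mono, of "Suc n" m] less by simp
      finally show ?thesis by (simp add: t_m)
    qed
    ultimately show False using local_time_mono[OF traj_path_measurable, of ?T ?t w z0] lt_T by simp
  qed
  from this[of n m] this[of m n] n m show ?thesis by (cases n m rule: linorder_cases) auto
qed

lemma path_upto_cong: "(\<And>s. 0 \<le> s \<Longrightarrow> s \<le> T \<Longrightarrow> p s = q s) \<Longrightarrow> 0 \<le> T \<Longrightarrow> path_upto T p = path_upto T q"
  by (auto simp: path_upto_def fun_eq_iff)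

text \<open>At completion the inverse local time and all local times can be read off from the skeleton.\<close>
lemma inv_local_time_completes:
  assumes start: "w 0 = (0, z0)" and mono: "\<forall>k. fst (w k) \<le> fst (w (Suc k))" and n: "completes u z0 n w" and "0 < u"
  shows "inv_local_time z0 u (traj w) = completion_time u z0 n (skeleton n w)"
    and "path_upto (completion_time u z0 n (skeleton n w)) (traj w)
      = path_upto (completion_time u z0 n (skeleton n w)) (skeleton_path z0 n (skeleton n w))"
    and "local_time (traj w) x (completion_time u z0 n (skeleton n w)) = (if x = z0 then u else occ z0 n (skeleton n w) x)"
proof -
  let ?z = "skeleton n w"
  let ?T = "completion_time u z0 n ?z"
  have inc: "increasing_upto n w" and T: "ereal ?T < fst (w (Suc n))"
    and x0: "jump_state z0 ?z n = z0" and below: "occ z0 n ?z z0 < u"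
    using n by (auto simp: completes_def)
  have inc_z: "increasing_times n ?z" by (rule increasing_times_skeleton[OF inc start])
  have T_ge: "jump_time ?z n < ?T" using below by (simp add: completion_time_def)
  then have T0: "0 < ?T" using jump_time_nonneg[OF inc_z, of n] by simp
  have agree: "traj w s = skeleton_path z0 n ?z s" if "0 \<le> s" "s \<le> ?T" for s
    using traj_skeleton[OF inc start mono T that] .
  show path: "path_upto ?T (traj w) = path_upto ?T (skeleton_path z0 n ?z)"
    using agree T0 by (intro path_upto_cong) auto
  have lt: "local_time (traj w) x t = occ z0 n ?z x + (if x = z0 then t - jump_time ?z n else 0)"
    if "jump_time ?z n \<le> t" "t \<le> ?T" for x t
    using local_time_agree[of t "traj w" "skeleton_path z0 n ?z" x] agree that
      local_time_events[OF inc_z that(1), of z0 x] x0 by simp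
  show "local_time (traj w) x ?T = (if x = z0 then u else occ z0 n ?z x)"
    using lt[of ?T x] T_ge by (auto simp: completion_time_def)
  have lt_T: "local_time (traj w) z0 ?T = u"
    using lt[of ?T z0] T_ge by (auto simp: completion_time_def)
  show "inv_local_time z0 u (traj w) = ?T"
    unfolding inv_local_time_def
  proof (rule cInf_eq_non_empty)
    \<comment> \<open>Shortly after the completion time the path still sits at \<open>z0\<close>.\<close>
    obtain d where d: "?T < d" "ereal d < fst (w (Suc n))"
      using ereal_dense2[OF T] by auto
    have after: "u < local_time (traj w) z0 d'" if "?T < d'" "d' \<le> d" for d'
    proof -
      have "traj w s = skeleton_path z0 n ?z s" if "0 \<le> s" "s \<le> d'" for s
        by (rule traj_skeleton[OF inc start mono d(2)]) (use that \<open>d' \<le> d\<close> in auto)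
      then have "local_time (traj w) z0 d' = local_time (skeleton_path z0 n ?z) z0 d'"
        by (intro local_time_agree) auto
      also have "\<dots> = occ z0 n ?z z0 + (d' - jump_time ?z n)"
        using local_time_events[OF inc_z, of d' z0 z0] x0 T_ge that by simp
      finally show ?thesis using that by (simp add: completion_time_def)
    qed
    show "{t. 0 \<le> t \<and> u < local_time (traj w) z0 t} \<noteq> {}"
      using after[of d] d T0 by (auto intro!: exI[of _ d])
    show "?T \<le> t" if "t \<in> {t. 0 \<le> t \<and> u < local_time (traj w) z0 t}" for t
      using that lt_T local_time_mono[OF traj_path_measurable, of t ?T w z0] by (cases "t \<le> ?T") auto
    show "b \<le> ?T" if "\<And>t. t \<in> {t. 0 \<le> t \<and> u < local_time (traj w) z0 t} \<Longrightarrow> b \<le> t" for b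
    proof (rule dense_ge_bounded[OF d(1)])
      fix d' assume "?T < d'" "d' < d"
      then show "b \<le> d'" using after[of d'] T0 that[of d'] by auto
    qed
  qed
qed

lemma path_upto_measurable:
  fixes p :: "'a \<Rightarrow> real \<Rightarrow> 'v::finite"
  assumes T [measurable]: "T \<in> borel_measurable M"
    and p: "\<And>t. 0 \<le> t \<Longrightarrow> (\<lambda>x. p x (min t (T x))) \<in> M \<rightarrow>\<^sub>M count_space UNIV"
  shows "(\<lambda>x. path_upto (T x) (p x)) \<in> M \<rightarrow>\<^sub>M stopped_path_space"
  unfolding path_upto_def
  by (intro measurable_Pair T measurable_restrict p) auto

context positive_field
begin

subsection \<open>The stopping time and the inverse clock\<close>

context
  fixes y :: "real \<Rightarrow> 'v"
  assumes y [measurable]: "y \<in> borel \<rightarrow>\<^sub>M count_space UNIV"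
begin

lemma L_check_continuous: "continuous_on A (\<lambda>s. L_check \<Phi> y s i)"
  unfolding L_check_def by (intro continuous_intros local_time_continuous[OF y])

lemma L_check_antimono: "s \<le> t \<Longrightarrow> L_check \<Phi> y t i \<le> L_check \<Phi> y s i"
  unfolding L_check_def using local_time_mono[OF y, of s t i] by simp

lemma alive_bounded: "0 \<le> s \<Longrightarrow> \<forall>i. 0 < L_check \<Phi> y s i \<Longrightarrow> s \<le> (\<Sum>i\<in>UNIV. \<Phi> i)"
proof -
  assume "0 \<le> s" and alive: "\<forall>i. 0 < L_check \<Phi> y s i"
  have "s = (\<Sum>i\<in>UNIV. local_time y i s)" using sum_local_time[OF y \<open>0 \<le> s\<close>] by simp
  also have "\<dots> \<le> (\<Sum>i\<in>UNIV. \<Phi> i)" using alive by (intro sum_mono) (simp add: L_check_def less_imp_le)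
  finally show ?thesis .
qed

lemma alive_bdd_above: "bdd_above {s. 0 \<le> s \<and> (\<forall>i. 0 < L_check \<Phi> y s i)}"
  using alive_bounded by (intro bdd_aboveI) blast

lemma less_S_end_iff: "0 \<le> s \<Longrightarrow> s < S_end \<Phi> y \<longleftrightarrow> (\<forall>i. 0 < L_check \<Phi> y s i)"
proof
  assume s: "0 \<le> s" "s < S_end \<Phi> y"
  have ne: "{s. 0 \<le> s \<and> (\<forall>i. 0 < L_check \<Phi> y s i)} \<noteq> {}"
  proof -
    have "0 \<in> {s. 0 \<le> s \<and> (\<forall>i. 0 < L_check \<Phi> y s i)}" by (simp add: L_check_def \<Phi>_pos)
    then show ?thesis by blast
  qed
  then obtain t where t: "s < t" "\<forall>i. 0 < L_check \<Phi> y t i"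
    using less_cSupD[OF ne s(2)[unfolded S_end_def]] by auto
  show "\<forall>i. 0 < L_check \<Phi> y s i"
  proof
    fix i
    show "0 < L_check \<Phi> y s i" using L_check_antimono[of s t i] t(1) t(2)[rule_format, of i] by simp
  qed
next
  assume s: "0 \<le> s" and alive: "\<forall>i. 0 < L_check \<Phi> y s i"
  define e where "e = Min (range (L_check \<Phi> y s)) / 2"
  have e: "0 < e" "e < L_check \<Phi> y s i" for i
  proof -
    have "0 < Min (range (L_check \<Phi> y s))" using alive by simp
    moreover have "Min (range (L_check \<Phi> y s)) \<le> L_check \<Phi> y s i" by simp
    ultimately show "0 < e" "e < L_check \<Phi> y s i" unfolding e_def by linarith+
  qed
  have "0 < L_check \<Phi> y (s + e) i" for i
    using local_time_diff_le[OF y, of s "s + e" i] e(1) e(2)[of i] by (simp add: L_check_def)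
  then have "s + e \<le> S_end \<Phi> y"
    unfolding S_end_def using s e(1) by (intro cSup_upper alive_bdd_above) auto
  then show "s < S_end \<Phi> y" using e(1) by simp
qed

lemma S_end_pos: "0 < S_end \<Phi> y"
  using \<Phi>_pos by (subst less_S_end_iff) (auto simp: L_check_def)

lemma L_check_nonneg: "s \<le> S_end \<Phi> y \<Longrightarrow> 0 \<le> L_check \<Phi> y s i"
proof (rule ccontr)
  assume "s \<le> S_end \<Phi> y" "\<not> 0 \<le> L_check \<Phi> y s i"
  define t where "t = s + L_check \<Phi> y s i / 2"
  have "t < s" "t < S_end \<Phi> y" using \<open>\<not> _\<close> \<open>s \<le> _\<close> by (auto simp: t_def)
  have "L_check \<Phi> y t i \<le> L_check \<Phi> y s i + (s - t)"
    using local_time_diff_le[OF y, of t s i] \<open>t < s\<close> by (simp add: L_check_def)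
  then have neg: "L_check \<Phi> y t i < 0" using \<open>\<not> _\<close> by (simp add: t_def)
  show False
  proof (cases "0 \<le> t")
    case True
    then have "0 < L_check \<Phi> y t i" using \<open>t < S_end \<Phi> y\<close> by (simp add: less_S_end_iff)
    then show False using neg by simp
  next
    case False
    then show False using neg \<Phi>_pos[of i] by (simp add: L_check_def)
  qed
qed

lemma D_check_strict_mono:
  assumes "0 \<le> s" "s < t" "t \<le> S_end \<Phi> y"
  shows "D_check \<Phi> y s < D_check \<Phi> y t"
proof -
  have le: "(L_check \<Phi> y t i)\<^sup>2 \<le> (L_check \<Phi> y s i)\<^sup>2" for i
    using L_check_antimono[of s t i] L_check_nonneg[of t i] assms by (intro power_mono) auto
  have "\<exists>i. local_time y i s < local_time y i t"
  proof (rule ccontr)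
    assume "\<not> ?thesis"
    then have "local_time y i t \<le> local_time y i s" for i by (simp add: not_less)
    then have "(\<Sum>i\<in>UNIV. local_time y i t) \<le> (\<Sum>i\<in>UNIV. local_time y i s)" by (intro sum_mono)
    then show False using sum_local_time[OF y, of s] sum_local_time[OF y, of t] assms by simp
  qed
  then obtain i where "L_check \<Phi> y t i < L_check \<Phi> y s i" by (auto simp: L_check_def)
  then have "(L_check \<Phi> y t i)\<^sup>2 < (L_check \<Phi> y s i)\<^sup>2"
    using L_check_nonneg[of t i] assms by (intro power_strict_mono) auto
  then have "(\<Sum>i\<in>UNIV. (L_check \<Phi> y t i)\<^sup>2) < (\<Sum>i\<in>UNIV. (L_check \<Phi> y s i)\<^sup>2)"
    using le by (intro sum_strict_mono_ex1) auto
  then show ?thesis by (simp add: D_check_def sum_subtractf)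
qed

lemma D_check_0: "D_check \<Phi> y 0 = 0"
  by (simp add: D_check_def L_check_def)

lemma D_check_surj:
  assumes "0 \<le> t" "t \<le> T_check \<Phi> y"
  shows "t \<in> D_check \<Phi> y ` {0..S_end \<Phi> y}"
proof -
  have "continuous_on {0..S_end \<Phi> y} (D_check \<Phi> y)"
    unfolding D_check_def by (intro continuous_intros L_check_continuous)
  then obtain s where "0 \<le> s" "s \<le> S_end \<Phi> y" "D_check \<Phi> y s = t"
    using IVT'[of "D_check \<Phi> y" 0 t "S_end \<Phi> y"] assms S_end_pos by (auto simp: D_check_0 T_check_def)
  then show ?thesis by auto
qed

lemma T_check_pos: "0 < T_check \<Phi> y"
  using D_check_strict_mono[of 0 "S_end \<Phi> y"] S_end_pos by (simp add: T_check_def D_check_0)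

lemma inv_D_check:
  assumes "0 \<le> t" "t \<le> T_check \<Phi> y"
  shows "inv_into {0..S_end \<Phi> y} (D_check \<Phi> y) t \<in> {0..S_end \<Phi> y}"
    and "D_check \<Phi> y (inv_into {0..S_end \<Phi> y} (D_check \<Phi> y) t) = t"
  using inv_into_into[OF D_check_surj[OF assms]] f_inv_into_f[OF D_check_surj[OF assms]] by auto

lemma less_inv_D_check_iff:
  assumes "0 \<le> t" "t \<le> T_check \<Phi> y" "0 \<le> c"
  shows "c < inv_into {0..S_end \<Phi> y} (D_check \<Phi> y) t \<longleftrightarrow> c < S_end \<Phi> y \<and> D_check \<Phi> y c < t"
proof -
  let ?s = "inv_into {0..S_end \<Phi> y} (D_check \<Phi> y) t"
  note s = inv_D_check[OF assms(1,2)]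
  show ?thesis
  proof
    assume "c < ?s"
    then show "c < S_end \<Phi> y \<and> D_check \<Phi> y c < t"
      using s D_check_strict_mono[of c ?s] assms(3) by auto
  next
    assume c: "c < S_end \<Phi> y \<and> D_check \<Phi> y c < t"
    show "c < ?s"
    proof (rule ccontr)
      assume "\<not> c < ?s"
      then have "D_check \<Phi> y ?s \<le> D_check \<Phi> y c"
        using s(1) c D_check_strict_mono[of ?s c] by (cases "?s = c") auto
      then show False using c s(2) by simp
    qed
  qed
qed

end

subsection \<open>Identification of the time-changed path\<close>

text \<open>Up to its stopping time the time-changed path is the path with the time-changed skeleton, and the field
  left over at the end vanishes at \<open>x0\<close> only.\<close>
lemma Z_check_skeleton:
  assumes y [measurable]: "y \<in> borel \<rightarrow>\<^sub>M count_space UNIV"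
    and inc: "increasing_times n z" and pos: "\<And>x. 0 < left n z x" and x0: "jump_state x0 z n = x0"
    and agree: "\<And>s. 0 \<le> s \<Longrightarrow> s \<le> jump_time z n + left n z x0 \<Longrightarrow> y s = skeleton_path x0 n z s"
  shows "T_check \<Phi> y = completion_time ((\<Phi> x0)\<^sup>2 / 2) x0 n (time_changed n z)"
    and "path_upto (T_check \<Phi> y) (Z_check \<Phi> y) = path_upto (T_check \<Phi> y) (skeleton_path x0 n (time_changed n z))"
    and "Phi_at \<Phi> (Z_check \<Phi> y) (T_check \<Phi> y) = (left n z)(x0 := 0)"
proof -
  let ?p = "skeleton_path x0 n z" and ?S = "jump_time z n + left n z x0" and ?z' = "time_changed n z"
  have L_agree: "L_check \<Phi> y s = L_check \<Phi> ?p s" if "s \<le> ?S" for s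
    using local_time_agree[of s y ?p] agree that by (auto simp: L_check_def fun_eq_iff)
  have L_late: "L_check \<Phi> y s = (left n z)(x0 := left n z x0 - (s - jump_time z n))" if "jump_time z n \<le> s" "s \<le> ?S" for s
    using L_agree[OF that(2)] L_check_events[OF inc that(1)] x0 by simp
  have tn: "0 \<le> jump_time z n" using jump_time_nonneg[OF inc] by simp
  have S0: "0 \<le> ?S" using tn pos[of x0] by simp
  have S_end: "S_end \<Phi> y = ?S"
  proof (rule antisym)
    have "\<not> (\<forall>i. 0 < L_check \<Phi> y ?S i)"
      using L_late[of ?S] pos[of x0] by (auto intro!: exI[of _ x0])
    then show "S_end \<Phi> y \<le> ?S" using less_S_end_iff[OF y S0] by auto
    show "?S \<le> S_end \<Phi> y"
    proof (rule dense_le_bounded[of "jump_time z n"])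
      show "jump_time z n < ?S" using pos[of x0] by simp
      fix s assume s: "jump_time z n < s" "s < ?S"
      then have "\<forall>i. 0 < L_check \<Phi> y s i" using L_late[of s] pos by auto
      then show "s \<le> S_end \<Phi> y" using less_S_end_iff[OF y, of s] s tn by auto
    qed
  qed
  have D_S: "D_check \<Phi> y ?S = clock n z + (left n z x0)\<^sup>2 / 2"
    unfolding D_check_def clock_def using L_late[of ?S] pos[of x0] sum_squares_upd[of "left n z" x0 0]
    by (simp add: less_imp_le field_simps del: fun_upd_apply)
  show T: "T_check \<Phi> y = completion_time ((\<Phi> x0)\<^sup>2 / 2) x0 n ?z'"
    unfolding T_check_def S_end D_S completion_time_def
    using occ_time_changed[OF inc pos, of x0] by (simp add: jump_time_time_changed field_simps)
  have D_jump: "D_check \<Phi> y (jump_time z k) = clock k z" and jump_in: "jump_time z k \<in> {0..S_end \<Phi> y}" if "k \<le> n" for k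
  proof -
    have inc_k: "increasing_times k z" using inc that by (auto simp: increasing_times_def)
    have le: "jump_time z k \<le> ?S" using jump_time_mono[OF inc that] pos[of x0] by simp
    then show "jump_time z k \<in> {0..S_end \<Phi> y}" using jump_time_nonneg[OF inc that] by (simp add: S_end)
    have "local_time ?p x (jump_time z k) = occ x0 k z x" for x
    proof (cases "k = n")
      case False
      have "traj (freeze n (events x0 z)) s = traj (freeze k (events x0 z)) s" if "0 \<le> s" "s < jump_time z k" for s
      proof -
        have later: "traj (freeze m (events x0 z)) s = traj (freeze k (events x0 z)) s" if "k \<le> m" "m \<le> n" for m
          using that
        proof (induction m rule: dec_induct)
          case (step m)
          have "jump_time z k \<le> jump_time z (Suc m)" using jump_time_mono[OF inc, of k "Suc m"] step by simp
          then show ?case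
            using traj_events_before[OF \<open>0 \<le> s\<close>, of z m x0] \<open>s < jump_time z k\<close> step by simp
        qed simp
        show ?thesis by (rule later[OF \<open>k \<le> n\<close> order_refl])
      qed
      then show ?thesis unfolding occ_def by (intro local_time_cong) auto
    qed (simp add: occ_def)
    then have "L_check \<Phi> y (jump_time z k) = left k z"
      using L_agree[OF le] by (auto simp: L_check_def left_def fun_eq_iff)
    then show "D_check \<Phi> y (jump_time z k) = clock k z" by (simp add: D_check_def clock_def)
  qed
  have Z: "Z_check \<Phi> y t = skeleton_path x0 n ?z' t" if t: "0 \<le> t" "t \<le> T_check \<Phi> y" for t
  proof -
    let ?s = "inv_into {0..S_end \<Phi> y} (D_check \<Phi> y) t"
    note s = inv_D_check[OF y t]
    have le_iff: "clock k z \<le> t \<longleftrightarrow> jump_time z k \<le> ?s" if "k \<le> n" for k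
    proof -
      have "D_check \<Phi> y (jump_time z k) \<le> D_check \<Phi> y ?s \<longleftrightarrow> jump_time z k \<le> ?s"
        using D_check_strict_mono[OF y, of "jump_time z k" ?s] D_check_strict_mono[OF y, of ?s "jump_time z k"]
          jump_in[OF that] s(1)
        by (cases "jump_time z k" ?s rule: linorder_cases) auto
      then show ?thesis by (simp add: D_jump[OF that] s(2))
    qed
    have "{k. fst (freeze n (events x0 ?z') k) \<le> ereal t} = {k. fst (freeze n (events x0 z) k) \<le> ereal ?s}"
      using le_iff by (auto simp: freeze_def events_eq jump_time_time_changed split: if_splits)
    moreover have "snd (freeze n (events x0 ?z') k) = snd (freeze n (events x0 z) k)" for k
      by (auto simp: freeze_def events_eq jump_state_time_changed)
    ultimately have "skeleton_path x0 n ?z' t = ?p ?s" by (simp add: traj_def)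
    also have "\<dots> = y ?s" using agree[of ?s] s(1) by (simp add: S_end)
    finally show ?thesis by (simp add: Z_check_def)
  qed
  show "path_upto (T_check \<Phi> y) (Z_check \<Phi> y) = path_upto (T_check \<Phi> y) (skeleton_path x0 n ?z')"
    using Z T_check_pos[OF y] by (intro path_upto_cong) auto
  show "Phi_at \<Phi> (Z_check \<Phi> y) (T_check \<Phi> y) = (left n z)(x0 := 0)"
  proof
    fix x
    have inc': "increasing_times n ?z'" by (rule increasing_time_changed[OF inc pos])
    have occ': "occ x0 n ?z' x = ((\<Phi> x)\<^sup>2 - (left n z x)\<^sup>2) / 2" for x by (rule occ_time_changed[OF inc pos])
    have T': "T_check \<Phi> y - jump_time ?z' n = (left n z x0)\<^sup>2 / 2"
      unfolding T by (simp add: completion_time_def occ' field_simps)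
    have "local_time (Z_check \<Phi> y) x (T_check \<Phi> y) = local_time (skeleton_path x0 n ?z') x (T_check \<Phi> y)"
      using Z by (intro local_time_agree) auto
    also have "\<dots> = occ x0 n ?z' x + (if x = x0 then (left n z x0)\<^sup>2 / 2 else 0)"
    proof -
      have "jump_time ?z' n \<le> T_check \<Phi> y" using T' zero_le_power2[of "left n z x0"] by linarith
      from local_time_events[OF inc' this, of x0 x] show ?thesis
        by (simp add: jump_state_time_changed x0 T')
    qed
    finally have lt: "(\<Phi> x)\<^sup>2 - 2 * local_time (Z_check \<Phi> y) x (T_check \<Phi> y) = (if x = x0 then 0 else (left n z x)\<^sup>2)"
      by (cases "x = x0") (simp_all add: occ' field_simps)
    show "Phi_at \<Phi> (Z_check \<Phi> y) (T_check \<Phi> y) x = ((left n z)(x0 := 0)) x"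
      unfolding Phi_at_def lt using pos[of x] by (simp add: less_imp_le)
  qed
qed

subsection \<open>The law of the stopped path and the final spins is a measurable function of the events\<close>

abbreviation evs :: "(nat \<Rightarrow> 'v event) measure" where "evs \<equiv> Pi\<^sub>M UNIV (\<lambda>_. event_space)"

lemma L_check_measurable [measurable (raw)]:
  fixes f :: "'a \<Rightarrow> nat \<Rightarrow> 'v event"
  assumes [measurable]: "f \<in> M \<rightarrow>\<^sub>M evs" "g \<in> borel_measurable M"
  shows "(\<lambda>x. L_check \<Phi> (traj (f x)) (g x) i) \<in> borel_measurable M"
  unfolding L_check_def by measurable

lemma S_end_measurable: "(\<lambda>w. S_end \<Phi> (traj w)) \<in> borel_measurable evs"
proof (rule borel_measurableI_greater)
  fix c
  have "{w \<in> space evs. c < S_end \<Phi> (traj w)} = {w \<in> space evs. c < 0 \<or> (\<forall>i. 0 < L_check \<Phi> (traj w) c i)}"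
  proof (cases "0 \<le> c")
    case False
    then have "c < S_end \<Phi> (traj w)" for w
      using S_end_pos[OF traj_path_measurable, of w] by linarith
    then show ?thesis using False by auto
  qed (use less_S_end_iff[OF traj_path_measurable, of c] in auto)
  also have "\<dots> \<in> sets evs" by measurable
  finally show "{w \<in> space evs. c < S_end \<Phi> (traj w)} \<in> sets evs" .
qed

lemma T_check_measurable: "(\<lambda>w. T_check \<Phi> (traj w)) \<in> borel_measurable evs"
  unfolding T_check_def D_check_def using S_end_measurable by measurable

text \<open>As \<open>D_check\<close> is increasing, comparing the inverse clock with a fixed time amounts to comparing the clock at that time.\<close>
lemma stopped_Z_check_measurable:
  "(\<lambda>x. Z_check \<Phi> (traj (fst x)) (min (max 0 (snd x)) (T_check \<Phi> (traj (fst x))))) \<in> evs \<Otimes>\<^sub>M borel \<rightarrow>\<^sub>M count_space UNIV"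
proof -
  let ?t = "\<lambda>x. min (max 0 (snd x)) (T_check \<Phi> (traj (fst x)))"
  let ?inv = "\<lambda>x. inv_into {0..S_end \<Phi> (traj (fst x))} (D_check \<Phi> (traj (fst x))) (?t x)"
  have T: "0 \<le> ?t x" "?t x \<le> T_check \<Phi> (traj (fst x))" for x :: "(nat \<Rightarrow> 'v event) \<times> real"
    using T_check_pos[OF traj_path_measurable, of "fst x"] by auto
  note [measurable] = measurable_compose[OF measurable_fst T_check_measurable] measurable_compose[OF measurable_fst S_end_measurable]
  have "?inv \<in> borel_measurable (evs \<Otimes>\<^sub>M borel)"
  proof (rule borel_measurableI_greater)
    fix c :: real
    show "{x \<in> space (evs \<Otimes>\<^sub>M borel). c < ?inv x} \<in> sets (evs \<Otimes>\<^sub>M borel)"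
    proof (cases "0 \<le> c")
      case True
      have "{x \<in> space (evs \<Otimes>\<^sub>M borel). c < ?inv x}
          = {x \<in> space (evs \<Otimes>\<^sub>M borel). c < S_end \<Phi> (traj (fst x)) \<and> D_check \<Phi> (traj (fst x)) c < ?t x}"
        using less_inv_D_check_iff[OF traj_path_measurable T True] by auto
      also have "\<dots> \<in> sets (evs \<Otimes>\<^sub>M borel)"
        unfolding D_check_def by measurable
      finally show ?thesis .
    next
      case False
      then have "{x \<in> space (evs \<Otimes>\<^sub>M borel). c < ?inv x} = space (evs \<Otimes>\<^sub>M borel)"
        using inv_D_check(1)[OF traj_path_measurable T] by (auto simp: not_le intro: less_le_trans)
      then show ?thesis by simp
    qed
  qed
  then show ?thesis
    unfolding Z_check_def by measurable
qed

lemma Phi_at_T_measurable: "(\<lambda>w. Phi_at \<Phi> (Z_check \<Phi> (traj w)) (T_check \<Phi> (traj w)) i) \<in> borel_measurable evs"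
proof -
  note [measurable] = T_check_measurable
  have "local_time (Z_check \<Phi> (traj w)) i (T_check \<Phi> (traj w))
      = local_time (\<lambda>t. Z_check \<Phi> (traj w) (min (max 0 t) (T_check \<Phi> (traj w)))) i (T_check \<Phi> (traj w))" for w
    by (intro local_time_agree) simp
  moreover have "(\<lambda>w. local_time (\<lambda>t. Z_check \<Phi> (traj w) (min (max 0 t) (T_check \<Phi> (traj w)))) i (T_check \<Phi> (traj w))) \<in> borel_measurable evs"
    using stopped_Z_check_measurable
    by (intro local_time_measurable) (simp_all add: case_prod_beta' T_check_measurable)
  ultimately show ?thesis unfolding Phi_at_def by simp
qed

lemma path_upto_Z_measurable: "(\<lambda>w. path_upto (T_check \<Phi> (traj w)) (Z_check \<Phi> (traj w))) \<in> evs \<rightarrow>\<^sub>M stopped_path_space"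
proof (rule path_upto_measurable[OF T_check_measurable])
  fix t :: real assume "0 \<le> t"
  have "(\<lambda>w. (w, t)) \<in> evs \<rightarrow>\<^sub>M evs \<Otimes>\<^sub>M borel" by measurable
  from measurable_compose[OF this stopped_Z_check_measurable]
  show "(\<lambda>w. Z_check \<Phi> (traj w) (min t (T_check \<Phi> (traj w)))) \<in> evs \<rightarrow>\<^sub>M count_space UNIV"
    using \<open>0 \<le> t\<close> by simp
qed

end

lemma prob_space_ising: "prob_space (ising E J (x0 :: 'v::finite))"
proof
  have Z: "0 < (\<Sum>\<sigma>\<in>spins x0. ising_weight E J \<sigma>)"
    using one_in_spins[of x0] by (intro sum_pos ising_weight_pos) (auto simp del: one_in_spins)
  have "emeasure (ising E J x0) (space (ising E J x0)) = (\<Sum>\<sigma>\<in>spins x0. ennreal (ising_weight E J \<sigma> / (\<Sum>\<sigma>'\<in>spins x0. ising_weight E J \<sigma>')))"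
    unfolding ising_def by (simp add: space_point_measure emeasure_point_measure_finite)
  also have "\<dots> = ennreal (\<Sum>\<sigma>\<in>spins x0. ising_weight E J \<sigma> / (\<Sum>\<sigma>'\<in>spins x0. ising_weight E J \<sigma>'))"
    using Z by (intro sum_ennreal divide_nonneg_nonneg less_imp_le[OF ising_weight_pos]) simp
  also have "\<dots> = 1" using Z by (simp add: sum_divide_distrib[symmetric])
  finally show "emeasure (ising E J x0) (space (ising E J x0)) = 1" .
qed

lemma measurable_ising: "f \<in> spins x0 \<rightarrow> space N \<Longrightarrow> f \<in> ising E J x0 \<rightarrow>\<^sub>M N"
  unfolding ising_def point_measure_def by (subst measurable_cong_sets[OF sets_density refl]) simp

lemma emeasure_distr_ising:
  fixes x0 :: "'v::finite"
  assumes "f \<in> spins x0 \<rightarrow> space N" "B \<in> sets N"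
  shows "emeasure (distr (ising E (interaction W L) x0) N f) B
    = (\<Sum>\<sigma>\<in>spins x0. ennreal (ising_weight E (interaction W L) \<sigma> / ising_partition E W x0 L) * indicator B (f \<sigma>))"
proof -
  have "emeasure (distr (ising E (interaction W L) x0) N f) B = (\<integral>\<^sup>+\<sigma>. indicator B (f \<sigma>) \<partial>ising E (interaction W L) x0)"
    using assms by (subst nn_integral_indicator[symmetric], simp) (subst nn_integral_distr, auto intro!: measurable_ising)
  then show ?thesis
    unfolding ising_def by (simp add: nn_integral_point_measure_finite ising_partition_eq)
qed

abbreviation outcomes :: "((real \<times> (real \<Rightarrow> 'v::finite)) \<times> ('v \<Rightarrow> real)) measure" where
  "outcomes \<equiv> stopped_path_space \<Otimes>\<^sub>M field_space"

context positive_field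
begin

definition final_law :: "(nat \<Rightarrow> 'v event) \<Rightarrow> ((real \<times> (real \<Rightarrow> 'v)) \<times> ('v \<Rightarrow> real)) measure" where
  "final_law w = (let y = traj w; T = T_check \<Phi> y; Z = Z_check \<Phi> y; \<Phi>T = Phi_at \<Phi> Z T
       in distr (ising E (interaction W \<Phi>T) x0) (stopped_path_space \<Otimes>\<^sub>M field_space)
            (\<lambda>\<sigma>. (path_upto T Z, \<lambda>x. \<sigma> x * \<Phi>T x)))"

lemma path_upto_in_space: "path_upto T (p :: real \<Rightarrow> 'v) \<in> space stopped_path_space"
  by (auto simp: path_upto_def space_pair_measure space_PiM)

lemma emeasure_final_law:
  assumes "B \<in> sets outcomes"
  shows "emeasure (final_law w) B = (let T = T_check \<Phi> (traj w); L = Phi_at \<Phi> (Z_check \<Phi> (traj w)) T in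
     (\<Sum>\<sigma>\<in>spins x0. ennreal (weight L \<sigma> / partition_fun L) * indicator B (path_upto T (Z_check \<Phi> (traj w)), \<lambda>x. \<sigma> x * L x)))"
  unfolding final_law_def Let_def
  by (rule emeasure_distr_ising[OF _ assms]) (auto simp: space_pair_measure[of stopped_path_space] path_upto_in_space space_PiM)

lemma final_law_measurable: "final_law \<in> evs \<rightarrow>\<^sub>M subprob_algebra outcomes"
proof (rule measurable_subprob_algebra)
  show "subprob_space (final_law w)" for w
    unfolding final_law_def Let_def
    by (intro prob_space_imp_subprob_space prob_space.prob_space_distr prob_space_ising measurable_ising)
       (auto simp: space_pair_measure[of stopped_path_space] path_upto_in_space space_PiM)
  show "sets (final_law w) = sets outcomes" for w
    unfolding final_law_def Let_def by simp
  fix B :: "((real \<times> (real \<Rightarrow> 'v)) \<times> ('v \<Rightarrow> real)) set" assume B [measurable]: "B \<in> sets outcomes"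
  note [measurable] = path_upto_Z_measurable Phi_at_T_measurable
  have [measurable]: "(\<lambda>w. partition_fun (Phi_at \<Phi> (Z_check \<Phi> (traj w)) (T_check \<Phi> (traj w)))) \<in> borel_measurable evs"
    "(\<lambda>w. weight (Phi_at \<Phi> (Z_check \<Phi> (traj w)) (T_check \<Phi> (traj w))) \<sigma>) \<in> borel_measurable evs" for \<sigma>
    by (rule moment_measurable weight_measurable, measurable)+
  have [measurable]: "(\<lambda>w. (\<lambda>x. \<sigma> x * Phi_at \<Phi> (Z_check \<Phi> (traj w)) (T_check \<Phi> (traj w)) x)) \<in> evs \<rightarrow>\<^sub>M field_space" for \<sigma>
    by (rule measurable_PiM_single') (auto simp: space_PiM)
  show "(\<lambda>w. emeasure (final_law w) B) \<in> borel_measurable evs"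
    unfolding emeasure_final_law[OF B] Let_def by measurable
qed

lemma prob_space_final_law: "prob_space (final_law w)"
  unfolding final_law_def Let_def
  by (intro prob_space.prob_space_distr prob_space_ising measurable_ising)
     (auto simp: space_pair_measure[of stopped_path_space] path_upto_in_space space_PiM)

lemma Z_field_law_eq: "Z_field_law E W x0 \<Phi> x0 = Y.PP \<bind> final_law"
  by (simp add: Z_field_law_def Y_process_def final_law_def[abs_def])

lemma final_law_kernel: "final_law \<in> Y.PP \<rightarrow>\<^sub>M subprob_algebra outcomes"
  using final_law_measurable by (simp add: measurable_cong_sets[OF Y.sets_PP refl])

lemma emeasure_Z_field_law:
  "B \<in> sets outcomes \<Longrightarrow> emeasure (Z_field_law E W x0 \<Phi> x0) B = (\<integral>\<^sup>+w. emeasure (final_law w) B \<partial>Y.PP)"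
  unfolding Z_field_law_eq by (rule emeasure_bind[OF _ final_law_kernel]) simp_all

lemma sets_Z_field_law: "sets (Z_field_law E W x0 \<Phi> x0) = sets outcomes"
  unfolding Z_field_law_eq by (rule sets_bind) (simp_all add: final_law_def Let_def)

lemma prob_space_Z_field_law: "prob_space (Z_field_law E W x0 \<Phi> x0)"
  unfolding Z_field_law_eq
  by (rule prob_space.prob_space_bind[OF Y.prob_space_PP _ final_law_kernel]) (simp add: prob_space_final_law)

end

section \<open>The Gaussian free field\<close>

interpretation lborel_product: product_sigma_finite "\<lambda>_ :: 'v. lborel :: real measure"
  by (simp add: product_sigma_finite_def sigma_finite_lborel)

lemma nn_integral_mirror:
  fixes f :: "real \<Rightarrow> ennreal"
  assumes [measurable]: "f \<in> borel_measurable borel"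
  shows "(\<integral>\<^sup>+y. f y \<partial>lborel) = (\<Sum>s\<in>{-1, 1}. \<integral>\<^sup>+y. f (s * y) * indicator {0<..} y \<partial>lborel)"
proof -
  have "(\<integral>\<^sup>+y. f y \<partial>lborel) = (\<integral>\<^sup>+y. f y * indicator {..<0} y + f y * indicator {0<..} y \<partial>lborel)"
    using AE_lborel_singleton[of "0::real"] by (intro nn_integral_cong_AE) (auto simp: indicator_def)
  also have "\<dots> = (\<integral>\<^sup>+y. f y * indicator {..<0} y \<partial>lborel) + (\<integral>\<^sup>+y. f y * indicator {0<..} y \<partial>lborel)"
    by (rule nn_integral_add) measurable
  also have "(\<integral>\<^sup>+y. f y * indicator {..<0} y \<partial>lborel) = (\<integral>\<^sup>+y. f (- y) * indicator {0<..} y \<partial>lborel)"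
    by (subst nn_integral_real_affine[where c = "-1" and t = 0])
       (auto intro!: nn_integral_cong simp: indicator_def)
  finally show ?thesis by simp
qed

lemma nn_integral_incseq_Union:
  fixes f :: "real \<Rightarrow> ennreal"
  assumes "f \<in> borel_measurable borel" "incseq I" "\<And>n. I n \<in> sets borel"
  shows "(\<integral>\<^sup>+y. f y * indicator (\<Union>n. I n) y \<partial>lborel) = (SUP n. \<integral>\<^sup>+y. f y * indicator (I n) y \<partial>lborel)"
  using SUP_emeasure_incseq[of I "density lborel f"] assms by (simp add: emeasure_density image_subset_iff)

text \<open>The substitution \<open>y = sqrt (a\<^sup>2 - 2 l)\<close> on the half line.\<close>
lemma nn_integral_half_line_substitution:
  fixes f :: "real \<Rightarrow> ennreal"
  assumes [measurable]: "f \<in> borel_measurable borel" and l: "0 \<le> l"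
  shows "(\<integral>\<^sup>+y. f y * indicator {0<..} y \<partial>lborel)
    = (\<integral>\<^sup>+a. ennreal (a / sqrt (a\<^sup>2 - 2 * l)) * indicator {sqrt (2 * l)<..} a * f (sqrt (a\<^sup>2 - 2 * l)) \<partial>lborel)"
proof -
  let ?m = "\<lambda>a. sqrt (a\<^sup>2 - 2 * l)" and ?g = "\<lambda>y. sqrt (y\<^sup>2 + 2 * l)"
  let ?F = "\<lambda>a. ennreal (a / ?m a) * f (?m a)"
  have arch: "1 / real (Suc n) \<le> y" if "0 < y" "1 / y < real n" for y n
    using that by (simp add: field_simps)
  define I where "I n = {1 / real (Suc n)..real (Suc n) + 1}" for n
  have I_pos: "0 < 1 / real (Suc n)" "1 / real (Suc n) < real (Suc n) + 1" for n
  proof -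
    show "0 < 1 / real (Suc n)" by simp
    have "1 / real (Suc n) \<le> 1" by simp
    then show "1 / real (Suc n) < real (Suc n) + 1" by linarith
  qed
  have step: "(\<integral>\<^sup>+a. ?F a * indicator {?g (1 / real (Suc n))..?g (real (Suc n) + 1)} a \<partial>lborel)
      = (\<integral>\<^sup>+y. f y * indicator (I n) y \<partial>lborel)" for n
  proof -
    have "(\<integral>\<^sup>+a. ?F a * indicator {?g (1 / real (Suc n))..?g (real (Suc n) + 1)} a \<partial>lborel)
        = (\<integral>\<^sup>+y. ?F (?g y) * ennreal (y / ?g y) * indicator {1 / real (Suc n)..real (Suc n) + 1} y \<partial>lborel)"
    proof (rule nn_integral_substitution_aux)
      fix y :: real assume y: "y \<in> {1 / real (Suc n)..real (Suc n) + 1}"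
      have "0 < y" using y I_pos(1)[of n] unfolding atLeastAtMost_iff by linarith
      then have pos: "0 < y\<^sup>2 + 2 * l" using l by (simp add: add_pos_nonneg)
      have "((\<lambda>y. y\<^sup>2 + 2 * l) has_real_derivative 2 * y) (at y)"
        by (auto intro!: derivative_eq_intros)
      from DERIV_chain2[OF DERIV_real_sqrt[OF pos] this]
      show "(?g has_real_derivative y / ?g y) (at y)" by (simp add: field_simps)
      show "0 \<le> y / ?g y" using \<open>0 < y\<close> l by simp
    next
      have "y\<^sup>2 + 2 * l \<noteq> 0" if "y \<in> {1 / real (Suc n)..real (Suc n) + 1}" for y
      proof -
        have "0 < y" using that I_pos(1)[of n] unfolding atLeastAtMost_iff by linarith
        then have "0 < y\<^sup>2" by simp
        then show ?thesis using l by linarith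
      qed
      then show "continuous_on {1 / real (Suc n)..real (Suc n) + 1} (\<lambda>y. y / ?g y)"
        by (intro continuous_intros) auto
    qed (use I_pos in auto)
    also have "\<dots> = (\<integral>\<^sup>+y. f y * indicator (I n) y \<partial>lborel)"
    proof (rule nn_integral_cong)
      fix y :: real
      show "?F (?g y) * ennreal (y / ?g y) * indicator {1 / real (Suc n)..real (Suc n) + 1} y = f y * indicator (I n) y"
      proof (cases "y \<in> I n")
        case True
        then have y: "0 < y" using I_pos(1)[of n] unfolding I_def atLeastAtMost_iff by linarith
        then have g: "0 < ?g y" using l by (simp add: add_pos_nonneg)
        have m: "?m (?g y) = y" using y l by simp
        have "ennreal (?g y / y) * ennreal (y / ?g y) = ennreal (?g y / y * (y / ?g y))"
          using y g by (intro ennreal_mult[symmetric]) (simp_all add: less_imp_le)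
        also have "?g y / y * (y / ?g y) = 1" using y g by simp
        finally have "ennreal (?g y / y) * ennreal (y / ?g y) = 1" by simp
        then have "ennreal (?g y / y) * f y * ennreal (y / ?g y) = f y" by (metis mult.commute mult.left_commute mult_1)
        then show ?thesis using True unfolding m I_def by simp
      next
        case False
        then have "indicator {1 / real (Suc n)..real (Suc n) + 1} y = (0 :: ennreal)" "indicator (I n) y = (0 :: ennreal)"
          by (simp_all add: I_def)
        then show ?thesis by (simp only: mult_zero_right)
      qed
    qed
    finally show ?thesis .
  qed
  have "incseq I"
    unfolding I_def by (intro incseq_SucI) (auto simp: field_simps)
  have "(\<integral>\<^sup>+y. f y * indicator {0<..} y \<partial>lborel) = (\<integral>\<^sup>+y. f y * indicator (\<Union>n. I n) y \<partial>lborel)"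
  proof -
    have "(\<Union>n. I n) = {0<..}"
    proof (intro equalityI subsetI)
      fix y :: real assume "y \<in> {0<..}"
      obtain n where n: "1 / y < real n" "y < real n"
        using reals_Archimedean2[of "max (1 / y) y"] by auto
      have "1 / real (Suc n) \<le> y" using n \<open>y \<in> _\<close> by (simp add: field_simps)
      then show "y \<in> (\<Union>n. I n)" using n by (auto simp: I_def intro!: exI[of _ n])
    next
      fix y assume "y \<in> (\<Union>n. I n)"
      then obtain n where "1 / real (Suc n) \<le> y" by (auto simp: I_def)
      then show "y \<in> {0<..}" using I_pos(1)[of n] unfolding greaterThan_iff by linarith
    qed
    then show ?thesis by simp
  qed
  also have "\<dots> = (SUP n. \<integral>\<^sup>+y. f y * indicator (I n) y \<partial>lborel)"
    by (rule nn_integral_incseq_Union[OF assms(1) \<open>incseq I\<close>]) (simp add: I_def)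
  also have "\<dots> = (SUP n. \<integral>\<^sup>+a. ?F a * indicator {?g (1 / real (Suc n))..?g (real (Suc n) + 1)} a \<partial>lborel)"
    unfolding step ..
  also have "\<dots> = (\<integral>\<^sup>+a. ?F a * indicator (\<Union>n. {?g (1 / real (Suc n))..?g (real (Suc n) + 1)}) a \<partial>lborel)"
  proof (rule nn_integral_incseq_Union[symmetric])
    show "incseq (\<lambda>n. {?g (1 / real (Suc n))..?g (real (Suc n) + 1)})"
    proof (rule incseq_SucI)
      fix n
      have "1 / real (Suc (Suc n)) \<le> 1 / real (Suc n)" by (intro divide_left_mono) auto
      then have "?g (1 / real (Suc (Suc n))) \<le> ?g (1 / real (Suc n))"
        using I_pos(1)[of "Suc n"] by (intro real_sqrt_le_mono add_mono power_mono) auto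
      moreover have "?g (real (Suc n) + 1) \<le> ?g (real (Suc (Suc n)) + 1)"
        by (intro real_sqrt_le_mono add_mono power_mono) auto
      ultimately show "{?g (1 / real (Suc n))..?g (real (Suc n) + 1)} \<subseteq> {?g (1 / real (Suc (Suc n)))..?g (real (Suc (Suc n)) + 1)}"
        unfolding atLeastatMost_subset_iff by blast
    qed
    show "?F \<in> borel_measurable borel" by measurable
  qed simp
  also have "(\<Union>n. {?g (1 / real (Suc n))..?g (real (Suc n) + 1)}) = {sqrt (2 * l)<..}"
  proof (intro equalityI subsetI)
    fix a assume "a \<in> (\<Union>n. {?g (1 / real (Suc n))..?g (real (Suc n) + 1)})"
    then obtain n where "?g (1 / real (Suc n)) \<le> a" by auto
    moreover have "sqrt (2 * l) < ?g (1 / real (Suc n))" using I_pos(1)[of n] by simp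
    ultimately show "a \<in> {sqrt (2 * l)<..}" unfolding greaterThan_iff by linarith
  next
    fix a assume a: "a \<in> {sqrt (2 * l)<..}"
    have a0: "0 \<le> sqrt (2 * l)" using l by simp
    then have "2 * l < a\<^sup>2" using a l by (metis greaterThan_iff power_strict_mono pos2 real_sqrt_pow2 zero_le_mult_iff zero_le_numeral)
    then have m: "0 < ?m a" by simp
    have "0 \<le> a" using a0 a unfolding greaterThan_iff by linarith
    then have ga: "?g (?m a) = a" using \<open>2 * l < a\<^sup>2\<close> by simp
    obtain n where n: "1 / ?m a < real n" "?m a < real n"
      using reals_Archimedean2[of "max (1 / ?m a) (?m a)"] by auto
    have "1 / real (Suc n) \<le> ?m a" by (rule arch[OF m n(1)])
    then have "?g (1 / real (Suc n)) \<le> ?g (?m a)" using I_pos(1)[of n]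
      by (intro real_sqrt_le_mono add_mono power_mono) auto
    moreover have "?g (?m a) \<le> ?g (real (Suc n) + 1)" using n m
      by (intro real_sqrt_le_mono add_mono power_mono) auto
    ultimately show "a \<in> (\<Union>n. {?g (1 / real (Suc n))..?g (real (Suc n) + 1)})"
      unfolding ga by (intro UN_I[of n]) auto
  qed
  also have "(\<integral>\<^sup>+a. ?F a * indicator {sqrt (2 * l)<..} a \<partial>lborel)
      = (\<integral>\<^sup>+a. ennreal (a / ?m a) * indicator {sqrt (2 * l)<..} a * f (?m a) \<partial>lborel)"
    by (intro nn_integral_cong) (simp add: ac_simps)
  finally show ?thesis .
qed

text \<open>The density of the substitution \<open>y = sqrt (a\<^sup>2 - 2 * l)\<close>, including its range.\<close>
abbreviation square_jacobian :: "real \<Rightarrow> real \<Rightarrow> ennreal" where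
  "square_jacobian l a \<equiv> ennreal (a / sqrt (a\<^sup>2 - 2 * l)) * indicator {sqrt (2 * l)<..} a"

lemma nn_integral_signed_substitution:
  fixes f :: "real \<Rightarrow> ennreal"
  assumes [measurable]: "f \<in> borel_measurable borel" and l: "0 \<le> l"
  shows "(\<integral>\<^sup>+y. f y \<partial>lborel) = (\<Sum>s\<in>{-1, 1}. \<integral>\<^sup>+a. square_jacobian l a * f (s * sqrt (a\<^sup>2 - 2 * l)) \<partial>lborel)"
proof -
  have "(\<integral>\<^sup>+y. f (s * y) * indicator {0<..} y \<partial>lborel) = (\<integral>\<^sup>+a. square_jacobian l a * f (s * sqrt (a\<^sup>2 - 2 * l)) \<partial>lborel)" for s
    by (rule nn_integral_half_line_substitution[OF _ l]) measurable
  then show ?thesis unfolding nn_integral_mirror[OF assms(1)] by simp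
qed

lemma nn_integral_signed_substitution_PiM:
  fixes l :: "'v \<Rightarrow> real"
  assumes "finite A" and "h \<in> borel_measurable (Pi\<^sub>M A (\<lambda>_. lborel))" and l: "\<And>x. 0 \<le> l x"
  shows "(\<integral>\<^sup>+f. h f \<partial>Pi\<^sub>M A (\<lambda>_. lborel)) = (\<Sum>\<sigma>\<in>A \<rightarrow>\<^sub>E {-1, 1}. \<integral>\<^sup>+a. (\<Prod>x\<in>A. square_jacobian (l x) (a x))
      * h (\<lambda>x\<in>A. \<sigma> x * sqrt ((a x)\<^sup>2 - 2 * l x)) \<partial>Pi\<^sub>M A (\<lambda>_. lborel))"
  using assms(1,2)
proof (induction A arbitrary: h rule: finite_induct)
  case empty
  have "(\<lambda>x\<in>{}. c x) = (\<lambda>_. undefined)" for c :: "'v \<Rightarrow> real" by (simp add: restrict_def)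
  then show ?case by (simp add: PiM_empty nn_integral_count_space_finite)
next
  case (insert y A)
  note [measurable] = insert.prems
  let ?P = "\<lambda>A. Pi\<^sub>M A (\<lambda>_ :: 'v. lborel :: real measure)"
  let ?m = "\<lambda>x a. sqrt (a\<^sup>2 - 2 * l x)"
  let ?S = "\<lambda>A. A \<rightarrow>\<^sub>E {-1, 1 :: real}"
  have upd [measurable]: "(\<lambda>x. (fst x)(y := snd x)) \<in> ?P A \<Otimes>\<^sub>M lborel \<rightarrow>\<^sub>M ?P (insert y A)"
    by (intro measurable_fun_upd[where J = A]) auto
  have hupd [measurable]: "(\<lambda>x. h ((fst x)(y := snd x))) \<in> borel_measurable (?P A \<Otimes>\<^sub>M lborel)"
    by (rule measurable_compose[OF upd insert.prems])
  have hupd1 [measurable]: "(\<lambda>a. h (f(y := a))) \<in> borel_measurable borel" if "f \<in> space (?P A)" for f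
    using measurable_compose[OF measurable_Pair1'[OF that] hupd] by simp
  define H where "H s f = (\<integral>\<^sup>+a. square_jacobian (l y) a * h (f(y := s * ?m y a)) \<partial>lborel)" for s f
  have H [measurable]: "H s \<in> borel_measurable (?P A)" for s
  proof -
    have "(\<lambda>x. (fst x, s * ?m y (snd x))) \<in> ?P A \<Otimes>\<^sub>M lborel \<rightarrow>\<^sub>M ?P A \<Otimes>\<^sub>M lborel" by measurable
    from measurable_compose[OF this hupd]
    have [measurable]: "(\<lambda>x. h ((fst x)(y := s * ?m y (snd x)))) \<in> borel_measurable (?P A \<Otimes>\<^sub>M lborel)" by simp
    have "(\<lambda>x. square_jacobian (l y) (snd x) * h ((fst x)(y := s * ?m y (snd x)))) \<in> borel_measurable (?P A \<Otimes>\<^sub>M lborel)"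
      by measurable
    then show ?thesis
      unfolding H_def by (intro lborel.borel_measurable_nn_integral) (simp add: case_prod_beta')
  qed
  have "(\<integral>\<^sup>+f. h f \<partial>?P (insert y A)) = (\<integral>\<^sup>+f. (\<integral>\<^sup>+a. h (f(y := a)) \<partial>lborel) \<partial>?P A)"
    by (rule lborel_product.product_nn_integral_insert[OF insert.hyps insert.prems])
  also have "\<dots> = (\<integral>\<^sup>+f. (\<Sum>s\<in>{-1, 1}. H s f) \<partial>?P A)"
    unfolding H_def by (intro nn_integral_cong nn_integral_signed_substitution l hupd1)
  also have "\<dots> = (\<Sum>s\<in>{-1, 1}. \<integral>\<^sup>+f. H s f \<partial>?P A)"
    by (rule nn_integral_sum) (rule H)
  also have "\<dots> = (\<Sum>s\<in>{-1, 1}. \<Sum>\<sigma>\<in>?S A. \<integral>\<^sup>+a. (\<Prod>x\<in>A. square_jacobian (l x) (a x)) * H s (\<lambda>x\<in>A. \<sigma> x * ?m x (a x)) \<partial>?P A)"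
    by (intro sum.cong refl insert.IH H)
  also have "\<dots> = (\<Sum>p\<in>{-1, 1} \<times> ?S A. \<integral>\<^sup>+a. (\<Prod>x\<in>A. square_jacobian (l x) (a x)) * H (fst p) (\<lambda>x\<in>A. snd p x * ?m x (a x)) \<partial>?P A)"
    by (simp add: sum.cartesian_product case_prod_beta')
  also have "\<dots> = (\<Sum>p\<in>{-1, 1} \<times> ?S A. \<integral>\<^sup>+a. (\<Prod>x\<in>insert y A. square_jacobian (l x) (a x))
      * h (\<lambda>x\<in>insert y A. ((snd p)(y := fst p)) x * ?m x (a x)) \<partial>?P (insert y A))"
  proof (rule sum.cong[OF refl])
    fix p :: "real \<times> ('v \<Rightarrow> real)"
    have jac: "square_jacobian (l x) \<in> borel_measurable borel" for x
      by measurable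
    have [measurable]: "(\<lambda>a. \<lambda>x\<in>insert y A. ((snd p)(y := fst p)) x * ?m x (a x)) \<in> ?P (insert y A) \<rightarrow>\<^sub>M ?P (insert y A)"
    proof (rule measurable_restrict)
      fix x assume "x \<in> insert y A"
      then have "(\<lambda>a. a x) \<in> ?P (insert y A) \<rightarrow>\<^sub>M lborel" by (rule measurable_component_singleton)
      then have [measurable]: "(\<lambda>a. a x) \<in> borel_measurable (?P (insert y A))" by simp
      show "(\<lambda>a. ((snd p)(y := fst p)) x * ?m x (a x)) \<in> ?P (insert y A) \<rightarrow>\<^sub>M lborel" by measurable
    qed
    have prod_meas: "(\<lambda>a. \<Prod>x\<in>A'. square_jacobian (l x) (a x)) \<in> borel_measurable (?P A')" if "finite A'" for A'
    proof (rule borel_measurable_prod_ennreal)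
      fix x assume "x \<in> A'"
      then have "(\<lambda>a. a x) \<in> ?P A' \<rightarrow>\<^sub>M lborel" by (rule measurable_component_singleton)
      then have "(\<lambda>a. a x) \<in> borel_measurable (?P A')" by simp
      from measurable_compose[OF this jac[of x]]
      show "(\<lambda>a. square_jacobian (l x) (a x)) \<in> borel_measurable (?P A')" .
    qed
    note [measurable] = prod_meas[of "insert y A"]
    have "(\<integral>\<^sup>+a. (\<Prod>x\<in>insert y A. square_jacobian (l x) (a x))
        * h (\<lambda>x\<in>insert y A. ((snd p)(y := fst p)) x * ?m x (a x)) \<partial>?P (insert y A))
      = (\<integral>\<^sup>+a. (\<integral>\<^sup>+b. (\<Prod>x\<in>insert y A. square_jacobian (l x) ((a(y := b)) x))
        * h (\<lambda>x\<in>insert y A. ((snd p)(y := fst p)) x * ?m x ((a(y := b)) x)) \<partial>lborel) \<partial>?P A)"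
      using insert.hyps by (intro lborel_product.product_nn_integral_insert) auto
    also have "\<dots> = (\<integral>\<^sup>+a. (\<Prod>x\<in>A. square_jacobian (l x) (a x)) * H (fst p) (\<lambda>x\<in>A. snd p x * ?m x (a x)) \<partial>?P A)"
    proof (rule nn_integral_cong)
      fix a assume a: "a \<in> space (?P A)"
      have prod: "(\<Prod>x\<in>insert y A. square_jacobian (l x) ((a(y := b)) x)) = (\<Prod>x\<in>A. square_jacobian (l x) (a x)) * square_jacobian (l y) b" for b
      proof -
        have "(\<Prod>x\<in>A. square_jacobian (l x) ((a(y := b)) x)) = (\<Prod>x\<in>A. square_jacobian (l x) (a x))"
          using insert.hyps by (intro prod.cong refl) auto
        then show ?thesis using insert.hyps by (simp add: mult.commute)
      qed
      have fn: "(\<lambda>x\<in>insert y A. ((snd p)(y := fst p)) x * ?m x ((a(y := b)) x)) = (\<lambda>x\<in>A. snd p x * ?m x (a x))(y := fst p * ?m y b)" for b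
        using insert.hyps by (auto simp: fun_eq_iff)
      have sp: "(\<lambda>x\<in>A. snd p x * ?m x (a x)) \<in> space (?P A)" by (simp add: space_PiM)
      have [measurable]: "(\<lambda>b. h ((\<lambda>x\<in>A. snd p x * ?m x (a x))(y := fst p * ?m y b))) \<in> borel_measurable borel"
        by (rule measurable_compose[OF _ hupd1[OF sp]]) measurable
      show "(\<integral>\<^sup>+b. (\<Prod>x\<in>insert y A. square_jacobian (l x) ((a(y := b)) x))
        * h (\<lambda>x\<in>insert y A. ((snd p)(y := fst p)) x * ?m x ((a(y := b)) x)) \<partial>lborel)
        = (\<Prod>x\<in>A. square_jacobian (l x) (a x)) * H (fst p) (\<lambda>x\<in>A. snd p x * ?m x (a x))"
        unfolding prod fn H_def mult.assoc by (rule nn_integral_cmult) measurable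
    qed
    finally show "(\<integral>\<^sup>+a. (\<Prod>x\<in>A. square_jacobian (l x) (a x)) * H (fst p) (\<lambda>x\<in>A. snd p x * ?m x (a x)) \<partial>?P A)
      = (\<integral>\<^sup>+a. (\<Prod>x\<in>insert y A. square_jacobian (l x) (a x))
        * h (\<lambda>x\<in>insert y A. ((snd p)(y := fst p)) x * ?m x (a x)) \<partial>?P (insert y A))" by simp
  qed
  also have "\<dots> = (\<Sum>\<sigma>\<in>?S (insert y A). \<integral>\<^sup>+a. (\<Prod>x\<in>insert y A. square_jacobian (l x) (a x))
      * h (\<lambda>x\<in>insert y A. \<sigma> x * ?m x (a x)) \<partial>?P (insert y A))"
    unfolding PiE_insert_eq
    using inj_combinator[OF insert.hyps(2), of "\<lambda>_. {-1, 1 :: real}"]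
    by (subst sum.reindex) (simp_all add: case_prod_beta')
  finally show ?case .
qed

lemma nn_integral_translation_PiM:
  assumes "finite A" and "h \<in> borel_measurable (Pi\<^sub>M A (\<lambda>_. lborel))"
  shows "(\<integral>\<^sup>+f. h (\<lambda>x\<in>A. f x + c) \<partial>Pi\<^sub>M A (\<lambda>_. lborel)) = (\<integral>\<^sup>+f. h f \<partial>Pi\<^sub>M A (\<lambda>_. lborel :: real measure))"
  using assms
proof (induction A arbitrary: h rule: finite_induct)
  case empty
  have "(\<lambda>x\<in>{}. d x) = (\<lambda>_. undefined)" for d :: "'a \<Rightarrow> real" by (simp add: restrict_def)
  then show ?case by (simp add: PiM_empty nn_integral_count_space_finite)
next
  case (insert y A)
  let ?P = "\<lambda>A. Pi\<^sub>M A (\<lambda>_ :: 'a. lborel :: real measure)"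
  note [measurable] = insert.prems
  have upd [measurable]: "(\<lambda>x. (fst x)(y := snd x)) \<in> ?P A \<Otimes>\<^sub>M lborel \<rightarrow>\<^sub>M ?P (insert y A)"
    by (intro measurable_fun_upd[where J = A]) auto
  have hupd: "(\<lambda>x. h ((fst x)(y := snd x))) \<in> borel_measurable (?P A \<Otimes>\<^sub>M lborel)"
    by (rule measurable_compose[OF upd insert.prems])
  have hupd1: "(\<lambda>a. h (f(y := a))) \<in> borel_measurable borel" if "f \<in> space (?P A)" for f
    using measurable_compose[OF measurable_Pair1'[OF that] hupd] by simp
  define H where "H f = (\<integral>\<^sup>+a. h (f(y := a)) \<partial>lborel)" for f
  have H: "H \<in> borel_measurable (?P A)"
    unfolding H_def using hupd by (intro lborel.borel_measurable_nn_integral) (simp add: case_prod_beta')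
  have shift: "(\<lambda>f. \<lambda>x\<in>insert y A. f x + c) \<in> ?P (insert y A) \<rightarrow>\<^sub>M ?P (insert y A)"
  proof (rule measurable_restrict)
    fix x assume "x \<in> insert y A"
    then have "(\<lambda>a. a x) \<in> ?P (insert y A) \<rightarrow>\<^sub>M lborel" by (rule measurable_component_singleton)
    then have [measurable]: "(\<lambda>a. a x) \<in> borel_measurable (?P (insert y A))" by simp
    show "(\<lambda>a. a x + c) \<in> ?P (insert y A) \<rightarrow>\<^sub>M lborel" by measurable
  qed
  have "(\<integral>\<^sup>+f. h (\<lambda>x\<in>insert y A. f x + c) \<partial>?P (insert y A))
      = (\<integral>\<^sup>+f. (\<integral>\<^sup>+a. h (\<lambda>x\<in>insert y A. (f(y := a)) x + c) \<partial>lborel) \<partial>?P A)"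
    by (rule lborel_product.product_nn_integral_insert[OF insert.hyps measurable_compose[OF shift insert.prems]])
  also have "\<dots> = (\<integral>\<^sup>+f. H (\<lambda>x\<in>A. f x + c) \<partial>?P A)"
  proof (rule nn_integral_cong)
    fix f :: "'a \<Rightarrow> real"
    let ?f = "\<lambda>x\<in>A. f x + c"
    have "(\<lambda>x\<in>insert y A. (f(y := a)) x + c) = ?f(y := c + 1 * a)" for a
      using insert.hyps by (auto simp: fun_eq_iff)
    then have "(\<integral>\<^sup>+a. h (\<lambda>x\<in>insert y A. (f(y := a)) x + c) \<partial>lborel) = (\<integral>\<^sup>+a. h (?f(y := c + 1 * a)) \<partial>lborel)"
      by simp
    also have "\<dots> = H ?f"
      unfolding H_def using nn_integral_real_affine[OF hupd1, of ?f 1 c] by (simp add: space_PiM)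
    finally show "(\<integral>\<^sup>+a. h (\<lambda>x\<in>insert y A. (f(y := a)) x + c) \<partial>lborel) = H ?f" .
  qed
  also have "\<dots> = (\<integral>\<^sup>+f. H f \<partial>?P A)" by (rule insert.IH[OF H])
  also have "\<dots> = (\<integral>\<^sup>+f. h f \<partial>?P (insert y A))"
    unfolding H_def by (rule lborel_product.product_nn_integral_insert[OF insert.hyps insert.prems, symmetric])
  finally show ?case .
qed

context conductance_network
begin

lemma sum_ordered_edges:
  "(\<Sum>x\<in>UNIV. \<Sum>y\<in>UNIV. if {x, y} \<in> E then f {x, y} else 0) = 2 * (\<Sum>e\<in>E. f e :: real)"
proof -
  have "(\<Sum>y\<in>UNIV. if {x, y} \<in> E then f {x, y} else 0) = (\<Sum>e\<in>E. if x \<in> e then f e else 0)" for x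
  proof -
    have "(\<Sum>e\<in>{e\<in>E. x \<notin> e}. f e) = (\<Sum>e\<in>E. if x \<notin> e then f e else 0)"
      by (simp add: sum.If_cases Int_def)
    moreover have "(\<Sum>e\<in>E. f e) = (\<Sum>e\<in>E. if x \<in> e then f e else 0) + (\<Sum>e\<in>E. if x \<notin> e then f e else 0)"
      unfolding sum.distrib[symmetric] by (intro sum.cong) auto
    ultimately show ?thesis using sum_edges_split[of f x] by simp
  qed
  then have "(\<Sum>x\<in>UNIV. \<Sum>y\<in>UNIV. if {x, y} \<in> E then f {x, y} else 0) = (\<Sum>e\<in>E. \<Sum>x\<in>UNIV. if x \<in> e then f e else 0)"
    by (simp add: sum.swap[of _ E])
  also have "\<dots> = (\<Sum>e\<in>E. 2 * f e)"
    by (intro sum.cong refl) (simp add: sum.If_cases card_edge)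
  finally show ?thesis by (simp add: sum_distrib_left)
qed

text \<open>Expanding the squares in the energy, the cross terms form the exponent of an Ising weight.\<close>
lemma exp_energy:
  "exp (- (1/2) * energy E W f)
    = exp (- (1/2) * (\<Sum>x\<in>UNIV. vertex_rate x * (f x)\<^sup>2)) * exp (\<Sum>e\<in>E. W e * (\<Prod>i\<in>e. f i))"
proof -
  have cross: "(\<Sum>x\<in>UNIV. \<Sum>y\<in>UNIV. cond x y * (f x * f y)) = 2 * (\<Sum>e\<in>E. W e * (\<Prod>i\<in>e. f i))"
    unfolding sum_ordered_edges[symmetric]
    by (intro sum.cong refl) (auto simp: conductance_def dest: edge_neq)
  have "energy E W f = (1/2) * (\<Sum>x\<in>UNIV. \<Sum>y\<in>UNIV. cond x y * (f x)\<^sup>2 + cond x y * (f y)\<^sup>2 - 2 * (cond x y * (f x * f y)))"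
    unfolding energy_def by (intro arg_cong2[where f = "(*)"] refl sum.cong) (simp add: power2_eq_square algebra_simps)
  also have "\<dots> = (1/2) * ((\<Sum>x\<in>UNIV. \<Sum>y\<in>UNIV. cond x y * (f x)\<^sup>2) + (\<Sum>x\<in>UNIV. \<Sum>y\<in>UNIV. cond x y * (f y)\<^sup>2)
      - 2 * (\<Sum>x\<in>UNIV. \<Sum>y\<in>UNIV. cond x y * (f x * f y)))"
    by (simp add: sum.distrib sum_subtractf sum_distrib_left)
  also have "(\<Sum>x\<in>UNIV. \<Sum>y\<in>UNIV. cond x y * (f y)\<^sup>2) = (\<Sum>x\<in>UNIV. \<Sum>y\<in>UNIV. cond x y * (f x)\<^sup>2)"
    by (subst sum.swap) (simp add: cond_commute)
  also have "(\<Sum>x\<in>UNIV. \<Sum>y\<in>UNIV. cond x y * (f x)\<^sup>2) = (\<Sum>x\<in>UNIV. vertex_rate x * (f x)\<^sup>2)"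
    by (simp add: vertex_rate_def sum_distrib_right)
  finally have "energy E W f = (\<Sum>x\<in>UNIV. vertex_rate x * (f x)\<^sup>2) - 2 * (\<Sum>e\<in>E. W e * (\<Prod>i\<in>e. f i))"
    unfolding cross by simp
  then show ?thesis by (simp add: exp_add[symmetric] algebra_simps)
qed

lemma energy_nonneg: "0 \<le> energy E W f"
  unfolding energy_def by (intro mult_nonneg_nonneg sum_nonneg cond_nonneg) auto

lemma energy_edge:
  assumes "{x, y} \<in> E"
  shows "W {x, y} * (f x - f y)\<^sup>2 \<le> 2 * energy E W f"
proof -
  have "cond x y * (f x - f y)\<^sup>2 \<le> (\<Sum>y\<in>UNIV. cond x y * (f x - f y)\<^sup>2)"
    by (rule member_le_sum) (auto intro!: mult_nonneg_nonneg cond_nonneg)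
  also have "\<dots> \<le> (\<Sum>x\<in>UNIV. \<Sum>y\<in>UNIV. cond x y * (f x - f y)\<^sup>2)"
    by (rule member_le_sum) (auto intro!: sum_nonneg mult_nonneg_nonneg cond_nonneg)
  finally show ?thesis using assms by (simp add: energy_def conductance_def)
qed

text \<open>A Poincare inequality, obtained by walking from \<open>x0\<close> along edges.\<close>
lemma energy_dominates:
  "\<exists>c>0. \<forall>f. f x0 = 0 \<longrightarrow> (\<Sum>x\<in>UNIV. (f x)\<^sup>2) \<le> c * energy E W f"
proof -
  have "\<exists>c>0. \<forall>f. f x0 = 0 \<longrightarrow> (f x)\<^sup>2 \<le> c * energy E W f" for x
    using connected_graph[of x0 x]
  proof (induction rule: rtranclp_induct)
    case base
    show ?case by (intro exI[of _ 1]) (simp add: energy_nonneg)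
  next
    case (step x y)
    then obtain c where c: "0 < c" "\<And>f. f x0 = 0 \<Longrightarrow> (f x)\<^sup>2 \<le> c * energy E W f" by blast
    have w: "0 < W {x, y}" using step edge_pos by blast
    have "(f y)\<^sup>2 \<le> (2 * c + 4 / W {x, y}) * energy E W f" if "f x0 = 0" for f
    proof -
      have "(f y)\<^sup>2 \<le> 2 * (f x)\<^sup>2 + 2 * (f x - f y)\<^sup>2"
        using sum_squares_ge_zero[of "2 * f x - f y" 0] by (simp add: power2_eq_square algebra_simps)
      also have "(f x - f y)\<^sup>2 \<le> 2 * energy E W f / W {x, y}"
        using energy_edge[OF step(2), of f] w by (simp add: field_simps)
      finally show ?thesis using c(2)[of f, OF that] by (simp add: algebra_simps)
    qed
    then show ?case using c(1) w by (intro exI[of _ "2 * c + 4 / W {x, y}"]) (simp add: add_pos_pos)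
  qed
  then obtain c where c: "\<And>x. 0 < c x" "\<And>x f. f x0 = 0 \<Longrightarrow> (f x)\<^sup>2 \<le> c x * energy E W f" by metis
  have "(\<Sum>x\<in>UNIV. (f x)\<^sup>2) \<le> (\<Sum>x\<in>UNIV. c x) * energy E W f" if "f x0 = 0" for f
    unfolding sum_distrib_right by (intro sum_mono c(2) that)
  then show ?thesis using c(1) by (intro exI[of _ "\<Sum>x\<in>UNIV. c x"]) (simp add: sum_pos)
qed

abbreviation U :: "'v set" where "U \<equiv> UNIV - {x0}"
abbreviation flat :: "('v \<Rightarrow> real) measure" where "flat \<equiv> Pi\<^sub>M U (\<lambda>_. lborel)"

lemma component_flat: "x \<noteq> x0 \<Longrightarrow> (\<lambda>f. f x) \<in> borel_measurable flat"
  using measurable_component_singleton[of x U "\<lambda>_. lborel :: real measure"] by simp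

lemma extend_component_flat [measurable]: "(\<lambda>f. (f(x0 := c)) x) \<in> borel_measurable flat"
  by (cases "x = x0") (simp_all add: component_flat)

lemma extend_flat [measurable]: "(\<lambda>f. f(x0 := c)) \<in> flat \<rightarrow>\<^sub>M field_space"
  by (rule measurable_PiM_single') (auto simp: extend_component_flat[unfolded fun_upd_apply])

lemma energy_measurable [measurable]: "(\<lambda>f. energy E W (f(x0 := c))) \<in> borel_measurable flat"
  unfolding energy_def by measurable

lemma gff_weight_measurable [measurable]: "gff_weight E W x0 \<in> borel_measurable flat"
  unfolding gff_weight_def by measurable

lemma gaussian_finite:
  assumes "0 < a" shows "(\<integral>\<^sup>+x. ennreal (exp (- (a * x\<^sup>2))) \<partial>lborel) < \<infinity>"
proof -
  define s where "s = sqrt (1 / (2 * a))"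
  have s: "0 < s" "s\<^sup>2 = 1 / (2 * a)" using assms by (simp_all add: s_def)
  have "exp (- (a * x\<^sup>2)) = sqrt (2 * pi * s\<^sup>2) * normal_density 0 s x" for x
    using s assms by (simp add: normal_density_def)
  then have "integrable lborel (\<lambda>x. exp (- (a * x\<^sup>2)))"
    using integrable_normal_density[OF s(1), of 0] by simp
  then show ?thesis by (simp add: integrable_iff_bounded)
qed

text \<open>By \<open>energy_dominates\<close> the weight is below a product of one-dimensional Gaussian weights.\<close>
lemma gff_weight_finite: "(\<integral>\<^sup>+f. ennreal (gff_weight E W x0 f) \<partial>flat) < \<infinity>"
proof -
  obtain c where c: "0 < c" "\<And>f. f x0 = 0 \<Longrightarrow> (\<Sum>x\<in>UNIV. (f x)\<^sup>2) \<le> c * energy E W f"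
    using energy_dominates by blast
  have "(\<integral>\<^sup>+f. ennreal (gff_weight E W x0 f) \<partial>flat) \<le> (\<integral>\<^sup>+f. (\<Prod>x\<in>U. ennreal (exp (- (1 / (2 * c) * (f x)\<^sup>2)))) \<partial>flat)"
  proof (rule nn_integral_mono)
    fix f :: "'v \<Rightarrow> real"
    have "(\<Sum>x\<in>UNIV. ((f(x0 := 0)) x)\<^sup>2) = (\<Sum>x\<in>U. (f x)\<^sup>2)"
      by (subst sum.remove[of _ x0]) (auto intro!: sum.cong)
    then have "(\<Sum>x\<in>U. (f x)\<^sup>2) \<le> c * energy E W (f(x0 := 0))" using c(2)[of "f(x0 := 0)"] by simp
    then have "- (1/2) * energy E W (f(x0 := 0)) \<le> - (1 / (2 * c)) * (\<Sum>x\<in>U. (f x)\<^sup>2)"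
      using c(1) by (simp add: field_simps)
    then have "gff_weight E W x0 f \<le> exp (\<Sum>x\<in>U. - (1 / (2 * c) * (f x)\<^sup>2))"
      unfolding gff_weight_def by (simp add: sum_negf sum_distrib_left)
    also have "\<dots> = (\<Prod>x\<in>U. exp (- (1 / (2 * c) * (f x)\<^sup>2)))" by (simp add: exp_sum)
    finally show "ennreal (gff_weight E W x0 f) \<le> (\<Prod>x\<in>U. ennreal (exp (- (1 / (2 * c) * (f x)\<^sup>2))))"
      by (subst prod_ennreal) (auto intro!: ennreal_leI)
  qed
  also have "\<dots> = (\<Prod>x\<in>U. \<integral>\<^sup>+y. ennreal (exp (- (1 / (2 * c) * y\<^sup>2))) \<partial>lborel)"
    by (rule lborel_product.product_nn_integral_prod) auto
  also have "\<dots> < \<infinity>"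
    using gaussian_finite[of "1 / (2 * c)"] c(1) by (simp add: less_top[symmetric] ennreal_prod_eq_top del: prod_constant)
  finally show ?thesis .
qed

lemma space_flat_not_null: "emeasure flat (space flat) \<noteq> 0"
proof
  assume 0: "emeasure flat (space flat) = 0"
  have "emeasure flat (Pi\<^sub>E U (\<lambda>_. {0..1})) = (\<Prod>x\<in>U. emeasure lborel {0..1 :: real})"
    by (rule lborel_product.emeasure_PiM) auto
  also have "\<dots> = 1" by simp
  finally have "1 \<le> emeasure flat (space flat)"
    using emeasure_space[of flat "Pi\<^sub>E U (\<lambda>_. {0..1})"] by simp
  then show False using 0 by simp
qed

definition gff_norm :: real where "gff_norm = integral\<^sup>L flat (gff_weight E W x0)"

lemma gff_weight_pos: "0 < gff_weight E W x0 f"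
  by (simp add: gff_weight_def)

lemma gff_norm_eq: "(\<integral>\<^sup>+f. ennreal (gff_weight E W x0 f) \<partial>flat) = ennreal gff_norm"
  and gff_norm_pos: "0 < gff_norm"
proof -
  have "integrable flat (gff_weight E W x0)"
    using gff_weight_finite gff_weight_pos by (intro integrableI_nonneg) (auto simp: less_imp_le)
  then show eq: "(\<integral>\<^sup>+f. ennreal (gff_weight E W x0 f) \<partial>flat) = ennreal gff_norm"
    unfolding gff_norm_def by (intro nn_integral_eq_integral) (auto simp: less_imp_le gff_weight_pos)
  have "(\<integral>\<^sup>+f. ennreal (gff_weight E W x0 f) \<partial>flat) \<noteq> 0"
  proof
    assume "(\<integral>\<^sup>+f. ennreal (gff_weight E W x0 f) \<partial>flat) = 0"
    then have "AE f in flat. ennreal (gff_weight E W x0 f) = 0"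
      by (subst (asm) nn_integral_0_iff_AE) auto
    then have "AE f in flat. False"
      by eventually_elim (metis ennreal_eq_0_iff gff_weight_pos not_le)
    then show False using space_flat_not_null by (simp add: AE_iff_null null_sets_def)
  qed
  then show "0 < gff_norm" unfolding eq by (simp add: ennreal_eq_0_iff not_le)
qed

abbreviation free_field :: "('v \<Rightarrow> real) measure" where "free_field \<equiv> gff E W x0"

lemma gff_eq: "free_field = distr (density flat (\<lambda>f. ennreal (gff_weight E W x0 f / gff_norm))) field_space (\<lambda>f. f(x0 := 0))"
  unfolding gff_def Let_def gff_norm_def ..

lemma sets_gff [simp, measurable_cong]: "sets free_field = sets field_space"
  and space_gff [simp]: "space free_field = UNIV"
  by (simp_all add: gff_eq space_PiM)

lemma nn_integral_gff:
  assumes [measurable]: "h \<in> borel_measurable field_space"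
  shows "(\<integral>\<^sup>+\<phi>. h \<phi> \<partial>free_field) = (\<integral>\<^sup>+f. ennreal (gff_weight E W x0 f / gff_norm) * h (f(x0 := 0)) \<partial>flat)"
  unfolding gff_eq by (simp add: nn_integral_distr nn_integral_density)

lemma prob_space_gff: "prob_space free_field"
proof
  have "emeasure free_field (space free_field) = (\<integral>\<^sup>+\<phi>. 1 \<partial>free_field)" by simp
  also have "\<dots> = (\<integral>\<^sup>+f. ennreal (1 / gff_norm) * ennreal (gff_weight E W x0 f) \<partial>flat)"
    using gff_norm_pos gff_weight_pos
    by (subst nn_integral_gff) (auto intro!: nn_integral_cong simp: ennreal_mult[symmetric] less_imp_le)
  also have "\<dots> = ennreal (1 / gff_norm) * ennreal gff_norm"
    by (subst nn_integral_cmult) (auto simp: gff_norm_eq)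
  also have "\<dots> = 1"
    using gff_norm_pos by (simp add: ennreal_mult[symmetric] less_imp_le)
  finally show "emeasure free_field (space free_field) = 1" .
qed

text \<open>Spin configurations are the sign vectors off \<open>x0\<close>.\<close>
lemma sum_spins:
  "(\<Sum>\<sigma>\<in>U \<rightarrow>\<^sub>E {-1, 1}. h \<sigma>) = (\<Sum>\<sigma>\<in>spins x0. h (restrict \<sigma> U))"
proof (rule sum.reindex_bij_betw[symmetric], rule bij_betwI[where g = "\<lambda>\<sigma>. \<sigma>(x0 := 1)"])
  show "(\<lambda>\<sigma>. restrict \<sigma> U) \<in> spins x0 \<rightarrow> U \<rightarrow>\<^sub>E {-1, 1}"
    by (auto simp: spins_def PiE_def)
  show "(\<lambda>\<sigma>. \<sigma>(x0 := 1)) \<in> (U \<rightarrow>\<^sub>E {-1, 1}) \<rightarrow> spins x0"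
    by (auto simp: spins_def PiE_def Pi_def)
  show "(restrict \<sigma> U)(x0 := 1) = \<sigma>" if "\<sigma> \<in> spins x0" for \<sigma>
    using that by (auto simp: spins_def fun_eq_iff)
  show "restrict (\<sigma>(x0 := 1)) U = \<sigma>" if "\<sigma> \<in> U \<rightarrow>\<^sub>E {-1, 1}" for \<sigma>
    using that by (auto simp: PiE_def extensional_def fun_eq_iff)
qed

lemma nn_integral_flat_signed:
  assumes "h \<in> borel_measurable flat" and l: "\<And>x. 0 \<le> l x"
  shows "(\<integral>\<^sup>+f. h f \<partial>flat) = (\<Sum>\<sigma>\<in>spins x0. \<integral>\<^sup>+a. (\<Prod>x\<in>U. square_jacobian (l x) (a x))
      * h (\<lambda>x\<in>U. \<sigma> x * sqrt ((a x)\<^sup>2 - 2 * l x)) \<partial>flat)"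
proof -
  have eq: "(\<lambda>x\<in>U. restrict \<sigma> U x * c x) = (\<lambda>x\<in>U. \<sigma> x * c x)" for \<sigma> c :: "'v \<Rightarrow> real"
    by (auto simp: fun_eq_iff)
  have "(\<integral>\<^sup>+f. h f \<partial>flat) = (\<Sum>\<sigma>\<in>U \<rightarrow>\<^sub>E {-1, 1}. \<integral>\<^sup>+a. (\<Prod>x\<in>U. square_jacobian (l x) (a x))
      * h (\<lambda>x\<in>U. \<sigma> x * sqrt ((a x)\<^sup>2 - 2 * l x)) \<partial>flat)"
    by (rule nn_integral_signed_substitution_PiM[OF finite assms(1) l])
  also have "\<dots> = (\<Sum>\<sigma>\<in>spins x0. \<integral>\<^sup>+a. (\<Prod>x\<in>U. square_jacobian (l x) (a x))
      * h (\<lambda>x\<in>U. restrict \<sigma> U x * sqrt ((a x)\<^sup>2 - 2 * l x)) \<partial>flat)"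
    by (rule sum_spins)
  finally show ?thesis unfolding eq .
qed

text \<open>The density at \<open>\<Phi>\<close> of the law of \<open>sqrt (\<phi>\<^sup>2 + 2 * \<ell>)\<close>. It is also what remains of the density of a Gaussian
  free field with boundary value \<open>\<Phi> x0\<close> after summation over the signs.\<close>
definition field_density :: "('v \<Rightarrow> real) \<Rightarrow> real" where
  "field_density \<Phi> = exp (- (1/2) * (\<Sum>x\<in>UNIV. vertex_rate x * (\<Phi> x)\<^sup>2)) * partition_fun \<Phi> / gff_norm"

lemma exp_energy_signed:
  assumes "\<sigma> \<in> spins x0"
  shows "exp (- (1/2) * energy E W (\<lambda>x. \<sigma> x * L x)) = exp (- (1/2) * (\<Sum>x\<in>UNIV. vertex_rate x * (L x)\<^sup>2)) * weight L \<sigma>"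
proof -
  have sq: "(\<sigma> x)\<^sup>2 = 1" for x
  proof -
    have "\<sigma> x = -1 \<or> \<sigma> x = 1" using assms by (simp add: spins_def)
    then show ?thesis by auto
  qed
  show ?thesis
    unfolding exp_energy ising_weight_def interaction_def
    by (simp add: power_mult_distrib sq prod.distrib mult.assoc mult.commute[of "\<Prod>i\<in>_. \<sigma> i"])
qed

text \<open>The density of the field is normalised: up to the signs it is the density of the free field with
  boundary value \<open>c\<close> instead of \<open>0\<close>, and the energy does not see constants.\<close>
lemma field_density_normalised:
  "(\<integral>\<^sup>+a. ennreal (field_density (a(x0 := c))) * (if \<forall>x\<in>U. 0 < a x then 1 else 0) \<partial>flat) = 1"
proof -
  define h where "h f = ennreal (exp (- (1/2) * energy E W (f(x0 := c))) / gff_norm)" for f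
  have h [measurable]: "h \<in> borel_measurable flat" unfolding h_def by measurable
  have [measurable]: "(\<lambda>a. \<forall>x\<in>U. 0 < a x) \<in> measurable flat (count_space UNIV)"
  proof (rule pred_intros_finite)
    fix x assume "x \<in> U"
    then have "(\<lambda>a. a x) \<in> borel_measurable flat" by (intro component_flat) auto
    then show "Measurable.pred flat (\<lambda>a. 0 < a x)" by measurable
  qed simp
  have jac: "(\<Prod>x\<in>U. square_jacobian 0 (a x)) = (if \<forall>x\<in>U. 0 < a x then 1 else 0)" for a :: "'v \<Rightarrow> real"
  proof (cases "\<forall>x\<in>U. 0 < a x")
    case True
    have "square_jacobian 0 (a x) = 1" if "x \<in> U" for x
    proof -
      have "0 < a x" using True that by blast
      then show ?thesis by (simp add: less_imp_le)
    qed
    then have "(\<Prod>x\<in>U. square_jacobian 0 (a x)) = (\<Prod>x\<in>U. 1)" by (intro prod.cong) auto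
    then show ?thesis unfolding if_P[OF True] by simp
  next
    case False
    then obtain x where x: "x \<in> U" "\<not> 0 < a x" by blast
    then have "square_jacobian 0 (a x) = 0" by simp
    with x(1) have "(\<Prod>x\<in>U. square_jacobian 0 (a x)) = 0" by (intro prod_zero bexI[of _ x]) simp_all
    then show ?thesis unfolding if_not_P[OF False] .
  qed
  have "(\<integral>\<^sup>+f. h f \<partial>flat) = (\<Sum>\<sigma>\<in>spins x0. \<integral>\<^sup>+a. (\<Prod>x\<in>U. square_jacobian 0 (a x)) * h (\<lambda>x\<in>U. \<sigma> x * sqrt ((a x)\<^sup>2 - 2 * 0)) \<partial>flat)"
    using nn_integral_flat_signed[OF h, of "\<lambda>_. 0"] by simp
  also have "\<dots> = (\<Sum>\<sigma>\<in>spins x0. \<integral>\<^sup>+a. ennreal (exp (- (1/2) * (\<Sum>x\<in>UNIV. vertex_rate x * ((a(x0 := c)) x)\<^sup>2)) * weight (a(x0 := c)) \<sigma> / gff_norm)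
      * (if \<forall>x\<in>U. 0 < a x then 1 else 0) \<partial>flat)"
  proof (intro sum.cong refl nn_integral_cong)
    fix \<sigma> a assume \<sigma>: "\<sigma> \<in> spins x0"
    show "(\<Prod>x\<in>U. square_jacobian 0 (a x)) * h (\<lambda>x\<in>U. \<sigma> x * sqrt ((a x)\<^sup>2 - 2 * 0))
      = ennreal (exp (- (1/2) * (\<Sum>x\<in>UNIV. vertex_rate x * ((a(x0 := c)) x)\<^sup>2)) * weight (a(x0 := c)) \<sigma> / gff_norm)
        * (if \<forall>x\<in>U. 0 < a x then 1 else 0)"
    proof (cases "\<forall>x\<in>U. 0 < a x")
      case True
      have "(\<lambda>x\<in>U. \<sigma> x * sqrt ((a x)\<^sup>2 - 2 * 0))(x0 := c) = (\<lambda>x. \<sigma> x * (a(x0 := c)) x)"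
        using True \<sigma> by (auto simp: fun_eq_iff spins_def less_imp_le)
      then have "h (\<lambda>x\<in>U. \<sigma> x * sqrt ((a x)\<^sup>2 - 2 * 0))
          = ennreal (exp (- (1/2) * (\<Sum>x\<in>UNIV. vertex_rate x * ((a(x0 := c)) x)\<^sup>2)) * weight (a(x0 := c)) \<sigma> / gff_norm)"
        unfolding h_def by (simp only: exp_energy_signed[OF \<sigma>])
      then show ?thesis unfolding jac if_P[OF True] by (simp only: mult_1 mult_1_right)
    next
      case False
      show ?thesis unfolding jac if_not_P[OF False] by simp
    qed
  qed
  also have "\<dots> = (\<integral>\<^sup>+a. (\<Sum>\<sigma>\<in>spins x0. ennreal (exp (- (1/2) * (\<Sum>x\<in>UNIV. vertex_rate x * ((a(x0 := c)) x)\<^sup>2)) * weight (a(x0 := c)) \<sigma> / gff_norm)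
      * (if \<forall>x\<in>U. 0 < a x then 1 else 0)) \<partial>flat)"
    by (rule nn_integral_sum[symmetric]) measurable
  also have "\<dots> = (\<integral>\<^sup>+a. ennreal (field_density (a(x0 := c))) * (if \<forall>x\<in>U. 0 < a x then 1 else 0) \<partial>flat)"
  proof (rule nn_integral_cong)
    fix a
    have "(\<Sum>\<sigma>\<in>spins x0. ennreal (exp (- (1/2) * (\<Sum>x\<in>UNIV. vertex_rate x * ((a(x0 := c)) x)\<^sup>2)) * weight (a(x0 := c)) \<sigma> / gff_norm))
        = ennreal (\<Sum>\<sigma>\<in>spins x0. exp (- (1/2) * (\<Sum>x\<in>UNIV. vertex_rate x * ((a(x0 := c)) x)\<^sup>2)) * weight (a(x0 := c)) \<sigma> / gff_norm)"
      using gff_norm_pos by (intro sum_ennreal) (auto simp: less_imp_le ising_weight_pos)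
    also have "(\<Sum>\<sigma>\<in>spins x0. exp (- (1/2) * (\<Sum>x\<in>UNIV. vertex_rate x * ((a(x0 := c)) x)\<^sup>2)) * weight (a(x0 := c)) \<sigma> / gff_norm)
        = field_density (a(x0 := c))"
      unfolding field_density_def ising_partition_eq by (simp only: sum_distrib_left sum_divide_distrib)
    finally show "(\<Sum>\<sigma>\<in>spins x0. ennreal (exp (- (1/2) * (\<Sum>x\<in>UNIV. vertex_rate x * ((a(x0 := c)) x)\<^sup>2)) * weight (a(x0 := c)) \<sigma> / gff_norm)
        * (if \<forall>x\<in>U. 0 < a x then 1 else 0)) = ennreal (field_density (a(x0 := c))) * (if \<forall>x\<in>U. 0 < a x then 1 else 0)"
      by (simp only: sum_distrib_right[symmetric])
  qed
  finally have "(\<integral>\<^sup>+a. ennreal (field_density (a(x0 := c))) * (if \<forall>x\<in>U. 0 < a x then 1 else 0) \<partial>flat) = (\<integral>\<^sup>+f. h f \<partial>flat)" by simp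
  also have "\<dots> = (\<integral>\<^sup>+f. h (\<lambda>x\<in>U. f x + c) \<partial>flat)"
    by (rule nn_integral_translation_PiM[symmetric, OF finite h])
  also have "\<dots> = (\<integral>\<^sup>+f. ennreal (1 / gff_norm) * ennreal (gff_weight E W x0 f) \<partial>flat)"
  proof (rule nn_integral_cong)
    fix f :: "'v \<Rightarrow> real"
    have "energy E W ((\<lambda>x\<in>U. f x + c)(x0 := c)) = energy E W (f(x0 := 0))"
      unfolding energy_def by (intro arg_cong2[where f = "(*)"] refl sum.cong) auto
    then show "h (\<lambda>x\<in>U. f x + c) = ennreal (1 / gff_norm) * ennreal (gff_weight E W x0 f)"
      using gff_norm_pos by (simp add: h_def gff_weight_def ennreal_mult[symmetric])
  qed
  also have "\<dots> = ennreal (1 / gff_norm) * ennreal gff_norm"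
    by (subst nn_integral_cmult) (auto simp: gff_norm_eq)
  also have "\<dots> = 1"
    using gff_norm_pos by (simp add: ennreal_mult[symmetric] less_imp_le)
  finally show ?thesis .
qed

end

section \<open>The path law given the field\<close>

context conductance_network
begin

definition final_field :: "('v \<Rightarrow> real) \<Rightarrow> nat \<Rightarrow> (nat \<Rightarrow> real \<times> 'v) \<Rightarrow> 'v \<Rightarrow> real" where
  "final_field \<Phi> n z x = (if x = x0 then 0 else sqrt ((\<Phi> x)\<^sup>2 - 2 * occ x0 n z x))"

definition stopped_skeleton :: "real \<Rightarrow> nat \<Rightarrow> (nat \<Rightarrow> real \<times> 'v) \<Rightarrow> real \<times> (real \<Rightarrow> 'v)" where
  "stopped_skeleton u n z = path_upto (completion_time u x0 n z) (skeleton_path x0 n z)"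

definition path_weight :: "nat \<Rightarrow> (nat \<Rightarrow> real \<times> 'v) \<Rightarrow> real" where
  "path_weight n z = (\<Prod>k<n. cond (jump_state x0 z k) (jump_state x0 z (Suc k)))"

text \<open>For \<open>n\<close> jumps with skeleton \<open>z\<close>, the density of the path given \<open>\<Phi>\<close>, times the weights of the signs for which
  path and field belong to \<open>B\<close>.\<close>
definition outcome_weight ::
    "real \<Rightarrow> ('v \<Rightarrow> real) \<Rightarrow> ((real \<times> (real \<Rightarrow> 'v)) \<times> ('v \<Rightarrow> real)) set \<Rightarrow> nat \<Rightarrow> (nat \<Rightarrow> real \<times> 'v) \<Rightarrow> ennreal" where
  "outcome_weight u \<Phi> B n z =
     ennreal (path_weight n z * (\<Prod>x\<in>U. \<Phi> x / final_field \<Phi> n z x) / partition_fun \<Phi>)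
     * (\<Sum>\<sigma>\<in>spins x0. ennreal (weight (final_field \<Phi> n z) \<sigma>)
         * indicator B (stopped_skeleton u n z, \<lambda>x. \<sigma> x * final_field \<Phi> n z x))"

definition admissible :: "('v \<Rightarrow> real) \<Rightarrow> nat \<Rightarrow> (nat \<Rightarrow> real \<times> 'v) \<Rightarrow> bool" where
  "admissible \<Phi> n z \<longleftrightarrow> increasing_times n z \<and> jump_state x0 z n = x0 \<and> (\<forall>x. 2 * occ x0 n z x < (\<Phi> x)\<^sup>2)"

text \<open>The conditional law of path and field given \<open>\<Phi>\<close>, as an explicit sum over the number of jumps.\<close>
definition path_law :: "real \<Rightarrow> ('v \<Rightarrow> real) \<Rightarrow> ((real \<times> (real \<Rightarrow> 'v)) \<times> ('v \<Rightarrow> real)) set \<Rightarrow> ennreal" where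
  "path_law u \<Phi> B = (\<Sum>n. \<integral>\<^sup>+z. (if admissible \<Phi> n z then outcome_weight u \<Phi> B n z else 0) \<partial>Pi\<^sub>M {1..n} (\<lambda>_. step_space))"

lemma path_weight_nonneg: "0 \<le> path_weight n z"
  unfolding path_weight_def by (intro prod_nonneg cond_nonneg)

lemma stopped_skeleton_in_space: "stopped_skeleton u n z \<in> space stopped_path_space"
  by (auto simp: stopped_skeleton_def path_upto_def space_pair_measure space_PiM)

context
  fixes F :: "'a \<Rightarrow> 'v \<Rightarrow> real" and G :: "'a \<Rightarrow> nat \<Rightarrow> real \<times> 'v" and M n
  assumes F: "F \<in> M \<rightarrow>\<^sub>M field_space" and G: "G \<in> M \<rightarrow>\<^sub>M Pi\<^sub>M {1..n} (\<lambda>_. step_space)"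
begin

lemma G_component: "1 \<le> k \<Longrightarrow> k \<le> n \<Longrightarrow> (\<lambda>x. G x k) \<in> M \<rightarrow>\<^sub>M step_space"
  using measurable_compose[OF G measurable_component_singleton[of k]] by simp

lemma F_component [measurable]: "(\<lambda>x. F x i) \<in> borel_measurable M"
  using measurable_compose[OF F measurable_component_singleton[of i]] by simp

lemma occ_G [measurable]: "(\<lambda>x. occ x0 n (G x) i) \<in> borel_measurable M"
  by (rule skeleton_occ[OF G_component order_refl])

lemma final_field_measurable [measurable]: "(\<lambda>x. final_field (F x) n (G x) i) \<in> borel_measurable M"
  unfolding final_field_def by measurable

lemma path_weight_measurable [measurable]: "(\<lambda>x. path_weight n (G x)) \<in> borel_measurable M"
  unfolding path_weight_def
proof (rule borel_measurable_prod)
  fix k assume "k \<in> {..<n}"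
  then have "(\<lambda>x. jump_state x0 (G x) k) \<in> M \<rightarrow>\<^sub>M count_space UNIV" "(\<lambda>x. jump_state x0 (G x) (Suc k)) \<in> M \<rightarrow>\<^sub>M count_space UNIV"
    by (auto intro!: skeleton_jump_state[OF G_component])
  note states [measurable] = this
  have [measurable]: "(\<lambda>x. cond (jump_state x0 (G x) k) j) \<in> borel_measurable M" for j
    by (rule measurable_compose[OF states(1)]) simp
  show "(\<lambda>x. cond (jump_state x0 (G x) k) (jump_state x0 (G x) (Suc k))) \<in> borel_measurable M"
    by (rule measurable_compose_countable[where f = "\<lambda>j x. cond (jump_state x0 (G x) k) j" and g = "\<lambda>x. jump_state x0 (G x) (Suc k)"]) measurable
qed

lemma stopped_skeleton_measurable [measurable]: "(\<lambda>x. stopped_skeleton u n (G x)) \<in> M \<rightarrow>\<^sub>M stopped_path_space"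
proof -
  note [measurable] = skeleton_jump_time[OF G_component order_refl] skeleton_freeze[OF G_component order_refl, where ?z0.0 = x0]
  have [measurable]: "(\<lambda>x. completion_time u x0 n (G x)) \<in> borel_measurable M"
    unfolding completion_time_def by measurable
  show ?thesis
    unfolding stopped_skeleton_def path_upto_def
    by (intro measurable_Pair measurable_restrict) (auto intro!: traj_measurable)
qed

lemma admissible_measurable [measurable]: "Measurable.pred M (\<lambda>x. admissible (F x) n (G x))"
proof -
  note [measurable] = skeleton_jump_state[OF G_component order_refl, where ?z0.0 = x0] skeleton_increasing[OF G_component]
  show ?thesis unfolding admissible_def by measurable
qed

lemma outcome_weight_measurable [measurable]:
  assumes B [measurable]: "B \<in> sets outcomes"
  shows "(\<lambda>x. outcome_weight u (F x) B n (G x)) \<in> borel_measurable M"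
proof -
  have [measurable]: "(\<lambda>x. partition_fun (F x)) \<in> borel_measurable M" "(\<lambda>x. weight (final_field (F x) n (G x)) \<sigma>) \<in> borel_measurable M" for \<sigma>
    by (rule moment_measurable weight_measurable, measurable)+
  have [measurable]: "(\<lambda>x. (\<lambda>y. \<sigma> y * final_field (F x) n (G x) y)) \<in> M \<rightarrow>\<^sub>M field_space" for \<sigma>
    by (rule measurable_PiM_single') (auto simp: space_PiM)
  show ?thesis unfolding outcome_weight_def by measurable
qed

end

lemma path_law_measurable [measurable]:
  assumes [measurable]: "B \<in> sets outcomes"
  shows "(\<lambda>\<Phi>. path_law u \<Phi> B) \<in> borel_measurable field_space"
proof -
  have "(\<lambda>\<Phi>. \<integral>\<^sup>+z. (if admissible \<Phi> n z then outcome_weight u \<Phi> B n z else 0) \<partial>Pi\<^sub>M {1..n} (\<lambda>_. step_space)) \<in> borel_measurable field_space" for n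
  proof (rule sigma_finite_measure.borel_measurable_nn_integral)
    show "sigma_finite_measure (Pi\<^sub>M {1..n} (\<lambda>_. step_space :: (real \<times> 'v) measure))"
      by (rule steps.sigma_finite) simp
    have [measurable]: "fst \<in> field_space \<Otimes>\<^sub>M Pi\<^sub>M {1..n} (\<lambda>_. step_space :: (real \<times> 'v) measure) \<rightarrow>\<^sub>M (field_space :: ('v \<Rightarrow> real) measure)"
      "snd \<in> (field_space :: ('v \<Rightarrow> real) measure) \<Otimes>\<^sub>M Pi\<^sub>M {1..n} (\<lambda>_. step_space) \<rightarrow>\<^sub>M Pi\<^sub>M {1..n} (\<lambda>_. step_space :: (real \<times> 'v) measure)"
      by simp_all
    note admissible_measurable[OF this] outcome_weight_measurable[OF this assms]
    then have "(\<lambda>x. if admissible (fst x) n (snd x) then outcome_weight u (fst x) B n (snd x) else 0)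
        \<in> borel_measurable (field_space \<Otimes>\<^sub>M Pi\<^sub>M {1..n} (\<lambda>_. step_space))"
      by (intro measurable_If_set measurable_If) (simp_all add: pred_def)
    then show "(\<lambda>(\<Phi>, z). if admissible \<Phi> n z then outcome_weight u \<Phi> B n z else 0)
        \<in> borel_measurable (field_space \<Otimes>\<^sub>M Pi\<^sub>M {1..n} (\<lambda>_. step_space))"
      by (simp add: case_prod_beta')
  qed
  then show ?thesis unfolding path_law_def by measurable
qed

end

lemma suminf_single:
  fixes f :: "nat \<Rightarrow> ennreal"
  assumes "\<And>n. n \<noteq> m \<Longrightarrow> f n = 0"
  shows "suminf f = f m"
  using suminf_finite[of "{m}" f] assms by simp

lemma ennreal_mult3: "0 \<le> a \<Longrightarrow> 0 \<le> b \<Longrightarrow> 0 \<le> c \<Longrightarrow> ennreal (a * (b * c)) = ennreal a * (ennreal b * ennreal c)"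
  by (simp add: ennreal_mult)

context rate_process
begin

lemma skeleton_PP [measurable]: "skeleton n \<in> PP \<rightarrow>\<^sub>M Pi\<^sub>M {1..n} (\<lambda>_. step_space)"
proof -
  have [measurable]: "(\<lambda>w. restrict w {0..<Suc n}) \<in> PP \<rightarrow>\<^sub>M Pi\<^sub>M {0..<Suc n} (\<lambda>_. event_space)"
    by (intro measurable_restrict) (simp add: measurable_cong_sets[OF sets_PP refl])
  have "(\<lambda>w. skeleton n (restrict w {0..<Suc n})) \<in> PP \<rightarrow>\<^sub>M Pi\<^sub>M {1..n} (\<lambda>_. step_space)"
    by measurable
  then show ?thesis by (simp only: skeleton_restrict)
qed

lemma survive_PP [measurable]:
  assumes [measurable]: "c \<in> borel_measurable (Pi\<^sub>M {1..n} (\<lambda>_. step_space))"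
  shows "Measurable.pred PP (\<lambda>w. increasing_upto n w \<and> ereal (c (skeleton n w)) < fst (w (Suc n)))"
proof -
  have [measurable]: "(\<lambda>w. restrict w {0..<Suc n}) \<in> PP \<rightarrow>\<^sub>M Pi\<^sub>M {0..<Suc n} (\<lambda>_. event_space)"
    by (intro measurable_restrict) (simp add: measurable_cong_sets[OF sets_PP refl])
  have "Measurable.pred PP (\<lambda>w. increasing_upto n (restrict w {0..<Suc n}))" by measurable
  then have [measurable]: "Measurable.pred PP (increasing_upto n)" by (simp only: increasing_upto_restrict)
  have "(\<lambda>w. w (Suc n)) \<in> PP \<rightarrow>\<^sub>M event_space" by (simp add: measurable_cong_sets[OF sets_PP refl])
  from measurable_compose[OF this measurable_fst]
  have [measurable]: "(\<lambda>w. fst (w (Suc n))) \<in> borel_measurable PP" .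
  show ?thesis by measurable
qed

end

context positive_field
begin

lemma completion_time_left: "completion_time (\<Phi> x0) x0 n z = jump_time z n + left n z x0"
  by (simp add: completion_time_def left_def)

lemma final_field_time_changed:
  assumes "increasing_times n z" "\<And>x. 0 < left n z x"
  shows "final_field \<Phi> n (time_changed n z) = (left n z)(x0 := 0)"
proof
  fix x
  have "(\<Phi> x)\<^sup>2 - 2 * occ x0 n (time_changed n z) x = (left n z x)\<^sup>2"
    using occ_time_changed[OF assms, of x] by simp
  then show "final_field \<Phi> n (time_changed n z) x = ((left n z)(x0 := 0)) x"
    using assms(2)[of x] by (simp add: final_field_def)
qed

text \<open>The explicit sum is dominated by the law of the process, because it only accounts for trajectories
  with finitely many jumps that end at \<open>x0\<close>.\<close>
lemma path_law_le_Z_field_law: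
  assumes B [measurable]: "B \<in> sets outcomes" and u: "u = (\<Phi> x0)\<^sup>2 / 2"
  shows "path_law u \<Phi> B \<le> emeasure (Z_field_law E W x0 \<Phi> x0) B"
proof -
  let ?Q = "\<lambda>n. Pi\<^sub>M {1..n} (\<lambda>_. step_space :: (real \<times> 'v) measure)"
  let ?c = "\<lambda>n. completion_time (\<Phi> x0) x0 n"
  define f where "f n z = (if jump_state x0 z n = x0 then outcome_weight u \<Phi> B n z else 0)" for n z
  define good where "good n z \<longleftrightarrow> increasing_times n z \<and> jump_state x0 z n = x0 \<and> (\<forall>x. 0 < left n z x)" for n z
  define g where "g n z = (if good n z then \<Sum>\<sigma>\<in>spins x0.
      ennreal (weight (final_field \<Phi> n (time_changed n z)) \<sigma> / partition_fun (final_field \<Phi> n (time_changed n z)))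
      * indicator B (stopped_skeleton u n (time_changed n z), \<lambda>x. \<sigma> x * final_field \<Phi> n (time_changed n z) x) else 0)" for n z
  have const: "(\<lambda>z. \<Phi>) \<in> ?Q n \<rightarrow>\<^sub>M field_space" for n by (simp add: space_PiM)
  have ident: "(\<lambda>z. z) \<in> ?Q n \<rightarrow>\<^sub>M ?Q n" for n by simp
  have f_meas: "f n \<in> borel_measurable (?Q n)" for n
    unfolding f_def using outcome_weight_measurable[OF const ident B] by measurable
  have good_meas [measurable]: "Measurable.pred (?Q n) (good n)" for n
  proof -
    have [measurable]: "Measurable.pred (?Q n) (\<lambda>z. \<forall>x. 0 < left n z x)"
    proof (rule pred_intros_countable)
      show "Measurable.pred (?Q n) (\<lambda>z. 0 < left n z x)" for x
        unfolding pred_def by (intro borel_measurable_less borel_measurable_const left_measurable order_refl)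
    qed
    show ?thesis unfolding good_def by measurable
  qed
  have g_meas [measurable]: "g n \<in> borel_measurable (?Q n)" for n
  proof -
    note tc = time_changed_measurable[of n]
    note [measurable] = final_field_measurable[OF const tc] stopped_skeleton_measurable[OF const tc]
    have [measurable]: "(\<lambda>x. partition_fun (final_field \<Phi> n (time_changed n x))) \<in> borel_measurable (?Q n)"
      "(\<lambda>x. weight (final_field \<Phi> n (time_changed n x)) \<sigma>) \<in> borel_measurable (?Q n)" for \<sigma>
      by (rule moment_measurable weight_measurable, measurable)+
    have field: "(\<lambda>z. (\<lambda>y. \<sigma> y * final_field \<Phi> n (time_changed n z) y)) \<in> ?Q n \<rightarrow>\<^sub>M field_space" for \<sigma>
    proof (rule measurable_PiM_single')
      show "(\<lambda>z. \<sigma> y * final_field \<Phi> n (time_changed n z) y) \<in> borel_measurable (?Q n)" for y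
        by (intro borel_measurable_times borel_measurable_const final_field_measurable[OF const tc])
    qed (simp add: Pi_iff PiE_iff)
    have outcome: "(\<lambda>z. indicator B (stopped_skeleton u n (time_changed n z), \<lambda>x. \<sigma> x * final_field \<Phi> n (time_changed n z) x) :: ennreal)
        \<in> borel_measurable (?Q n)" for \<sigma>
      by (rule measurable_compose[OF measurable_Pair[OF stopped_skeleton_measurable[OF const tc] field] borel_measurable_indicator[OF B]])
    have weight: "(\<lambda>z. ennreal (weight (final_field \<Phi> n (time_changed n z)) \<sigma> / partition_fun (final_field \<Phi> n (time_changed n z))))
        \<in> borel_measurable (?Q n)" for \<sigma>
      by measurable
    have "(\<lambda>z. \<Sum>\<sigma>\<in>spins x0. ennreal (weight (final_field \<Phi> n (time_changed n z)) \<sigma> / partition_fun (final_field \<Phi> n (time_changed n z)))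
        * indicator B (stopped_skeleton u n (time_changed n z), \<lambda>x. \<sigma> x * final_field \<Phi> n (time_changed n z) x)) \<in> borel_measurable (?Q n)"
      by (intro borel_measurable_sum borel_measurable_times_ennreal weight outcome)
    from measurable_If[OF this borel_measurable_const[of 0] predE[OF good_meas]]
    show ?thesis unfolding g_def .
  qed
  have pointwise: "Y.path_density n z * (g n z * emeasure (next_event (Y_rate E W x0 \<Phi> (skeleton_path x0 n z)) (jump_time z n) (jump_state x0 z n))
        {e. ereal (?c n z) < fst e})
      = (if increasing_times n z \<and> (\<forall>x. 0 < left n z x)
        then ennreal (\<Prod>k<n. left (Suc k) z (jump_state x0 z k)) * f n (time_changed n z) else 0)" for n z
  proof (cases "good n z")
    case False
    then show ?thesis
      by (auto simp: g_def f_def good_def jump_state_time_changed)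
  next
    case True
    then have inc: "increasing_times n z" and x0: "jump_state x0 z n = x0" and pos: "\<And>x. 0 < left n z x"
      by (auto simp: good_def)
    let ?z' = "time_changed n z" and ?M = "(left n z)(x0 := 0)"
    let ?D = "\<Prod>k<n. left (Suc k) z (jump_state x0 z k)" and ?A = "\<Prod>k<n. left (Suc k) z (jump_state x0 z (Suc k))"
    let ?R = "\<Prod>x\<in>U. \<Phi> x / left n z x"
    have x0': "jump_state x0 ?z' n = x0" using x0 by (simp add: jump_state_time_changed)
    note ff = final_field_time_changed[OF inc pos]
    have Z: "0 < partition_fun \<Phi>" "0 < partition_fun ?M" "0 < partition_fun (left n z)"
      by (rule ising_partition_pos)+
    have D: "0 \<le> ?D"
      using left_antimono[OF inc] pos by (intro prod_nonneg) (meson Suc_leI lessThan_iff less_imp_le less_le_trans)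
    have R: "0 \<le> ?R" using \<Phi>_pos pos by (intro prod_nonneg divide_nonneg_nonneg) (auto simp: less_imp_le)
    have pw: "path_weight n ?z' = path_weight n z"
      unfolding path_weight_def by (intro prod.cong refl) (simp add: jump_state_time_changed)
    have R': "(\<Prod>x\<in>U. \<Phi> x / final_field \<Phi> n ?z' x) = ?R"
      unfolding ff by (intro prod.cong refl) simp
    have rho: "Y.path_density n z = ennreal (path_weight n z * (?D * ?R) * partition_fun (left n z) / partition_fun \<Phi>)"
      using inc pos arrivals_departures_closed[OF inc pos x0]
      by (simp add: Y_path_density x0 path_weight_def prod.distrib)
    have surv: "emeasure (next_event (Y_rate E W x0 \<Phi> (skeleton_path x0 n z)) (jump_time z n) (jump_state x0 z n))
        {e. ereal (?c n z) < fst e} = ennreal (partition_fun ?M / partition_fun (left n z))"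
      using Y_survival[OF inc pos x0] by (simp add: x0 completion_time_left)
    have weights: "ennreal (path_weight n z * (?D * ?R) * partition_fun (left n z) / partition_fun \<Phi>)
        * (ennreal (weight ?M \<sigma> / partition_fun ?M) * i * ennreal (partition_fun ?M / partition_fun (left n z)))
      = ennreal ?D * (ennreal (path_weight n z * ?R / partition_fun \<Phi>) * (ennreal (weight ?M \<sigma>) * i))" for \<sigma> i
    proof -
      have "path_weight n z * (?D * ?R) * partition_fun (left n z) / partition_fun \<Phi> * (weight ?M \<sigma> / partition_fun ?M * (partition_fun ?M / partition_fun (left n z)))
          = ?D * (path_weight n z * ?R / partition_fun \<Phi> * weight ?M \<sigma>)"
        using Z by (simp add: field_simps)
      moreover have "ennreal (path_weight n z * (?D * ?R) * partition_fun (left n z) / partition_fun \<Phi> * (weight ?M \<sigma> / partition_fun ?M * (partition_fun ?M / partition_fun (left n z))))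
          = ennreal (path_weight n z * (?D * ?R) * partition_fun (left n z) / partition_fun \<Phi>)
            * (ennreal (weight ?M \<sigma> / partition_fun ?M) * ennreal (partition_fun ?M / partition_fun (left n z)))"
        using Z D R path_weight_nonneg[of n z] ising_weight_pos[of E "interaction W ?M" \<sigma>]
        by (intro ennreal_mult3 mult_nonneg_nonneg divide_nonneg_nonneg) (simp_all add: less_imp_le)
      moreover have "ennreal (?D * (path_weight n z * ?R / partition_fun \<Phi> * weight ?M \<sigma>))
          = ennreal ?D * (ennreal (path_weight n z * ?R / partition_fun \<Phi>) * ennreal (weight ?M \<sigma>))"
        using Z D R path_weight_nonneg[of n z] ising_weight_pos[of E "interaction W ?M" \<sigma>]
        by (intro ennreal_mult3 mult_nonneg_nonneg divide_nonneg_nonneg) (simp_all add: less_imp_le)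
      ultimately show ?thesis by (simp only: mult.assoc mult.commute mult.left_commute)
    qed
    have "Y.path_density n z * (g n z * emeasure (next_event (Y_rate E W x0 \<Phi> (skeleton_path x0 n z)) (jump_time z n) (jump_state x0 z n))
        {e. ereal (?c n z) < fst e})
      = (\<Sum>\<sigma>\<in>spins x0. ennreal (path_weight n z * (?D * ?R) * partition_fun (left n z) / partition_fun \<Phi>)
        * (ennreal (weight ?M \<sigma> / partition_fun ?M) * indicator B (stopped_skeleton u n ?z', \<lambda>x. \<sigma> x * ?M x) * ennreal (partition_fun ?M / partition_fun (left n z))))"
      unfolding rho surv g_def if_P[OF True] ff by (simp only: sum_distrib_left sum_distrib_right)
    also have "\<dots> = ennreal ?D * f n ?z'"
      unfolding weights f_def outcome_weight_def pw if_P[OF x0'] ff R'[unfolded ff] by (simp only: sum_distrib_left)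
    finally show ?thesis using inc pos by simp
  qed
  have "path_law u \<Phi> B = (\<Sum>n. \<integral>\<^sup>+w. g n (skeleton n w) * (if increasing_upto n w \<and> ereal (?c n (skeleton n w)) < fst (w (Suc n)) then 1 else 0) \<partial>Y.PP)"
    unfolding path_law_def
  proof (rule suminf_cong)
    fix n
    have "(\<integral>\<^sup>+w. g n (skeleton n w) * (if increasing_upto n w \<and> ereal (?c n (skeleton n w)) < fst (w (Suc n)) then 1 else 0) \<partial>Y.PP)
      = (\<integral>\<^sup>+z. Y.path_density n z * (g n z * emeasure (next_event (Y_rate E W x0 \<Phi> (skeleton_path x0 n z)) (jump_time z n) (jump_state x0 z n))
        {e. ereal (?c n z) < fst e}) \<partial>?Q n)"
      by (rule Y.nn_integral_PP_skeleton) measurable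
    also have "\<dots> = (\<integral>\<^sup>+z. (if increasing_times n z \<and> (\<forall>x. 2 * occ x0 n z x < (\<Phi> x)\<^sup>2) then f n z else 0) \<partial>?Q n)"
      unfolding pointwise by (rule nn_integral_time_change[OF f_meas])
    also have "\<dots> = (\<integral>\<^sup>+z. (if admissible \<Phi> n z then outcome_weight u \<Phi> B n z else 0) \<partial>?Q n)"
      by (intro nn_integral_cong) (simp add: admissible_def f_def)
    finally show "(\<integral>\<^sup>+z. (if admissible \<Phi> n z then outcome_weight u \<Phi> B n z else 0) \<partial>?Q n)
        = (\<integral>\<^sup>+w. g n (skeleton n w) * (if increasing_upto n w \<and> ereal (?c n (skeleton n w)) < fst (w (Suc n)) then 1 else 0) \<partial>Y.PP)" ..
  qed
  also have "\<dots> = (\<integral>\<^sup>+w. (\<Sum>n. g n (skeleton n w) * (if increasing_upto n w \<and> ereal (?c n (skeleton n w)) < fst (w (Suc n)) then 1 else 0)) \<partial>Y.PP)"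
    by (rule nn_integral_suminf[symmetric]) measurable
  also have "\<dots> \<le> (\<integral>\<^sup>+w. emeasure (final_law w) B \<partial>Y.PP)"
  proof (rule nn_integral_mono_AE)
    show "AE w in Y.PP. (\<Sum>n. g n (skeleton n w) * (if increasing_upto n w \<and> ereal (?c n (skeleton n w)) < fst (w (Suc n)) then 1 else 0))
        \<le> emeasure (final_law w) B"
      using Y.AE_PP_ordered
    proof eventually_elim
      case (elim w)
      then have start: "w 0 = (0, x0)" and mono: "\<forall>k. fst (w k) \<le> fst (w (Suc k))" by auto
      let ?h = "\<lambda>n. g n (skeleton n w) * (if increasing_upto n w \<and> ereal (?c n (skeleton n w)) < fst (w (Suc n)) then 1 else 0)"
      have nonzero: "completes (\<Phi> x0) x0 n w \<and> good n (skeleton n w)" if "?h n \<noteq> 0" for n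
        using that by (auto simp: completes_def g_def good_def left_def split: if_splits)
      show ?case
      proof (cases "\<exists>m. ?h m \<noteq> 0")
        case False
        then have "?h n = 0" for n by blast
        then show ?thesis by (simp only: suminf_zero) simp
      next
        case True
        then obtain m where m: "?h m \<noteq> 0" by blast
        let ?z = "skeleton m w"
        have compl: "completes (\<Phi> x0) x0 m w" and "good m ?z" using nonzero[OF m] by auto
        then have inc: "increasing_times m ?z" and x0: "jump_state x0 ?z m = x0" and pos: "\<And>x. 0 < left m ?z x"
          by (auto simp: good_def)
        have incw: "increasing_upto m w" and T: "ereal (?c m ?z) < fst (w (Suc m))" using compl by (auto simp: completes_def)
        have "?h n = 0" if "n \<noteq> m" for n
          using completes_unique[OF start mono compl, of n] nonzero[of n] that by blast
        then have "suminf ?h = ?h m" by (rule suminf_single)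
        also have "\<dots> = g m ?z" using incw T by simp
        also have "\<dots> = emeasure (final_law w) B"
        proof -
          have agree: "traj w s = skeleton_path x0 m ?z s" if "0 \<le> s" "s \<le> jump_time ?z m + left m ?z x0" for s
            using traj_skeleton[OF incw start mono T] that by (simp add: completion_time_left)
          have Z: "T_check \<Phi> (traj w) = completion_time u x0 m (time_changed m ?z)"
            "path_upto (T_check \<Phi> (traj w)) (Z_check \<Phi> (traj w)) = path_upto (T_check \<Phi> (traj w)) (skeleton_path x0 m (time_changed m ?z))"
            "Phi_at \<Phi> (Z_check \<Phi> (traj w)) (T_check \<Phi> (traj w)) = (left m ?z)(x0 := 0)"
            unfolding u by (rule Z_check_skeleton[OF traj_path_measurable inc pos x0 agree]; assumption)+
          have path: "path_upto (T_check \<Phi> (traj w)) (Z_check \<Phi> (traj w)) = stopped_skeleton u m (time_changed m ?z)"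
            using Z(2) unfolding stopped_skeleton_def Z(1) .
          show ?thesis
            unfolding emeasure_final_law[OF B] Let_def path Z(3) g_def if_P[OF \<open>good m ?z\<close>] final_field_time_changed[OF inc pos] ..
        qed
        finally show ?thesis by simp
      qed
    qed
  qed
  also have "\<dots> = emeasure (Z_field_law E W x0 \<Phi> x0) B"
    by (rule emeasure_Z_field_law[OF B, symmetric])
  finally show ?thesis .
qed

end

section \<open>The joint law of path and field\<close>

lemma inv_local_time_measurable:
  fixes x0 :: "'v::finite"
  assumes "0 < u"
  shows "(\<lambda>w. inv_local_time x0 u (traj w)) \<in> borel_measurable (Pi\<^sub>M UNIV (\<lambda>_. event_space :: 'v event measure))"
proof (rule borel_measurableI_less)
  fix c :: real
  let ?E = "Pi\<^sub>M UNIV (\<lambda>_. event_space :: 'v event measure)"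
  let ?lt = "\<lambda>w. local_time (traj w) x0" and ?S = "\<lambda>w. {t. 0 \<le> t \<and> u < local_time (traj w) x0 t}"
  have nonempty_iff: "?S w \<noteq> {} \<longleftrightarrow> (\<exists>n::nat. u < ?lt w (real n))" for w
  proof
    assume "?S w \<noteq> {}"
    then obtain t where t: "0 \<le> t" "u < ?lt w t" by auto
    obtain n :: nat where "t \<le> real n" using real_arch_simple by blast
    then have "u < ?lt w (real n)" using local_time_mono[OF traj_path_measurable, of t "real n" w x0] t by simp
    then show "\<exists>n::nat. u < ?lt w (real n)" ..
  next
    assume "\<exists>n::nat. u < ?lt w (real n)"
    then obtain n :: nat where "u < ?lt w (real n)" ..
    then have "real n \<in> ?S w" by simp
    then show "?S w \<noteq> {}" by blast
  qed
  have less_iff: "Inf (?S w) < c \<longleftrightarrow> u < ?lt w c" if ne: "?S w \<noteq> {}" for w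
  proof
    assume "Inf (?S w) < c"
    then obtain t where "t \<in> ?S w" "t < c" using cInf_lessD[OF ne] by blast
    then show "u < ?lt w c" using local_time_mono[OF traj_path_measurable, of t c w x0] by simp
  next
    assume less: "u < ?lt w c"
    define t where "t = c - (?lt w c - u) / 2"
    have "?lt w c - ?lt w t \<le> c - t"
      using less by (intro local_time_diff_le[OF traj_path_measurable]) (simp add: t_def)
    then have "u < ?lt w t" using less by (simp add: t_def field_simps)
    moreover have "0 \<le> t"
    proof (rule ccontr)
      assume "\<not> 0 \<le> t"
      then have "?lt w t = 0" by simp
      then show False using \<open>u < ?lt w t\<close> assms by simp
    qed
    ultimately have "Inf (?S w) \<le> t" by (intro cInf_lower bdd_belowI[of _ 0]) auto
    also have "t < c" using less by (simp add: t_def)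
    finally show "Inf (?S w) < c" .
  qed
  have "{w \<in> space ?E. inv_local_time x0 u (traj w) < c}
      = {w \<in> space ?E. if \<exists>n::nat. u < ?lt w (real n) then u < ?lt w c else Inf ({} :: real set) < c}"
  proof (intro Collect_cong conj_cong refl)
    fix w
    show "(inv_local_time x0 u (traj w) < c) = (if \<exists>n::nat. u < ?lt w (real n) then u < ?lt w c else Inf ({} :: real set) < c)"
    proof (cases "?S w = {}")
      case True
      then have "\<not> (\<exists>n::nat. u < ?lt w (real n))" using nonempty_iff[of w] by blast
      then show ?thesis unfolding inv_local_time_def True by (simp only: if_False)
    next
      case False
      then have "\<exists>n::nat. u < ?lt w (real n)" using nonempty_iff[of w] by blast
      then show ?thesis unfolding inv_local_time_def using less_iff[OF False] by (simp only: if_True)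
    qed
  qed
  also have "\<dots> \<in> sets ?E"
    by measurable
  finally show "{w \<in> space ?E. inv_local_time x0 u (traj w) < c} \<in> sets ?E" .
qed

context conductance_network
begin

lemma markov_survival:
  assumes x0: "jump_state x0 z n = x0" and below: "occ x0 n z x0 < u"
  shows "emeasure (next_event (markov_rate E W (skeleton_path x0 n z)) (jump_time z n) (jump_state x0 z n))
      {e. ereal (completion_time u x0 n z) < fst e} = ennreal (exp (- (vertex_rate x0 * (u - occ x0 n z x0))))"
proof -
  let ?R = "markov_rate E W (skeleton_path x0 n z)" and ?a = "jump_time z n" and ?c = "completion_time u x0 n z"
  have c: "?c = ?a + (u - occ x0 n z x0)" by (simp add: completion_time_def)
  have "(\<integral>\<^sup>+t. (\<Sum>j\<in>UNIV. ennreal (jump_density ?R ?a t j)) * indicator {?a<..?c} t \<partial>lborel)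
      = (\<integral>\<^sup>+t. ennreal (vertex_rate x0 * exp (- (vertex_rate x0 * (t - ?a)))) * indicator {?a..?c} t \<partial>lborel)"
  proof (rule nn_integral_cong_AE)
    show "AE t in lborel. (\<Sum>j\<in>UNIV. ennreal (jump_density ?R ?a t j)) * indicator {?a<..?c} t
        = ennreal (vertex_rate x0 * exp (- (vertex_rate x0 * (t - ?a)))) * indicator {?a..?c} t"
      using AE_lborel_singleton[of ?a]
    proof eventually_elim
      case (elim t)
      show ?case
      proof (cases "t \<in> {?a<..?c}")
        case True
        then have "(\<Sum>j\<in>UNIV. ennreal (jump_density ?R ?a t j)) = ennreal (vertex_rate x0 * exp (- (vertex_rate x0 * (t - ?a))))"
          by (simp add: markov_jump_density x0 cond_nonneg sum_distrib_right[symmetric] vertex_rate_def)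
        then show ?thesis using True by simp
      next
        case False
        then have "t \<notin> {?a..?c}" using elim by auto
        then show ?thesis using False by simp
      qed
    qed
  qed
  also have "\<dots> = ennreal (exp (- (vertex_rate x0 * (?a - ?a))) - exp (- (vertex_rate x0 * (?c - ?a))))"
    using below by (intro nn_integral_derivative) (auto intro!: derivative_eq_intros simp: vertex_rate_nonneg c)
  finally have mass: "(\<integral>\<^sup>+t. (\<Sum>j\<in>UNIV. ennreal (jump_density ?R ?a t j)) * indicator {?a<..?c} t \<partial>lborel)
      = ennreal (1 - exp (- (vertex_rate x0 * (u - occ x0 n z x0))))"
    by (simp add: c)
  show ?thesis
  proof (rule emeasure_next_event_survive[OF _ _ mass])
    show "(\<lambda>t. ?R t k) \<in> borel_measurable borel" for k by (rule X.rate_measurable1)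
    show "jump_mass ?R ?a UNIV \<le> 1"
      using X.jump_mass_le[of "events x0 z" n] by (simp add: events_eq)
    show "exp (- (vertex_rate x0 * (u - occ x0 n z x0))) \<le> 1" using below vertex_rate_nonneg[of x0] by simp
  qed simp
qed

lemma completes_PP [measurable]: "Measurable.pred X.PP (completes u x0 n)"
proof -
  have ct: "completion_time u x0 n \<in> borel_measurable (Pi\<^sub>M {1..n} (\<lambda>_. step_space))" by measurable
  have "Measurable.pred (Pi\<^sub>M {1..n} (\<lambda>_. step_space)) (\<lambda>z. jump_state x0 z n = x0 \<and> occ x0 n z x0 < u)" by measurable
  from measurable_compose[OF X.skeleton_PP this]
  have [measurable]: "Measurable.pred X.PP (\<lambda>w. jump_state x0 (skeleton n w) n = x0 \<and> occ x0 n (skeleton n w) x0 < u)" .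
  note [measurable] = X.survive_PP[OF ct]
  have "Measurable.pred X.PP (\<lambda>w. (increasing_upto n w \<and> ereal (completion_time u x0 n (skeleton n w)) < fst (w (Suc n))) \<and>
      (jump_state x0 (skeleton n w) n = x0 \<and> occ x0 n (skeleton n w) x0 < u))"
    by measurable
  then show ?thesis unfolding completes_def by (simp only: conj_assoc)
qed

lemma nn_integral_completes:
  assumes [measurable]: "g \<in> borel_measurable (Pi\<^sub>M {1..n} (\<lambda>_. step_space))"
  shows "(\<integral>\<^sup>+w. (if completes u x0 n w then g (skeleton n w) else 0) \<partial>X.PP)
    = (\<integral>\<^sup>+z. X.path_density n z * (if jump_state x0 z n = x0 \<and> occ x0 n z x0 < u
        then ennreal (exp (- (vertex_rate x0 * (u - occ x0 n z x0)))) * g z else 0) \<partial>Pi\<^sub>M {1..n} (\<lambda>_. step_space))"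
proof -
  define g' where "g' z = (if jump_state x0 z n = x0 \<and> occ x0 n z x0 < u then g z else 0)" for z
  have g' [measurable]: "g' \<in> borel_measurable (Pi\<^sub>M {1..n} (\<lambda>_. step_space))" unfolding g'_def by measurable
  have "(\<integral>\<^sup>+w. (if completes u x0 n w then g (skeleton n w) else 0) \<partial>X.PP)
      = (\<integral>\<^sup>+w. g' (skeleton n w) * (if increasing_upto n w \<and> ereal (completion_time u x0 n (skeleton n w)) < fst (w (Suc n)) then 1 else 0) \<partial>X.PP)"
    by (intro nn_integral_cong) (auto simp: completes_def g'_def)
  also have "\<dots> = (\<integral>\<^sup>+z. X.path_density n z * (g' z *
        emeasure (next_event (markov_rate E W (skeleton_path x0 n z)) (jump_time z n) (jump_state x0 z n)) {e. ereal (completion_time u x0 n z) < fst e})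
        \<partial>Pi\<^sub>M {1..n} (\<lambda>_. step_space))"
    by (rule X.nn_integral_PP_skeleton) measurable
  also have "\<dots> = (\<integral>\<^sup>+z. X.path_density n z * (if jump_state x0 z n = x0 \<and> occ x0 n z x0 < u
        then ennreal (exp (- (vertex_rate x0 * (u - occ x0 n z x0)))) * g z else 0) \<partial>Pi\<^sub>M {1..n} (\<lambda>_. step_space))"
  proof (rule nn_integral_cong)
    fix z :: "nat \<Rightarrow> real \<times> 'v"
    show "X.path_density n z * (g' z *
        emeasure (next_event (markov_rate E W (skeleton_path x0 n z)) (jump_time z n) (jump_state x0 z n)) {e. ereal (completion_time u x0 n z) < fst e})
      = X.path_density n z * (if jump_state x0 z n = x0 \<and> occ x0 n z x0 < u
        then ennreal (exp (- (vertex_rate x0 * (u - occ x0 n z x0)))) * g z else 0)"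
    proof (cases "jump_state x0 z n = x0 \<and> occ x0 n z x0 < u")
      case True
      then show ?thesis using markov_survival[of z n u] by (simp add: g'_def mult.commute)
    next
      case False
      then show ?thesis unfolding g'_def by (simp only: if_False mult_zero_left mult_zero_right)
    qed
  qed
  finally show ?thesis .
qed

text \<open>By \<open>completion_mass\<close> the expected number of \<open>n\<close> for which the path completes after \<open>n\<close> jumps is \<open>1\<close>, and there is at
  most one such \<open>n\<close>.\<close>
lemma AE_completes:
  assumes "0 < u"
  shows "AE w in X.PP. \<exists>n. completes u x0 n w"
proof -
  have mass: "(\<Sum>n. \<integral>\<^sup>+w. (if completes u x0 n w then 1 else 0) \<partial>X.PP) = 1"
  proof (rule trans[OF suminf_cong completion_mass[OF assms]])
    fix n
    show "(\<integral>\<^sup>+w. (if completes u x0 n w then 1 else 0) \<partial>X.PP)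
      = (\<integral>\<^sup>+z. X.path_density n z * (if jump_state x0 z n = x0 \<and> occ x0 n z x0 < u
       then ennreal (exp (- (vertex_rate x0 * (u - occ x0 n z x0)))) else 0) \<partial>Pi\<^sub>M {1..n} (\<lambda>_. step_space))"
      using nn_integral_completes[of "\<lambda>_. 1" n u] by (simp cong: if_cong)
  qed
  interpret P: prob_space X.PP by (rule X.prob_space_PP)
  let ?N = "\<lambda>w. \<Sum>n. (if completes u x0 n w then 1 else 0 :: ennreal)"
  have N_meas: "?N \<in> borel_measurable X.PP" by measurable
  have "(\<integral>\<^sup>+w. ?N w \<partial>X.PP) = 1"
    by (rule trans[OF nn_integral_suminf mass]) measurable
  have le: "AE w in X.PP. ?N w \<le> (if \<exists>n. completes u x0 n w then 1 else 0)"
    using X.AE_PP_ordered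
  proof eventually_elim
    case (elim w)
    show ?case
    proof (cases "\<exists>m. completes u x0 m w")
      case True
      then obtain m where m: "completes u x0 m w" by blast
      have "(if completes u x0 n w then 1 else 0 :: ennreal) = 0" if "n \<noteq> m" for n
        using completes_unique[OF _ _ m, of n] elim that by auto
      then have "?N w = (if completes u x0 m w then 1 else 0)" by (rule suminf_single)
      then show ?thesis using m True by simp
    qed simp
  qed
  have "1 \<le> (\<integral>\<^sup>+w. (if \<exists>n. completes u x0 n w then 1 else 0) \<partial>X.PP)"
    using nn_integral_mono_AE[OF le] \<open>(\<integral>\<^sup>+w. ?N w \<partial>X.PP) = 1\<close> by (simp only:)
  also have "\<dots> = (\<integral>\<^sup>+w. indicator {w \<in> space X.PP. \<exists>n. completes u x0 n w} w \<partial>X.PP)"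
    by (intro nn_integral_cong) (auto simp: indicator_def)
  also have "\<dots> = emeasure X.PP {w \<in> space X.PP. \<exists>n. completes u x0 n w}"
    by (rule nn_integral_indicator) measurable
  finally have "emeasure X.PP {w \<in> space X.PP. \<exists>n. completes u x0 n w} = 1"
    using P.emeasure_le_1 by (intro antisym)
  moreover have "Measurable.pred X.PP (\<lambda>w. \<exists>n. completes u x0 n w)" by measurable
  ultimately show ?thesis by (simp only: P.AE_iff_emeasure_eq_1)
qed

abbreviation observed_field :: "real \<Rightarrow> (nat \<Rightarrow> 'v event) \<times> ('v \<Rightarrow> real) \<Rightarrow> 'v \<Rightarrow> real" where
  "observed_field u \<equiv> (\<lambda>(\<omega>, \<phi>) x. sqrt ((\<phi> x)\<^sup>2 + 2 * local_time (traj \<omega>) x (inv_local_time x0 u (traj \<omega>))))"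

abbreviation observed_path :: "real \<Rightarrow> (nat \<Rightarrow> 'v event) \<times> ('v \<Rightarrow> real) \<Rightarrow> (real \<times> (real \<Rightarrow> 'v)) \<times> ('v \<Rightarrow> real)" where
  "observed_path u \<equiv> (\<lambda>(\<omega>, \<phi>). (path_upto (inv_local_time x0 u (traj \<omega>)) (traj \<omega>), \<phi>))"

text \<open>At \<open>x0\<close> the free field vanishes and the local time is \<open>u\<close>, so only the values off \<open>x0\<close> are random.\<close>
abbreviation boundary :: "real \<Rightarrow> ('v \<Rightarrow> real) \<Rightarrow> 'v \<Rightarrow> real" where
  "boundary u a \<equiv> a(x0 := sqrt (2 * u))"

definition marginal_density :: "real \<Rightarrow> ('v \<Rightarrow> real) \<Rightarrow> ennreal" where
  "marginal_density u a = ennreal (field_density (boundary u a)) * (if \<forall>x\<in>U. 0 < a x then 1 else 0)"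

lemma marginal_density_measurable [measurable]: "marginal_density u \<in> borel_measurable flat"
proof -
  have [measurable]: "Measurable.pred flat (\<lambda>a. \<forall>x\<in>U. 0 < a x)"
  proof (rule pred_intros_finite)
    fix x assume "x \<in> U"
    then have "(\<lambda>a. a x) \<in> borel_measurable flat" by (intro component_flat) auto
    then show "Measurable.pred flat (\<lambda>a. 0 < a x)" by measurable
  qed simp
  have [measurable]: "(\<lambda>a. field_density (boundary u a)) \<in> borel_measurable flat"
    unfolding field_density_def by measurable
  show ?thesis unfolding marginal_density_def by measurable
qed

lemma observed_field_measurable: "0 < u \<Longrightarrow> observed_field u \<in> X.PP \<Otimes>\<^sub>M free_field \<rightarrow>\<^sub>M field_space"
proof -
  assume u: "0 < u"
  have fst_PP: "fst \<in> X.PP \<Otimes>\<^sub>M free_field \<rightarrow>\<^sub>M Pi\<^sub>M UNIV (\<lambda>_. event_space)"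
    using measurable_fst[of X.PP free_field] by (simp add: measurable_cong_sets[OF refl X.sets_PP])
  note [measurable] = fst_PP measurable_compose[OF fst_PP inv_local_time_measurable[OF u, of x0]]
  have component: "(\<lambda>p. snd p x) \<in> borel_measurable (X.PP \<Otimes>\<^sub>M free_field)" for x
  proof -
    have "(\<lambda>\<phi>. \<phi> x) \<in> borel_measurable free_field" by (simp add: measurable_cong_sets[OF sets_gff refl])
    from measurable_compose[OF measurable_snd this] show ?thesis .
  qed
  show ?thesis
    unfolding case_prod_beta'
  proof (rule measurable_PiM_single')
    show "(\<lambda>p. sqrt ((snd p x)\<^sup>2 + 2 * local_time (traj (fst p)) x (inv_local_time x0 u (traj (fst p)))))
        \<in> borel_measurable (X.PP \<Otimes>\<^sub>M free_field)" for x
      by (intro measurable_compose[OF _ borel_measurable_sqrt] borel_measurable_add borel_measurable_times borel_measurable_power borel_measurable_const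
          local_time_traj_measurable fst_PP measurable_compose[OF fst_PP inv_local_time_measurable[OF u]] component)
  qed simp
qed

lemma observed_path_measurable: "0 < u \<Longrightarrow> observed_path u \<in> X.PP \<Otimes>\<^sub>M free_field \<rightarrow>\<^sub>M outcomes"
proof -
  assume u: "0 < u"
  have fst_PP: "fst \<in> X.PP \<Otimes>\<^sub>M free_field \<rightarrow>\<^sub>M Pi\<^sub>M UNIV (\<lambda>_. event_space)"
    using measurable_fst[of X.PP free_field] by (simp add: measurable_cong_sets[OF refl X.sets_PP])
  note [measurable] = fst_PP measurable_compose[OF fst_PP inv_local_time_measurable[OF u, of x0]]
  have [measurable]: "(\<lambda>p. path_upto (inv_local_time x0 u (traj (fst p))) (traj (fst p))) \<in> X.PP \<Otimes>\<^sub>M free_field \<rightarrow>\<^sub>M stopped_path_space"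
    by (rule path_upto_measurable) measurable
  have [measurable]: "snd \<in> X.PP \<Otimes>\<^sub>M free_field \<rightarrow>\<^sub>M field_space"
    using measurable_snd[of X.PP free_field] by (simp add: measurable_cong_sets[OF refl sets_gff])
  show ?thesis unfolding case_prod_beta' by measurable
qed

text \<open>For a fixed skeleton, the change of variables from the free field to its signs and to \<open>\<Phi>\<close> turns the density of
  path and field into the density of \<open>\<Phi>\<close> times the weight of the outcome: the exponents combine to
  \<open>\<Phi>\<^sup>2 / 2 = \<phi>\<^sup>2 / 2 + \<ell>\<close>, and the cross terms are the Ising weight of the signs.\<close>
lemma skeleton_change_of_variables:
  assumes u: "0 < u" and h [measurable]: "h \<in> borel_measurable field_space" and B [measurable]: "B \<in> sets outcomes"
  shows "X.path_density n z * (if jump_state x0 z n = x0 \<and> occ x0 n z x0 < u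
        then ennreal (exp (- (vertex_rate x0 * (u - occ x0 n z x0)))) *
          (\<integral>\<^sup>+\<phi>. h (\<lambda>x. sqrt ((\<phi> x)\<^sup>2 + 2 * (if x = x0 then u else occ x0 n z x))) * indicator B (stopped_skeleton u n z, \<phi>) \<partial>free_field) else 0)
    = (\<integral>\<^sup>+a. marginal_density u a * h (boundary u a) *
        (if admissible (boundary u a) n z then outcome_weight u (boundary u a) B n z else 0) \<partial>flat)"
proof (cases "increasing_times n z \<and> jump_state x0 z n = x0 \<and> occ x0 n z x0 < u")
  case False
  have "\<not> admissible (boundary u a) n z" for a
  proof
    assume "admissible (boundary u a) n z"
    then have "increasing_times n z" "jump_state x0 z n = x0" "2 * occ x0 n z x0 < (boundary u a x0)\<^sup>2"
      by (auto simp only: admissible_def)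
    then show False using False u by simp
  qed
  then show ?thesis using False by (auto simp: markov_path_density)
next
  case True
  then have inc: "increasing_times n z" and x0: "jump_state x0 z n = x0" and below: "occ x0 n z x0 < u" by auto
  define lt where "lt x = (if x = x0 then u else occ x0 n z x)" for x
  define H where "H f = ennreal (gff_weight E W x0 f / gff_norm) *
      (h (\<lambda>x. sqrt (((f(x0 := 0)) x)\<^sup>2 + 2 * lt x)) * indicator B (stopped_skeleton u n z, f(x0 := 0)))" for f
  have sqrt_field: "(\<lambda>\<phi> x. sqrt ((\<phi> x)\<^sup>2 + 2 * lt x)) \<in> (field_space :: ('v \<Rightarrow> real) measure) \<rightarrow>\<^sub>M field_space"
    by (rule measurable_PiM_single') (auto simp: space_PiM)
  have hB [measurable]: "(\<lambda>\<phi>. h (\<lambda>x. sqrt ((\<phi> x)\<^sup>2 + 2 * lt x)) * indicator B (stopped_skeleton u n z, \<phi>)) \<in> borel_measurable field_space"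
  proof -
    have "(\<lambda>\<phi>. indicator B (stopped_skeleton u n z, \<phi>) :: ennreal) \<in> borel_measurable field_space"
      using stopped_skeleton_in_space[of u n z]
      by (intro measurable_compose[OF measurable_Pair1' borel_measurable_indicator[OF B]])
    then show ?thesis by (intro borel_measurable_times_ennreal measurable_compose[OF sqrt_field h])
  qed
  have H [measurable]: "H \<in> borel_measurable flat"
    unfolding H_def using measurable_compose[OF extend_flat hB, of 0] by measurable
  let ?c = "path_weight n z * exp (- (\<Sum>x\<in>UNIV. vertex_rate x * lt x))"
  have c_nonneg: "0 \<le> ?c" using path_weight_nonneg[of n z] by simp
  have factor: "X.path_density n z * ennreal (exp (- (vertex_rate x0 * (u - occ x0 n z x0)))) = ennreal ?c"
  proof -
    have "(\<Sum>x\<in>UNIV. vertex_rate x * lt x) = (\<Sum>x\<in>UNIV. vertex_rate x * occ x0 n z x) + vertex_rate x0 * (u - occ x0 n z x0)"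
    proof -
      have "(\<Sum>x\<in>UNIV. vertex_rate x * lt x) = (\<Sum>x\<in>UNIV. vertex_rate x * occ x0 n z x + (if x = x0 then vertex_rate x0 * (u - occ x0 n z x0) else 0))"
        by (intro sum.cong) (auto simp: lt_def algebra_simps)
      then show ?thesis by (simp add: sum.distrib)
    qed
    then have "exp (- (\<Sum>x\<in>UNIV. vertex_rate x * lt x)) = exp (- (\<Sum>x\<in>UNIV. vertex_rate x * occ x0 n z x)) * exp (- (vertex_rate x0 * (u - occ x0 n z x0)))"
      by (simp only: exp_add minus_add_distrib)
    then have "?c = path_weight n z * exp (- (\<Sum>x\<in>UNIV. vertex_rate x * occ x0 n z x)) * exp (- (vertex_rate x0 * (u - occ x0 n z x0)))"
      by (simp only: mult.assoc)
    moreover have "X.path_density n z = ennreal (path_weight n z * exp (- (\<Sum>x\<in>UNIV. vertex_rate x * occ x0 n z x)))"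
      using inc by (simp add: markov_path_density path_weight_def)
    ultimately show ?thesis
      using path_weight_nonneg[of n z] by (simp only:) (subst ennreal_mult[symmetric], auto)
  qed
  define K where "K \<sigma> a = ennreal ?c * ((\<Prod>x\<in>U. square_jacobian (occ x0 n z x) (a x)) * H (\<lambda>x\<in>U. \<sigma> x * sqrt ((a x)\<^sup>2 - 2 * occ x0 n z x)))" for \<sigma> a
  have jac_meas [measurable]: "(\<lambda>a. (\<Prod>x\<in>U. square_jacobian (occ x0 n z x) (a x)) * H (\<lambda>x\<in>U. \<sigma> x * sqrt ((a x)\<^sup>2 - 2 * occ x0 n z x))) \<in> borel_measurable flat" for \<sigma>
  proof -
    have [measurable]: "(\<lambda>a. \<Prod>x\<in>U. square_jacobian (occ x0 n z x) (a x)) \<in> borel_measurable flat"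
    proof (rule borel_measurable_prod_ennreal)
      fix x assume "x \<in> U"
      then have [measurable]: "(\<lambda>a. a x) \<in> borel_measurable flat" by (intro component_flat) auto
      show "(\<lambda>a. square_jacobian (occ x0 n z x) (a x)) \<in> borel_measurable flat" by measurable
    qed
    have "(\<lambda>a. \<lambda>x\<in>U. \<sigma> x * sqrt ((a x)\<^sup>2 - 2 * occ x0 n z x)) \<in> flat \<rightarrow>\<^sub>M flat"
    proof (rule measurable_restrict)
      fix x assume "x \<in> U"
      then have [measurable]: "(\<lambda>a. a x) \<in> borel_measurable flat" by (intro component_flat) auto
      show "(\<lambda>a. \<sigma> x * sqrt ((a x)\<^sup>2 - 2 * occ x0 n z x)) \<in> flat \<rightarrow>\<^sub>M lborel" by measurable
    qed
    from measurable_compose[OF this H] show ?thesis by measurable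
  qed
  have K_meas: "K \<sigma> \<in> borel_measurable flat" for \<sigma> unfolding K_def by measurable
  have "(\<integral>\<^sup>+\<phi>. h (\<lambda>x. sqrt ((\<phi> x)\<^sup>2 + 2 * lt x)) * indicator B (stopped_skeleton u n z, \<phi>) \<partial>free_field) = (\<integral>\<^sup>+f. H f \<partial>flat)"
    unfolding H_def by (rule nn_integral_gff[OF hB])
  also have "\<dots> = (\<Sum>\<sigma>\<in>spins x0. \<integral>\<^sup>+a. (\<Prod>x\<in>U. square_jacobian (occ x0 n z x) (a x)) * H (\<lambda>x\<in>U. \<sigma> x * sqrt ((a x)\<^sup>2 - 2 * occ x0 n z x)) \<partial>flat)"
    by (rule nn_integral_flat_signed[OF H occ_nonneg])
  finally have "ennreal ?c * (\<integral>\<^sup>+\<phi>. h (\<lambda>x. sqrt ((\<phi> x)\<^sup>2 + 2 * lt x)) * indicator B (stopped_skeleton u n z, \<phi>) \<partial>free_field)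
      = (\<Sum>\<sigma>\<in>spins x0. \<integral>\<^sup>+a. K \<sigma> a \<partial>flat)"
    unfolding K_def by (simp only: sum_distrib_left nn_integral_cmult[OF jac_meas])
  also have "\<dots> = (\<integral>\<^sup>+a. (\<Sum>\<sigma>\<in>spins x0. K \<sigma> a) \<partial>flat)"
    by (rule nn_integral_sum[symmetric]) (rule K_meas)
  also have "\<dots> = (\<integral>\<^sup>+a. marginal_density u a * h (boundary u a) *
        (if admissible (boundary u a) n z then outcome_weight u (boundary u a) B n z else 0) \<partial>flat)"
  proof (rule nn_integral_cong)
    fix a :: "'v \<Rightarrow> real"
    show "(\<Sum>\<sigma>\<in>spins x0. K \<sigma> a) = marginal_density u a * h (boundary u a) *
        (if admissible (boundary u a) n z then outcome_weight u (boundary u a) B n z else 0)"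
    proof (cases "\<forall>x\<in>U. sqrt (2 * occ x0 n z x) < a x")
      case False
      then obtain x where x: "x \<in> U" "\<not> sqrt (2 * occ x0 n z x) < a x" by blast
      then have "square_jacobian (occ x0 n z x) (a x) = 0" by simp
      with x(1) have "(\<Prod>x\<in>U. square_jacobian (occ x0 n z x) (a x)) = 0" by (intro prod_zero bexI[of _ x]) simp_all
      then have K0: "K \<sigma> a = 0" for \<sigma> by (simp add: K_def)
      have excluded: "\<not> ((\<forall>x\<in>U. 0 < a x) \<and> admissible (boundary u a) n z)"
      proof
        assume A: "(\<forall>x\<in>U. 0 < a x) \<and> admissible (boundary u a) n z"
        then have "0 < a x" "2 * occ x0 n z x < (boundary u a x)\<^sup>2" using x(1) by (auto simp only: admissible_def)
        then have "2 * occ x0 n z x < (a x)\<^sup>2" using x(1) by simp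
        then have "sqrt (2 * occ x0 n z x) < sqrt ((a x)\<^sup>2)" by (rule real_sqrt_less_mono)
        then show False using x(2) \<open>0 < a x\<close> by simp
      qed
      show ?thesis
      proof (cases "\<forall>x\<in>U. 0 < a x")
        case True
        then have "\<not> admissible (boundary u a) n z" using excluded by blast
        then show ?thesis by (simp only: K0 if_False sum.neutral_const mult_zero_right)
      next
        case False
        show ?thesis
          unfolding marginal_density_def if_not_P[OF False] by (simp only: K0 sum.neutral_const mult_zero_left mult_zero_right)
      qed
    next
      case pos: True
      have a_pos: "0 < a x" if "x \<in> U" for x
        using pos that occ_nonneg[of x0 n z x] by (meson le_less_trans real_sqrt_ge_zero mult_nonneg_nonneg zero_le_numeral)
      let ?\<Phi> = "boundary u a" and ?M = "final_field (boundary u a) n z"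
      have sq: "2 * occ x0 n z x < (a x)\<^sup>2" if "x \<in> U" for x
        using pos that a_pos[OF that] occ_nonneg[of x0 n z x] by (metis less_imp_le power_strict_mono pos2 real_sqrt_ge_zero real_sqrt_pow2 mult_nonneg_nonneg zero_le_numeral)
      have adm: "admissible ?\<Phi> n z"
        unfolding admissible_def using inc x0 sq below u by auto
      have M_sq: "(?M x)\<^sup>2 / 2 + lt x = (?\<Phi> x)\<^sup>2 / 2" for x
        using sq[of x] u by (cases "x = x0") (simp_all add: final_field_def lt_def less_imp_le field_simps)
      have M_pos: "0 < ?M x" if "x \<in> U" for x
        using sq[OF that] that by (simp add: final_field_def)
      have \<Phi>_nonneg: "0 \<le> ?\<Phi> x" for x using a_pos[of x] u by (cases "x = x0") (simp_all add: less_imp_le)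
      let ?P = "\<Prod>x\<in>U. ?\<Phi> x / ?M x"
      have P: "0 \<le> ?P" by (intro prod_nonneg divide_nonneg_nonneg \<Phi>_nonneg less_imp_le[OF M_pos])
      have jac: "(\<Prod>x\<in>U. square_jacobian (occ x0 n z x) (a x)) = ennreal ?P"
      proof -
        have "(\<Prod>x\<in>U. square_jacobian (occ x0 n z x) (a x)) = (\<Prod>x\<in>U. ennreal (?\<Phi> x / ?M x))"
          using pos by (intro prod.cong refl) (auto simp: final_field_def)
        also have "\<dots> = ennreal ?P"
          by (intro prod_ennreal divide_nonneg_nonneg \<Phi>_nonneg less_imp_le[OF M_pos])
        finally show ?thesis .
      qed
      have Z: "0 < partition_fun ?\<Phi>" by (rule ising_partition_pos)
      have expo: "(\<Sum>x\<in>UNIV. vertex_rate x * lt x) + (1/2) * (\<Sum>x\<in>UNIV. vertex_rate x * (?M x)\<^sup>2) = (1/2) * (\<Sum>x\<in>UNIV. vertex_rate x * (?\<Phi> x)\<^sup>2)"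
      proof -
        have "(\<Sum>x\<in>UNIV. vertex_rate x * lt x) + (1/2) * (\<Sum>x\<in>UNIV. vertex_rate x * (?M x)\<^sup>2)
            = (\<Sum>x\<in>UNIV. vertex_rate x * ((?M x)\<^sup>2 / 2 + lt x))"
          by (simp add: sum_distrib_left sum.distrib[symmetric] algebra_simps)
        also have "\<dots> = (1/2) * (\<Sum>x\<in>UNIV. vertex_rate x * (?\<Phi> x)\<^sup>2)"
          unfolding M_sq by (simp add: sum_distrib_left)
        finally show ?thesis .
      qed
      have K_eq: "K \<sigma> a = ennreal (field_density ?\<Phi>) * h ?\<Phi> * (ennreal (path_weight n z * ?P / partition_fun ?\<Phi>)
          * (ennreal (weight ?M \<sigma>) * indicator B (stopped_skeleton u n z, \<lambda>x. \<sigma> x * ?M x)))" if \<sigma>: "\<sigma> \<in> spins x0" for \<sigma>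
      proof -
        have field: "(\<lambda>x\<in>U. \<sigma> x * sqrt ((a x)\<^sup>2 - 2 * occ x0 n z x))(x0 := 0) = (\<lambda>x. \<sigma> x * ?M x)"
          by (auto simp: fun_eq_iff final_field_def)
        have "(\<sigma> x)\<^sup>2 = 1" for x
        proof -
          have "\<sigma> x = -1 \<or> \<sigma> x = 1" using \<sigma> by (simp add: spins_def)
          then show ?thesis by auto
        qed
        then have "sqrt ((\<sigma> x * ?M x)\<^sup>2 + 2 * lt x) = ?\<Phi> x" for x
        proof -
          have "(\<sigma> x * ?M x)\<^sup>2 + 2 * lt x = (?\<Phi> x)\<^sup>2"
            using M_sq[of x] \<open>\<And>x. (\<sigma> x)\<^sup>2 = 1\<close> unfolding power_mult_distrib by simp
          then show ?thesis using \<Phi>_nonneg[of x] by (simp only: real_sqrt_abs abs_of_nonneg)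
        qed
        then have \<Phi>_eq: "(\<lambda>x. sqrt ((\<sigma> x * ?M x)\<^sup>2 + 2 * lt x)) = ?\<Phi>" by (rule ext)
        have gw: "gff_weight E W x0 (\<lambda>x\<in>U. \<sigma> x * sqrt ((a x)\<^sup>2 - 2 * occ x0 n z x))
            = exp (- (1/2) * (\<Sum>x\<in>UNIV. vertex_rate x * (?M x)\<^sup>2)) * weight ?M \<sigma>"
          unfolding gff_weight_def field by (rule exp_energy_signed[OF \<sigma>])
        have real_eq: "?c * ?P * (exp (- (1/2) * (\<Sum>x\<in>UNIV. vertex_rate x * (?M x)\<^sup>2)) * weight ?M \<sigma> / gff_norm)
            = field_density ?\<Phi> * (path_weight n z * ?P / partition_fun ?\<Phi>) * weight ?M \<sigma>"
        proof -
          have "exp (- (\<Sum>x\<in>UNIV. vertex_rate x * lt x)) * exp (- (1/2) * (\<Sum>x\<in>UNIV. vertex_rate x * (?M x)\<^sup>2))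
              = exp (- (1/2) * (\<Sum>x\<in>UNIV. vertex_rate x * (?\<Phi> x)\<^sup>2))"
            unfolding exp_add[symmetric] using expo by simp
          then have "?c * ?P * (exp (- (1/2) * (\<Sum>x\<in>UNIV. vertex_rate x * (?M x)\<^sup>2)) * weight ?M \<sigma> / gff_norm)
            = exp (- (1/2) * (\<Sum>x\<in>UNIV. vertex_rate x * (?\<Phi> x)\<^sup>2)) * path_weight n z * ?P * weight ?M \<sigma> / gff_norm"
            by (simp add: algebra_simps)
          also have "\<dots> = field_density ?\<Phi> * (path_weight n z * ?P / partition_fun ?\<Phi>) * weight ?M \<sigma>"
            using Z unfolding field_density_def by simp
          finally show ?thesis .
        qed
        have fd: "0 \<le> field_density ?\<Phi>"
          unfolding field_density_def using Z gff_norm_pos by (simp add: less_imp_le)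
        note nn = P path_weight_nonneg[of n z] less_imp_le[OF ising_weight_pos[of E "interaction W ?M" \<sigma>]] less_imp_le[OF Z] less_imp_le[OF gff_norm_pos] fd
        have "ennreal ?c * (ennreal ?P * ennreal (exp (- (1/2) * (\<Sum>x\<in>UNIV. vertex_rate x * (?M x)\<^sup>2)) * weight ?M \<sigma> / gff_norm))
            = ennreal (?c * ?P * (exp (- (1/2) * (\<Sum>x\<in>UNIV. vertex_rate x * (?M x)\<^sup>2)) * weight ?M \<sigma> / gff_norm))"
          unfolding mult.assoc[of ?c] using c_nonneg nn
          by (intro ennreal_mult3[symmetric] mult_nonneg_nonneg divide_nonneg_nonneg) simp_all
        also have "\<dots> = ennreal (field_density ?\<Phi>) * (ennreal (path_weight n z * ?P / partition_fun ?\<Phi>) * ennreal (weight ?M \<sigma>))"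
          unfolding real_eq mult.assoc[of "field_density ?\<Phi>"] using nn
          by (intro ennreal_mult3 mult_nonneg_nonneg divide_nonneg_nonneg) simp_all
        finally have prod_eq: "ennreal ?c * (ennreal ?P * ennreal (exp (- (1/2) * (\<Sum>x\<in>UNIV. vertex_rate x * (?M x)\<^sup>2)) * weight ?M \<sigma> / gff_norm))
            = ennreal (field_density ?\<Phi>) * (ennreal (path_weight n z * ?P / partition_fun ?\<Phi>) * ennreal (weight ?M \<sigma>))" .
        have "K \<sigma> a = (ennreal ?c * (ennreal ?P * ennreal (exp (- (1/2) * (\<Sum>x\<in>UNIV. vertex_rate x * (?M x)\<^sup>2)) * weight ?M \<sigma> / gff_norm)))
            * (h ?\<Phi> * indicator B (stopped_skeleton u n z, \<lambda>x. \<sigma> x * ?M x))"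
          unfolding K_def H_def jac gw field \<Phi>_eq by (simp only: mult.assoc)
        then show ?thesis unfolding prod_eq by (simp only: mult.assoc mult.commute mult.left_commute)
      qed
      have "(\<Sum>\<sigma>\<in>spins x0. K \<sigma> a) = (\<Sum>\<sigma>\<in>spins x0. ennreal (field_density ?\<Phi>) * h ?\<Phi> * (ennreal (path_weight n z * ?P / partition_fun ?\<Phi>)
          * (ennreal (weight ?M \<sigma>) * indicator B (stopped_skeleton u n z, \<lambda>x. \<sigma> x * ?M x))))"
        by (intro sum.cong refl K_eq)
      also have "\<dots> = ennreal (field_density ?\<Phi>) * h ?\<Phi> * outcome_weight u ?\<Phi> B n z"
        unfolding outcome_weight_def by (simp only: sum_distrib_left)
      also have "\<dots> = marginal_density u a * h ?\<Phi> * (if admissible ?\<Phi> n z then outcome_weight u ?\<Phi> B n z else 0)"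
        unfolding marginal_density_def if_P[OF adm] using a_pos by simp
      finally show ?thesis .
    qed
  qed
  finally have total: "ennreal ?c * (\<integral>\<^sup>+\<phi>. h (\<lambda>x. sqrt ((\<phi> x)\<^sup>2 + 2 * lt x)) * indicator B (stopped_skeleton u n z, \<phi>) \<partial>free_field)
    = (\<integral>\<^sup>+a. marginal_density u a * h (boundary u a) *
        (if admissible (boundary u a) n z then outcome_weight u (boundary u a) B n z else 0) \<partial>flat)" .
  have factor': "X.path_density n z * (ennreal (exp (- (vertex_rate x0 * (u - occ x0 n z x0)))) * I) = ennreal ?c * I" for I
    by (simp only: mult.assoc[symmetric] factor)
  have reached: "jump_state x0 z n = x0 \<and> occ x0 n z x0 < u" using x0 below by blast
  show ?thesis
    unfolding if_P[OF reached] factor' using total unfolding lt_def .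
qed

end

context conductance_network
begin

lemma observed_at_completion:
  assumes w: "w 0 = (0, x0) \<and> (\<forall>k. fst (w k) \<le> fst (w (Suc k)))" and n: "completes u x0 n w" and u: "0 < u"
  shows "observed_field u (w, \<phi>) = (\<lambda>x. sqrt ((\<phi> x)\<^sup>2 + 2 * (if x = x0 then u else occ x0 n (skeleton n w) x)))"
    and "observed_path u (w, \<phi>) = (stopped_skeleton u n (skeleton n w), \<phi>)"
proof -
  note facts = inv_local_time_completes[OF conjunct1[OF w] conjunct2[OF w] n u]
  show "observed_field u (w, \<phi>) = (\<lambda>x. sqrt ((\<phi> x)\<^sup>2 + 2 * (if x = x0 then u else occ x0 n (skeleton n w) x)))"
    unfolding split facts(1) facts(3) ..
  show "observed_path u (w, \<phi>) = (stopped_skeleton u n (skeleton n w), \<phi>)"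
    unfolding split facts(1) facts(2) stopped_skeleton_def ..
qed

text \<open>Summing over the number of jumps before completion gives the joint law: \<open>\<Phi>\<close> has density
  \<open>marginal_density\<close>, and given \<open>\<Phi>\<close> the outcome is distributed according to \<open>path_law\<close>.\<close>
lemma joint_law:
  assumes u: "0 < u" and h [measurable]: "h \<in> borel_measurable field_space" and B [measurable]: "B \<in> sets outcomes"
  shows "(\<integral>\<^sup>+p. h (observed_field u p) * indicator B (observed_path u p) \<partial>(X.PP \<Otimes>\<^sub>M free_field))
    = (\<integral>\<^sup>+a. marginal_density u a * h (boundary u a) * path_law u (boundary u a) B \<partial>flat)"
proof -
  interpret G: prob_space free_field by (rule prob_space_gff)
  let ?Q = "\<lambda>n. Pi\<^sub>M {1..n} (\<lambda>_. step_space :: (real \<times> 'v) measure)"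
  let ?H = "\<lambda>p. h (observed_field u p) * indicator B (observed_path u p)"
  define F where "F n z \<phi> = h (\<lambda>x. sqrt ((\<phi> x)\<^sup>2 + 2 * (if x = x0 then u else occ x0 n z x))) * indicator B (stopped_skeleton u n z, \<phi>)" for n z \<phi>
  define g where "g n z = (\<integral>\<^sup>+\<phi>. F n z \<phi> \<partial>free_field)" for n z
  define w where "w n a z = (if admissible (boundary u a) n z then outcome_weight u (boundary u a) B n z else 0)" for n a z
  have H: "?H \<in> borel_measurable (X.PP \<Otimes>\<^sub>M free_field)"
    by (intro borel_measurable_times_ennreal measurable_compose[OF observed_field_measurable[OF u] h]
        measurable_compose[OF observed_path_measurable[OF u] borel_measurable_indicator[OF B]])
  have g [measurable]: "g n \<in> borel_measurable (?Q n)" for n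
  proof -
    have fst_Q: "fst \<in> ?Q n \<Otimes>\<^sub>M free_field \<rightarrow>\<^sub>M ?Q n" by (rule measurable_fst)
    have snd_G: "snd \<in> ?Q n \<Otimes>\<^sub>M free_field \<rightarrow>\<^sub>M (field_space :: ('v \<Rightarrow> real) measure)"
      using measurable_snd[of "?Q n" free_field] by (simp add: measurable_cong_sets[OF refl sets_gff])
    note [measurable] = occ_G[OF snd_G fst_Q] F_component[OF snd_G fst_Q]
    have "(\<lambda>p. (\<lambda>x. sqrt ((snd p x)\<^sup>2 + 2 * (if x = x0 then u else occ x0 n (fst p) x)))) \<in> ?Q n \<Otimes>\<^sub>M free_field \<rightarrow>\<^sub>M field_space"
    proof (rule measurable_PiM_single')
      show "(\<lambda>p. sqrt ((snd p x)\<^sup>2 + 2 * (if x = x0 then u else occ x0 n (fst p) x))) \<in> borel_measurable (?Q n \<Otimes>\<^sub>M free_field)" for x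
        by measurable
    qed simp
    then have "(\<lambda>p. F n (fst p) (snd p)) \<in> borel_measurable (?Q n \<Otimes>\<^sub>M free_field)"
      unfolding F_def
      by (intro borel_measurable_times_ennreal measurable_compose[OF _ h]
          measurable_compose[OF measurable_Pair[OF stopped_skeleton_measurable[OF snd_G fst_Q] snd_G] borel_measurable_indicator[OF B]])
    then show ?thesis
      unfolding g_def by (intro G.borel_measurable_nn_integral) (simp add: case_prod_beta')
  qed
  have sum_meas: "(\<lambda>v. if completes u x0 n v then g n (skeleton n v) else 0) \<in> borel_measurable X.PP" for n
    by (rule measurable_If[OF measurable_compose[OF X.skeleton_PP g] borel_measurable_const predE[OF completes_PP]])
  have c_meas [measurable]: "(\<lambda>a. marginal_density u a * h (boundary u a)) \<in> borel_measurable flat"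
    by (intro borel_measurable_times_ennreal marginal_density_measurable measurable_compose[OF extend_flat h])
  have w_joint: "(\<lambda>(a, z). w n a z) \<in> borel_measurable (flat \<Otimes>\<^sub>M ?Q n)" for n
  proof -
    have F: "(\<lambda>p. boundary u (fst p)) \<in> flat \<Otimes>\<^sub>M ?Q n \<rightarrow>\<^sub>M field_space"
      by (rule measurable_compose[OF measurable_fst extend_flat])
    show ?thesis
      unfolding w_def case_prod_beta'
      by (rule measurable_If[OF outcome_weight_measurable[OF F measurable_snd B] borel_measurable_const predE[OF admissible_measurable[OF F measurable_snd]]])
  qed
  have sf: "pair_sigma_finite flat (?Q n)" for n :: nat
  proof (rule pair_sigma_finite.intro)
    show "sigma_finite_measure flat"
      by (rule product_sigma_finite.sigma_finite) (simp_all add: product_sigma_finite_def lborel.sigma_finite_measure_axioms)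
    show "sigma_finite_measure (?Q n)" by (rule steps.sigma_finite) simp
  qed
  have w_snd: "w n a \<in> borel_measurable (?Q n)" if "a \<in> space flat" for n a
    using measurable_Pair2[OF w_joint that] by simp
  have w_int: "(\<lambda>a. \<integral>\<^sup>+z. w n a z \<partial>?Q n) \<in> borel_measurable flat" for n
    by (rule sigma_finite_measure.borel_measurable_nn_integral[OF steps.sigma_finite w_joint]) simp
  have "(\<integral>\<^sup>+p. ?H p \<partial>(X.PP \<Otimes>\<^sub>M free_field)) = (\<integral>\<^sup>+v. \<integral>\<^sup>+\<phi>. ?H (v, \<phi>) \<partial>free_field \<partial>X.PP)"
    by (rule G.nn_integral_fst[OF H, symmetric])
  also have "\<dots> = (\<integral>\<^sup>+v. (\<Sum>n. if completes u x0 n v then g n (skeleton n v) else 0) \<partial>X.PP)"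
  proof (rule nn_integral_cong_AE)
    show "AE v in X.PP. (\<integral>\<^sup>+\<phi>. ?H (v, \<phi>) \<partial>free_field) = (\<Sum>n. if completes u x0 n v then g n (skeleton n v) else 0)"
      using X.AE_PP_ordered AE_completes[OF u]
    proof eventually_elim
      case (elim v)
      then obtain m where m: "completes u x0 m v" by blast
      have "(if completes u x0 n v then g n (skeleton n v) else 0) = 0" if "n \<noteq> m" for n
        using completes_unique[OF _ _ m, of n] elim(1) that by (auto split: if_splits)
      then have "(\<Sum>n. if completes u x0 n v then g n (skeleton n v) else 0) = (if completes u x0 m v then g m (skeleton m v) else 0)"
        by (rule suminf_single)
      also have "\<dots> = (\<integral>\<^sup>+\<phi>. ?H (v, \<phi>) \<partial>free_field)"
        unfolding if_P[OF m] g_def F_def observed_at_completion[OF elim(1) m u] ..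
      finally show ?case ..
    qed
  qed
  also have "\<dots> = (\<Sum>n. \<integral>\<^sup>+v. (if completes u x0 n v then g n (skeleton n v) else 0) \<partial>X.PP)"
    by (rule nn_integral_suminf[OF sum_meas])
  also have "\<dots> = (\<Sum>n. \<integral>\<^sup>+a. marginal_density u a * h (boundary u a) * (\<integral>\<^sup>+z. w n a z \<partial>?Q n) \<partial>flat)"
  proof (rule suminf_cong)
    fix n
    have joint: "(\<lambda>(a, z). marginal_density u a * h (boundary u a) * w n a z) \<in> borel_measurable (flat \<Otimes>\<^sub>M ?Q n)"
      unfolding case_prod_beta'
      by (rule borel_measurable_times_ennreal[OF measurable_compose[OF measurable_fst c_meas] w_joint[unfolded case_prod_beta']])
    have "(\<integral>\<^sup>+v. (if completes u x0 n v then g n (skeleton n v) else 0) \<partial>X.PP)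
        = (\<integral>\<^sup>+z. \<integral>\<^sup>+a. marginal_density u a * h (boundary u a) * w n a z \<partial>flat \<partial>?Q n)"
    proof (rule trans[OF nn_integral_completes[OF g] nn_integral_cong])
      fix z :: "nat \<Rightarrow> real \<times> 'v"
      show "X.path_density n z * (if jump_state x0 z n = x0 \<and> occ x0 n z x0 < u
          then ennreal (exp (- (vertex_rate x0 * (u - occ x0 n z x0)))) * g n z else 0)
        = (\<integral>\<^sup>+a. marginal_density u a * h (boundary u a) * w n a z \<partial>flat)"
        unfolding g_def F_def w_def by (rule skeleton_change_of_variables[OF u h B])
    qed
    also have "\<dots> = (\<integral>\<^sup>+a. \<integral>\<^sup>+z. marginal_density u a * h (boundary u a) * w n a z \<partial>?Q n \<partial>flat)"
      by (rule pair_sigma_finite.Fubini'[OF sf joint])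
    also have "\<dots> = (\<integral>\<^sup>+a. marginal_density u a * h (boundary u a) * (\<integral>\<^sup>+z. w n a z \<partial>?Q n) \<partial>flat)"
      by (rule nn_integral_cong) (rule nn_integral_cmult[OF w_snd])
    finally show "(\<integral>\<^sup>+v. (if completes u x0 n v then g n (skeleton n v) else 0) \<partial>X.PP)
        = (\<integral>\<^sup>+a. marginal_density u a * h (boundary u a) * (\<integral>\<^sup>+z. w n a z \<partial>?Q n) \<partial>flat)" .
  qed
  also have "\<dots> = (\<integral>\<^sup>+a. (\<Sum>n. marginal_density u a * h (boundary u a) * (\<integral>\<^sup>+z. w n a z \<partial>?Q n)) \<partial>flat)"
    by (rule nn_integral_suminf[symmetric]) (intro borel_measurable_times_ennreal[OF c_meas w_int])
  also have "\<dots> = (\<integral>\<^sup>+a. marginal_density u a * h (boundary u a) * path_law u (boundary u a) B \<partial>flat)"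
    unfolding path_law_def w_def by (simp only: ennreal_suminf_cmult)
  finally show ?thesis .
qed

section \<open>The conditional law\<close>

lemma outcome_weight_compl:
  "outcome_weight u \<Phi> B n z + outcome_weight u \<Phi> (space outcomes - B) n z = outcome_weight u \<Phi> (space outcomes) n z"
proof -
  have "indicator B (stopped_skeleton u n z, f) + indicator (space outcomes - B) (stopped_skeleton u n z, f)
      = (indicator (space outcomes) (stopped_skeleton u n z, f) :: ennreal)" for f :: "'v \<Rightarrow> real"
    using stopped_skeleton_in_space[of u n z]
    by (auto simp: indicator_def space_pair_measure[of stopped_path_space] space_PiM[of UNIV])
  then show ?thesis
    unfolding outcome_weight_def distrib_left[symmetric] sum.distrib[symmetric] by (simp only:)
qed

lemma path_law_compl:
  assumes B: "B \<in> sets outcomes"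
  shows "path_law u \<Phi> B + path_law u \<Phi> (space outcomes - B) = path_law u \<Phi> (space outcomes)"
proof -
  let ?Q = "\<lambda>n. Pi\<^sub>M {1..n} (\<lambda>_. step_space :: (real \<times> 'v) measure)"
  have B': "space outcomes - B \<in> sets (outcomes :: ((real \<times> (real \<Rightarrow> 'v)) \<times> ('v \<Rightarrow> real)) measure)"
    using B by (rule sets.compl_sets)
  have const: "(\<lambda>z. \<Phi>) \<in> ?Q n \<rightarrow>\<^sub>M field_space" for n by (simp add: space_PiM)
  have ident: "(\<lambda>z. z) \<in> ?Q n \<rightarrow>\<^sub>M ?Q n" for n by simp
  have meas: "(\<lambda>z. if admissible \<Phi> n z then outcome_weight u \<Phi> C n z else 0) \<in> borel_measurable (?Q n)"
    if "C \<in> sets outcomes" for C n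
    by (rule measurable_If[OF outcome_weight_measurable[OF const ident that] borel_measurable_const predE[OF admissible_measurable[OF const ident]]])
  have "(\<integral>\<^sup>+z. (if admissible \<Phi> n z then outcome_weight u \<Phi> B n z else 0) \<partial>?Q n)
      + (\<integral>\<^sup>+z. (if admissible \<Phi> n z then outcome_weight u \<Phi> (space outcomes - B) n z else 0) \<partial>?Q n)
    = (\<integral>\<^sup>+z. (if admissible \<Phi> n z then outcome_weight u \<Phi> (space outcomes) n z else 0) \<partial>?Q n)" for n
    unfolding nn_integral_add[OF meas[OF B] meas[OF B'], symmetric]
    by (rule nn_integral_cong) (simp add: outcome_weight_compl)
  then show ?thesis
    unfolding path_law_def by (simp only: suminf_add[OF summableI summableI])
qed

text \<open>The values of \<open>\<Phi>\<close> for which no mass is lost in \<open>path_law\<close>, that is, for which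
  the law of the process is carried by trajectories with finitely many jumps that end at \<open>x0\<close>.\<close>
definition regular :: "real \<Rightarrow> ('v \<Rightarrow> real) \<Rightarrow> bool" where
  "regular u \<Phi> \<longleftrightarrow> (\<forall>x. 0 < \<Phi> x) \<and> \<Phi> x0 = sqrt (2 * u) \<and> path_law u \<Phi> (space outcomes) = 1"

lemma regular_measurable [measurable]: "Measurable.pred field_space (regular u)"
proof -
  have [measurable]: "(\<lambda>\<Phi>. path_law u \<Phi> (space outcomes)) \<in> borel_measurable field_space"
    by (rule path_law_measurable) (rule sets.top)
  show ?thesis unfolding regular_def by measurable
qed

lemma path_law_le:
  assumes "\<forall>x. 0 < \<Phi> x" "\<Phi> x0 = sqrt (2 * u)" "0 < u" "B \<in> sets outcomes"
  shows "path_law u \<Phi> B \<le> emeasure (Z_field_law E W x0 \<Phi> x0) B"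
proof -
  interpret positive_field E W x0 \<Phi> by unfold_locales (use assms(1) in blast)
  show ?thesis using assms by (intro path_law_le_Z_field_law) simp_all
qed

lemma Z_field_law_prob:
  assumes "\<forall>x. 0 < \<Phi> x"
  shows "prob_space (Z_field_law E W x0 \<Phi> x0)" "sets (Z_field_law E W x0 \<Phi> x0) = sets outcomes"
proof -
  interpret positive_field E W x0 \<Phi> by unfold_locales (use assms in blast)
  show "prob_space (Z_field_law E W x0 \<Phi> x0)" by (rule prob_space_Z_field_law)
  show "sets (Z_field_law E W x0 \<Phi> x0) = sets outcomes" by (rule sets_Z_field_law)
qed

text \<open>Two measures, one below the other, of the same finite mass coincide.\<close>
lemma path_law_regular:
  assumes reg: "regular u \<Phi>" and u: "0 < u" and B: "B \<in> sets outcomes"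
  shows "path_law u \<Phi> B = emeasure (Z_field_law E W x0 \<Phi> x0) B"
proof (rule antisym)
  let ?K = "Z_field_law E W x0 \<Phi> x0"
  have pos: "\<forall>x. 0 < \<Phi> x" and x0: "\<Phi> x0 = sqrt (2 * u)" and one: "path_law u \<Phi> (space outcomes) = 1"
    using reg by (auto simp: regular_def)
  interpret K: prob_space ?K by (rule Z_field_law_prob[OF pos])
  note sets_K = Z_field_law_prob(2)[OF pos]
  note space_K = sets_eq_imp_space_eq[OF sets_K]
  show le: "path_law u \<Phi> B \<le> emeasure ?K B" by (rule path_law_le[OF pos x0 u B])
  have B': "space outcomes - B \<in> sets (outcomes :: ((real \<times> (real \<Rightarrow> 'v)) \<times> ('v \<Rightarrow> real)) measure)"
    using B by (rule sets.compl_sets)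
  have "emeasure ?K (space outcomes - B) + emeasure ?K B = emeasure ?K (space ?K)"
    using B B' sets.sets_into_space[OF B] unfolding space_K[symmetric]
    by (subst plus_emeasure) (auto simp: sets_K Un_absorb2)
  also have "\<dots> = path_law u \<Phi> B + path_law u \<Phi> (space outcomes - B)"
    unfolding path_law_compl[OF B] one by (rule K.emeasure_space_1)
  also have "\<dots> \<le> path_law u \<Phi> B + emeasure ?K (space outcomes - B)"
    by (intro add_left_mono path_law_le[OF pos x0 u B'])
  finally have "emeasure ?K (space outcomes - B) + emeasure ?K B \<le> emeasure ?K (space outcomes - B) + path_law u \<Phi> B"
    by (simp only: add.commute)
  then show "emeasure ?K B \<le> path_law u \<Phi> B"
    using K.emeasure_finite[of "space outcomes - B"] by (simp add: ennreal_add_left_cancel_le)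
qed

lemma observed_in_space:
  assumes "0 < u" "p \<in> space (X.PP \<Otimes>\<^sub>M free_field)"
  shows "indicator (space outcomes) (observed_path u p) = (1 :: ennreal)"
  using measurable_space[OF observed_path_measurable[OF assms(1)] assms(2)] by (simp only: indicator_simps)

lemma prob_space_pair: "prob_space (X.PP \<Otimes>\<^sub>M free_field)"
proof -
  interpret A: prob_space X.PP by (rule X.prob_space_PP)
  interpret C: prob_space free_field by (rule prob_space_gff)
  interpret J: pair_prob_space X.PP free_field ..
  show ?thesis by (rule J.P.prob_space_axioms)
qed

text \<open>The joint law and the marginal of \<open>\<Phi>\<close> both have mass \<open>1\<close>, and the former is obtained from the latter by
  integrating \<open>path_law\<close>, which is at most \<open>1\<close>. So no mass can be lost.\<close>
lemma AE_marginal_regular: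
  assumes u: "0 < u"
  shows "AE a in flat. marginal_density u a \<noteq> 0 \<longrightarrow> regular u (boundary u a)"
proof -
  interpret M: prob_space "X.PP \<Otimes>\<^sub>M free_field" by (rule prob_space_pair)
  let ?p = "\<lambda>a. path_law u (boundary u a) (space outcomes)"
  let ?m = "marginal_density u"
  have p [measurable]: "?p \<in> borel_measurable flat"
    by (rule measurable_compose[OF extend_flat path_law_measurable]) (rule sets.top)
  have pos: "\<forall>x. 0 < boundary u a x" if "?m a \<noteq> 0" for a
  proof -
    have "\<forall>x\<in>U. 0 < a x" using that by (auto simp: marginal_density_def split: if_splits)
    then show ?thesis using u by simp
  qed
  have le: "?m a * ?p a \<le> ?m a" for a
  proof (cases "?m a = 0")
    case False
    note pos = pos[OF False]
    interpret K: prob_space "Z_field_law E W x0 (boundary u a) x0" by (rule Z_field_law_prob[OF pos])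
    have "?p a \<le> 1"
      by (rule order_trans[OF path_law_le[OF pos _ u sets.top] K.emeasure_le_1]) simp
    then show ?thesis using mult_left_mono[of "?p a" 1 "?m a"] by simp
  qed simp
  have m_total: "(\<integral>\<^sup>+a. ?m a \<partial>flat) = 1"
    unfolding marginal_density_def by (rule field_density_normalised)
  have "(\<integral>\<^sup>+a. ?m a * ?p a \<partial>flat) = (\<integral>\<^sup>+a. ?m a * 1 * ?p a \<partial>flat)" by simp
  also have "\<dots> = (\<integral>\<^sup>+p. 1 * indicator (space outcomes) (observed_path u p) \<partial>(X.PP \<Otimes>\<^sub>M free_field))"
    by (rule joint_law[OF u borel_measurable_const sets.top, symmetric])
  also have "\<dots> = (\<integral>\<^sup>+p. 1 \<partial>(X.PP \<Otimes>\<^sub>M free_field))"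
    by (rule nn_integral_cong) (simp only: observed_in_space[OF u] mult_1)
  also have "\<dots> = 1" by (simp add: M.emeasure_space_1)
  finally have mp_total: "(\<integral>\<^sup>+a. ?m a * ?p a \<partial>flat) = 1" .
  have "(\<integral>\<^sup>+a. (?m a - ?m a * ?p a) \<partial>flat) = (\<integral>\<^sup>+a. ?m a \<partial>flat) - (\<integral>\<^sup>+a. ?m a * ?p a \<partial>flat)"
    using le by (intro nn_integral_diff) (simp_all add: mp_total)
  also have "\<dots> = 0" by (simp add: m_total mp_total)
  finally have "AE a in flat. ?m a - ?m a * ?p a = 0"
    by (subst (asm) nn_integral_0_iff_AE) simp_all
  then show ?thesis
  proof eventually_elim
    case (elim a)
    show ?case
    proof
      assume nz: "?m a \<noteq> 0"
      have fin: "?m a < \<top>" by (simp add: marginal_density_def ennreal_mult_less_top)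
      have "?m a * ?p a = ?m a * 1"
        using elim le[of a] by (intro antisym) (simp_all add: diff_eq_0_iff_ennreal)
      then have "?p a = 1" using nz fin unfolding ennreal_mult_cancel_left by auto
      then show "regular u (boundary u a)" using pos[OF nz] by (simp add: regular_def)
    qed
  qed
qed

lemma AE_observed_regular:
  assumes u: "0 < u"
  shows "AE p in X.PP \<Otimes>\<^sub>M free_field. regular u (observed_field u p)"
proof -
  let ?bad = "{\<Phi> \<in> space field_space. \<not> regular u \<Phi>}"
  have bad: "?bad \<in> sets field_space" by measurable
  have ind: "indicator ?bad \<in> borel_measurable (field_space :: ('v \<Rightarrow> real) measure)"
    using bad by (rule borel_measurable_indicator)
  have "(\<integral>\<^sup>+p. indicator ?bad (observed_field u p) \<partial>(X.PP \<Otimes>\<^sub>M free_field))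
      = (\<integral>\<^sup>+p. indicator ?bad (observed_field u p) * indicator (space outcomes) (observed_path u p) \<partial>(X.PP \<Otimes>\<^sub>M free_field))"
    by (rule nn_integral_cong) (simp only: observed_in_space[OF u] mult_1_right)
  also have "\<dots> = (\<integral>\<^sup>+a. marginal_density u a * indicator ?bad (boundary u a) * path_law u (boundary u a) (space outcomes) \<partial>flat)"
    by (rule joint_law[OF u ind sets.top])
  also have "\<dots> = (\<integral>\<^sup>+a. 0 \<partial>flat)"
    using AE_marginal_regular[OF u] by (intro nn_integral_cong_AE, eventually_elim) (auto simp: indicator_def)
  finally have "(\<integral>\<^sup>+p. indicator ?bad (observed_field u p) \<partial>(X.PP \<Otimes>\<^sub>M free_field)) = 0" by simp
  then have "AE p in X.PP \<Otimes>\<^sub>M free_field. (indicator ?bad (observed_field u p) :: ennreal) = 0"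
    by (subst (asm) nn_integral_0_iff_AE) (rule measurable_compose[OF observed_field_measurable[OF u] ind])
  then show ?thesis
    by eventually_elim (auto simp: indicator_def space_PiM split: if_splits)
qed

text \<open>By \<open>joint_law\<close>, the kernel \<open>path_law\<close> has the averaging property that characterises the conditional law.\<close>
lemma conditional_law:
  assumes u: "0 < u"
  shows "has_conditional_law (X.PP \<Otimes>\<^sub>M free_field) (observed_field u) field_space (observed_path u) outcomes
    (\<lambda>\<Phi>. Z_field_law E W x0 \<Phi> x0)"
  unfolding has_conditional_law_def
proof (intro conjI ballI)
  let ?M = "X.PP \<Otimes>\<^sub>M free_field" and ?X = "observed_field u" and ?Y = "observed_path u"
  let ?F = "vimage_algebra (space ?M) ?X field_space"
  show "prob_space ?M" by (rule prob_space_pair)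
  then interpret M: prob_space ?M .
  show X: "?X \<in> ?M \<rightarrow>\<^sub>M field_space" by (rule observed_field_measurable[OF u])
  show Y: "?Y \<in> ?M \<rightarrow>\<^sub>M outcomes" by (rule observed_path_measurable[OF u])
  show "AE p in ?M. prob_space (Z_field_law E W x0 (?X p) x0) \<and> sets (Z_field_law E W x0 (?X p) x0) = sets outcomes"
    using AE_observed_regular[OF u]
  proof eventually_elim
    case (elim p)
    then have "\<forall>x. 0 < ?X p x" unfolding regular_def by (rule conjunct1)
    then show ?case by (intro conjI Z_field_law_prob)
  qed
  fix B :: "((real \<times> (real \<Rightarrow> 'v)) \<times> ('v \<Rightarrow> real)) set" assume B: "B \<in> sets outcomes"
  let ?f = "indicator (?Y -` B \<inter> space ?M) :: _ \<Rightarrow> real"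
  define \<gamma> where "\<gamma> \<Phi> = min 1 (path_law u \<Phi> B)" for \<Phi>
  define g where "g p = enn2real (\<gamma> (?X p))" for p
  have \<gamma> [measurable]: "\<gamma> \<in> borel_measurable field_space"
    unfolding \<gamma>_def using path_law_measurable[OF B] by measurable
  have \<gamma>_real: "ennreal (enn2real (\<gamma> \<Phi>)) = \<gamma> \<Phi>" for \<Phi>
    by (simp add: \<gamma>_def ennreal_enn2real min_less_iff_disj)
  have \<gamma>_le: "enn2real (\<gamma> \<Phi>) \<le> 1" for \<Phi>
    using enn2real_mono[of "\<gamma> \<Phi>" 1] by (simp add: \<gamma>_def)
  have X_space: "?X \<in> space ?M \<rightarrow> space field_space" using measurable_space[OF X] by blast
  have "subalgebra ?M ?F"
    unfolding subalgebra_def using sets_vimage_algebra2[OF X_space] measurable_sets[OF X]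
    by (auto simp: space_vimage_algebra)
  then interpret S: finite_measure_subalgebra ?M ?F by unfold_locales
  have X_F: "?X \<in> ?F \<rightarrow>\<^sub>M field_space" by (rule measurable_vimage_algebra1[OF X_space])
  have g_F: "g \<in> borel_measurable ?F"
    unfolding g_def by (rule borel_measurable_enn2real[OF measurable_compose[OF X_F \<gamma>]])
  have g_M: "g \<in> borel_measurable ?M"
    unfolding g_def by (rule borel_measurable_enn2real[OF measurable_compose[OF X \<gamma>]])
  have Y_B: "?Y -` B \<inter> space ?M \<in> sets ?M" by (rule measurable_sets[OF Y B])
  have "AE p in ?M. real_cond_exp ?M ?F ?f p = g p"
  proof (rule S.real_cond_exp_charact[OF _ _ _ g_F])
    show int_f: "integrable ?M ?f" using Y_B by (simp add: M.emeasure_eq_measure less_top[symmetric])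
    show int_g: "integrable ?M g"
      by (rule M.integrable_const_bound[OF _ g_M, of 1]) (simp add: g_def \<gamma>_le)
    fix A assume "A \<in> sets ?F"
    then obtain C where C: "C \<in> sets field_space" and A: "A = ?X -` C \<inter> space ?M"
      unfolding sets_vimage_algebra2[OF X_space] by blast
    have A_sets: "A \<in> sets ?M" unfolding A by (rule measurable_sets[OF X C])
    have C_meas: "indicator C \<in> borel_measurable field_space" using C by (rule borel_measurable_indicator)
    have C\<gamma>_meas: "(\<lambda>\<Phi>. indicator C \<Phi> * \<gamma> \<Phi>) \<in> borel_measurable field_space"
      by (rule borel_measurable_times_ennreal[OF C_meas \<gamma>])
    have "(\<integral>\<^sup>+p. ennreal (indicator A p *\<^sub>R ?f p) \<partial>?M) = (\<integral>\<^sup>+p. indicator C (?X p) * indicator B (?Y p) \<partial>?M)"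
      by (rule nn_integral_cong) (simp only: A indicator_def vimage_eq Int_iff simp_thms, simp)
    also have "\<dots> = (\<integral>\<^sup>+a. marginal_density u a * indicator C (boundary u a) * path_law u (boundary u a) B \<partial>flat)"
      by (rule joint_law[OF u C_meas B])
    also have "\<dots> = (\<integral>\<^sup>+a. marginal_density u a * (indicator C (boundary u a) * \<gamma> (boundary u a)) * path_law u (boundary u a) (space outcomes) \<partial>flat)"
    proof (rule nn_integral_cong_AE)
      show "AE a in flat. marginal_density u a * indicator C (boundary u a) * path_law u (boundary u a) B
          = marginal_density u a * (indicator C (boundary u a) * \<gamma> (boundary u a)) * path_law u (boundary u a) (space outcomes)"
        using AE_marginal_regular[OF u]
      proof eventually_elim
        case (elim a)
        show ?case
        proof (cases "marginal_density u a = 0")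
          case False
          then have reg: "regular u (boundary u a)" using elim by blast
          then have one: "path_law u (boundary u a) (space outcomes) = 1" unfolding regular_def by blast
          have "path_law u (boundary u a) B \<le> path_law u (boundary u a) (space outcomes)"
            unfolding path_law_compl[OF B, symmetric] by simp
          then have "\<gamma> (boundary u a) = path_law u (boundary u a) B"
            unfolding \<gamma>_def one by (rule min_absorb2)
          then show ?thesis unfolding one by (simp only: mult_1_right mult.assoc)
        qed (simp only: mult_zero_left)
      qed
    qed
    also have "\<dots> = (\<integral>\<^sup>+p. (indicator C (?X p) * \<gamma> (?X p)) * indicator (space outcomes) (?Y p) \<partial>?M)"
      by (rule joint_law[OF u C\<gamma>_meas sets.top, symmetric])
    also have "\<dots> = (\<integral>\<^sup>+p. ennreal (indicator A p *\<^sub>R g p) \<partial>?M)"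
    proof (rule nn_integral_cong)
      fix p assume p: "p \<in> space ?M"
      then have "p \<in> A \<longleftrightarrow> ?X p \<in> C" unfolding A by blast
      then have "ennreal (indicator A p *\<^sub>R g p) = indicator C (?X p) * ennreal (g p)"
        by (cases "?X p \<in> C") simp_all
      then show "(indicator C (?X p) * \<gamma> (?X p)) * indicator (space outcomes) (?Y p) = ennreal (indicator A p *\<^sub>R g p)"
        unfolding observed_in_space[OF u p] by (simp only: g_def \<gamma>_real mult_1_right)
    qed
    finally have nn: "(\<integral>\<^sup>+p. ennreal (indicator A p *\<^sub>R ?f p) \<partial>?M) = (\<integral>\<^sup>+p. ennreal (indicator A p *\<^sub>R g p) \<partial>?M)" .
    have "(\<integral>p. indicator A p *\<^sub>R ?f p \<partial>?M) = enn2real (\<integral>\<^sup>+p. ennreal (indicator A p *\<^sub>R ?f p) \<partial>?M)"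
      using A_sets int_f by (intro integral_eq_nn_integral) (auto intro!: borel_measurable_scaleR)
    also have "\<dots> = (\<integral>p. indicator A p *\<^sub>R g p \<partial>?M)"
      unfolding nn by (intro integral_eq_nn_integral[symmetric] borel_measurable_scaleR borel_measurable_indicator A_sets g_M) (simp add: g_def)
    finally show "(LINT p:A|?M. ?f p) = (LINT p:A|?M. g p)" unfolding set_lebesgue_integral_def .
  qed
  then show "AE p in ?M. real_cond_exp ?M ?F ?f p = measure (Z_field_law E W x0 (?X p) x0) B"
    using AE_observed_regular[OF u]
  proof eventually_elim
    case (elim p)
    then have reg: "regular u (?X p)" by blast
    have pos: "\<forall>x. 0 < ?X p x" using reg unfolding regular_def by (rule conjunct1)
    interpret K: prob_space "Z_field_law E W x0 (?X p) x0" by (rule Z_field_law_prob[OF pos])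
    have "\<gamma> (?X p) = emeasure (Z_field_law E W x0 (?X p) x0) B"
      unfolding \<gamma>_def path_law_regular[OF reg u B] using K.emeasure_le_1 by (rule min_absorb2)
    then have "g p = measure (Z_field_law E W x0 (?X p) x0) B" unfolding g_def measure_def by (simp only:)
    then show ?case using elim(1) by (simp only:)
  qed
qed

end

theorem theorem5:
  fixes E :: "'v::finite set set" and W :: "'v set \<Rightarrow> real" and x0 :: 'v and u :: real
  assumes "conductance_graph E W" and "0 < u"
  shows "has_conditional_law
           (markov_process E W x0 \<Otimes>\<^sub>M gff E W x0)
           (\<lambda>(\<omega>, \<phi>) x. sqrt ((\<phi> x)\<^sup>2 + 2 * local_time (traj \<omega>) x (inv_local_time x0 u (traj \<omega>))))
           field_space
           (\<lambda>(\<omega>, \<phi>). (path_upto (inv_local_time x0 u (traj \<omega>)) (traj \<omega>), \<phi>))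
           (stopped_path_space \<Otimes>\<^sub>M field_space)
           (\<lambda>\<Phi>. Z_field_law E W x0 \<Phi> x0)"
proof -
  interpret conductance_network E W x0 using assms(1) by unfold_locales
  show ?thesis unfolding markov_process_def by (rule conditional_law[OF assms(2)])
qed

end
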